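(* Let the quiver be of type $A^{(1)}_{e-1}$ with $e>2$ or of type $A_\infty$. Let $x\in I$, $\Lambda=\Lambda_x$, let $\lambda=(k,1^r)$ (with $k,r\ge 1$) be a hook partition with residues computed with respect to $\Lambda_x$, and let $\alpha=\alpha_\lambda\in Q^+$. Let $v=z^\lambda$ be the standard cyclic generator of the permutation module $M^\lambda$ over $R_\alpha$. For $1\le i\le r$ put $A_i=(i,1)\in[\lambda]$, $\psi^{A_i}=\psi^{G^{A_i}}$, and let $M_i$ be the $R_\alpha$-submodule of $M^\lambda$ generated by $\{\psi^{A_i}v,\dots,\psi^{A_r}v\}$; put $M_0=M^\lambda$ and $M_{r+1}=0$. Then $$M^\lambda=M_0\supsetneq M_1\supsetneq M_2\supsetneq\cdots\supsetneq M_r\supsetneq M_{r+1}=0,$$ and for every $0\le i\le r$ there is an isomorphism of $R_\alpha$-modules $M_i/M_{i+1}\cong S^{\lambda_i}$, where $$\lambda_0=\lambda=(k,1^r),\qquad \lambda_1=(k+1,1^{r-1}),\qquad \lambda_i=\big(k\,|\,\underbrace{1\,|\,1\,|\cdots|\,1}_{i-2\text{ times}}\,|\,(2,1^{r-i})\big)\quad(2\le i\le r),$$ and $S^{\lambda_i}$ is the Specht module (over $R^{\Lambda(i)}_\alpha$) formed with respect to the charge $\kappa(i)$ given by $$\kappa(0)=(x),\qquad \kappa(1)=(x-1),\qquad \kappa(i)=(x,x-1,\dots,x-i+2,\,x-i)\quad(2\le i\le r),$$ with $\Lambda(i)$ the dominant weight determined by $\kappa(i)$.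
   Context: Quiver and KLR algebra. The quiver is of type $A^{(1)}_{e-1}$ with $e>2$ (vertex set $I=\mathbb Z/e\mathbb Z$) or of type $A_\infty$ (vertex set $I=\mathbb Z$), with arrows $i\to i+1$ for all $i\in I$. $\Bbbk$ is a field. $Q^+=\bigoplus_{i\in I}\mathbb Z_{\ge0}\alpha_i$. For $\alpha\in Q^+$ of height $n$ (sum of coefficients), $I^\alpha=\{\mathbf i=(i_1,\dots,i_n)\in I^n:\alpha_{i_1}+\cdots+\alpha_{i_n}=\alpha\}$, and $\sigma_r=(r,r+1)\in\mathfrak S_n$ acts on it by place permutation. $R_\alpha$ is the unital $\Bbbk$-algebra generated by $e(\mathbf i)$ ($\mathbf i\in I^\alpha$), $y_1,\dots,y_n$, $\psi_1,\dots,\psi_{n-1}$ subject to: $e(\mathbf i)e(\mathbf j)=\delta_{\mathbf i,\mathbf j}e(\mathbf i)$; $\sum_{\mathbf i}e(\mathbf i)=1$; $y_re(\mathbf i)=e(\mathbf i)y_r$; $\psi_re(\mathbf i)=e(\sigma_r\mathbf i)\psi_r$; $y_ry_s=y_sy_r$; $\psi_ry_s=y_s\psi_r$ if $s\ne r,r+1$; $\psi_r\psi_s=\psi_s\psi_r$ if $|r-s|>1$; $\psi_ry_{r+1}e(\mathbf i)=(y_r\psi_r+\delta_{i_r,i_{r+1}})e(\mathbf i)$; $y_{r+1}\psi_re(\mathbf i)=(\psi_ry_r+\delta_{i_r,i_{r+1}})e(\mathbf i)$; $\psi_r^2e(\mathbf i)=qe(\mathbf i)$ with $q=0$ if $i_r=i_{r+1}$,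 $q=y_{r+1}-y_r$ if $i_r\to i_{r+1}$, $q=y_r-y_{r+1}$ if $i_r\leftarrow i_{r+1}$, $q=1$ otherwise; $\psi_r\psi_{r+1}\psi_re(\mathbf i)=(\psi_{r+1}\psi_r\psi_{r+1}+c)e(\mathbf i)$ with $c=1$ if $i_r=i_{r+2}\to i_{r+1}$, $c=-1$ if $i_r=i_{r+2}\leftarrow i_{r+1}$, $c=0$ otherwise. For a dominant weight $\Lambda=\sum a_i\Lambda_i$, the cyclotomic quotient $R^\Lambda_\alpha$ is obtained by adding the relations $y_1^{a_{i_1}}e(\mathbf i)=0$ for all $\mathbf i\in I^\alpha$; its modules are regarded as $R_\alpha$-modules. Tableaux. An $\ell$-partition $\mu=(\mu^{(1)}|\cdots|\mu^{(\ell)})$ of $n$ is an $\ell$-tuple of partitions (components may be empty) of total size $n$; its Young diagram $[\mu]$ consists of nodes $(m,a,b)$ with $1\le b\le\mu^{(m)}_a$ (for $\ell=1$ write $(a,b)$). Given a charge $\kappa=(\kappa_1,\dots,\kappa_\ell)$, the node $(m,a,b)$ has residue $\kappa_m+b-a\in I$ (mod $e$ in type $A^{(1)}_{e-1}$); the weight determined by $\kappa$ is $\sum_m\Lambda_{\kappa_m}$ (indices in $I$), and $\alpha_\mu$ is the sum of $\alpha_{\mathrm{res}(A)}$ over the nodes $A$. A partition with fundamental weight $\Lambda_x$ is the case $\kappa=(x)$. A $\mu$-tableau is a bijection $[\mu]\to\{1,\dots,n\}$; it is row-standard if entries increase along rows. $T^\mu$ is the tableau with $1,\dots,n$ entered in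 order along successive rows, first component first; $\mathbf i^\mu$ is its residue sequence ($r$-th entry = residue of the node containing $r$). $\mathfrak S_n$ acts on tableaux from the left on entries, and $w^T$ is defined by $w^TT^\mu=T$. For each $w\in\mathfrak S_n$ fix a reduced expression $w=\sigma_{i_1}\cdots\sigma_{i_m}$ and put $\psi_w=\psi_{i_1}\cdots\psi_{i_m}$, $\psi^T=\psi_{w^T}$. A Garnir node is $A=(m,a,b)\in[\mu]$ with $(m,a+1,b)\in[\mu]$; its Garnir belt is $\{(m,a,c)\in[\mu]:c\ge b\}\cup\{(m,a+1,c):1\le c\le b\}$; the Garnir tableau $G^A$ is the row-standard tableau agreeing with $T^\mu$ outside the belt and whose entries in the belt increase from bottom left to top right (first along the lower row, then along the upper row). Modules. With $\alpha=\alpha_\mu$, the permutation module $M^\mu$ is the cyclic $R_\alpha$-module with standard cyclic generator $z^\mu$ and relations: (1) $e(\mathbf j)z^\mu=\delta_{\mathbf j,\mathbf i^\mu}z^\mu$; (2) $y_rz^\mu=0$ for all $r$; (3) $\psi_rz^\mu=0$ whenever $r,r+1$ lie in the same row of $T^\mu$. The (universal) Specht module $S^\mu$ is the quotient of $M^\mu$ by the additional relations (4) $\psi^{G^A}z^\mu=0$ for all Garnir nodes $A\in[\mu]$ (this is the correct definition for multipartitions all of whose components are hooks); it factors through $R^\Lambda_\alpha$ for $\Lambda$ determined by $\kappa$. Gradings are disregarded. The nodes $A_1,\dots,A_r$ are all the Garnir nodes of $(k,1^r)$. *)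

theory Defs
  imports
    "HOL-Algebra.QuotRing"
    "HOL-Algebra.Module"
    "HOL-Library.Poly_Mapping"
    "HOL-Combinatorics.Permutations"
    "HOL-Combinatorics.Multiset_Permutations"
begin

section \<open>Quivers\<close>

text \<open>The parameter \<open>e\<close> encodes the quiver: \<open>e > 2\<close> gives the cyclic quiver on
  \<open>e\<close> vertices, and \<open>e = 0\<close> gives the linear quiver with vertex set all integers.
  Since \<open>i mod 0 = i\<close>, reduction modulo \<open>e\<close> is a map from the integers onto the
  vertex set in both cases.\<close>

definition vertices :: "nat \<Rightarrow> int set" where
  "vertices e = (if e = 0 then UNIV else {0..<int e})"

definition arrow :: "nat \<Rightarrow> int \<Rightarrow> int \<Rightarrow> bool" where
  "arrow e i j \<longleftrightarrow> i \<in> vertices e \<and> j = (i + 1) mod int e"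

text \<open>An element of the positive root cone is a finite multiset of vertices; its height is
  its size, and \<open>I\<^sup>\<alpha>\<close> is \<^const>\<open>permutations_of_multiset\<close>.
  Mathematical sequences start at index 1, lists at index 0.\<close>

abbreviation entry :: "'a list \<Rightarrow> nat \<Rightarrow> 'a" where
  "entry is r \<equiv> is ! (r - 1)"

definition swap_places :: "nat \<Rightarrow> 'a list \<Rightarrow> 'a list" where
  "swap_places r is = is[r - 1 := entry is (r + 1), r := entry is r]"


section \<open>Free algebras\<close>

text \<open>The free unital algebra on a set of letters is the algebra of finitely supported
  functions on words, under the convolution product of \<^theory>\<open>HOL-Library.Poly_Mapping\<close>.
  That product needs the word monoid to be written additively.\<close>

datatype 'g fword = FWord (letters: "'g list")

instantiation fword :: (type) monoid_add
begin
definition zero_fword :: "'a fword" where "0 = FWord []"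
definition plus_fword :: "'a fword \<Rightarrow> 'a fword \<Rightarrow> 'a fword" where
  "u + v = FWord (letters u @ letters v)"
instance
  by standard (simp_all add: zero_fword_def plus_fword_def)
end

definition free_gen :: "'g \<Rightarrow> ('g fword \<Rightarrow>\<^sub>0 'k::field)" where
  "free_gen g = Poly_Mapping.single (FWord [g]) 1"

definition free_algebra :: "'g set \<Rightarrow> ('g fword \<Rightarrow>\<^sub>0 'k::field) ring" where
  "free_algebra X =
     \<lparr>carrier = {p. \<forall>w \<in> Poly_Mapping.keys p. set (letters w) \<subseteq> X},
      monoid.mult = (*), one = 1, zero = 0, add = (+)\<rparr>"

lemma free_algebra_mult_closed:
  assumes "p \<in> carrier (free_algebra X)" "q \<in> carrier (free_algebra X)"
  shows "p * q \<in> carrier (free_algebra X)"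
  using assms keys_mult[of p q]
  by (fastforce simp: free_algebra_def plus_fword_def)

lemma free_algebra_ring:
  fixes X :: "'g set"
  shows "ring (free_algebra X :: ('g fword \<Rightarrow>\<^sub>0 'k::field) ring)"
    (is "ring ?F")
proof (rule ringI)
  show "abelian_group ?F"
  proof (rule abelian_groupI)
    fix p q :: "'g fword \<Rightarrow>\<^sub>0 'k"
    assume "p \<in> carrier ?F" "q \<in> carrier ?F"
    then show "p \<oplus>\<^bsub>?F\<^esub> q \<in> carrier ?F"
      using subsetD[OF Poly_Mapping.keys_add[of p q]]
      by (simp add: free_algebra_def) blast
  next
    fix p :: "'g fword \<Rightarrow>\<^sub>0 'k"
    assume "p \<in> carrier ?F"
    then have "- p \<in> carrier ?F"
      "- p \<oplus>\<^bsub>?F\<^esub> p = \<zero>\<^bsub>?F\<^esub>"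
      by (auto simp: free_algebra_def)
    then show "\<exists>q \<in> carrier ?F. q \<oplus>\<^bsub>?F\<^esub> p = \<zero>\<^bsub>?F\<^esub>"
      by blast
  qed (auto simp: free_algebra_def algebra_simps)
  show "Group.monoid ?F"
  proof (rule Group.monoidI)
    show "\<one>\<^bsub>?F\<^esub> \<in> carrier ?F"
      unfolding free_algebra_def by (auto simp: zero_fword_def)
    fix p q :: "'g fword \<Rightarrow>\<^sub>0 'k"
    assume "p \<in> carrier ?F" "q \<in> carrier ?F"
    then show "p \<otimes>\<^bsub>?F\<^esub> q \<in> carrier ?F"
      using free_algebra_mult_closed by (simp add: free_algebra_def)
  qed (auto simp: free_algebra_def mult.assoc)
qed (auto simp: free_algebra_def algebra_simps)


section \<open>Left modules over a ring with carrier\<close>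

text \<open>The locale \<^locale>\<open>module\<close> of \<^theory>\<open>HOL-Algebra.Module\<close> requires a commutative
  ring; the following has the same axioms over an arbitrary ring.  As there, the fields \<open>mult\<close>
  and \<open>one\<close> of the module record carry no meaning.\<close>

locale left_module = R?: ring R + M?: abelian_group M
    for R :: "('a, 'c) ring_scheme" (structure) and M :: "('a, 'b, 'd) module_scheme" (structure) +
  assumes smult_closed:
      "\<lbrakk>a \<in> carrier R; x \<in> carrier M\<rbrakk> \<Longrightarrow> a \<odot>\<^bsub>M\<^esub> x \<in> carrier M"
    and smult_l_distr:
      "\<lbrakk>a \<in> carrier R; b \<in> carrier R; x \<in> carrier M\<rbrakk> \<Longrightarrow>
        (a \<oplus>\<^bsub>R\<^esub> b) \<odot>\<^bsub>M\<^esub> x = a \<odot>\<^bsub>M\<^esub> x \<oplus>\<^bsub>M\<^esub> b \<odot>\<^bsub>M\<^esub> x"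
    and smult_r_distr:
      "\<lbrakk>a \<in> carrier R; x \<in> carrier M; y \<in> carrier M\<rbrakk> \<Longrightarrow>
        a \<odot>\<^bsub>M\<^esub> (x \<oplus>\<^bsub>M\<^esub> y) = a \<odot>\<^bsub>M\<^esub> x \<oplus>\<^bsub>M\<^esub> a \<odot>\<^bsub>M\<^esub> y"
    and smult_assoc:
      "\<lbrakk>a \<in> carrier R; b \<in> carrier R; x \<in> carrier M\<rbrakk> \<Longrightarrow>
        (a \<otimes>\<^bsub>R\<^esub> b) \<odot>\<^bsub>M\<^esub> x = a \<odot>\<^bsub>M\<^esub> (b \<odot>\<^bsub>M\<^esub> x)"
    and smult_one:
      "x \<in> carrier M \<Longrightarrow> \<one>\<^bsub>R\<^esub> \<odot>\<^bsub>M\<^esub> x = x"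

definition left_module_iso ::
  "('a, 'c) ring_scheme \<Rightarrow> ('a, 'm) module \<Rightarrow> ('a, 'n) module \<Rightarrow> bool" where
  "left_module_iso R M N \<longleftrightarrow>
     left_module R M \<and> left_module R N \<and>
     (\<exists>f. bij_betw f (carrier M) (carrier N) \<and>
          (\<forall>x \<in> carrier M. \<forall>y \<in> carrier M. f (x \<oplus>\<^bsub>M\<^esub> y) = f x \<oplus>\<^bsub>N\<^esub> f y) \<and>
          (\<forall>a \<in> carrier R. \<forall>x \<in> carrier M. f (a \<odot>\<^bsub>M\<^esub> x) = a \<odot>\<^bsub>N\<^esub> f x))"

definition gen_submodule ::
  "('a, 'c) ring_scheme \<Rightarrow> ('a, 'm) module \<Rightarrow> 'm set \<Rightarrow> 'm set" where
  "gen_submodule R M S = \<Inter>{H. submodule H R M \<and> S \<subseteq> H}"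

text \<open>The action on cosets mirrors \<^const>\<open>rcoset_mult\<close>; when \<open>N\<close> is a submodule, it sends the
  coset of \<open>x\<close> to the coset of \<open>a \<odot> x\<close>.\<close>

definition quot_module :: "('a, 'm) module \<Rightarrow> 'm set \<Rightarrow> ('a, 'm set) module" where
  "quot_module M N =
     \<lparr>carrier = a_rcosets\<^bsub>M\<^esub> N, monoid.mult = rcoset_mult M N, one = N +>\<^bsub>M\<^esub> \<one>\<^bsub>M\<^esub>,
      zero = N, add = set_add M,
      smult = (\<lambda>a X. \<Union>x\<in>X. N +>\<^bsub>M\<^esub> (a \<odot>\<^bsub>M\<^esub> x))\<rparr>"

definition restrict_module :: "('a, 'm) module \<Rightarrow> 'm set \<Rightarrow> ('a, 'm) module" where
  "restrict_module M H = M\<lparr>carrier := H\<rparr>"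

definition regular_module :: "'a ring \<Rightarrow> ('a, 'a) module" where
  "regular_module R =
     \<lparr>carrier = carrier R, monoid.mult = monoid.mult R, one = one R, zero = zero R, add = add R,
      smult = monoid.mult R\<rparr>"

text \<open>The cyclic left module with one generator \<open>z\<close> and relations \<open>a \<odot> z = 0\<close> for \<open>a \<in> S\<close>.\<close>

definition cyclic_module :: "'a ring \<Rightarrow> 'a set \<Rightarrow> ('a, 'a set) module" where
  "cyclic_module R S = quot_module (regular_module R) (gen_submodule R (regular_module R) S)"

definition cyclic_gen :: "'a ring \<Rightarrow> 'a set \<Rightarrow> 'a set" where
  "cyclic_gen R S = gen_submodule R (regular_module R) S +>\<^bsub>regular_module R\<^esub> \<one>\<^bsub>R\<^esub>"

definition annihilates :: "'a set \<Rightarrow> ('a, 'm) module \<Rightarrow> bool" where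
  "annihilates J M \<longleftrightarrow> (\<forall>a \<in> J. \<forall>x \<in> carrier M. a \<odot>\<^bsub>M\<^esub> x = \<zero>\<^bsub>M\<^esub>)"


lemma regular_left_module:
  fixes R :: "'a ring"
  assumes "ring R"
  shows "left_module R (regular_module R)"
proof -
  interpret ring R by fact
  show ?thesis
  proof (intro left_module.intro left_module_axioms.intro)
    show "abelian_group (regular_module R)"
      by (rule abelian_groupI) (auto simp: regular_module_def a_ac intro: l_neg)
  qed (auto simp: regular_module_def l_distr r_distr m_assoc ring_axioms)
qed

lemma quot_left_module:
  assumes "left_module R M" "submodule N R M"
  shows "left_module R (quot_module M N)"
proof -
  interpret left_module R M by fact
  interpret N: submodule N R M by fact
  interpret abelian_subgroup N M
    by (rule abelian_subgroupI3)
      (auto simp: additive_subgroup_def N.subgroup_axioms M.abelian_group_axioms)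
  have zero: "N +>\<^bsub>M\<^esub> \<zero>\<^bsub>M\<^esub> = N"
    by (simp add: a_subset a_coset_add_zero)
  have add: "(N +>\<^bsub>M\<^esub> x) <+>\<^bsub>M\<^esub> (N +>\<^bsub>M\<^esub> y) = N +>\<^bsub>M\<^esub> (x \<oplus>\<^bsub>M\<^esub> y)"
    if "x \<in> carrier M" "y \<in> carrier M" for x y
    using that by (rule a_rcos_sum)
  have act: "(\<Union>y \<in> N +>\<^bsub>M\<^esub> x. N +>\<^bsub>M\<^esub> (a \<odot>\<^bsub>M\<^esub> y)) = N +>\<^bsub>M\<^esub> (a \<odot>\<^bsub>M\<^esub> x)"
    if a: "a \<in> carrier R" and x: "x \<in> carrier M" for a x
  proof -
    have "N +>\<^bsub>M\<^esub> (a \<odot>\<^bsub>M\<^esub> y) = N +>\<^bsub>M\<^esub> (a \<odot>\<^bsub>M\<^esub> x)" if "y \<in> N +>\<^bsub>M\<^esub> x" for y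
    proof -
      from that obtain h where h: "h \<in> N" "y = h \<oplus>\<^bsub>M\<^esub> x"
        by (auto simp: a_r_coset_def')
      then have "a \<odot>\<^bsub>M\<^esub> y = a \<odot>\<^bsub>M\<^esub> h \<oplus>\<^bsub>M\<^esub> a \<odot>\<^bsub>M\<^esub> x"
        using a x a_Hcarr by (simp add: smult_r_distr)
      moreover have "a \<odot>\<^bsub>M\<^esub> h \<in> N"
        using a h(1) by (rule N.smult_closed)
      ultimately have "a \<odot>\<^bsub>M\<^esub> y \<in> N +>\<^bsub>M\<^esub> (a \<odot>\<^bsub>M\<^esub> x)"
        by (auto simp: a_r_coset_def')
      then show ?thesis
        using a_repr_independence[OF _ smult_closed[OF a x] N.subgroup_axioms] by simp
    qed
    moreover have "x \<in> N +>\<^bsub>M\<^esub> x"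
      using x by (rule a_rcos_self)
    ultimately show ?thesis by blast
  qed
  have coset: "\<exists>x \<in> carrier M. X = N +>\<^bsub>M\<^esub> x" if "X \<in> a_rcosets\<^bsub>M\<^esub> N" for X
    using that by (auto simp: A_RCOSETS_def')
  have closed: "N +>\<^bsub>M\<^esub> x \<in> a_rcosets\<^bsub>M\<^esub> N" if "x \<in> carrier M" for x
    using that by (auto simp: A_RCOSETS_def')
  show ?thesis
  proof (intro left_module.intro left_module_axioms.intro)
    show "abelian_group (quot_module M N)"
    proof (rule abelian_groupI)
      fix X Y Z
      assume "X \<in> carrier (quot_module M N)" "Y \<in> carrier (quot_module M N)"
        "Z \<in> carrier (quot_module M N)"
      then obtain x y z where "x \<in> carrier M" "X = N +>\<^bsub>M\<^esub> x"
        "y \<in> carrier M" "Y = N +>\<^bsub>M\<^esub> y" "z \<in> carrier M" "Z = N +>\<^bsub>M\<^esub> z"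
        using coset[of X] coset[of Y] coset[of Z] by (auto simp: quot_module_def)
      then show "X \<oplus>\<^bsub>quot_module M N\<^esub> Y \<oplus>\<^bsub>quot_module M N\<^esub> Z =
          X \<oplus>\<^bsub>quot_module M N\<^esub> (Y \<oplus>\<^bsub>quot_module M N\<^esub> Z)"
        by (simp add: quot_module_def add M.a_assoc)
    next
      fix X Y
      assume "X \<in> carrier (quot_module M N)" "Y \<in> carrier (quot_module M N)"
      then obtain x y where xy: "x \<in> carrier M" "X = N +>\<^bsub>M\<^esub> x"
        "y \<in> carrier M" "Y = N +>\<^bsub>M\<^esub> y"
        using coset[of X] coset[of Y] by (auto simp: quot_module_def)
      show "X \<oplus>\<^bsub>quot_module M N\<^esub> Y \<in> carrier (quot_module M N)"
        using xy closed by (simp add: quot_module_def add)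
      show "X \<oplus>\<^bsub>quot_module M N\<^esub> Y = Y \<oplus>\<^bsub>quot_module M N\<^esub> X"
        using xy by (simp add: quot_module_def add M.a_comm)
    next
      show "\<zero>\<^bsub>quot_module M N\<^esub> \<in> carrier (quot_module M N)"
        using closed[OF M.zero_closed] zero by (simp add: quot_module_def)
    next
      fix X
      assume "X \<in> carrier (quot_module M N)"
      then obtain x where x: "x \<in> carrier M" "X = N +>\<^bsub>M\<^esub> x"
        using coset[of X] by (auto simp: quot_module_def)
      have "N <+>\<^bsub>M\<^esub> X = X"
        using add[OF M.zero_closed x(1)] x zero by simp
      then show "\<zero>\<^bsub>quot_module M N\<^esub> \<oplus>\<^bsub>quot_module M N\<^esub> X = X"
        by (simp add: quot_module_def)
      have "(N +>\<^bsub>M\<^esub> (\<ominus>\<^bsub>M\<^esub> x)) <+>\<^bsub>M\<^esub> X = N"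
        using x zero by (simp add: add M.l_neg)
      then show "\<exists>Y \<in> carrier (quot_module M N).
          Y \<oplus>\<^bsub>quot_module M N\<^esub> X = \<zero>\<^bsub>quot_module M N\<^esub>"
        using closed[OF M.a_inv_closed[OF x(1)]] by (auto simp: quot_module_def)
    qed
  next
    fix a X Y
    assume a: "a \<in> carrier R"
      and "X \<in> carrier (quot_module M N)" "Y \<in> carrier (quot_module M N)"
    then obtain x y where x: "x \<in> carrier M" "X = N +>\<^bsub>M\<^esub> x"
      and y: "y \<in> carrier M" "Y = N +>\<^bsub>M\<^esub> y"
      using coset[of X] coset[of Y] by (auto simp: quot_module_def)
    show "a \<odot>\<^bsub>quot_module M N\<^esub> (X \<oplus>\<^bsub>quot_module M N\<^esub> Y) =
        a \<odot>\<^bsub>quot_module M N\<^esub> X \<oplus>\<^bsub>quot_module M N\<^esub> a \<odot>\<^bsub>quot_module M N\<^esub> Y"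
      using a x y by (simp add: quot_module_def add act smult_closed smult_r_distr)
  next
    fix a b X
    assume a: "a \<in> carrier R" and b: "b \<in> carrier R" and "X \<in> carrier (quot_module M N)"
    then obtain x where x: "x \<in> carrier M" "X = N +>\<^bsub>M\<^esub> x"
      using coset[of X] by (auto simp: quot_module_def)
    show "a \<odot>\<^bsub>quot_module M N\<^esub> X \<in> carrier (quot_module M N)"
      using a x by (simp add: quot_module_def act closed smult_closed)
    show "(a \<oplus>\<^bsub>R\<^esub> b) \<odot>\<^bsub>quot_module M N\<^esub> X =
        a \<odot>\<^bsub>quot_module M N\<^esub> X \<oplus>\<^bsub>quot_module M N\<^esub> b \<odot>\<^bsub>quot_module M N\<^esub> X"
      using a b x by (simp add: quot_module_def add act smult_closed smult_l_distr)
    show "(a \<otimes>\<^bsub>R\<^esub> b) \<odot>\<^bsub>quot_module M N\<^esub> X =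
        a \<odot>\<^bsub>quot_module M N\<^esub> (b \<odot>\<^bsub>quot_module M N\<^esub> X)"
      using a b x by (simp add: quot_module_def act smult_closed smult_assoc)
  next
    fix X
    assume "X \<in> carrier (quot_module M N)"
    then obtain x where x: "x \<in> carrier M" "X = N +>\<^bsub>M\<^esub> x"
      using coset[of X] by (auto simp: quot_module_def)
    show "\<one>\<^bsub>R\<^esub> \<odot>\<^bsub>quot_module M N\<^esub> X = X"
      using x by (simp add: quot_module_def act smult_one)
  qed (rule R.ring_axioms)
qed


section \<open>KLR algebras\<close>

datatype klr_letter = LetE "int list" | LetY nat | LetPsi nat

type_synonym 'k klr_free = "klr_letter fword \<Rightarrow>\<^sub>0 'k"

type_synonym 'k klr = "'k klr_free set"

definition klr_letters :: "int multiset \<Rightarrow> klr_letter set" where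
  "klr_letters \<alpha> =
     LetE ` permutations_of_multiset \<alpha> \<union> LetY ` {1..size \<alpha>} \<union> LetPsi ` {1..<size \<alpha>}"

abbreviation fe :: "int list \<Rightarrow> 'k::field klr_free" where "fe is \<equiv> free_gen (LetE is)"
abbreviation fy :: "nat \<Rightarrow> 'k::field klr_free" where "fy r \<equiv> free_gen (LetY r)"
abbreviation fpsi :: "nat \<Rightarrow> 'k::field klr_free" where "fpsi r \<equiv> free_gen (LetPsi r)"

definition quad_coeff :: "nat \<Rightarrow> int list \<Rightarrow> nat \<Rightarrow> 'k::field klr_free" where
  "quad_coeff e is r =
     (if entry is r = entry is (r + 1) then 0
      else if arrow e (entry is r) (entry is (r + 1)) then fy (r + 1) - fy r
      else if arrow e (entry is (r + 1)) (entry is r) then fy r - fy (r + 1)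
      else 1)"

definition braid_coeff :: "nat \<Rightarrow> int list \<Rightarrow> nat \<Rightarrow> 'k::field klr_free" where
  "braid_coeff e is r =
     (if entry is r = entry is (r + 2) \<and> arrow e (entry is r) (entry is (r + 1)) then 1
      else if entry is r = entry is (r + 2) \<and> arrow e (entry is (r + 1)) (entry is r) then - 1
      else 0)"

text \<open>Each defining relation \<open>a = b\<close> is recorded as the element \<open>a - b\<close>.\<close>

inductive_set klr_relators :: "nat \<Rightarrow> int multiset \<Rightarrow> 'k::field klr_free set"
  for e :: nat and \<alpha> :: "int multiset" where
  idem: "\<lbrakk>is \<in> permutations_of_multiset \<alpha>; js \<in> permutations_of_multiset \<alpha>\<rbrakk> \<Longrightarrow>
    fe is * fe js - (if is = js then fe is else 0) \<in> klr_relators e \<alpha>"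
| unit: "(\<Sum>is \<in> permutations_of_multiset \<alpha>. fe is) - 1 \<in> klr_relators e \<alpha>"
| dot_idem: "\<lbrakk>is \<in> permutations_of_multiset \<alpha>; r \<in> {1..size \<alpha>}\<rbrakk> \<Longrightarrow>
    fy r * fe is - fe is * fy r \<in> klr_relators e \<alpha>"
| cross_idem: "\<lbrakk>is \<in> permutations_of_multiset \<alpha>; r \<in> {1..<size \<alpha>}\<rbrakk> \<Longrightarrow>
    fpsi r * fe is - fe (swap_places r is) * fpsi r \<in> klr_relators e \<alpha>"
| dot_dot: "\<lbrakk>r \<in> {1..size \<alpha>}; s \<in> {1..size \<alpha>}\<rbrakk> \<Longrightarrow>
    fy r * fy s - fy s * fy r \<in> klr_relators e \<alpha>"
| cross_dot: "\<lbrakk>r \<in> {1..<size \<alpha>}; s \<in> {1..size \<alpha>}; s \<noteq> r; s \<noteq> r + 1\<rbrakk> \<Longrightarrow>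
    fpsi r * fy s - fy s * fpsi r \<in> klr_relators e \<alpha>"
| cross_cross: "\<lbrakk>r \<in> {1..<size \<alpha>}; s \<in> {1..<size \<alpha>}; \<bar>int r - int s\<bar> > 1\<rbrakk> \<Longrightarrow>
    fpsi r * fpsi s - fpsi s * fpsi r \<in> klr_relators e \<alpha>"
| slide_right: "\<lbrakk>is \<in> permutations_of_multiset \<alpha>; r \<in> {1..<size \<alpha>}\<rbrakk> \<Longrightarrow>
    fpsi r * fy (r + 1) * fe is
      - (fy r * fpsi r + (if entry is r = entry is (r + 1) then 1 else 0)) * fe is
      \<in> klr_relators e \<alpha>"
| slide_left: "\<lbrakk>is \<in> permutations_of_multiset \<alpha>; r \<in> {1..<size \<alpha>}\<rbrakk> \<Longrightarrow>
    fy (r + 1) * fpsi r * fe is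
      - (fpsi r * fy r + (if entry is r = entry is (r + 1) then 1 else 0)) * fe is
      \<in> klr_relators e \<alpha>"
| quadratic: "\<lbrakk>is \<in> permutations_of_multiset \<alpha>; r \<in> {1..<size \<alpha>}\<rbrakk> \<Longrightarrow>
    fpsi r * fpsi r * fe is - quad_coeff e is r * fe is \<in> klr_relators e \<alpha>"
| braid: "\<lbrakk>is \<in> permutations_of_multiset \<alpha>; r \<in> {1..<size \<alpha>}; r + 1 \<in> {1..<size \<alpha>}\<rbrakk> \<Longrightarrow>
    fpsi r * fpsi (r + 1) * fpsi r * fe is
      - (fpsi (r + 1) * fpsi r * fpsi (r + 1) + braid_coeff e is r) * fe is
      \<in> klr_relators e \<alpha>"

definition klr_ideal :: "nat \<Rightarrow> int multiset \<Rightarrow> 'k::field klr_free set" where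
  "klr_ideal e \<alpha> = Idl\<^bsub>free_algebra (klr_letters \<alpha>)\<^esub> (klr_relators e \<alpha>)"

text \<open>The scalars lie in the free algebra as multiples of \<open>1\<close>, so its two-sided ring ideals
  are algebra ideals, and modules over the quotient ring are automatically vector spaces with
  linear action.\<close>

definition klr_algebra :: "nat \<Rightarrow> int multiset \<Rightarrow> 'k::field klr ring" where
  "klr_algebra e \<alpha> = free_algebra (klr_letters \<alpha>) Quot klr_ideal e \<alpha>"

lemma swap_places_closed:
  assumes "is \<in> permutations_of_multiset \<alpha>" "r \<in> {1..<size \<alpha>}"
  shows "swap_places r is \<in> permutations_of_multiset \<alpha>"
proof -
  have "mset is = \<alpha>"
    using assms(1) by (simp add: permutations_of_multiset_def)
  moreover from this have "r < length is" "r - 1 < length is"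
    using assms(2) by auto
  ultimately have "mset (is[r - 1 := is ! r, r := is ! (r - 1)]) = \<alpha>"
    using mset_swap[of r "is" "r - 1"] by metis
  then show ?thesis
    by (simp add: permutations_of_multiset_def swap_places_def)
qed

lemma klr_relators_closed:
  "(klr_relators e \<alpha> :: 'k::field klr_free set) \<subseteq> carrier (free_algebra (klr_letters \<alpha>))"
proof
  let ?C = "carrier (free_algebra (klr_letters \<alpha>)) :: 'k klr_free set"
  note mult = free_algebra_mult_closed
  have add: "p + q \<in> ?C" if "p \<in> ?C" "q \<in> ?C" for p q
    using that subsetD[OF Poly_Mapping.keys_add[of p q]]
    by (simp add: free_algebra_def) blast
  have neg: "- p \<in> ?C" if "p \<in> ?C" for p
    using that by (simp add: free_algebra_def)
  have diff: "p - q \<in> ?C" if "p \<in> ?C" "q \<in> ?C" for p q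
    using add[OF that(1) neg[OF that(2)]] by simp
  have zero: "0 \<in> ?C" and one: "1 \<in> ?C"
    by (auto simp: free_algebra_def zero_fword_def)
  have sum: "sum f A \<in> ?C" if "\<And>a. a \<in> A \<Longrightarrow> f a \<in> ?C" for f and A :: "int list set"
    using that by (induction A rule: infinite_finite_induct) (auto intro: zero add)
  have e: "fe is \<in> ?C" if "is \<in> permutations_of_multiset \<alpha>" for "is"
    using that by (auto simp: free_algebra_def free_gen_def klr_letters_def)
  have y: "fy r \<in> ?C" if "1 \<le> r" "r \<le> size \<alpha>" for r
    using that by (auto simp: free_algebra_def free_gen_def klr_letters_def)
  have psi: "fpsi r \<in> ?C" if "1 \<le> r" "r < size \<alpha>" for r
    using that by (auto simp: free_algebra_def free_gen_def klr_letters_def)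
  fix p :: "'k klr_free"
  assume "p \<in> klr_relators e \<alpha>"
  then show "p \<in> ?C"
    by cases
      (auto simp: quad_coeff_def braid_coeff_def
        intro!: diff add mult neg zero one sum e y psi swap_places_closed)
qed

lemma klr_algebra_ring: "ring (klr_algebra e \<alpha>)"
  unfolding klr_algebra_def klr_ideal_def
  by (intro ideal.quotient_is_ring ring.genideal_ideal free_algebra_ring klr_relators_closed)

definition klr_class :: "nat \<Rightarrow> int multiset \<Rightarrow> 'k::field klr_free \<Rightarrow> 'k klr" where
  "klr_class e \<alpha> p = klr_ideal e \<alpha> +>\<^bsub>free_algebra (klr_letters \<alpha>)\<^esub> p"

text \<open>A dominant weight \<open>\<Lambda>\<close> is given by its coefficients.  The cyclotomic quotient is
  \<open>klr_algebra e \<alpha> Quot cyclotomic_ideal e \<alpha> \<Lambda>\<close>, so its modules are the modules over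
  \<open>klr_algebra e \<alpha>\<close> annihilated by \<open>cyclotomic_ideal e \<alpha> \<Lambda>\<close>.\<close>

definition cyclotomic_ideal ::
  "nat \<Rightarrow> int multiset \<Rightarrow> (int \<Rightarrow> nat) \<Rightarrow> 'k::field klr set" where
  "cyclotomic_ideal e \<alpha> \<Lambda> =
     Idl\<^bsub>klr_algebra e \<alpha>\<^esub>
       {klr_class e \<alpha> (fy 1 ^ \<Lambda> (entry is 1) * fe is) | is. is \<in> permutations_of_multiset \<alpha>}"


section \<open>Reduced expressions\<close>

definition word_perm :: "nat list \<Rightarrow> nat \<Rightarrow> nat" where
  "word_perm ws = foldr (\<lambda>i f. transpose i (i + 1) \<circ> f) ws id"

definition reduced_expression :: "nat \<Rightarrow> (nat \<Rightarrow> nat) \<Rightarrow> nat list \<Rightarrow> bool" where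
  "reduced_expression n w ws \<longleftrightarrow>
     set ws \<subseteq> {1..<n} \<and> word_perm ws = w \<and>
     (\<forall>vs. set vs \<subseteq> {1..<n} \<and> word_perm vs = w \<longrightarrow> length ws \<le> length vs)"

definition reduced_choice :: "nat \<Rightarrow> ((nat \<Rightarrow> nat) \<Rightarrow> nat list) \<Rightarrow> bool" where
  "reduced_choice n red \<longleftrightarrow> (\<forall>w. w permutes {1..n} \<longrightarrow> reduced_expression n w (red w))"

definition fpsi_perm :: "((nat \<Rightarrow> nat) \<Rightarrow> nat list) \<Rightarrow> (nat \<Rightarrow> nat) \<Rightarrow> 'k::field klr_free" where
  "fpsi_perm red w = prod_list (map fpsi (red w))"


section \<open>Multipartitions and tableaux\<close>

text \<open>A multipartition is a list of components, each the list of its positive row lengths.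
  Nodes are triples (component, row, column), all counted from 1.\<close>

type_synonym mpart = "nat list list"
type_synonym node = "nat \<times> nat \<times> nat"

definition young :: "mpart \<Rightarrow> node set" where
  "young \<mu> = {(m, a, b). m \<in> {1..length \<mu>} \<and> a \<in> {1..length (entry \<mu> m)} \<and>
                        b \<in> {1..entry (entry \<mu> m) a}}"

definition mpart_size :: "mpart \<Rightarrow> nat" where
  "mpart_size \<mu> = sum_list (map sum_list \<mu>)"

fun residue :: "nat \<Rightarrow> int list \<Rightarrow> node \<Rightarrow> int" where
  "residue e \<kappa> (m, a, b) = (entry \<kappa> m + int b - int a) mod int e"

definition content :: "nat \<Rightarrow> int list \<Rightarrow> mpart \<Rightarrow> int multiset" where
  "content e \<kappa> \<mu> = image_mset (residue e \<kappa>) (mset_set (young \<mu>))"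

definition charge_weight :: "nat \<Rightarrow> int list \<Rightarrow> int \<Rightarrow> nat" where
  "charge_weight e \<kappa> i = card {m \<in> {1..length \<kappa>}. entry \<kappa> m mod int e = i}"

text \<open>Tableaux are functions on all triples; only the values on the Young diagram matter.\<close>

fun init_tableau :: "mpart \<Rightarrow> node \<Rightarrow> nat" where
  "init_tableau \<mu> (m, a, b) =
     mpart_size (take (m - 1) \<mu>) + sum_list (take (a - 1) (entry \<mu> m)) + b"

definition init_residues :: "nat \<Rightarrow> int list \<Rightarrow> mpart \<Rightarrow> int list" where
  "init_residues e \<kappa> \<mu> =
     map (\<lambda>r. residue e \<kappa> (the_inv_into (young \<mu>) (init_tableau \<mu>) r)) [1..<mpart_size \<mu> + 1]"

definition tableau_perm :: "mpart \<Rightarrow> (node \<Rightarrow> nat) \<Rightarrow> nat \<Rightarrow> nat" where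
  "tableau_perm \<mu> T =
     (THE w. w permutes {1..mpart_size \<mu>} \<and> (\<forall>N \<in> young \<mu>. w (init_tableau \<mu> N) = T N))"

definition same_row :: "mpart \<Rightarrow> nat \<Rightarrow> nat \<Rightarrow> bool" where
  "same_row \<mu> r s \<longleftrightarrow>
     (\<exists>m a b c. (m, a, b) \<in> young \<mu> \<and> (m, a, c) \<in> young \<mu> \<and>
        init_tableau \<mu> (m, a, b) = r \<and> init_tableau \<mu> (m, a, c) = s)"

definition garnir_nodes :: "mpart \<Rightarrow> node set" where
  "garnir_nodes \<mu> = {(m, a, b). (m, a, b) \<in> young \<mu> \<and> (m, a + 1, b) \<in> young \<mu>}"

fun garnir_belt :: "mpart \<Rightarrow> node \<Rightarrow> node set" where
  "garnir_belt \<mu> (m, a, b) =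
     {(m, a, c) | c. (m, a, c) \<in> young \<mu> \<and> b \<le> c} \<union> {(m, a + 1, c) | c. 1 \<le> c \<and> c \<le> b}"

text \<open>In the initial tableau the belt of \<open>A = (m, a, b)\<close> holds consecutive numbers, the smallest
  being the entry \<open>u\<close> of \<open>A\<close>.  In the Garnir tableau \<open>u, \<dots>, u + b - 1\<close> fill the lower row of
  the belt, and \<open>u + b, u + b + 1, \<dots>\<close> its upper row from column \<open>b\<close> on.\<close>

fun garnir_tableau :: "mpart \<Rightarrow> node \<Rightarrow> node \<Rightarrow> nat" where
  "garnir_tableau \<mu> (m, a, b) (m', a', c) =
     (if (m', a', c) \<notin> garnir_belt \<mu> (m, a, b) then init_tableau \<mu> (m', a', c)
      else if a' = a + 1 then init_tableau \<mu> (m, a, b) + (c - 1)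
      else init_tableau \<mu> (m, a, b) + c)"

lemma garnir_tableau_belt:
  assumes "A \<in> garnir_nodes \<mu>"
  shows "garnir_tableau \<mu> A ` garnir_belt \<mu> A = init_tableau \<mu> ` garnir_belt \<mu> A"
proof -
  obtain m a b where A: "A = (m, a, b)" by (cases A)
  let ?u = "init_tableau \<mu> (m, a, b)" and ?l = "entry (entry \<mu> m) a"
  from assms A have m: "m \<in> {1..length \<mu>}" and a: "a \<in> {1..<length (entry \<mu> m)}"
    and b: "1 \<le> b" "b \<le> ?l"
    by (auto simp: garnir_nodes_def young_def)
  define U where "U = (\<lambda>c. (m, a, c)) ` {b..?l}"
  define L where "L = (\<lambda>c. (m, a + 1, c)) ` {1..b}"
  have belt: "garnir_belt \<mu> A = U \<union> L"
    using m a b by (auto simp: A U_def L_def young_def)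
  from a obtain a' where a': "a = Suc a'" "a' < length (entry \<mu> m)"
    by (cases a) auto
  have next_row: "init_tableau \<mu> (m, a + 1, c) = ?u + (?l - b) + c" for c
    using a' b by (simp add: take_Suc_conv_app_nth)
  have initU: "init_tableau \<mu> ` U = {?u..?u + (?l - b)}"
  proof -
    have "init_tableau \<mu> ` U = (\<lambda>c. ?u - b + c) ` {b..?l}"
      by (simp add: U_def image_image)
    also have "\<dots> = {?u - b + b..?u - b + ?l}"
      unfolding image_add_atLeastAtMost by (simp only: add.commute)
    also have "\<dots> = {?u..?u + (?l - b)}"
      using b by simp
    finally show ?thesis .
  qed
  have initL: "init_tableau \<mu> ` L = {?u + (?l - b) + 1..?u + (?l - b) + b}"
    unfolding L_def image_image next_row image_add_atLeastAtMost by (simp only: add.commute)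
  have "garnir_tableau \<mu> A ` L = (\<lambda>c. ?u + (c - 1)) ` {1..b}"
    unfolding L_def image_image A
    by (intro image_cong refl) (auto simp del: init_tableau.simps)
  also have "\<dots> = (+) ?u ` ((\<lambda>c. c - 1) ` {1..b})"
    by (simp only: image_image)
  also have "(\<lambda>c. c - 1) ` {1..b} = {0..b - 1}"
    using b by (auto simp: image_iff intro!: bexI[of _ "Suc _"])
  finally have garL: "garnir_tableau \<mu> A ` L = {?u..?u + (b - 1)}"
    unfolding image_add_atLeastAtMost by (simp only: add_0_left add.commute)
  have "garnir_tableau \<mu> A ` U = (\<lambda>c. ?u + c) ` {b..?l}"
    unfolding U_def image_image A
    using m a b
    by (intro image_cong refl) (auto simp: young_def simp del: init_tableau.simps)
  then have garU: "garnir_tableau \<mu> A ` U = {?u + b..?u + ?l}"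
    unfolding image_add_atLeastAtMost by (simp only: add.commute)
  show ?thesis
    unfolding belt image_Un initU initL garL garU set_eq_iff Un_iff atLeastAtMost_iff
    using b by (auto simp del: init_tableau.simps)
qed


section \<open>Permutation modules and Specht modules\<close>

definition perm_relators :: "nat \<Rightarrow> int list \<Rightarrow> mpart \<Rightarrow> 'k::field klr set" where
  "perm_relators e \<kappa> \<mu> = (let \<alpha> = content e \<kappa> \<mu> in
     {klr_class e \<alpha> (fe js - (if js = init_residues e \<kappa> \<mu> then 1 else 0)) | js.
        js \<in> permutations_of_multiset \<alpha>} \<union>
     {klr_class e \<alpha> (fy r) | r. r \<in> {1..size \<alpha>}} \<union>
     {klr_class e \<alpha> (fpsi r) | r. r \<in> {1..<size \<alpha>} \<and> same_row \<mu> r (r + 1)})"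

definition perm_module :: "nat \<Rightarrow> int list \<Rightarrow> mpart \<Rightarrow> ('k::field klr, 'k klr set) module" where
  "perm_module e \<kappa> \<mu> = cyclic_module (klr_algebra e (content e \<kappa> \<mu>)) (perm_relators e \<kappa> \<mu>)"

definition perm_gen :: "nat \<Rightarrow> int list \<Rightarrow> mpart \<Rightarrow> 'k::field klr set" where
  "perm_gen e \<kappa> \<mu> = cyclic_gen (klr_algebra e (content e \<kappa> \<mu>)) (perm_relators e \<kappa> \<mu>)"

definition garnir_elem ::
  "((nat \<Rightarrow> nat) \<Rightarrow> nat list) \<Rightarrow> nat \<Rightarrow> int list \<Rightarrow> mpart \<Rightarrow> node \<Rightarrow> 'k::field klr set" where
  "garnir_elem red e \<kappa> \<mu> A =
     klr_class e (content e \<kappa> \<mu>) (fpsi_perm red (tableau_perm \<mu> (garnir_tableau \<mu> A)))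
       \<odot>\<^bsub>perm_module e \<kappa> \<mu>\<^esub> perm_gen e \<kappa> \<mu>"

text \<open>This presentation of the Specht module is the right one only for multipartitions all of
  whose components are hooks.\<close>

definition specht_module ::
  "((nat \<Rightarrow> nat) \<Rightarrow> nat list) \<Rightarrow> nat \<Rightarrow> int list \<Rightarrow> mpart \<Rightarrow> ('k::field klr, 'k klr set set) module" where
  "specht_module red e \<kappa> \<mu> =
     quot_module (perm_module e \<kappa> \<mu>)
       (gen_submodule (klr_algebra e (content e \<kappa> \<mu>)) (perm_module e \<kappa> \<mu>)
          (garnir_elem red e \<kappa> \<mu> ` garnir_nodes \<mu>))"


section \<open>The filtration for a hook\<close>

definition hook :: "nat \<Rightarrow> nat \<Rightarrow> nat list" where
  "hook k r = k # replicate r 1"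

definition layer_shape :: "nat \<Rightarrow> nat \<Rightarrow> nat \<Rightarrow> mpart" where
  "layer_shape k r i =
     (if i = 0 then [hook k r]
      else if i = 1 then [hook (k + 1) (r - 1)]
      else [[k]] @ replicate (i - 2) [1] @ [hook 2 (r - i)])"

definition layer_charge :: "int \<Rightarrow> nat \<Rightarrow> int list" where
  "layer_charge x i =
     (if i = 0 then [x]
      else if i = 1 then [x - 1]
      else map (\<lambda>j. x - int j) [0..<i - 1] @ [x - int i])"

definition hook_filtration ::
  "((nat \<Rightarrow> nat) \<Rightarrow> nat list) \<Rightarrow> nat \<Rightarrow> int \<Rightarrow> nat \<Rightarrow> nat \<Rightarrow> nat \<Rightarrow> 'k::field klr set set" where
  "hook_filtration red e x k r i = (let M = perm_module e [x] [hook k r] in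
     if i = 0 then carrier M
     else if i \<le> r then
       gen_submodule (klr_algebra e (content e [x] [hook k r])) M
         {garnir_elem red e [x] [hook k r] (1, j, 1) | j. j \<in> {i..r}}
     else {\<zero>\<^bsub>M\<^esub>})"

end

theory Submission
  imports
    "HOL-Computational_Algebra.Formal_Laurent_Series"
    "HOL-Library.Function_Algebras"
    Defs
begin

hide_const (open) Polynomial.content
hide_fact (open) Polynomial.content_def

text \<open>A row-standard tableau is encoded by the word whose \<open>j\<close>-th letter is the row containing \<open>j\<close>; the
  residues of the tableau are then read off the word, and a descent of the word is an inversion.
  Applying crossings to the generator \<open>v\<close> along the words gives a spanning set of \<open>M\<^sup>\<lambda>\<close>, and a word with
  a violated column condition is, up to words with fewer inversions, a multiple of the Garnir element
  for that column.  So the words without violations span the Specht modules.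

  Linear independence comes from a deformation: over the Laurent series in \<open>X\<close> the KLR relations have a
  seminormal representation on the functions of such words, in which a dot acts on row \<open>a\<close> by \<open>X\<^bsup>a+1\<^esup>\<close>,
  and its coordinates with respect to the crossing basis specialise at \<open>X = 0\<close> to functionals on \<open>M\<^sup>\<lambda>\<close>.

  The Garnir element \<open>\<psi>\<^bsup>A\<^sub>i\<^esup>v\<close> satisfies the relations of \<open>S\<^bsup>\<lambda>\<^sub>i\<^esup>\<close> modulo \<open>M\<^bsub>i+1\<^esub>\<close>, which gives a surjection
  from \<open>S\<^bsup>\<lambda>\<^sub>i\<^esup>\<close> onto \<open>M\<^sub>i/M\<^bsub>i+1\<^esub>\<close>.  It sends the word of a standard \<open>\<lambda>\<^sub>i\<close>-tableau to an element whose leading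
  word arises by moving the first node of row \<open>i\<close> to a new row below it; this leading word violates the
  column condition there but none further down.  Hence the leading words of all layers are distinct, the images are
  independent, and the surjections are isomorphisms.

  The cyclotomic relations hold because a dot on the first strand slides to \<open>v\<close>, where it vanishes, up
  to terms in which an earlier row of the same residue starts the word.\<close>

section \<open>Words\<close>

text \<open>A product of crossings depends on the reduced expression, but only up to words with
  fewer inversions, so all spanning and independence arguments compare leading words. The
  straightening is done once, for operators that satisfy the KLR relations modulo a stable subspace
  \<open>Z\<close>. With \<open>Z\<close> a left ideal of the free algebra it gives spanning sets;
  with \<open>Z = {0}\<close> it shows that a power series lattice in the deformation is stable,
  although single crossings have poles at \<open>X = 0\<close>. This stability is what allows the
  specialisation. All modules are lifted to left ideals of the free algebra, and an isomorphism
  becomes an equality of annihilators: \<open>specht_ideal i\<close> against the annihilator of the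
  Garnir element modulo the next layer. One inclusion is a check of relations. The other needs
  independence modulo the next layer, where no basis is known in advance; it follows from the
  independence of all layers taken together. Hooks matter because their Garnir nodes lie in the
  first column: such a Garnir permutation is one chain of crossings with a single reduced
  expression, so nothing depends on \<open>red\<close>.\<close>

lemma swap_places_append:
  "swap_places (Suc (length A)) (A @ x # y # B) = A @ y # x # B"
  by (simp add: swap_places_def nth_append list_update_append)

lemma length_swap_places [simp]: "length (swap_places s T) = length T"
  by (simp add: swap_places_def)

lemma split_at_pair:
  assumes "1 \<le> s" "s < length T"
  obtains A x y B where "T = A @ x # y # B" "s = Suc (length A)"
proof
  show "T = take (s - 1) T @ T ! (s - 1) # T ! s # drop (Suc s) T"
    using assms by (metis Cons_nth_drop_Suc One_nat_def Suc_pred' append_take_drop_id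
        less_eq_Suc_le less_imp_diff_less)
  show "s = Suc (length (take (s - 1) T))"
    using assms by simp
qed

lemma split_at_triple:
  assumes "1 \<le> s" "s + 1 < length T"
  obtains A x y z B where "T = A @ x # y # z # B" "s = Suc (length A)"
proof -
  obtain A x y B where *: "T = A @ x # y # B" "s = Suc (length A)"
    using assms by (auto intro: split_at_pair[of s T])
  then obtain z B' where "B = z # B'"
    using assms by (cases B) auto
  with * that show thesis by blast
qed

lemma swap_places_swap_places:
  assumes "1 \<le> s" "s < length T"
  shows "swap_places s (swap_places s T) = T"
proof -
  obtain A x y B where "T = A @ x # y # B" "s = Suc (length A)"
    by (rule split_at_pair[OF assms])
  then show ?thesis
    by (simp add: swap_places_append)
qed

lemma nth_swap_places:
  assumes "1 \<le> s" "s < length T" "j < length T"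
  shows "swap_places s T ! j = (if j = s - 1 then T ! s else if j = s then T ! (s - 1) else T ! j)"
  using assms by (auto simp: swap_places_def nth_list_update)

lemma swap_places_commute:
  assumes "1 \<le> r" "r < length T" "1 \<le> s" "s < length T" "r + 1 < s \<or> s + 1 < r"
  shows "swap_places r (swap_places s T) = swap_places s (swap_places r T)"
proof (rule nth_equalityI)
  fix j assume "j < length (swap_places r (swap_places s T))"
  then have "j < length T" by simp
  moreover have "r - 1 < length T" "s - 1 < length T" "r \<noteq> s" "r - 1 \<noteq> s" "s - 1 \<noteq> r"
    "r - 1 \<noteq> s - 1"
    using assms by auto
  ultimately show "swap_places r (swap_places s T) ! j = swap_places s (swap_places r T) ! j"
    using assms(1-4) by (simp add: nth_swap_places)
qed simp

lemma mset_swap_places: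
  assumes "1 \<le> s" "s < length T"
  shows "mset (swap_places s T) = mset T"
proof -
  obtain A x y B where "T = A @ x # y # B" "s = Suc (length A)"
    by (rule split_at_pair[OF assms])
  then show ?thesis
    by (simp add: swap_places_append)
qed

section \<open>Inversions, descents and reduced words\<close>

fun inversions :: "nat list \<Rightarrow> nat" where
  "inversions [] = 0"
| "inversions (x # xs) = length (filter (\<lambda>y. y < x) xs) + inversions xs"

definition descent :: "nat list \<Rightarrow> nat \<Rightarrow> bool" where
  "descent T s \<longleftrightarrow> 1 \<le> s \<and> s < length T \<and> T ! s < T ! (s - 1)"

definition ascent :: "nat list \<Rightarrow> nat \<Rightarrow> bool" where
  "ascent T s \<longleftrightarrow> 1 \<le> s \<and> s < length T \<and> T ! (s - 1) < T ! s"

lemma descent_append [simp]: "descent (A @ x # y # B) (Suc (length A)) \<longleftrightarrow> y < x"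
  by (simp add: descent_def nth_append)

lemma ascent_append [simp]: "ascent (A @ x # y # B) (Suc (length A)) \<longleftrightarrow> x < y"
  by (simp add: ascent_def nth_append)

lemma inversions_swap_append:
  assumes "y < x"
  shows "inversions (A @ x # y # B) = Suc (inversions (A @ y # x # B))"
  using assms by (induction A) auto

lemma inversions_swap_descent:
  assumes "descent T s"
  shows "inversions T = Suc (inversions (swap_places s T))"
proof -
  obtain A x y B where "T = A @ x # y # B" "s = Suc (length A)"
    using assms by (auto simp: descent_def intro: split_at_pair[of s T])
  with assms show ?thesis
    using inversions_swap_append[of y x A B] by (simp add: swap_places_append)
qed

lemma inversions_swap_ascent:
  assumes "ascent T s"
  shows "inversions (swap_places s T) = Suc (inversions T)"
proof -
  obtain A x y B where "T = A @ x # y # B" "s = Suc (length A)"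
    using assms by (auto simp: ascent_def intro: split_at_pair[of s T])
  with assms show ?thesis
    using inversions_swap_append[of x y A B] by (simp add: swap_places_append)
qed

lemma descent_swap_iff_ascent:
  "1 \<le> s \<Longrightarrow> s < length T \<Longrightarrow> descent (swap_places s T) s \<longleftrightarrow> ascent T s"
  "1 \<le> s \<Longrightarrow> s < length T \<Longrightarrow> ascent (swap_places s T) s \<longleftrightarrow> descent T s"
  by (auto simp: descent_def ascent_def nth_swap_places)

lemma sorted_iff_no_descent: "sorted T \<longleftrightarrow> (\<forall>s. \<not> descent T s)"
proof
  assume "sorted T"
  then show "\<forall>s. \<not> descent T s"
    by (auto simp: descent_def not_less intro!: sorted_nth_mono)
next
  assume *: "\<forall>s. \<not> descent T s"
  then show "sorted T"
    unfolding sorted_iff_nth_Suc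
  proof (intro allI impI)
    fix i assume "Suc i < length T"
    then show "T ! i \<le> T ! Suc i"
      using *[rule_format, of "Suc i"] by (auto simp: descent_def)
  qed
qed

text \<open>A reduced expression for the shortest permutation that carries the sorted word to
  \<open>T\<close>. Equal letters are never exchanged, so no crossing inside a row is used. Taking
  the least descent merely fixes a choice; another choice changes the resulting vector by words with
  fewer inversions.\<close>

function reduced_word :: "nat list \<Rightarrow> nat list" where
  "reduced_word T = (if \<exists>s. descent T s
     then (LEAST s. descent T s) # reduced_word (swap_places (LEAST s. descent T s) T) else [])"
  by auto
termination
  by (relation "measure inversions")
    (auto simp: inversions_swap_descent[OF LeastI[of "descent _"]])

declare reduced_word.simps [simp del]

lemma reduced_word_sorted: "sorted T \<Longrightarrow> reduced_word T = []"
  by (subst reduced_word.simps) (simp add: sorted_iff_no_descent)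

lemma reduced_word_unsorted:
  assumes "\<not> sorted T"
  obtains s where "descent T s" "reduced_word T = s # reduced_word (swap_places s T)"
proof
  have "\<exists>s. descent T s" using assms by (simp add: sorted_iff_no_descent)
  then show "descent T (LEAST s. descent T s)"
    by (rule LeastI_ex)
  show "reduced_word T =
      (LEAST s. descent T s) # reduced_word (swap_places (LEAST s. descent T s) T)"
    using \<open>\<exists>s. descent T s\<close> by (subst reduced_word.simps) simp
qed

section \<open>Words of initial tableaux and their residues\<close>

fun row_word :: "nat \<Rightarrow> nat list \<Rightarrow> nat list" where
  "row_word j [] = []"
| "row_word j (l # L) = replicate l j @ row_word (Suc j) L"

lemma row_word_append: "row_word j (L @ L') = row_word j L @ row_word (j + length L) L'"
  by (induction L arbitrary: j) auto

lemma length_row_word [simp]: "length (row_word j L) = sum_list L"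
  by (induction L arbitrary: j) auto

lemma set_row_word: "set (row_word j L) \<subseteq> {j..<j + length L}"
proof (induction L arbitrary: j)
  case (Cons l L)
  show ?case using Cons[of "Suc j"] by (auto simp: set_replicate_conv_if)
qed simp

lemma sorted_row_word: "sorted (row_word j L)"
proof (induction L arbitrary: j)
  case (Cons l L)
  have "\<forall>y \<in> set (row_word (Suc j) L). j \<le> y"
    using set_row_word[of "Suc j" L] by force
  with Cons show ?case
    by (auto simp: sorted_append)
qed simp

text \<open>In a word the letter \<open>a\<close> stands for a node of row \<open>a\<close> (rows are counted from 0 through all
  components); the state \<open>\<sigma>\<close> records the residue of the next node in each row.\<close>

fun word_residues :: "nat \<Rightarrow> (nat \<Rightarrow> int) \<Rightarrow> nat list \<Rightarrow> int list" where
  "word_residues e \<sigma> [] = []"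
| "word_residues e \<sigma> (c # T) = (\<sigma> c mod int e) # word_residues e (\<sigma>(c := \<sigma> c + 1)) T"

fun advance :: "(nat \<Rightarrow> int) \<Rightarrow> nat list \<Rightarrow> nat \<Rightarrow> int" where
  "advance \<sigma> [] = \<sigma>"
| "advance \<sigma> (c # T) = advance (\<sigma>(c := \<sigma> c + 1)) T"

lemma length_word_residues [simp]: "length (word_residues e \<sigma> T) = length T"
  by (induction T arbitrary: \<sigma>) auto

lemma word_residues_append:
  "word_residues e \<sigma> (A @ B) = word_residues e \<sigma> A @ word_residues e (advance \<sigma> A) B"
  by (induction A arbitrary: \<sigma>) auto

lemma advance_append: "advance \<sigma> (A @ B) = advance (advance \<sigma> A) B"
  by (induction A arbitrary: \<sigma>) auto

lemma advance_notin: "c \<notin> set A \<Longrightarrow> advance \<sigma> A c = \<sigma> c"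
  by (induction A arbitrary: \<sigma>) auto

lemma word_residues_replicate:
  "word_residues e \<sigma> (replicate l c) = map (\<lambda>b. (\<sigma> c + int b) mod int e) [0..<l]"
proof (induction l arbitrary: \<sigma>)
  case (Suc l)
  then show ?case
    by (simp add: map_upt_Suc algebra_simps del: upt_Suc)
qed simp

text \<open>Distinct rows advance independently, so their residues travel with the letters. Equal
  letters must be excluded: their exchange leaves the word alone, while consecutive nodes of a row
  have different residues in general.\<close>

lemma word_residues_swap:
  assumes "1 \<le> s" "s < length T" "T ! (s - 1) \<noteq> T ! s"
  shows "word_residues e \<sigma> (swap_places s T) = swap_places s (word_residues e \<sigma> T)"
proof -
  obtain A x y B where T: "T = A @ x # y # B" "s = Suc (length A)"
    using assms by (auto intro: split_at_pair[of s T])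
  with assms(3) have xy: "x \<noteq> y" by (simp add: nth_append)
  define \<tau> where "\<tau> = advance \<sigma> A"
  have "\<tau>(x := \<tau> x + 1, y := \<tau> y + 1) = \<tau>(y := \<tau> y + 1, x := \<tau> x + 1)"
    using xy by auto
  moreover have "swap_places s (word_residues e \<sigma> A @ u # v # R) = word_residues e \<sigma> A @ v # u # R"
    for u v R using swap_places_append[of "word_residues e \<sigma> A"] T(2) by simp
  ultimately show ?thesis
    using xy T swap_places_append[of A x y B]
    by (simp add: word_residues_append \<tau>_def[symmetric])
qed

lemma word_residues_map:
  assumes "inj f"
  shows "word_residues e \<sigma> (map f T) = word_residues e (\<sigma> \<circ> f) T"
proof (induction T arbitrary: \<sigma>)
  case (Cons c T)
  have eq: "(\<sigma>(f c := \<sigma> (f c) + 1)) \<circ> f = (\<sigma> \<circ> f)(c := (\<sigma> \<circ> f) c + 1)"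
    using assms by (auto simp: inj_eq)
  show ?case
    unfolding list.map word_residues.simps Cons.IH eq by simp
qed simp

text \<open>The tableau of \<open>T\<close> is not column-standard at the rows \<open>a\<close> and \<open>a + 1\<close>, when the latter has
  length one.\<close>

fun violates :: "nat \<Rightarrow> nat list \<Rightarrow> bool" where
  "violates a [] \<longleftrightarrow> False"
| "violates a (c # T) \<longleftrightarrow> c \<noteq> a \<and> (c = Suc a \<or> violates a T)"

lemma violates_append:
  "violates a (A @ B) \<longleftrightarrow> violates a A \<or> (a \<notin> set A \<and> violates a B)"
  by (induction A) auto

section \<open>Detaching the first node of a row\<close>

definition shift :: "nat \<Rightarrow> nat \<Rightarrow> nat" where
  "shift d c = (if c \<le> d then c else Suc c)"

definition unshift :: "nat \<Rightarrow> nat \<Rightarrow> nat" where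
  "unshift d c = (if c \<le> d then c else c - 1)"

text \<open>Only the first \<open>d\<close> is renamed: it becomes the single node of a new row
  \<open>Suc d\<close>. Later occurrences of \<open>d\<close> remain in row \<open>d\<close>, and
  the rows beyond it are renumbered to make room. Merging the two rows by \<open>unshift\<close>
  undoes this, which gives injectivity.\<close>

fun split_row :: "nat \<Rightarrow> nat list \<Rightarrow> nat list" where
  "split_row d [] = []"
| "split_row d (c # T) = (if c = d then Suc d # map (shift d) T else shift d c # split_row d T)"

lemma shift_eq_iff [simp]: "shift d c = shift d c' \<longleftrightarrow> c = c'"
  by (auto simp: shift_def)

lemma inj_shift: "inj (shift d)"
  by (auto simp: inj_def)

lemma map_unshift_split_row: "map (unshift d) (split_row d T) = T"
  by (induction T) (auto simp: unshift_def shift_def comp_def map_idI)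

lemma split_row_inject: "split_row d T = split_row d U \<longleftrightarrow> T = U"
  by (metis map_unshift_split_row)

lemma length_split_row [simp]: "length (split_row d T) = length T"
  by (induction T) auto

lemma split_row_append:
  "split_row d (A @ B) = (if d \<in> set A then split_row d A @ map (shift d) B
     else map (shift d) A @ split_row d B)"
  by (induction A) auto

text \<open>Equal letters are excluded because a pair \<open>d\<close>, \<open>d\<close> containing
  the first \<open>d\<close> turns into \<open>Suc d\<close>, \<open>d\<close>, which the exchange
  no longer fixes.\<close>

lemma split_row_swap:
  assumes "1 \<le> s" "s < length T" "T ! (s - 1) \<noteq> T ! s"
  shows "split_row d (swap_places s T) = swap_places s (split_row d T)"
proof -
  obtain A x y B where T: "T = A @ x # y # B" "s = Suc (length A)"
    using assms by (auto intro: split_at_pair[of s T])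
  with assms(3) have "x \<noteq> y" by (simp add: nth_append)
  with T show ?thesis
    using swap_places_append[of A x y B] swap_places_append[of "map (shift d) A"]
      swap_places_append[of "split_row d A"]
    by (auto simp: split_row_append)
qed

text \<open>The renumbering is strictly increasing, and the new letter \<open>Suc d\<close> lies
  strictly between the images of the letters below and above \<open>d\<close>.\<close>

lemma split_row_ascent:
  assumes "ascent T s"
  shows "ascent (split_row d T) s"
proof -
  obtain A x y B where T: "T = A @ x # y # B" "s = Suc (length A)"
    using assms by (auto simp: ascent_def intro: split_at_pair[of s T])
  with assms have "x < y" by simp
  with T show ?thesis
    using ascent_append[of "map (shift d) A"] ascent_append[of "split_row d A"]
    by (auto simp: split_row_append shift_def)
qed

lemma mset_split_row:
  assumes "d \<in> set T"
  shows "mset (split_row d T) = add_mset (Suc d) (image_mset (shift d) (mset T - {#d#}))"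
  using assms by (induction T) auto

text \<open>The detached node keeps the residue of the first node of row \<open>d\<close>, and the
  rest of that row starts one residue later. Once the first \<open>d\<close> has been read, the two
  states agree along \<open>shift d\<close>.\<close>

lemma word_residues_split_row:
  assumes "\<tau> (Suc d) = \<sigma> d" "\<tau> d = \<sigma> d + 1" "\<And>c. c \<noteq> d \<Longrightarrow> \<tau> (shift d c) = \<sigma> c"
  shows "word_residues e \<tau> (split_row d T) = word_residues e \<sigma> T"
  using assms
proof (induction T arbitrary: \<sigma> \<tau>)
  case (Cons c T)
  show ?case
  proof (cases "c = d")
    case True
    have "((\<tau>(Suc d := \<tau> (Suc d) + 1)) \<circ> shift d) c' = (\<sigma>(d := \<sigma> d + 1)) c'" for c'
    proof (cases "c' = d")
      case True
      then show ?thesis using Cons.prems(2) by (simp add: shift_def)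
    next
      case False
      then have "shift d c' \<noteq> Suc d" by (auto simp: shift_def)
      then show ?thesis using Cons.prems(3)[OF False] False by simp
    qed
    then have eq: "(\<tau>(Suc d := \<tau> (Suc d) + 1)) \<circ> shift d = \<sigma>(d := \<sigma> d + 1)"
      by (rule ext)
    have "split_row d (c # T) = Suc d # map (shift d) T"
      using True by simp
    then show ?thesis
      unfolding word_residues.simps word_residues_map[OF inj_shift] eq True
      using Cons.prems(1) by (simp add: word_residues_map[OF inj_shift] eq[unfolded Cons.prems(1)])
  next
    case False
    have neq: "shift d c \<noteq> Suc d" "shift d c \<noteq> d"
      using False by (auto simp: shift_def)
    have "word_residues e (\<tau>(shift d c := \<tau> (shift d c) + 1)) (split_row d T) =
        word_residues e (\<sigma>(c := \<sigma> c + 1)) T"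
      using neq False Cons.prems by (intro Cons.IH) auto
    then show ?thesis
      using False Cons.prems(3)[OF False] by simp
  qed
qed simp

lemma violates_split_row:
  assumes "d \<in> set T"
  shows "violates d (split_row d T)"
  using assms by (induction T) (auto simp: shift_def)

lemma violates_map_shift:
  assumes "d < a"
  shows "violates (Suc a) (map (shift d) T) \<longleftrightarrow> violates a T"
  using assms by (induction T) (auto simp: shift_def)

text \<open>Rows \<open>a\<close> and \<open>a + 1\<close> of the old word become rows
  \<open>a + 1\<close> and \<open>a + 2\<close>. For \<open>a = d\<close> only the first node of row
  \<open>d\<close> decides about a violation, and this is exactly the node renamed
  \<open>Suc d\<close>.\<close>

lemma not_violates_split_row:
  assumes "d \<le> a" "\<not> violates a T"
  shows "\<not> violates (Suc a) (split_row d T)"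
  using assms
proof (induction T)
  case (Cons c T)
  show ?case
  proof (cases "c = d")
    case True
    with Cons.prems show ?thesis
      by (cases "a = d") (auto simp: violates_map_shift)
  next
    case False
    with Cons show ?thesis
      by (auto simp: shift_def)
  qed
qed simp

section \<open>Operators satisfying the quiver Hecke relations\<close>

text \<open>The relations are demanded only on \<open>C\<close> and only modulo the stable subspace
  \<open>Z\<close>. This covers both a left ideal \<open>Z\<close> of the free algebra, where the
  operators are left multiplications, and the seminormal model with \<open>Z = {0}\<close>. The
  scalars form a commutative ring because that model is studied over power series. The sets
  \<open>wt i\<close> replace the images of the idempotents.\<close>

locale klr_operators = Modules.module scale
  for scale :: "'s::comm_ring_1 \<Rightarrow> 'v::ab_group_add \<Rightarrow> 'v" +
  fixes e n :: nat and C Z :: "'v set" and wt :: "int list \<Rightarrow> 'v set"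
    and Y Psi :: "nat \<Rightarrow> 'v \<Rightarrow> 'v"
  assumes subspace_Z: "subspace Z"
    and Y_add: "Y s (x + y) = Y s x + Y s y"
    and Y_scale: "Y s (scale c x) = scale c (Y s x)"
    and Psi_add: "Psi s (x + y) = Psi s x + Psi s y"
    and Psi_scale: "Psi s (scale c x) = scale c (Psi s x)"
    and Y_C: "\<lbrakk>1 \<le> s; s \<le> n; x \<in> C\<rbrakk> \<Longrightarrow> Y s x \<in> C"
    and Y_Z: "\<lbrakk>1 \<le> s; s \<le> n; x \<in> Z\<rbrakk> \<Longrightarrow> Y s x \<in> Z"
    and Psi_C: "\<lbrakk>1 \<le> r; r < n; x \<in> C\<rbrakk> \<Longrightarrow> Psi r x \<in> C"
    and Psi_Z: "\<lbrakk>1 \<le> r; r < n; x \<in> Z\<rbrakk> \<Longrightarrow> Psi r x \<in> Z"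
    and wt_C: "x \<in> wt i \<Longrightarrow> x \<in> C"
    and wt_Psi: "\<lbrakk>1 \<le> r; r < n; x \<in> wt i\<rbrakk> \<Longrightarrow> Psi r x \<in> wt (swap_places r i)"
    and Psi_Y: "\<lbrakk>1 \<le> r; r < n; 1 \<le> s; s \<le> n; s \<noteq> r; s \<noteq> Suc r; x \<in> C\<rbrakk> \<Longrightarrow>
      Psi r (Y s x) - Y s (Psi r x) \<in> Z"
    and Psi_Psi: "\<lbrakk>1 \<le> r; r < n; 1 \<le> s; s < n; r + 1 < s \<or> s + 1 < r; x \<in> C\<rbrakk> \<Longrightarrow>
      Psi r (Psi s x) - Psi s (Psi r x) \<in> Z"
    and slide_right: "\<lbrakk>1 \<le> r; r < n; x \<in> wt i\<rbrakk> \<Longrightarrow>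
      Psi r (Y (Suc r) x) - (Y r (Psi r x) + (if i ! (r - 1) = i ! r then x else 0)) \<in> Z"
    and slide_left: "\<lbrakk>1 \<le> r; r < n; x \<in> wt i\<rbrakk> \<Longrightarrow>
      Y (Suc r) (Psi r x) - (Psi r (Y r x) + (if i ! (r - 1) = i ! r then x else 0)) \<in> Z"
    and quadratic: "\<lbrakk>1 \<le> r; r < n; x \<in> wt i\<rbrakk> \<Longrightarrow>
      Psi r (Psi r x) -
        (if i ! (r - 1) = i ! r then 0
         else if arrow e (i ! (r - 1)) (i ! r) then Y (Suc r) x - Y r x
         else if arrow e (i ! r) (i ! (r - 1)) then Y r x - Y (Suc r) x
         else x) \<in> Z"
    and braid: "\<lbrakk>1 \<le> r; Suc r < n; x \<in> wt i\<rbrakk> \<Longrightarrow>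
      Psi r (Psi (Suc r) (Psi r x)) -
        (Psi (Suc r) (Psi r (Psi (Suc r) x)) +
         (if i ! (r - 1) = i ! Suc r \<and> arrow e (i ! (r - 1)) (i ! r) then x
          else if i ! (r - 1) = i ! Suc r \<and> arrow e (i ! r) (i ! (r - 1)) then - x
          else 0)) \<in> Z"
begin

lemma Psi_0 [simp]: "Psi s 0 = 0" and Y_0 [simp]: "Y s 0 = 0"
  using Psi_scale[of s 0 0] Y_scale[of s 0 0] by simp_all

lemma Psi_uminus: "Psi s (- x) = - Psi s x"
  using Psi_scale[of s "- 1" x] by simp

lemma Psi_diff: "Psi s (x - y) = Psi s x - Psi s y"
  using Psi_add[of s x "- y"] by (simp add: Psi_uminus)

definition cong :: "'v \<Rightarrow> 'v \<Rightarrow> bool" (infix "\<approx>" 50) where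
  "x \<approx> y \<longleftrightarrow> x - y \<in> Z"

lemma cong_refl [simp, intro]: "x \<approx> x"
  by (simp add: cong_def subspace_0 subspace_Z)

lemma cong_sym: "x \<approx> y \<Longrightarrow> y \<approx> x"
  using subspace_neg[OF subspace_Z, of "x - y"] by (simp add: cong_def)

lemma cong_trans [trans]: "x \<approx> y \<Longrightarrow> y \<approx> z \<Longrightarrow> x \<approx> z"
  using subspace_add[OF subspace_Z, of "x - y" "y - z"] by (simp add: cong_def)

lemma cong_Psi: "1 \<le> r \<Longrightarrow> r < n \<Longrightarrow> x \<approx> y \<Longrightarrow> Psi r x \<approx> Psi r y"
  using Psi_Z[of r "x - y"] by (simp add: cong_def Psi_diff)

lemma cong_0_iff: "x \<approx> 0 \<longleftrightarrow> x \<in> Z"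
  by (simp add: cong_def)

lemma cong_mem_iff: "x \<approx> y \<Longrightarrow> x \<in> Z \<longleftrightarrow> y \<in> Z"
  by (metis cong_0_iff cong_sym cong_trans)

abbreviation cross :: "nat list \<Rightarrow> 'v \<Rightarrow> 'v" where
  "cross ws x \<equiv> foldr Psi ws x"

lemma cross_add: "cross ws (x + y) = cross ws x + cross ws y"
  by (induction ws) (auto simp: Psi_add)

lemma cross_scale: "cross ws (scale c x) = scale c (cross ws x)"
  by (induction ws) (auto simp: Psi_scale)

lemma cross_C: "set ws \<subseteq> {1..<n} \<Longrightarrow> x \<in> C \<Longrightarrow> cross ws x \<in> C"
  by (induction ws) (auto intro!: Psi_C)

lemma cross_Z: "set ws \<subseteq> {1..<n} \<Longrightarrow> x \<in> Z \<Longrightarrow> cross ws x \<in> Z"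
  by (induction ws) (auto intro!: Psi_Z)

lemma cross_cong: "set ws \<subseteq> {1..<n} \<Longrightarrow> x \<approx> y \<Longrightarrow> cross ws x \<approx> cross ws y"
  by (induction ws) (auto intro!: cong_Psi)

end

section \<open>Triangular action on the crossing vectors\<close>

lemma reduced_word_subset: "set (reduced_word T) \<subseteq> {1..<length T}"
proof (induction "inversions T" arbitrary: T rule: less_induct)
  case less
  show ?case
  proof (cases "sorted T")
    case False
    then obtain s where "descent T s" "reduced_word T = s # reduced_word (swap_places s T)"
      by (rule reduced_word_unsorted)
    then show ?thesis
      using less[of "swap_places s T"] inversions_swap_descent[of T s]
      by (auto simp: descent_def)
  qed (simp add: reduced_word_sorted)
qed

text \<open>The vector \<open>v\<close> behaves like the generator of a permutation module, up to possibly nonzero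
  eigenvalues of the dots.\<close>

locale klr_vector = klr_operators +
  fixes \<sigma> :: "nat \<Rightarrow> int" and T0 :: "nat list" and v
  assumes sorted_T0: "sorted T0" and length_T0: "length T0 = n"
    and wt_v: "v \<in> wt (word_residues e \<sigma> T0)"
    and Y_v: "\<lbrakk>1 \<le> s; s \<le> n\<rbrakk> \<Longrightarrow> \<exists>c. Y s v - scale c v \<in> Z"
    and Psi_v: "\<lbrakk>1 \<le> s; s < n; T0 ! (s - 1) = T0 ! s\<rbrakk> \<Longrightarrow> Psi s v \<in> Z"
begin

definition basis :: "nat list \<Rightarrow> 'b" where
  "basis T = cross (reduced_word T) v"

text \<open>The correction terms of the braid, slide and quadratic relations all have fewer
  crossings, so computations with words are exact up to this filtration. It contains
  \<open>Z\<close> at every level.\<close>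

definition below :: "nat \<Rightarrow> 'b set" where
  "below l = span (Z \<union> basis ` {T. mset T = mset T0 \<and> inversions T < l})"

lemma subspace_below: "subspace (below l)"
  by (simp add: below_def)

lemma Z_below: "x \<in> Z \<Longrightarrow> x \<in> below l"
  by (simp add: below_def span_base)

lemma basis_below: "mset T = mset T0 \<Longrightarrow> inversions T < l \<Longrightarrow> basis T \<in> below l"
  by (auto simp: below_def intro!: span_base)

lemma below_mono: "l \<le> l' \<Longrightarrow> x \<in> below l \<Longrightarrow> x \<in> below l'"
  unfolding below_def by (rule subsetD[OF span_mono]) auto

lemma length_word: "mset T = mset T0 \<Longrightarrow> length T = n"
  by (metis length_T0 size_mset)

lemma basis_sorted: "mset T = mset T0 \<Longrightarrow> sorted T \<Longrightarrow> T = T0 \<and> basis T = v"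
  by (metis basis_def foldr_Nil id_apply properties_for_sort reduced_word_sorted sorted_T0)

lemma basis_T0: "basis T0 = v"
  using basis_sorted[OF refl sorted_T0] by simp

lemma basis_unsorted:
  assumes "\<not> sorted T"
  obtains u where "descent T u" "basis T = Psi u (basis (swap_places u T))"
  using assms by (rule reduced_word_unsorted) (auto simp: basis_def)

lemma mset_swap_word: "mset T = mset T0 \<Longrightarrow> 1 \<le> s \<Longrightarrow> s < n \<Longrightarrow> mset (swap_places s T) = mset T0"
  by (simp add: mset_swap_places length_word)

lemma wt_basis: "mset T = mset T0 \<Longrightarrow> basis T \<in> wt (word_residues e \<sigma> T)"
proof (induction "inversions T" arbitrary: T rule: less_induct)
  case less
  show ?case
  proof (cases "sorted T")
    case True
    then show ?thesis using basis_sorted[OF less.prems] wt_v by auto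
  next
    case False
    then obtain u where u: "descent T u" "basis T = Psi u (basis (swap_places u T))"
      by (rule basis_unsorted)
    then have un: "1 \<le> u" "u < n" "u < length T" "T ! u < T ! (u - 1)"
      using length_word[OF less.prems] by (auto simp: descent_def)
    have "basis (swap_places u T) \<in> wt (word_residues e \<sigma> (swap_places u T))"
      using inversions_swap_descent[OF u(1)] un mset_swap_word[OF less.prems]
      by (intro less.hyps) auto
    from wt_Psi[OF un(1,2) this] show ?thesis
      using un u(2) by (simp add: word_residues_swap swap_places_swap_places)
  qed
qed

lemma basis_C: "mset T = mset T0 \<Longrightarrow> basis T \<in> C"
  using wt_basis wt_C by blast

text \<open>Note that \<open>below (Suc l)\<close> is spanned by words with at most \<open>l\<close>
  inversions. So a crossing raises the inversion count only at an ascent, with leading coefficient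
  one, and a dot never raises it. The three statements share one induction because each of them uses
  the others on shorter words.\<close>

definition triangular :: "nat list \<Rightarrow> bool" where
  "triangular T \<longleftrightarrow>
     (\<forall>s. ascent T s \<longrightarrow> Psi s (basis T) - basis (swap_places s T) \<in> below (Suc (inversions T))) \<and>
     (\<forall>s. 1 \<le> s \<longrightarrow> s < n \<longrightarrow> \<not> ascent T s \<longrightarrow> Psi s (basis T) \<in> below (Suc (inversions T))) \<and>
     (\<forall>s. 1 \<le> s \<longrightarrow> s \<le> n \<longrightarrow> Y s (basis T) \<in> below (Suc (inversions T)))"

text \<open>Stated under a hypothesis on shorter words so that it can serve inside the induction for
  triangularity.\<close>

lemma Psi_below_aux:
  assumes "\<And>T. mset T = mset T0 \<Longrightarrow> inversions T < l \<Longrightarrow> triangular T"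
    and "1 \<le> s" "s < n" and x: "x \<in> below l"
  shows "Psi s x \<in> below (Suc l)"
  using x unfolding below_def[of l]
proof (induction rule: span_induct_alt)
  case base
  show ?case by (simp add: subspace_0[OF subspace_below])
next
  case (step c x y)
  have "Psi s x \<in> below (Suc l)"
  proof (cases "x \<in> Z")
    case True
    then show ?thesis using Psi_Z assms(2,3) Z_below by blast
  next
    case False
    with step obtain T where T: "x = basis T" "mset T = mset T0" "inversions T < l"
      by auto
    show ?thesis
    proof (cases "ascent T s")
      case True
      then have "Psi s x - basis (swap_places s T) \<in> below (Suc l)"
        using assms(1)[OF T(2,3)] T below_mono[of "Suc (inversions T)" "Suc l"]
        by (auto simp: triangular_def)
      moreover have "basis (swap_places s T) \<in> below (Suc l)"
        using T assms(2,3) inversions_swap_ascent[OF True]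
        by (intro basis_below mset_swap_word) auto
      ultimately show ?thesis
        using subspace_add[OF subspace_below] by fastforce
    next
      case False
      then show ?thesis
        using assms(1)[OF T(2,3)] assms(2,3) T below_mono[of "Suc (inversions T)" "Suc l"]
        by (auto simp: triangular_def)
    qed
  qed
  then show ?case
    using step by (simp add: Psi_add Psi_scale subspace_add subspace_scale subspace_below)
qed

lemma Y_below_aux:
  assumes "\<And>T. mset T = mset T0 \<Longrightarrow> inversions T < l \<Longrightarrow> triangular T"
    and "1 \<le> s" "s \<le> n" and x: "x \<in> below l"
  shows "Y s x \<in> below l"
  using x unfolding below_def[of l]
proof (induction rule: span_induct_alt)
  case base
  show ?case by (simp add: span_zero)
next
  case (step c x y)
  have "Y s x \<in> below l"
  proof (cases "x \<in> Z")
    case True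
    then show ?thesis using Y_Z assms(2,3) Z_below by blast
  next
    case False
    with step obtain T where "x = basis T" "mset T = mset T0" "inversions T < l"
      by auto
    then show ?thesis
      using assms below_mono[of "Suc (inversions T)" l] by (auto simp: triangular_def)
  qed
  then show ?case
    using step unfolding below_def by (simp add: Y_add Y_scale span_add span_scale)
qed

definition agree :: "nat \<Rightarrow> 'b \<Rightarrow> 'b \<Rightarrow> bool" where
  "agree l x y \<longleftrightarrow> x - y \<in> below l"

lemma agree_refl [simp]: "agree l x x"
  by (simp add: agree_def subspace_0[OF subspace_below])

lemma agree_sym: "agree l x y \<Longrightarrow> agree l y x"
  using subspace_neg[OF subspace_below, of "x - y" l] by (simp add: agree_def)

lemma agree_trans [trans]: "agree l x y \<Longrightarrow> agree l y z \<Longrightarrow> agree l x z"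
  using subspace_add[OF subspace_below, of "x - y" l "y - z"] by (simp add: agree_def)

lemma cong_agree: "x \<approx> y \<Longrightarrow> agree l x y"
  by (simp add: cong_def agree_def Z_below)

lemma agree_below: "agree l x y \<Longrightarrow> y \<in> below l \<Longrightarrow> x \<in> below l"
  using subspace_add[OF subspace_below, of "x - y" l y] by (simp add: agree_def)

lemma agree_add_below: "y \<in> below l \<Longrightarrow> agree l (x + y) x"
  by (simp add: agree_def)

text \<open>The descent \<open>u\<close> used to define a basis vector need not be the position
  \<open>s\<close> of the new crossing. Far apart positions commute; adjacent ones involve three
  letters, which are rearranged by the braid relation at the cost of a shorter word. This is
  Matsumoto's theorem up to shorter words, for words with repeated letters.\<close>

lemma triangular_step:
  assumes IH: "\<And>U. mset U = mset T0 \<Longrightarrow> inversions U < inversions T \<Longrightarrow> triangular U"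
    and T: "mset T = mset T0"
  shows "triangular T"
proof -
  let ?l = "inversions T"
  have len: "length T = n" by (rule length_word[OF T])
  have PB: "Psi s x \<in> below (Suc m)" if "x \<in> below m" "m \<le> ?l" "1 \<le> s" "s < n" for s x m
    using that by (intro Psi_below_aux IH) auto
  have YB: "Y s x \<in> below m" if "x \<in> below m" "m \<le> ?l" "1 \<le> s" "s \<le> n" for s x m
    using that by (intro Y_below_aux IH) auto
  have AP: "agree (Suc m) (Psi s x) (Psi s y)" if "agree m x y" "m \<le> ?l" "1 \<le> s" "s < n" for s x y m
    using PB[of "x - y" m s] that by (simp add: agree_def Psi_diff)
  have up: "agree (Suc (inversions U)) (Psi s (basis U)) (basis (swap_places s U))"
    if "mset U = mset T0" "inversions U < ?l" "ascent U s" for U s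
    using IH[OF that(1,2)] that(3) by (auto simp: triangular_def agree_def)
  have down: "agree (inversions U) (basis U) (Psi u (basis (swap_places u U)))"
    if "mset U = mset T0" "inversions U \<le> ?l" "descent U u" for U u
  proof -
    have u: "1 \<le> u" "u < n" "u < length U"
      using that length_word[OF that(1)] by (auto simp: descent_def)
    have "ascent (swap_places u U) u"
      using that(3) u by (simp add: descent_swap_iff_ascent)
    then show ?thesis
      using up[of "swap_places u U" u] inversions_swap_descent[OF that(3)] that u
      by (simp add: swap_places_swap_places mset_swap_word agree_sym)
  qed
  have flat: "Psi s (basis U) \<in> below (Suc (inversions U))"
    if "mset U = mset T0" "inversions U < ?l" "1 \<le> s" "s < n" "\<not> ascent U s" for U s
    using IH[OF that(1,2)] that(3-5) by (auto simp: triangular_def)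
  have braid_agree: "agree m (Psi r (Psi (Suc r) (Psi r (basis U)))) (Psi (Suc r) (Psi r (Psi (Suc r) (basis U))))"
    if "mset U = mset T0" "inversions U < m" "1 \<le> r" "Suc r < n" for U r m
  proof -
    let ?i = "word_residues e \<sigma> U"
    let ?c = "if ?i ! (r - 1) = ?i ! Suc r \<and> arrow e (?i ! (r - 1)) (?i ! r) then basis U
          else if ?i ! (r - 1) = ?i ! Suc r \<and> arrow e (?i ! r) (?i ! (r - 1)) then - basis U
          else 0"
    have "?c \<in> below m"
      using basis_below[OF that(1,2)] by (simp add: subspace_neg subspace_0 subspace_below)
    then have "agree m (Psi (Suc r) (Psi r (Psi (Suc r) (basis U))) + ?c)
        (Psi (Suc r) (Psi r (Psi (Suc r) (basis U))))"
      by (rule agree_add_below)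
    moreover have "agree m (Psi r (Psi (Suc r) (Psi r (basis U))))
        (Psi (Suc r) (Psi r (Psi (Suc r) (basis U))) + ?c)"
      using braid[OF that(3,4) wt_basis[OF that(1)]] by (intro cong_agree) (simp only: cong_def)
    ultimately show ?thesis by (blast intro: agree_trans)
  qed
  have comm: "agree m (Psi s (Psi u (basis U))) (Psi u (Psi s (basis U)))"
    if "mset U = mset T0" "1 \<le> s" "s < n" "1 \<le> u" "u < n" "s + 1 < u \<or> u + 1 < s" for U s u m
    using Psi_Psi[OF that(2-6) basis_C[OF that(1)]] by (intro cong_agree) (simp only: cong_def)
  have triple: "\<exists>A x y z B. U = A @ x # y # z # B \<and> r = Suc (length A)"
    if "length U = n" "1 \<le> r" "Suc r < n" for U :: "nat list" and r
    using split_at_triple[of r U] that by (metis Suc_eq_plus1)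
  have Suc_swap: "swap_places (Suc (Suc (length A))) (A @ x # y # z # B) = A @ x # z # y # B"
    for A B and x y z :: nat
    using swap_places_append[of "A @ [x]" y z B] by simp
  have Suc_des: "descent (A @ x # y # z # B) (Suc (Suc (length A))) \<longleftrightarrow> z < y"
    for A B x y z
    using descent_append[of "A @ [x]" y z B] by simp
  have Suc_asc: "ascent (A @ x # y # z # B) (Suc (Suc (length A))) \<longleftrightarrow> y < z"
    for A B x y z
    using ascent_append[of "A @ [x]" y z B] by simp
  have Suc_inv: "inversions (A @ x # y # z # B) = Suc (inversions (A @ x # z # y # B))"
    if "z < y" for A B and x y z :: nat
    using inversions_swap_append[OF that, of "A @ [x]" B] by simp
  have ascents: "agree (Suc ?l) (Psi s (basis T)) (basis (swap_places s T))" if s: "ascent T s" for s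
  proof -
    let ?U = "swap_places s T"
    have sn: "1 \<le> s" "s < n" "s < length T" using s len by (auto simp: ascent_def)
    have U: "mset ?U = mset T0" using T sn by (simp add: mset_swap_word)
    have "descent ?U s" using s sn by (simp add: descent_swap_iff_ascent)
    then have "\<not> sorted ?U" by (auto simp: sorted_iff_no_descent)
    then obtain u where u: "descent ?U u" "basis ?U = Psi u (basis (swap_places u ?U))"
      by (rule basis_unsorted)
    have un: "1 \<le> u" "u < n" "u < length ?U" using u len by (auto simp: descent_def)
    consider "u = s" | "s + 1 < u \<or> u + 1 < s" | "u = Suc s" | "s = Suc u" by linarith
    then show ?thesis
    proof cases
      case 1
      then show ?thesis using u sn by (simp add: swap_places_swap_places)
    next
      case 2
      have uT: "descent T u"
        using u(1) 2 un sn by (auto simp: descent_def nth_swap_places split: if_splits)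
      let ?V = "swap_places u T"
      have V: "mset ?V = mset T0" using T un by (simp add: mset_swap_word)
      have lV: "?l = Suc (inversions ?V)" by (rule inversions_swap_descent[OF uT])
      have sV: "ascent ?V s"
        using s 2 un sn by (auto simp: ascent_def nth_swap_places split: if_splits)
      have "agree (Suc ?l) (Psi s (basis T)) (Psi s (Psi u (basis ?V)))"
        by (rule AP[OF down[OF T _ uT]]) (use sn in auto)
      also have "agree (Suc ?l) \<dots> (Psi u (Psi s (basis ?V)))"
        by (rule comm[OF V]) (use sn un 2 in auto)
      also have "agree (Suc ?l) \<dots> (Psi u (basis (swap_places s ?V)))"
        using AP[OF up[OF V _ sV], of u] lV un by auto
      also have "swap_places s ?V = swap_places u ?U"
        using 2 sn un by (intro swap_places_commute) auto
      finally show ?thesis using u by simp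
    next
      case 3
      \<comment> \<open>Here the swapped word carries \<open>c\<close>, \<open>b\<close>,
        \<open>a\<close> with \<open>a < b < c\<close>, the longest arrangement of the three
        letters. Both routes to it start from the increasing arrangement \<open>?T2\<close> and are
        the two sides of the braid relation.\<close>
      then obtain A b c a B where TA: "T = A @ b # c # a # B" "s = Suc (length A)"
        using triple[of T s] len sn un by auto
      have order: "b < c" "a < b"
        using s u(1) 3 TA by (auto simp: swap_places_append Suc_des)
      let ?T1 = "A @ b # a # c # B" and ?T2 = "A @ a # b # c # B" and ?T3 = "A @ a # c # b # B"
        and ?T4 = "A @ c # a # b # B"
      have ms: "mset ?T1 = mset T0" "mset ?T2 = mset T0" "mset ?T3 = mset T0" "mset ?T4 = mset T0"
        by (simp_all add: T[symmetric] TA(1) add_mset_commute)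
      have l: "?l = Suc (inversions ?T1)" "inversions ?T1 = Suc (inversions ?T2)"
        "inversions ?T3 = Suc (inversions ?T2)"
        using order TA Suc_inv[of a c A b B] Suc_inv[of b c A a B]
          inversions_swap_append[of a b A "c # B"] by auto
      have d1: "agree ?l (basis T) (Psi (Suc s) (basis ?T1))"
        using down[OF T order_refl, of "Suc s"] TA order by (simp add: Suc_des Suc_swap)
      have d2: "agree ?l (Psi (Suc s) (basis ?T1)) (Psi (Suc s) (Psi s (basis ?T2)))"
        using AP[OF down[OF ms(1), of s], of "Suc s"] TA order l 3 un
        by (simp add: swap_places_append)
      have "agree (Suc ?l) (Psi s (basis T)) (Psi s (Psi (Suc s) (Psi s (basis ?T2))))"
        by (rule AP[OF agree_trans[OF d1 d2]]) (use sn in auto)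
      also have "agree (Suc ?l) \<dots> (Psi (Suc s) (Psi s (Psi (Suc s) (basis ?T2))))"
        by (rule braid_agree[OF ms(2)]) (use sn un 3 l in auto)
      also have "agree (Suc ?l) \<dots> (Psi (Suc s) (basis ?T4))"
      proof (rule AP)
        have "agree (Suc (inversions ?T2)) (Psi (Suc s) (basis ?T2)) (basis ?T3)"
          using up[OF ms(2), of "Suc s"] TA order l by (simp add: Suc_asc Suc_swap)
        then have "agree ?l (Psi s (Psi (Suc s) (basis ?T2))) (Psi s (basis ?T3))"
          using AP[of "Suc (inversions ?T2)" _ _ s] l sn by simp
        also have "agree ?l \<dots> (basis ?T4)"
          using up[OF ms(3), of s] TA order l by (simp add: swap_places_append)
        finally show "agree ?l (Psi s (Psi (Suc s) (basis ?T2))) (basis ?T4)" .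
      qed (use un 3 in auto)
      also have "Psi (Suc s) (basis ?T4) = basis ?U"
        using u(2) 3 TA by (simp add: swap_places_append Suc_swap)
      finally show ?thesis .
    next
      case 4
      then obtain A c a b B where TA: "T = A @ c # a # b # B" "u = Suc (length A)"
        using triple[of T u] len sn un by auto
      have order: "a < b" "b < c"
        using s u(1) 4 TA by (auto simp: Suc_asc Suc_swap)
      let ?T1 = "A @ a # c # b # B" and ?T2 = "A @ a # b # c # B" and ?T3 = "A @ b # a # c # B"
        and ?T4 = "A @ b # c # a # B"
      have ms: "mset ?T1 = mset T0" "mset ?T2 = mset T0" "mset ?T3 = mset T0" "mset ?T4 = mset T0"
        by (simp_all add: T[symmetric] TA(1) add_mset_commute)
      have l: "?l = Suc (inversions ?T1)" "inversions ?T1 = Suc (inversions ?T2)"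
        "inversions ?T3 = Suc (inversions ?T2)"
        using order TA Suc_inv[of b c A a B] inversions_swap_append[of a c A "b # B"]
          inversions_swap_append[of a b A "c # B"] by auto
      have d1: "agree ?l (basis T) (Psi u (basis ?T1))"
        using down[OF T order_refl, of u] TA order by (simp add: swap_places_append)
      have d2: "agree ?l (Psi u (basis ?T1)) (Psi u (Psi s (basis ?T2)))"
        using AP[OF down[OF ms(1), of s], of u] TA order l 4 un
        by (simp add: Suc_swap Suc_des)
      have "agree (Suc ?l) (Psi s (basis T)) (Psi s (Psi u (Psi s (basis ?T2))))"
        by (rule AP[OF agree_trans[OF d1 d2]]) (use sn in auto)
      also have "agree (Suc ?l) \<dots> (Psi u (Psi s (Psi u (basis ?T2))))"
        using agree_sym[OF braid_agree[OF ms(2), of "Suc ?l" u]] sn un 4 l by simp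
      also have "agree (Suc ?l) \<dots> (Psi u (basis ?T4))"
      proof (rule AP)
        have "agree (Suc (inversions ?T2)) (Psi u (basis ?T2)) (basis ?T3)"
          using up[OF ms(2), of u] TA order l by (simp add: swap_places_append)
        then have "agree ?l (Psi s (Psi u (basis ?T2))) (Psi s (basis ?T3))"
          using AP[of "Suc (inversions ?T2)" _ _ s] l sn by simp
        also have "agree ?l \<dots> (basis ?T4)"
          using up[OF ms(3), of s] TA order l 4 by (simp add: Suc_asc Suc_swap)
        finally show "agree ?l (Psi s (Psi u (basis ?T2))) (basis ?T4)" .
      qed (use un 4 in auto)
      also have "Psi u (basis ?T4) = basis ?U"
        using u(2) 4 TA by (simp add: swap_places_append Suc_swap)
      finally show ?thesis .
    qed
  qed
  have nonascents: "Psi s (basis T) \<in> below (Suc ?l)" if sn: "1 \<le> s" "s < n" "\<not> ascent T s" for s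
  proof (cases "descent T s")
    case True
    let ?V = "swap_places s T"
    have V: "mset ?V = mset T0" using T sn by (simp add: mset_swap_word)
    have lV: "?l = Suc (inversions ?V)" by (rule inversions_swap_descent[OF True])
    let ?i = "word_residues e \<sigma> ?V"
    let ?q = "if ?i ! (s - 1) = ?i ! s then 0
         else if arrow e (?i ! (s - 1)) (?i ! s) then Y (Suc s) (basis ?V) - Y s (basis ?V)
         else if arrow e (?i ! s) (?i ! (s - 1)) then Y s (basis ?V) - Y (Suc s) (basis ?V)
         else basis ?V"
    have bV: "basis ?V \<in> below ?l" using lV V by (intro basis_below) auto
    have "?q \<in> below ?l"
      using bV YB[OF bV, of s] YB[OF bV, of "Suc s"] sn
      by (auto intro!: subspace_diff[OF subspace_below] subspace_0[OF subspace_below])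
    then have q: "?q \<in> below (Suc ?l)" by (rule below_mono[rotated]) simp
    have "agree (Suc ?l) (Psi s (basis T)) (Psi s (Psi s (basis ?V)))"
      by (rule AP[OF down[OF T _ True]]) (use sn in auto)
    also have "agree (Suc ?l) \<dots> ?q"
      using quadratic[OF sn(1,2) wt_basis[OF V]] by (intro cong_agree) (simp only: cong_def)
    finally show ?thesis using q by (rule agree_below)
  next
    case False
    \<comment> \<open>Equal neighbours: this is a crossing inside a row. It is moved past the chosen
      descents, by commutation or by the braid relation, until it meets \<open>v\<close>.\<close>
    with sn have eq: "T ! (s - 1) = T ! s"
      using len by (auto simp: descent_def ascent_def)
    show ?thesis
    proof (cases "sorted T")
      case True
      then show ?thesis
        using basis_sorted[OF T True] Psi_v[OF sn(1,2)] eq by (auto intro: Z_below)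
    next
      case False
      then obtain u where u: "descent T u" "basis T = Psi u (basis (swap_places u T))"
        by (rule basis_unsorted)
      have un: "1 \<le> u" "u < n" "u < length T" using u len by (auto simp: descent_def)
      have "u \<noteq> s" using u eq by (auto simp: descent_def)
      then consider "s + 1 < u \<or> u + 1 < s" | "u = Suc s" | "s = Suc u" by linarith
      then show ?thesis
      proof cases
        case 1
        let ?V = "swap_places u T"
        have V: "mset ?V = mset T0" using T un by (simp add: mset_swap_word)
        have lV: "?l = Suc (inversions ?V)" by (rule inversions_swap_descent[OF u(1)])
        have sV: "\<not> ascent ?V s"
          using eq 1 un sn by (auto simp: ascent_def nth_swap_places split: if_splits)
        have "Psi u (Psi s (basis ?V)) \<in> below (Suc ?l)"
          using PB[OF flat[OF V _ sn(1,2) sV], of u] lV un by simp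
        moreover have "agree (Suc ?l) (Psi s (basis T)) (Psi u (Psi s (basis ?V)))"
          unfolding u(2) by (rule comm[OF V]) (use sn un 1 in auto)
        ultimately show ?thesis by (rule agree_below[rotated])
      next
        case 2
        then obtain A a c B where TA: "T = A @ a # a # c # B" "s = Suc (length A)"
          using triple[of T s] len sn un eq by (auto simp: nth_append)
        have order: "c < a"
          using u(1) 2 TA by (auto simp: Suc_des)
        let ?T1 = "A @ a # c # a # B" and ?T2 = "A @ c # a # a # B"
        have ms: "mset ?T1 = mset T0" "mset ?T2 = mset T0"
          by (simp_all add: T[symmetric] TA(1) add_mset_commute)
        have l: "?l = Suc (inversions ?T1)" "inversions ?T1 = Suc (inversions ?T2)"
          using order TA Suc_inv[of c a A a B] inversions_swap_append[of c a A "a # B"] by auto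
        have d1: "agree ?l (basis T) (Psi (Suc s) (basis ?T1))"
          using down[OF T order_refl, of "Suc s"] TA order by (simp add: Suc_des Suc_swap)
        have d2: "agree ?l (Psi (Suc s) (basis ?T1)) (Psi (Suc s) (Psi s (basis ?T2)))"
          using AP[OF down[OF ms(1), of s], of "Suc s"] TA order l 2 un
          by (simp add: swap_places_append)
        have "agree (Suc ?l) (Psi s (basis T)) (Psi s (Psi (Suc s) (Psi s (basis ?T2))))"
          by (rule AP[OF agree_trans[OF d1 d2]]) (use sn in auto)
        also have "agree (Suc ?l) \<dots> (Psi (Suc s) (Psi s (Psi (Suc s) (basis ?T2))))"
          by (rule braid_agree[OF ms(2)]) (use sn un 2 l in auto)
        finally have "agree (Suc ?l) (Psi s (basis T))
          (Psi (Suc s) (Psi s (Psi (Suc s) (basis ?T2))))" .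
        moreover have "Psi (Suc s) (basis ?T2) \<in> below (Suc (inversions ?T2))"
          using flat[OF ms(2), of "Suc s"] TA l 2 un by (simp add: Suc_asc)
        then have "Psi (Suc s) (Psi s (Psi (Suc s) (basis ?T2))) \<in> below (Suc ?l)"
          using l sn un 2 by (auto intro!: PB)
        ultimately show ?thesis by (rule agree_below)
      next
        case 3
        then obtain A a c B where TA: "T = A @ c # a # a # B" "u = Suc (length A)"
          using triple[of T u] len sn un eq by (auto simp: nth_append)
        have order: "a < c"
          using u(1) 3 TA by auto
        let ?T1 = "A @ a # c # a # B" and ?T2 = "A @ a # a # c # B"
        have ms: "mset ?T1 = mset T0" "mset ?T2 = mset T0"
          by (simp_all add: T[symmetric] TA(1) add_mset_commute)
        have l: "?l = Suc (inversions ?T1)" "inversions ?T1 = Suc (inversions ?T2)"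
          using order TA Suc_inv[of a c A a B] inversions_swap_append[of a c A "a # B"] by auto
        have d1: "agree ?l (basis T) (Psi u (basis ?T1))"
          using down[OF T order_refl, of u] TA order by (simp add: swap_places_append)
        have d2: "agree ?l (Psi u (basis ?T1)) (Psi u (Psi s (basis ?T2)))"
          using AP[OF down[OF ms(1), of s], of u] TA order l 3 un
          by (simp add: Suc_swap Suc_des)
        have "agree (Suc ?l) (Psi s (basis T)) (Psi s (Psi u (Psi s (basis ?T2))))"
          by (rule AP[OF agree_trans[OF d1 d2]]) (use sn in auto)
        also have "agree (Suc ?l) \<dots> (Psi u (Psi s (Psi u (basis ?T2))))"
          using agree_sym[OF braid_agree[OF ms(2), of "Suc ?l" u]] sn un 3 l by simp
        finally have "agree (Suc ?l) (Psi s (basis T)) (Psi u (Psi s (Psi u (basis ?T2))))" .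
        moreover have "Psi u (basis ?T2) \<in> below (Suc (inversions ?T2))"
          using flat[OF ms(2), of u] TA l un by simp
        then have "Psi u (Psi s (Psi u (basis ?T2))) \<in> below (Suc ?l)"
          using l sn un 3 by (auto intro!: PB)
        ultimately show ?thesis by (rule agree_below)
      qed
    qed
  qed
  have dots: "Y s (basis T) \<in> below (Suc ?l)" if sn: "1 \<le> s" "s \<le> n" for s
  proof (cases "sorted T")
    case True
    then have v: "basis T = v" "T = T0" using basis_sorted[OF T] by auto
    obtain c where "Y s v - scale c v \<in> Z" using Y_v sn by blast
    then have "agree (Suc ?l) (Y s v) (scale c v)" by (simp add: agree_def Z_below)
    moreover have "v \<in> below (Suc ?l)"
      using basis_below[OF T, of "Suc ?l"] v by simp
    ultimately show ?thesis
      unfolding v(1) by (auto intro: agree_below subspace_scale[OF subspace_below])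
  next
    case False
    then obtain u where u: "descent T u" "basis T = Psi u (basis (swap_places u T))"
      by (rule basis_unsorted)
    have un: "1 \<le> u" "u < n" "u < length T" using u len by (auto simp: descent_def)
    \<comment> \<open>The dot passes the outermost crossing \<open>u\<close> by a slide relation;
      the extra term is at most the shorter basis vector of \<open>?V\<close>.\<close>
    let ?V = "swap_places u T"
    have V: "mset ?V = mset T0" using T un by (simp add: mset_swap_word)
    have lV: "?l = Suc (inversions ?V)" by (rule inversions_swap_descent[OF u(1)])
    have bV: "basis ?V \<in> below ?l" using lV V by (intro basis_below) auto
    have PY: "Psi u (Y t (basis ?V)) \<in> below (Suc ?l)" if "1 \<le> t" "t \<le> n" for t
      using PB[OF YB[OF bV _ that]] un by simp
    note wV = wt_basis[OF V]
    let ?d = "if word_residues e \<sigma> ?V ! (u - 1) = word_residues e \<sigma> ?V ! u then basis ?V else 0"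
    have d: "?d \<in> below (Suc ?l)"
      using below_mono[OF _ bV, of "Suc ?l"] by (simp add: subspace_0[OF subspace_below])
    consider "s = u" | "s = Suc u" | "s \<noteq> u" "s \<noteq> Suc u" by blast
    then show ?thesis
    proof cases
      case 1
      have "agree (Suc ?l) (Psi u (Y (Suc u) (basis ?V))) (Y u (basis T) + ?d)"
        using slide_right[OF un(1,2) wV] unfolding u(2)
        by (intro cong_agree) (simp only: cong_def)
      from agree_below[OF agree_sym[OF this] PY] have "Y u (basis T) + ?d \<in> below (Suc ?l)"
        using un by simp
      from subspace_diff[OF subspace_below this d] 1 show ?thesis by simp
    next
      case 2
      have "agree (Suc ?l) (Y (Suc u) (basis T)) (Psi u (Y u (basis ?V)) + ?d)"
        using slide_left[OF un(1,2) wV] unfolding u(2)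
        by (intro cong_agree) (simp only: cong_def)
      from agree_below[OF this subspace_add[OF subspace_below PY d]] 2 un show ?thesis by simp
    next
      case 3
      have "agree (Suc ?l) (Psi u (Y s (basis ?V))) (Y s (basis T))"
        using Psi_Y[OF un(1,2) sn 3 basis_C[OF V]] unfolding u(2)
        by (intro cong_agree) (simp only: cong_def)
      from agree_below[OF agree_sym[OF this] PY[OF sn]] show ?thesis .
    qed
  qed
  show ?thesis
    unfolding triangular_def using ascents nonascents dots by (auto simp: agree_def)
qed

lemma triangular: "mset T = mset T0 \<Longrightarrow> triangular T"
  by (induction "inversions T" arbitrary: T rule: less_induct) (auto intro: triangular_step)

lemma Psi_below: "1 \<le> s \<Longrightarrow> s < n \<Longrightarrow> x \<in> below l \<Longrightarrow> Psi s x \<in> below (Suc l)"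
  by (rule Psi_below_aux[OF triangular])

lemma agree_Psi: "1 \<le> s \<Longrightarrow> s < n \<Longrightarrow> agree l x y \<Longrightarrow> agree (Suc l) (Psi s x) (Psi s y)"
  using Psi_below[of s "x - y" l] by (simp add: agree_def Psi_diff)

lemma Psi_basis_ascent:
  "mset T = mset T0 \<Longrightarrow> ascent T s \<Longrightarrow>
     agree (Suc (inversions T)) (Psi s (basis T)) (basis (swap_places s T))"
  using triangular by (auto simp: triangular_def agree_def)

lemma basis_descent:
  assumes "mset T = mset T0" "descent T s"
  shows "agree (inversions T) (basis T) (Psi s (basis (swap_places s T)))"
proof -
  have s: "1 \<le> s" "s < n" "s < length T"
    using assms length_word by (auto simp: descent_def)
  then show ?thesis
    using Psi_basis_ascent[of "swap_places s T" s] inversions_swap_descent[OF assms(2)] assms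
    by (simp add: swap_places_swap_places mset_swap_word agree_sym descent_swap_iff_ascent)
qed

definition full :: "'b set" where
  "full = span (Z \<union> basis ` {T. mset T = mset T0})"

lemma below_full: "below l \<subseteq> full"
  unfolding below_def full_def by (rule span_mono) auto

lemma full_below: "x \<in> full \<Longrightarrow> \<exists>l. x \<in> below l"
  unfolding full_def
proof (induction rule: span_induct_alt)
  case base
  then show ?case using subspace_0[OF subspace_below] by blast
next
  case (step c x y)
  then obtain l where l: "y \<in> below l" by blast
  have "\<exists>l. x \<in> below l"
    using step.hyps by (auto intro: Z_below basis_below)
  then obtain l' where "x \<in> below l'" by blast
  then have "scale c x + y \<in> below (max l l')"
    using l below_mono[of l "max l l'"] below_mono[of l' "max l l'"]
    by (intro subspace_add subspace_scale subspace_below) auto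
  then show ?case by blast
qed

lemma Psi_full: "1 \<le> s \<Longrightarrow> s < n \<Longrightarrow> x \<in> full \<Longrightarrow> Psi s x \<in> full"
  using full_below Psi_below below_full by blast

lemma Y_full: "1 \<le> s \<Longrightarrow> s \<le> n \<Longrightarrow> x \<in> full \<Longrightarrow> Y s x \<in> full"
  using full_below Y_below_aux[OF triangular] below_full by blast

end

section \<open>Chains of consecutive crossings\<close>

context klr_operators
begin

lemma cross_Psi_commute:
  assumes "set ws \<subseteq> {1..<n}" "1 \<le> s" "s < n" "\<And>w. w \<in> set ws \<Longrightarrow> w + 1 < s \<or> s + 1 < w" "x \<in> C"
  shows "cross ws (Psi s x) \<approx> Psi s (cross ws x)"
  using assms
proof (induction ws)
  case (Cons w ws)
  have "Psi w (cross ws (Psi s x)) \<approx> Psi w (Psi s (cross ws x))"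
    using Cons by (intro cong_Psi) auto
  also have "\<dots> \<approx> Psi s (Psi w (cross ws x))"
    unfolding cong_def using Cons.prems(1-3,5) Cons.prems(4)[of w]
    by (intro Psi_Psi cross_C) auto
  finally show ?case by simp
qed simp

lemma cross_Y_commute:
  assumes "set ws \<subseteq> {1..<n}" "1 \<le> s" "s \<le> n" "\<And>w. w \<in> set ws \<Longrightarrow> s \<noteq> w \<and> s \<noteq> Suc w" "x \<in> C"
  shows "cross ws (Y s x) \<approx> Y s (cross ws x)"
  using assms
proof (induction ws)
  case (Cons w ws)
  have "Psi w (cross ws (Y s x)) \<approx> Psi w (Y s (cross ws x))"
    using Cons by (intro cong_Psi) auto
  also have "\<dots> \<approx> Y s (Psi w (cross ws x))"
    unfolding cong_def using Cons.prems(1-3,5) Cons.prems(4)[of w]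
    by (intro Psi_Y cross_C) auto
  finally show ?case by simp
qed simp

lemma cross_cross_commute:
  assumes "set ws \<subseteq> {1..<n}" "set ws' \<subseteq> {1..<n}"
    and "\<And>w w'. w \<in> set ws \<Longrightarrow> w' \<in> set ws' \<Longrightarrow> w + 1 < w' \<or> w' + 1 < w" "x \<in> C"
  shows "cross ws (cross ws' x) \<approx> cross ws' (cross ws x)"
  using assms(2,3)
proof (induction ws')
  case (Cons w' ws')
  have "cross ws (Psi w' (cross ws' x)) \<approx> Psi w' (cross ws (cross ws' x))"
    using Cons.prems assms(1,4) by (intro cross_Psi_commute cross_C) auto
  also have "\<dots> \<approx> Psi w' (cross ws' (cross ws x))"
    using Cons by (intro cong_Psi) auto
  finally show ?case by simp
qed simp

lemma cross_upt: "a < b \<Longrightarrow> cross [a..<b] x = Psi a (cross [Suc a..<b] x)"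
  by (simp add: upt_conv_Cons)

lemma cross_upt_last: "a < b \<Longrightarrow> cross [a..<b] x = cross [a..<b - 1] (Psi (b - 1) x)"
  by (cases b) auto

lemma cross_upt_split: "a \<le> b \<Longrightarrow> b \<le> c \<Longrightarrow> cross [a..<c] x = cross [a..<b] (cross [b..<c] x)"
  by (metis foldr_append le_Suc_ex upt_add_eq_append)

lemma wt_cross:
  "set ws \<subseteq> {1..<n} \<Longrightarrow> x \<in> wt i \<Longrightarrow> cross ws x \<in> wt (foldr swap_places ws i)"
  by (induction ws) (auto intro!: wt_Psi)

lemma cong_Y_Psi:
  "1 \<le> r \<Longrightarrow> r < n \<Longrightarrow> x \<in> wt i \<Longrightarrow>
     Y r (Psi r x) \<approx> Psi r (Y (Suc r) x) - (if i ! (r - 1) = i ! r then x else 0)"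
  using subspace_neg[OF subspace_Z slide_right] by (simp add: cong_def algebra_simps)

lemma cong_Y_Suc_Psi:
  "1 \<le> r \<Longrightarrow> r < n \<Longrightarrow> x \<in> wt i \<Longrightarrow>
     Y (Suc r) (Psi r x) \<approx> Psi r (Y r x) + (if i ! (r - 1) = i ! r then x else 0)"
  using slide_left by (simp add: cong_def)

lemma cross_delta:
  "cross ws (if P then x else 0) \<in> Z" if "P \<Longrightarrow> cross ws x \<in> Z"
  using that cross_scale[of ws 0 0] by (simp add: subspace_0 subspace_Z)

lemma cross_diff: "cross ws (x - y) = cross ws x - cross ws y"
  by (induction ws) (auto simp: Psi_diff)

end

text \<open>A chain carries one strand across a whole block. Garnir elements of first-column nodes
  have this form, the block being a row and the strand the node below it.\<close>

lemma foldr_swap_places_upt: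
  "foldr swap_places [Suc (length A)..<Suc (length A) + length D] (A @ D @ z # B) = A @ z # D @ B"
proof (induction D arbitrary: A)
  case (Cons d D)
  have "[Suc (length A)..<Suc (length A) + length (d # D)] =
      Suc (length A) # [Suc (length (A @ [d]))..<Suc (length (A @ [d])) + length D]"
    by (simp add: upt_conv_Cons del: upt_Suc)
  then show ?case
    using Cons.IH[of "A @ [d]"] swap_places_append[of A d z "D @ B"] by (simp del: upt_Suc)
qed simp

lemma length_foldr_swap_places [simp]: "length (foldr swap_places ws i) = length i"
  by (induction ws) auto

lemma nth_foldr_swap_places_upt:
  assumes "1 \<le> a" "a \<le> b" "b \<le> length i" "j < length i"
  shows "foldr swap_places [a..<b] i ! j =
    (if j < a - 1 then i ! j else if j = a - 1 then i ! (b - 1) else if j < b then i ! (j - 1) else i ! j)"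
proof -
  define A D B where "A = take (a - 1) i" "D = take (b - a) (drop (a - 1) i)" "B = drop b i"
  have i: "i = A @ D @ i ! (b - 1) # B"
  proof -
    have "i = A @ drop (a - 1) i" by (simp add: A_D_B_def)
    also have "drop (a - 1) i = D @ drop (b - a) (drop (a - 1) i)" by (simp only: A_D_B_def append_take_drop_id)
    also have "drop (b - a) (drop (a - 1) i) = drop (b - 1) i" using assms by (simp add: algebra_simps)
    also have "\<dots> = i ! (b - 1) # B"
      using assms Cons_nth_drop_Suc[of "b - 1" i] by (simp add: A_D_B_def)
    finally show ?thesis .
  qed
  have len: "length A = a - 1" "length D = b - a"
    using assms by (auto simp: A_D_B_def)
  have ab: "[a..<b] = [Suc (length A)..<Suc (length A) + length D]"
    using assms len by simp
  have "foldr swap_places [a..<b] i = A @ i ! (b - 1) # D @ B"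
    unfolding ab by (subst i) (rule foldr_swap_places_upt)
  moreover have "(A @ z # D @ B) ! j = (if j < a - 1 then (A @ D @ z # B) ! j else if j = a - 1 then z
      else if j < b then (A @ D @ z # B) ! (j - 1) else (A @ D @ z # B) ! j)" for z
  proof -
    consider "j < a - 1" | "j = a - 1" | "a - 1 < j" "j < b" | "b \<le> j" by linarith
    then show ?thesis
    proof cases
      case 3
      obtain m where m: "a = Suc m" using assms(1) by (cases a) auto
      then have "j - m = Suc (j - Suc m)" "j - Suc m < length D" "\<not> j - 1 < m" "length A = m"
        using 3 len by auto
      then show ?thesis using 3 by (simp add: nth_append m)
    next
      case 4
      then have "j - (a - 1) = Suc (j - a)" "\<not> j - a < length D" "j - (a - 1) - length D = Suc (j - b)"
        "j - a - length D = j - b"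
        using assms len by auto
      then show ?thesis using 4 len assms by (auto simp: nth_append)
    qed (use len in \<open>auto simp: nth_append\<close>)
  qed
  ultimately show ?thesis by (simp only: i[symmetric])
qed

section \<open>A row followed by a row of length one\<close>

text \<open>The row occupies positions \<open>u\<close> to \<open>p - 1\<close> and the one-node row
  below it position \<open>p\<close>. If the row starts at residue \<open>x\<close>, the lower node
  has residue \<open>x - 1\<close> and the second node of the row has residue \<open>x + 1\<close>;
  these two differ because \<open>e\<close> is not 2. The chain from \<open>u\<close> to
  \<open>p\<close> is the Garnir element that generates a layer.\<close>

locale klr_link = klr_operators +
  fixes v i and u p :: nat
  assumes up: "1 \<le> u" "u < p" "p \<le> n" and length_i: "length i = n"
    and wt_v: "v \<in> wt i"
    and Y_v: "\<lbrakk>1 \<le> s; s \<le> n\<rbrakk> \<Longrightarrow> Y s v \<in> Z"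
    and Psi_row: "\<lbrakk>u \<le> s; Suc s < p\<rbrakk> \<Longrightarrow> Psi s v \<in> Z"
    and neq_start: "i ! (u - 1) \<noteq> i ! (p - 1)"
    and neq_second: "Suc u < p \<Longrightarrow> i ! u \<noteq> i ! (p - 1)"
    and arrow_start: "arrow e (i ! (p - 1)) (i ! (u - 1))"
begin

lemma v_C: "v \<in> C"
  by (rule wt_C[OF wt_v])

lemma wt_chain:
  assumes "u \<le> j" "j \<le> p"
  shows "cross [j..<p] v \<in> wt (foldr swap_places [j..<p] i)"
  using assms up by (intro wt_cross wt_v) auto

lemma chain_row:
  assumes "u \<le> s" "Suc s < j" "j \<le> p"
  shows "Psi s (cross [j..<p] v) \<in> Z"
proof -
  have "Psi s (cross [j..<p] v) \<approx> cross [j..<p] (Psi s v)"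
    using assms up by (intro cong_sym[OF cross_Psi_commute] v_C) auto
  moreover have "cross [j..<p] (Psi s v) \<in> Z"
    using assms up by (intro cross_Z Psi_row) auto
  ultimately show ?thesis by (simp add: cong_mem_iff)
qed

text \<open>Resolving a crossing of two strands of equal residue lets a crossing of two strands of the
  row reach \<open>v\<close>.\<close>

lemma resolved_chain:
  assumes "u \<le> a" "a < j" "j < p"
  shows "cross [a..<j] (cross [Suc j..<p] v) \<in> Z"
proof -
  have "cross [a..<j - 1] (Psi (j - 1) (cross [Suc j..<p] v)) \<in> Z"
    using assms up by (intro cross_Z chain_row) auto
  then show ?thesis using assms by (simp add: cross_upt_last)
qed

text \<open>The correction left when a dot slides through crossing \<open>j\<close>. It occurs only
  for equal residues, which excludes \<open>j = a\<close>; for \<open>a < j\<close> it is a resolved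
  chain and vanishes.\<close>

lemma delta_chain:
  assumes "u \<le> a" "a \<le> j" "j < p" "i ! (a - 1) \<noteq> i ! (p - 1)"
  shows "cross [a..<j] (if foldr swap_places [Suc j..<p] i ! (j - 1) = foldr swap_places [Suc j..<p] i ! j
           then cross [Suc j..<p] v else 0) \<in> Z"
proof (rule cross_delta)
  have nth: "foldr swap_places [Suc j..<p] i ! (j - 1) = i ! (j - 1)"
    "foldr swap_places [Suc j..<p] i ! j = i ! (p - 1)"
    using assms up length_i by (simp_all add: nth_foldr_swap_places_upt)
  assume "foldr swap_places [Suc j..<p] i ! (j - 1) = foldr swap_places [Suc j..<p] i ! j"
  then have "a \<noteq> j" using assms(4) nth by auto
  then show "cross [a..<j] (cross [Suc j..<p] v) \<in> Z"
    using assms by (intro resolved_chain) auto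
qed

text \<open>The dot sits on the strand that is carried across the row and slides along it down to
  \<open>v\<close>. Besides \<open>a = u\<close>, the start \<open>a = Suc u\<close> is required for
  the dots that come out of the quadratic relation at \<open>u\<close>.\<close>

lemma Y_chain_aux:
  assumes "u \<le> a" "a < p \<Longrightarrow> i ! (a - 1) \<noteq> i ! (p - 1)" "a \<le> j" "j \<le> p"
  shows "cross [a..<j] (Y j (cross [j..<p] v)) \<in> Z"
  using assms(4,3)
proof (induction rule: inc_induct)
  case base
  show ?case using up assms(1) Y_v by (auto intro!: cross_Z)
next
  case (step j)
  let ?i = "foldr swap_places [Suc j..<p] i" and ?x = "cross [Suc j..<p] v"
  let ?d = "if ?i ! (j - 1) = ?i ! j then ?x else 0"
  have "Y j (Psi j ?x) \<approx> Psi j (Y (Suc j) ?x) - ?d"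
    using step up assms(1) by (intro cong_Y_Psi wt_chain) auto
  then have "cross [a..<j] (Y j (cross [j..<p] v)) \<approx> cross [a..<j] (Psi j (Y (Suc j) ?x) - ?d)"
    using step up assms(1) by (simp only: cross_upt[of j p]) (intro cross_cong, auto)
  also have "\<dots> = cross [a..<Suc j] (Y (Suc j) ?x) - cross [a..<j] ?d"
    using step by (simp add: cross_diff)
  finally show ?case
    using step assms delta_chain[of a j] by (simp add: cong_mem_iff subspace_diff subspace_Z)
qed

lemma Y_chain:
  assumes "1 \<le> s" "s \<le> n"
  shows "Y s (cross [u..<p] v) \<in> Z"
proof -
  consider "s < u \<or> p < s" | "s = u" | "u < s" "s \<le> p" by linarith
  then show ?thesis
  proof cases
    case 1
    have "Y s (cross [u..<p] v) \<approx> cross [u..<p] (Y s v)"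
      using 1 assms up by (intro cong_sym[OF cross_Y_commute] v_C) auto
    moreover have "cross [u..<p] (Y s v) \<in> Z"
      using assms up by (intro cross_Z Y_v) auto
    ultimately show ?thesis by (simp add: cong_mem_iff)
  next
    case 2
    then show ?thesis using Y_chain_aux[of u u] up neq_start by simp
  next
    case 3
    \<comment> \<open>The strand at position \<open>s\<close> after the chain is the row strand that
      started at position \<open>j\<close>. It takes part in crossing \<open>j\<close> alone, so
      there is just one possible correction.\<close>
    then obtain j where j: "s = Suc j" "u \<le> j" "j < p" by (cases s) auto
    let ?i = "foldr swap_places [Suc j..<p] i" and ?x = "cross [Suc j..<p] v"
    let ?d = "if ?i ! (j - 1) = ?i ! j then ?x else 0"
    have "Y s (cross [u..<p] v) = Y s (cross [u..<j] (cross [j..<p] v))"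
      using j by (simp add: cross_upt_split[of u j p])
    also have "\<dots> \<approx> cross [u..<j] (Y s (cross [j..<p] v))"
      using j up assms by (intro cong_sym[OF cross_Y_commute] cross_C v_C) auto
    also have "\<dots> = cross [u..<j] (Y s (Psi j ?x))"
      using j by (simp only: cross_upt[of j p])
    also have "\<dots> \<approx> cross [u..<j] (Psi j (Y j ?x) + ?d)"
    proof (rule cross_cong)
      show "Y s (Psi j ?x) \<approx> Psi j (Y j ?x) + ?d"
        unfolding j(1) using j up by (intro cong_Y_Suc_Psi wt_chain) auto
    qed (use j up in auto)
    also have "\<dots> = cross [u..<j] (Psi j (Y j ?x)) + cross [u..<j] ?d"
      by (simp add: cross_add)
    finally have *: "Y s (cross [u..<p] v) \<approx> cross [u..<j] (Psi j (Y j ?x)) + cross [u..<j] ?d" .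
    have "Y j ?x \<approx> cross [Suc j..<p] (Y j v)"
      using j up by (intro cong_sym[OF cross_Y_commute] v_C) auto
    moreover have "cross [Suc j..<p] (Y j v) \<in> Z"
      using j up by (intro cross_Z Y_v) auto
    ultimately have "Y j ?x \<in> Z" by (simp add: cong_mem_iff)
    then have "cross [u..<j] (Psi j (Y j ?x)) \<in> Z"
      using j up by (intro cross_Z Psi_Z) auto
    with * show ?thesis
      using j delta_chain[of u j] neq_start by (simp add: cong_mem_iff subspace_add subspace_Z)
  qed
qed

text \<open>After the chain the positions \<open>u\<close> to \<open>p\<close> behave like one
  longer row. At \<open>s = u\<close> the quadratic relation turns the double crossing into dots
  that vanish; further right the braid relation produces a crossing inside the old row. The braid
  correction also contains such a crossing, except for \<open>j = u\<close>, where the residues rule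
  it out.\<close>

lemma Psi_chain_row:
  assumes "u \<le> s" "s < p"
  shows "Psi s (cross [u..<p] v) \<in> Z"
proof (cases "s = u")
  case True
  let ?i = "foldr swap_places [Suc u..<p] i" and ?x = "cross [Suc u..<p] v"
  have wx: "?x \<in> wt ?i" using up by (intro wt_chain) auto
  have nth: "?i ! (u - 1) = i ! (u - 1)" "?i ! u = i ! (p - 1)"
    using up length_i by (simp_all add: nth_foldr_swap_places_upt)
  have Yu: "Y u ?x \<in> Z"
  proof -
    have "Y u ?x \<approx> cross [Suc u..<p] (Y u v)"
      using up by (intro cong_sym[OF cross_Y_commute] v_C) auto
    moreover have "cross [Suc u..<p] (Y u v) \<in> Z"
      using up by (intro cross_Z Y_v) auto
    ultimately show ?thesis by (simp add: cong_mem_iff)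
  qed
  have YSu: "Y (Suc u) ?x \<in> Z"
    using Y_chain_aux[of "Suc u" "Suc u"] up neq_second by simp
  have "Psi u (Psi u ?x) \<approx> (if ?i ! (u - 1) = ?i ! u then 0
         else if arrow e (?i ! (u - 1)) (?i ! u) then Y (Suc u) ?x - Y u ?x
         else if arrow e (?i ! u) (?i ! (u - 1)) then Y u ?x - Y (Suc u) ?x
         else ?x)"
    unfolding cong_def using up by (intro quadratic wx) auto
  moreover have "\<dots> \<in> Z"
    using nth neq_start arrow_start Yu YSu by (auto intro!: subspace_diff subspace_Z)
  ultimately show ?thesis
    using True up by (simp add: cross_upt cong_mem_iff)
next
  case False
  then obtain j where j: "s = Suc j" "u \<le> j" "Suc j < p" using assms by (cases s) auto
  let ?x = "cross [Suc (Suc j)..<p] v" and ?i = "foldr swap_places [Suc (Suc j)..<p] i"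
  let ?c = "if ?i ! (j - 1) = ?i ! Suc j \<and> arrow e (?i ! (j - 1)) (?i ! j) then ?x
          else if ?i ! (j - 1) = ?i ! Suc j \<and> arrow e (?i ! j) (?i ! (j - 1)) then - ?x
          else 0"
  have wx: "?x \<in> wt ?i" using up j by (intro wt_chain) auto
  have nth: "?i ! (j - 1) = i ! (j - 1)" "?i ! Suc j = i ! (p - 1)"
    using up j length_i by (simp_all add: nth_foldr_swap_places_upt)
  have c: "cross [u..<j] ?c \<in> Z"
  proof (cases "u = j")
    case True
    then show ?thesis using nth neq_start by (simp add: subspace_0 subspace_Z)
  next
    case False
    have "Psi (j - 1) ?x \<in> Z"
      using j up False by (intro chain_row) auto
    then have "Psi (j - 1) ?c \<in> Z"
      by (simp add: Psi_uminus subspace_neg subspace_Z subspace_0)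
    then have "cross [u..<j - 1] (Psi (j - 1) ?c) \<in> Z"
      using j up by (intro cross_Z) auto
    then show ?thesis using False j(2) by (simp only: cross_upt_last)
  qed
  have jx: "Psi j ?x \<in> Z"
    using j up by (intro chain_row) auto
  have "Psi s (cross [u..<p] v) = Psi s (cross [u..<j] (cross [j..<p] v))"
    using j by (simp add: cross_upt_split[of u j p])
  also have "\<dots> \<approx> cross [u..<j] (Psi s (cross [j..<p] v))"
    using j up assms by (intro cong_sym[OF cross_Psi_commute] cross_C v_C) auto
  also have "\<dots> = cross [u..<j] (Psi (Suc j) (Psi j (Psi (Suc j) ?x)))"
    using j by (simp add: cross_upt)
  also have "\<dots> \<approx> cross [u..<j] (Psi j (Psi (Suc j) (Psi j ?x)) - ?c)"
  proof (rule cross_cong)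
    have "Psi j (Psi (Suc j) (Psi j ?x)) - (Psi (Suc j) (Psi j (Psi (Suc j) ?x)) + ?c) \<in> Z"
      using j up by (intro braid wx) auto
    then have "Psi j (Psi (Suc j) (Psi j ?x)) - ?c \<approx> Psi (Suc j) (Psi j (Psi (Suc j) ?x))"
      by (simp only: cong_def diff_diff_eq add.commute)
    then show "Psi (Suc j) (Psi j (Psi (Suc j) ?x)) \<approx> Psi j (Psi (Suc j) (Psi j ?x)) - ?c"
      by (rule cong_sym)
  qed (use j up in auto)
  also have "\<dots> = cross [u..<j] (Psi j (Psi (Suc j) (Psi j ?x))) - cross [u..<j] ?c"
    by (simp only: cross_diff)
  finally have *: "Psi s (cross [u..<p] v) \<approx>
      cross [u..<j] (Psi j (Psi (Suc j) (Psi j ?x))) - cross [u..<j] ?c" .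
  have "cross [u..<j] (Psi j (Psi (Suc j) (Psi j ?x))) \<in> Z"
    using jx j up by (intro cross_Z[OF _ Psi_Z[OF _ _ Psi_Z]]) auto
  with c have "cross [u..<j] (Psi j (Psi (Suc j) (Psi j ?x))) - cross [u..<j] ?c \<in> Z"
    by (intro subspace_diff subspace_Z)
  with * show ?thesis by (simp only: cong_mem_iff)
qed

text \<open>The strands \<open>p\<close> and \<open>p + 1\<close> both cross the row, and braid
  relations pull their mutual crossing through the row to \<open>v\<close>, where
  \<open>Psi p v\<close> vanishes. A correction \<open>c j\<close> is killed only after
  multiplication by the crossing \<open>j - 1\<close> of two row strands, whence the induction on
  \<open>prefix\<close>. At \<open>j = u\<close> this factor is missing, and the residue hypothesis
  makes the correction zero.\<close>

lemma chain_chain: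
  assumes "p < n" "Psi p v \<in> Z" "i ! (u - 1) \<noteq> i ! p"
  shows "cross [u..<Suc p] (cross [u..<p] v) \<in> Z"
proof -
  define D where "D j = cross [j..<Suc p] (cross [j..<p] v)" for j
  define q where "q j = cross [Suc (Suc j)..<Suc p] (cross [Suc j..<p] v)" for j
  define c where "c j = (let i' = foldr swap_places [Suc (Suc j)..<Suc p] (foldr swap_places [Suc j..<p] i) in
      if i' ! (j - 1) = i' ! Suc j \<and> arrow e (i' ! (j - 1)) (i' ! j) then q j
      else if i' ! (j - 1) = i' ! Suc j \<and> arrow e (i' ! j) (i' ! (j - 1)) then - q j
      else 0)" for j
  have step: "D j \<approx> Psi (Suc j) (Psi j (D (Suc j))) + c j" if j: "u \<le> j" "j < p" for j
  proof -
    let ?X = "cross [Suc j..<p] v"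
    have XC: "?X \<in> C" using up j by (intro cross_C v_C) auto
    have "q j \<in> wt (foldr swap_places [Suc (Suc j)..<Suc p] (foldr swap_places [Suc j..<p] i))"
      unfolding q_def using up j assms(1) by (intro wt_cross[OF _ wt_chain]) auto
    from braid[OF _ _ this, of j] have "Psi j (Psi (Suc j) (Psi j (q j))) \<approx>
        Psi (Suc j) (Psi j (Psi (Suc j) (q j))) + c j"
      unfolding cong_def c_def Let_def using j up assms(1) by fastforce
    moreover have "Psi (Suc j) (q j) = D (Suc j)"
      using j by (simp add: q_def D_def cross_upt del: upt_Suc)
    moreover have "D j \<approx> Psi j (Psi (Suc j) (Psi j (q j)))"
    proof -
      have "D j = Psi j (Psi (Suc j) (cross [Suc (Suc j)..<Suc p] (Psi j ?X)))"
        using j by (simp add: D_def cross_upt del: upt_Suc)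
      also have "\<dots> \<approx> Psi j (Psi (Suc j) (Psi j (q j)))"
        unfolding q_def using j up assms(1) XC
        by (intro cong_Psi cross_Psi_commute) (auto simp del: upt_Suc)
      finally show ?thesis .
    qed
    ultimately show ?thesis by (metis cong_trans)
  qed
  have prefix: "Psi (j - 1) (D j) \<in> Z" if "u < j" "j \<le> p" for j
    using that(2,1)
  proof (induction rule: inc_induct)
    case base
    show ?case using assms up base by (auto simp: D_def intro!: Psi_Z)
  next
    case (step j)
    have "Psi (j - 1) (cross [Suc j..<p] v) \<in> Z"
      using step up by (intro chain_row) auto
    then have "cross [Suc (Suc j)..<Suc p] (Psi (j - 1) (cross [Suc j..<p] v)) \<in> Z"
      using up assms(1) by (intro cross_Z) auto
    moreover have "cross [Suc (Suc j)..<Suc p] (Psi (j - 1) (cross [Suc j..<p] v)) \<approx> Psi (j - 1) (q j)"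
      unfolding q_def using step up assms(1)
      by (intro cross_Psi_commute cross_C v_C) (auto simp del: upt_Suc)
    ultimately have "Psi (j - 1) (q j) \<in> Z" by (simp only: cong_mem_iff)
    then have c: "Psi (j - 1) (c j) \<in> Z"
      by (simp add: c_def Let_def Psi_uminus subspace_neg subspace_Z subspace_0)
    have "Psi (j - 1) (D j) \<approx> Psi (j - 1) (Psi (Suc j) (Psi j (D (Suc j))) + c j)"
      using step up \<open>\<And>j. \<lbrakk>u \<le> j; j < p\<rbrakk> \<Longrightarrow> D j \<approx> Psi (Suc j) (Psi j (D (Suc j))) + c j\<close>[of j]
      by (intro cong_Psi) auto
    moreover have "Psi (j - 1) (Psi (Suc j) (Psi j (D (Suc j)))) \<in> Z"
      using step up assms(1) by (intro Psi_Z[OF _ _ Psi_Z]) auto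
    ultimately show ?case
      using c by (simp add: Psi_add cong_mem_iff subspace_add subspace_Z)
  qed
  have "c u = 0"
    unfolding c_def Let_def using up assms length_i diff_le_self[of u 1, THEN le_imp_less_Suc] by (simp add: nth_foldr_swap_places_upt del: upt_Suc)
  moreover have "Psi (Suc u) (Psi u (D (Suc u))) \<in> Z"
    using prefix[of "Suc u"] up assms(1) by (intro Psi_Z[of "Suc u"]) auto
  ultimately have "D u \<in> Z"
    using step[of u] up by (simp add: cong_mem_iff)
  then show ?thesis by (simp add: D_def)
qed

end

section \<open>Standard words\<close>

lemma sorted_eq: "sorted xs \<Longrightarrow> sorted ys \<Longrightarrow> mset xs = mset ys \<Longrightarrow> xs = ys" for xs ys :: "nat list"
  by (metis properties_for_sort)

lemma takeWhile_neq_append: "a \<notin> set P \<Longrightarrow> takeWhile (\<lambda>c. c \<noteq> a) (P @ a # Q) = P"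
  by (induction P) auto

lemma violates_Suc_mem: "violates a T \<Longrightarrow> Suc a \<in> set T"
  by (induction T) auto

lemma append_eq_at_first:
  assumes "P @ a # Q = A @ a # B" "a \<notin> set P" "a \<notin> set A"
  shows "P = A \<and> Q = B"
proof -
  have "P = A"
    using assms takeWhile_neq_append[of a P Q] takeWhile_neq_append[of a A B] by simp
  with assms(1) show ?thesis by simp
qed

text \<open>A violating word other than the minimal one keeps its violation under some descent: the only
  descent that may destroy it is the pair \<open>a + 1, a\<close>, and if this is the only descent then the word is
  sorted on both sides of it.\<close>

lemma violates_descent:
  assumes T0: "T0 = A @ replicate (Suc \<rho>) a @ Suc a # B" "sorted T0" "a \<notin> set A" "a \<notin> set B"
      "Suc a \<notin> set A" "Suc a \<notin> set B"
    and T: "mset T = mset T0" "violates a T"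
  shows "T = A @ Suc a # replicate (Suc \<rho>) a @ B \<or> (\<exists>u. descent T u \<and> violates a (swap_places u T))"
proof (rule disjCI)
  assume no: "\<nexists>u. descent T u \<and> violates a (swap_places u T)"
  have desc: "x = Suc a \<and> y = a" if "T = P @ x # y # Q" "y < x" for P x y Q
  proof (rule ccontr)
    assume neq: "\<not> (x = Suc a \<and> y = a)"
    have "descent T (Suc (length P))" using that by simp
    moreover have "violates a (swap_places (Suc (length P)) T)"
      using T(2) that neq by (auto simp: violates_append swap_places_append)
    ultimately show False using no by blast
  qed
  have count: "count (mset T) (Suc a) = 1" "count (mset T) a = Suc \<rho>"
    unfolding T(1) T0(1) using T0(3-6) by (auto simp: not_in_iff[symmetric])
  have "\<not> violates a T0"
    using T0 violates_Suc_mem[of a A] by (auto simp: violates_append)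
  with T have "\<not> sorted T" using sorted_eq[OF _ T0(2)] by blast
  then obtain u where u: "descent T u" by (auto simp: sorted_iff_no_descent)
  obtain P x y Q where T': "T = P @ x # y # Q" "u = Suc (length P)"
    using u by (auto simp: descent_def intro: split_at_pair[of u T])
  with u desc have xy: "x = Suc a" "y = a" by auto
  have Suc_notin: "Suc a \<notin> set P" "Suc a \<notin> set Q"
    using count(1) T' xy by (auto simp: count_eq_zero_iff)
  have "a \<notin> set P"
    using T(2) T' xy Suc_notin violates_Suc_mem[of a P] by (auto simp: violates_append)
  have sP: "sorted (P @ [Suc a])"
  proof (rule ccontr)
    assume "\<not> sorted (P @ [Suc a])"
    then obtain s where s: "descent (P @ [Suc a]) s" unfolding sorted_iff_no_descent by blast
    then obtain P1 x1 y1 P2 where 1: "P @ [Suc a] = P1 @ x1 # y1 # P2" "s = Suc (length P1)"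
      by (auto simp: descent_def intro: split_at_pair[of s "P @ [Suc a]"])
    then have "T = P1 @ x1 # y1 # (P2 @ a # Q)" using T' xy by (metis append.assoc append_Cons append_Nil)
    with s 1 have "x1 = Suc a" using desc by fastforce
    moreover have "x1 \<in> set P"
      using 1(1) by (cases P2 rule: rev_cases) (auto simp: append_eq_append_conv2 Cons_eq_append_conv)
    ultimately show False using Suc_notin by simp
  qed
  have sQ: "sorted (a # Q)"
  proof (rule ccontr)
    assume "\<not> sorted (a # Q)"
    then obtain s where s: "descent (a # Q) s" unfolding sorted_iff_no_descent by blast
    then obtain P1 x1 y1 P2 where 1: "a # Q = P1 @ x1 # y1 # P2" "s = Suc (length P1)"
      by (auto simp: descent_def intro: split_at_pair[of s "a # Q"])
    then have "T = (P @ Suc a # P1) @ x1 # y1 # P2" using T' xy by simp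
    with s 1 have "x1 = Suc a" using desc by fastforce
    moreover have "x1 \<in> set (a # Q)" using 1 by simp
    ultimately show False using Suc_notin by simp
  qed
  have "\<forall>c \<in> set P. c < a"
    using sP Suc_notin \<open>a \<notin> set P\<close> by (auto simp: sorted_append le_less less_Suc_eq)
  then have "sorted (P @ a # Q)"
    using sP sQ by (fastforce simp: sorted_append)
  moreover have "sorted (A @ replicate (Suc \<rho>) a @ B)"
    using T0(1,2) by (auto simp: sorted_append)
  moreover have "mset (P @ a # Q) = mset (A @ replicate (Suc \<rho>) a @ B)"
  proof -
    have "add_mset (Suc a) (mset (P @ a # Q)) = add_mset (Suc a) (mset (A @ replicate (Suc \<rho>) a @ B))"
      using T(1) T0(1) T' xy by simp
    then show ?thesis by simp
  qed
  ultimately have "P @ a # Q = A @ replicate (Suc \<rho>) a @ B"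
    by (rule sorted_eq)
  then have "P = A \<and> Q = replicate \<rho> a @ B"
    using append_eq_at_first[of P a Q A "replicate \<rho> a @ B"] \<open>a \<notin> set P\<close> T0(3) by simp
  then show "T = A @ Suc a # replicate (Suc \<rho>) a @ B"
    using T' xy by simp
qed

context klr_vector
begin

text \<open>Every crossing of the chain exchanges \<open>a\<close> with a smaller letter on its
  left, so each step is an ascent and only swaps the leading word.\<close>

lemma chain_basis:
  assumes "T0 = A @ D @ a # B" "\<And>d. d \<in> set D \<Longrightarrow> d < a"
  shows "agree (inversions (A @ a # D @ B)) (cross [Suc (length A)..<Suc (length A) + length D] v)
     (basis (A @ a # D @ B))"
  using assms
proof (induction D arbitrary: A)
  case Nil
  then have "A @ a # [] @ B = T0" by simp
  then show ?case by (simp add: basis_T0 del: append.simps)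
next
  case (Cons d D)
  let ?T = "A @ d # a # D @ B"
  have IH: "agree (inversions ?T) (cross [Suc (Suc (length A))..<Suc (Suc (length A)) + length D] v)
      (basis ?T)"
    using Cons.IH[of "A @ [d]"] Cons.prems by simp
  have len: "n = length A + Suc (Suc (length D + length B))"
    using Cons.prems(1) length_T0 by simp
  have asc: "ascent ?T (Suc (length A))" using Cons.prems(2) by simp
  have ms: "mset ?T = mset T0" using Cons.prems(1) by simp
  have inv: "inversions (A @ a # (d # D) @ B) = Suc (inversions ?T)"
    using inversions_swap_append[of d a A "D @ B"] Cons.prems(2) by simp
  have upt: "[Suc (length A)..<Suc (length A) + length (d # D)] =
      Suc (length A) # [Suc (Suc (length A))..<Suc (Suc (length A)) + length D]"
    by (simp add: upt_conv_Cons del: upt_Suc)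
  have "agree (Suc (inversions ?T)) (cross [Suc (length A)..<Suc (length A) + length (d # D)] v)
      (Psi (Suc (length A)) (basis ?T))"
    unfolding upt using agree_Psi[OF _ _ IH, of "Suc (length A)"] len by simp
  also have "agree (Suc (inversions ?T)) \<dots> (basis (swap_places (Suc (length A)) ?T))"
    by (rule Psi_basis_ascent[OF ms asc])
  finally show ?case
    unfolding inv using swap_places_append[of A d a "D @ B"] by simp
qed

text \<open>By \<open>violates_descent\<close>, crossings can be stripped from a violating word
  without losing the violation until only the Garnir chain remains.\<close>

lemma basis_violating:
  assumes T0: "T0 = A @ replicate (Suc \<rho>) a @ Suc a # B" "a \<notin> set A" "a \<notin> set B"
      "Suc a \<notin> set A" "Suc a \<notin> set B"
    and garnir: "cross [Suc (length A)..<Suc (length A) + Suc \<rho>] v \<in> Z"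
    and T: "mset T = mset T0" "violates a T"
  shows "basis T \<in> below (inversions T)"
  using T
proof (induction "inversions T" arbitrary: T rule: less_induct)
  case less
  consider "T = A @ Suc a # replicate (Suc \<rho>) a @ B"
    | u where "descent T u" "violates a (swap_places u T)"
    using violates_descent[OF T0(1) sorted_T0 T0(2-5) less.prems] by blast
  then show ?case
  proof cases
    case 1
    have "agree (inversions T) (cross [Suc (length A)..<Suc (length A) + length (replicate (Suc \<rho>) a)] v)
        (basis (A @ Suc a # replicate (Suc \<rho>) a @ B))"
      unfolding 1 by (rule chain_basis) (use T0 in \<open>auto simp: set_replicate_conv_if split: if_splits\<close>)
    then have "agree (inversions T) (cross [Suc (length A)..<Suc (length A) + Suc \<rho>] v) (basis T)"
      by (simp only: length_replicate 1)
    then show ?thesis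
      using garnir by (blast intro: agree_below agree_sym Z_below)
  next
    case 2
    have u: "1 \<le> u" "u < n" using 2 length_word[OF less.prems(1)] by (auto simp: descent_def)
    let ?V = "swap_places u T"
    have inv: "inversions T = Suc (inversions ?V)" by (rule inversions_swap_descent[OF 2(1)])
    have "basis ?V \<in> below (inversions ?V)"
      using inv u less.prems 2 by (intro less.hyps mset_swap_word) auto
    then have "Psi u (basis ?V) \<in> below (inversions T)"
      unfolding inv using u by (intro Psi_below)
    with basis_descent[OF less.prems(1) 2(1)] show ?thesis
      by (rule agree_below)
  qed
qed

text \<open>Straightening: a non-standard word is replaced by words with fewer inversions, which
  terminates by induction on the level.\<close>

lemma full_standard:
  assumes "\<And>T. mset T = mset T0 \<Longrightarrow> \<not> S T \<Longrightarrow> basis T \<in> below (inversions T)"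
  shows "full \<subseteq> span (Z \<union> basis ` {T. mset T = mset T0 \<and> S T})" (is "_ \<subseteq> ?H")
proof -
  have "below l \<subseteq> ?H" for l
  proof (induction l)
    case 0
    show ?case unfolding below_def by (rule span_mono) auto
  next
    case (Suc l)
    have "basis T \<in> ?H" if T: "mset T = mset T0" "inversions T < Suc l" for T
    proof (cases "S T")
      case True
      then show ?thesis using T by (auto intro!: span_base)
    next
      case False
      then show ?thesis
        using assms[OF T(1)] Suc T below_mono[of "inversions T" l] by auto
    qed
    then show ?case
      unfolding below_def[of "Suc l"] by (intro span_minimal) (auto intro: span_base)
  qed
  then show ?thesis using full_below by blast
qed

text \<open>\<open>split_row\<close> commutes with exchanges of distinct letters and preserves
  ascents. Hence the reduced word of \<open>T\<close>, applied to a vector with leading word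
  \<open>split_row d T1\<close>, climbs through ascents only and its leading word can be
  followed.\<close>

lemma split_row_basis:
  assumes start: "sorted T1" "length T1 = n"
      "agree (inversions (split_row d T1)) g (basis (split_row d T1))"
    and mset: "\<And>T. mset T = mset T1 \<Longrightarrow> mset (split_row d T) = mset T0"
    and T: "mset T = mset T1"
  shows "agree (inversions (split_row d T)) (cross (reduced_word T) g) (basis (split_row d T))"
  using T
proof (induction "inversions T" arbitrary: T rule: less_induct)
  case less
  have len: "length T = n" using less.prems start(2) by (metis size_mset)
  show ?case
  proof (cases "sorted T")
    case True
    then have "T = T1" using less.prems start(1) by (blast intro: sorted_eq)
    with True show ?thesis using start(3) by (simp add: reduced_word_sorted)
  next
    case False
    then obtain u where u: "descent T u" "reduced_word T = u # reduced_word (swap_places u T)"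
      by (rule reduced_word_unsorted)
    then have un: "1 \<le> u" "u < length T" "T ! u \<noteq> T ! (u - 1)" by (auto simp: descent_def)
    let ?V = "swap_places u T"
    have V: "mset ?V = mset T1" using less.prems un by (simp add: mset_swap_places)
    have "ascent ?V u" using u un by (simp add: descent_swap_iff_ascent)
    then have asc: "ascent (split_row d ?V) u" by (rule split_row_ascent)
    have swap: "swap_places u (split_row d ?V) = split_row d T"
      using un by (simp add: split_row_swap swap_places_swap_places)
    have inv: "inversions (split_row d T) = Suc (inversions (split_row d ?V))"
      using inversions_swap_ascent[OF asc] swap by simp
    have "agree (inversions (split_row d ?V)) (cross (reduced_word ?V) g) (basis (split_row d ?V))"
      using inversions_swap_descent[OF u(1)] V by (intro less.hyps) auto
    from agree_Psi[OF _ _ this, of u]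
    have "agree (inversions (split_row d T)) (cross (reduced_word T) g) (Psi u (basis (split_row d ?V)))"
      using un len u(2) inv by simp
    also have "agree (inversions (split_row d T)) \<dots> (basis (split_row d T))"
      using Psi_basis_ascent[OF mset[OF V] asc] inv swap by simp
    finally show ?thesis .
  qed
qed

end

section \<open>Nilpotency of the first dot\<close>

definition first_position :: "nat \<Rightarrow> nat list \<Rightarrow> nat" where
  "first_position a T = Suc (length (takeWhile (\<lambda>c. c \<noteq> a) T))"

lemma first_position_append [simp]: "a \<notin> set A \<Longrightarrow> first_position a (A @ a # B) = Suc (length A)"
  by (simp add: first_position_def takeWhile_neq_append)

lemma word_residues_first:
  assumes "a \<notin> set A"
  shows "word_residues e \<sigma> (A @ a # B) ! length A = \<sigma> a mod int e"
  using assms by (simp add: word_residues_append nth_append advance_notin)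

context klr_vector
begin

text \<open>The vector obtained from \<open>v\<close> by bringing the first node of row
  \<open>a\<close> to the front.\<close>

definition head :: "nat \<Rightarrow> 'b" where
  "head a = cross [1..<first_position a T0] v"

lemma v_C: "v \<in> C"
  by (rule wt_C[OF wt_v])

lemma wt_head:
  assumes "a \<in> set T0" "set ws \<subseteq> {2..<n}"
  shows "\<exists>i. cross ws (head a) \<in> wt i \<and> length i = n \<and> i ! 0 = \<sigma> a mod int e"
  using assms(2)
proof (induction ws)
  case Nil
  obtain A B where T0: "T0 = A @ a # B" "a \<notin> set A"
    using assms(1) by (blast dest: split_list_first)
  let ?i = "word_residues e \<sigma> T0"
  have "head a \<in> wt (foldr swap_places [1..<first_position a T0] ?i)"
    unfolding head_def using T0 length_T0 by (intro wt_cross wt_v) auto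
  moreover have "foldr swap_places [1..<first_position a T0] ?i ! 0 = \<sigma> a mod int e"
    using T0 word_residues_first[OF T0(2)]
    by (simp add: nth_foldr_swap_places_upt del: upt_Suc)
  moreover have "length (foldr swap_places ws ?i) = n" for ws
    by (induction ws) (auto simp: length_T0)
  ultimately show ?case by auto
next
  case (Cons w ws)
  then obtain i where i: "cross ws (head a) \<in> wt i" "length i = n" "i ! 0 = \<sigma> a mod int e"
    by auto
  then have "Psi w (cross ws (head a)) \<in> wt (swap_places w i)" "swap_places w i ! 0 = i ! 0"
    using Cons.prems by (auto intro!: wt_Psi simp: nth_swap_places)
  with i show ?case by auto
qed

text \<open>Crossings from position 2 on leave the first strand alone. Removing all descents there
  leaves a word with sorted tail, and that is the leading word of \<open>head a\<close> for its
  first letter \<open>a\<close>.\<close>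

lemma full_head:
  assumes "n > 0"
  shows "full \<subseteq> span (Z \<union> {cross ws (head a) | ws a. a \<in> set T0 \<and> set ws \<subseteq> {2..<n}})"
  (is "_ \<subseteq> span (Z \<union> ?G)")
proof -
  have Psi_H: "Psi s x \<in> span (Z \<union> ?G)" if "2 \<le> s" "s < n" "x \<in> span (Z \<union> ?G)" for s x
    using that(3)
  proof (induction rule: span_induct_alt)
    case base
    show ?case by (simp add: span_zero)
  next
    case (step c x y)
    have "Psi s x \<in> Z \<union> ?G"
    proof (cases "x \<in> Z")
      case True
      then show ?thesis using Psi_Z that by auto
    next
      case False
      then obtain ws a where "x = cross ws (head a)" "a \<in> set T0" "set ws \<subseteq> {2..<n}"
        using step by auto
      then have "Psi s x = cross (s # ws) (head a)" "set (s # ws) \<subseteq> {2..<n}" using that by auto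
      then show ?thesis using \<open>a \<in> set T0\<close> by blast
    qed
    then show ?case
      using step by (simp add: Psi_add Psi_scale span_add span_scale span_base)
  qed
  have "basis T \<in> span (Z \<union> ?G)" if "mset T = mset T0" for T
    using that
  proof (induction "inversions T" arbitrary: T rule: less_induct)
    case less
    have below_H: "below (inversions T) \<subseteq> span (Z \<union> ?G)"
      unfolding below_def
      by (rule span_minimal) (use less.hyps in \<open>auto intro: span_base\<close>)
    show ?case
    proof (cases "\<exists>u \<ge> 2. descent T u")
      case True
      then obtain u where u: "2 \<le> u" "descent T u" by blast
      then have un: "1 \<le> u" "u < n" using length_word[OF less.prems] by (auto simp: descent_def)
      have "basis (swap_places u T) \<in> span (Z \<union> ?G)"
        using inversions_swap_descent[OF u(2)] un less.prems
        by (intro less.hyps mset_swap_word) auto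
      then have "Psi u (basis (swap_places u T)) \<in> span (Z \<union> ?G)"
        using Psi_H u un by blast
      moreover have "basis T - Psi u (basis (swap_places u T)) \<in> span (Z \<union> ?G)"
        using basis_descent[OF less.prems u(2)] below_H by (auto simp: agree_def)
      ultimately show ?thesis
        using span_add by fastforce
    next
      case False
      show ?thesis
      proof (cases T)
        case Nil
        then show ?thesis using assms length_word[OF less.prems] by simp
      next
        case (Cons a T')
        have "sorted T'"
          unfolding sorted_iff_no_descent
        proof (intro allI notI)
          fix s assume "descent T' s"
          then have "descent T (Suc s)" "2 \<le> Suc s"
            using Cons by (auto simp: descent_def nth_Cons')
          then show False using False by blast
        qed
        have "a \<in> set T0" using less.prems Cons by (metis list.set_intros(1) set_mset_mset)
        then obtain A B where T0: "T0 = A @ a # B" "a \<notin> set A"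
          by (blast dest: split_list_first)
        have "sorted (A @ B)" using T0 sorted_T0 by (auto simp: sorted_append)
        moreover have "mset T' = mset (A @ B)" using less.prems Cons T0 by simp
        ultimately have T': "T' = A @ B" using \<open>sorted T'\<close> by (blast intro: sorted_eq)
        have "d < a" if "d \<in> set A" for d
          using that T0 sorted_T0 by (auto simp: sorted_append le_less)
        then have "agree (inversions (a # A @ B)) (cross [Suc 0..<Suc (length A)] v) (basis (a # A @ B))"
          using chain_basis[of "[]" A a B] T0 by simp
        moreover have "first_position a T0 = Suc (length A)"
          using T0 by simp
        ultimately have "agree (inversions T) (head a) (basis T)"
          by (simp only: Cons T' head_def One_nat_def)
        moreover have "head a \<in> span (Z \<union> ?G)"
          using \<open>a \<in> set T0\<close> by (intro span_base UnI2 CollectI exI[of _ "[]"] exI[of _ a]) auto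
        ultimately show ?thesis
          using below_H span_diff[of "head a" "Z \<union> ?G" "head a - basis T"] by (auto simp: agree_def)
      qed
    qed
  qed
  then show ?thesis
    unfolding full_def by (intro span_minimal) (auto intro: span_base)
qed

context
  assumes n_pos: "n > 0" and Y_Z_v: "\<And>s. 1 \<le> s \<Longrightarrow> s \<le> n \<Longrightarrow> Y s v \<in> Z"
begin

text \<open>The dot on the first strand slides to \<open>v\<close> except for crossings with strands of the same
  residue; resolving such a crossing brings an earlier row to the front.\<close>

lemma Y_head:
  assumes a: "a \<in> set T0" and ws: "set ws \<subseteq> {2..<n}"
  shows "Y 1 (cross ws (head a)) \<in> span (Z \<union> {cross ws' (head b) | ws' b.
     b \<in> set T0 \<and> b < a \<and> \<sigma> b mod int e = \<sigma> a mod int e \<and> set ws' \<subseteq> {2..<n}})"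
  (is "_ \<in> span (Z \<union> ?G)")
proof -
  obtain A B where T0: "T0 = A @ a # B" "a \<notin> set A"
    using a by (blast dest: split_list_first)
  define p where "p = first_position a T0"
  have p: "p = Suc (length A)" using T0 by (simp add: p_def)
  have pn: "1 \<le> p" "p \<le> n" using p T0 length_T0 by auto
  let ?i = "word_residues e \<sigma> T0"
  have len_i: "length ?i = n" by (simp add: length_T0)
  have Z_span: "x \<in> span (Z \<union> ?G)" if "x \<in> Z" for x
    using that by (simp add: span_base)
  have cong_span: "x \<in> span (Z \<union> ?G)" if "x \<approx> y" "y \<in> span (Z \<union> ?G)" for x y
    using that Z_span[of "x - y"] span_add[of "x - y" "Z \<union> ?G" y] by (simp add: cong_def)
  have Psi_H: "cross ws x \<in> span (Z \<union> ?G)" if "x \<in> span (Z \<union> ?G)" for x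
    using that
  proof (induction rule: span_induct_alt)
    case base
    show ?case using cross_scale[of ws 0 0] by (simp add: span_zero)
  next
    case (step c x y)
    have "cross ws x \<in> Z \<union> ?G"
    proof (cases "x \<in> Z")
      case True
      then show ?thesis using cross_Z[of ws x] ws by fastforce
    next
      case False
      then obtain ws' b where b: "x = cross ws' (head b)" "b \<in> set T0" "b < a"
          "\<sigma> b mod int e = \<sigma> a mod int e" "set ws' \<subseteq> {2..<n}"
        using step by auto
      have "cross ws x = cross (ws @ ws') (head b)" "set (ws @ ws') \<subseteq> {2..<n}" using b ws by auto
      then show ?thesis using b(2-4) by blast
    qed
    then show ?case
      using step by (simp add: cross_add cross_scale span_add span_scale span_base)
  qed
  have aux: "cross [1..<j] (Y j (cross [j..<p] v)) \<in> span (Z \<union> ?G)" if "1 \<le> j" "j \<le> p" for j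
    using that(2,1)
  proof (induction rule: inc_induct)
    case base
    show ?case using pn Y_Z_v by (intro Z_span) (auto intro!: cross_Z)
  next
    case (step j)
    let ?i' = "foldr swap_places [Suc j..<p] ?i" and ?x = "cross [Suc j..<p] v"
    let ?d = "if ?i' ! (j - 1) = ?i' ! j then ?x else 0"
    have wx: "?x \<in> wt ?i'" using pn step by (intro wt_cross wt_v) auto
    have "Y j (Psi j ?x) \<approx> Psi j (Y (Suc j) ?x) - ?d"
      using step pn by (intro cong_Y_Psi wx) auto
    then have "cross [1..<j] (Y j (cross [j..<p] v)) \<approx> cross [1..<j] (Psi j (Y (Suc j) ?x) - ?d)"
      using step pn by (simp only: cross_upt[of j p]) (intro cross_cong, auto)
    also have "\<dots> = cross [1..<Suc j] (Y (Suc j) ?x) - cross [1..<j] ?d"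
      using step by (simp add: cross_diff)
    finally have *: "cross [1..<j] (Y j (cross [j..<p] v)) \<approx>
        cross [1..<Suc j] (Y (Suc j) ?x) - cross [1..<j] ?d" .
    have nth: "?i' ! (j - 1) = ?i ! (j - 1)" "?i' ! j = \<sigma> a mod int e"
      using step pn len_i p T0 word_residues_first[OF T0(2), of e \<sigma> B]
      by (simp_all add: nth_foldr_swap_places_upt del: upt_Suc)
    have "cross [1..<j] ?d \<in> span (Z \<union> ?G)"
    proof (cases "?i' ! (j - 1) = ?i' ! j")
      case True
      have jA: "j - 1 < length A" using step p by auto
      define b where "b = T0 ! (j - 1)"
      have bA: "b = A ! (j - 1)" using jA T0 by (simp add: b_def nth_append)
      then have "b \<in> set A" using jA by auto
      then have b: "b \<in> set T0" "b < a" using T0 sorted_T0 by (auto simp: sorted_append le_less)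
      have comm: "cross [1..<j] ?x \<approx> cross [Suc j..<p] (cross [1..<j] v)"
        using step pn by (intro cross_cross_commute v_C) auto
      \<comment> \<open>Either strand \<open>j\<close> continues the row of its left neighbour, so
        that crossing \<open>j - 1\<close> lies inside a row and kills \<open>v\<close>, or it is
        the first node of row \<open>b\<close> and the prefix of the chain is
        \<open>head b\<close>.\<close>
      have "cross [1..<j] ?x \<in> span (Z \<union> ?G)"
      proof (cases "j \<ge> 2 \<and> T0 ! (j - 2) = b")
        case True
        have "j - 1 - 1 = j - 2" by simp
        then have "Psi (j - 1) v \<in> Z" using True step pn by (intro Psi_v) (auto simp: b_def)
        then have "cross [1..<j - 1] (Psi (j - 1) v) \<in> Z"
          using step pn by (intro cross_Z) auto
        then have "cross [1..<j] v \<in> Z" using True by (subst cross_upt_last) auto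
        then have "cross [Suc j..<p] (cross [1..<j] v) \<in> Z"
          using step pn by (intro cross_Z[of "[Suc j..<p]"]) auto
        with comm show ?thesis by (blast intro: cong_span Z_span)
      next
        case False
        have split: "T0 = take (j - 1) T0 @ b # drop j T0"
          using id_take_nth_drop[of "j - 1" T0] step pn length_T0 by (simp add: b_def)
        have b_notin: "b \<notin> set (take (j - 1) T0)"
        proof
          assume "b \<in> set (take (j - 1) T0)"
          then obtain l where l: "l < j - 1" "T0 ! l = b"
            using step pn length_T0 by (auto simp: in_set_conv_nth)
          then have "T0 ! l \<le> T0 ! (j - 2)" "T0 ! (j - 2) \<le> T0 ! (j - 1)"
            using sorted_T0 step pn length_T0 by (auto intro!: sorted_nth_mono)
          then have "T0 ! (j - 2) = b" using l by (simp add: b_def)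
          with False l show False by simp
        qed
        have "first_position b T0 = j"
          using first_position_append[OF b_notin, of "drop j T0"] split step pn length_T0 by simp
        then have hd: "cross [1..<j] v = head b" by (simp add: head_def)
        have "?i ! (j - 1) = \<sigma> b mod int e"
          using word_residues_first[OF b_notin, of e \<sigma> "drop j T0"] split step pn length_T0 by simp
        then have "cross [Suc j..<p] (head b) \<in> ?G"
          using b nth True step pn by (intro CollectI exI[of _ "[Suc j..<p]"] exI[of _ b]) auto
        then have "cross [Suc j..<p] (cross [1..<j] v) \<in> span (Z \<union> ?G)"
          unfolding hd by (intro span_base UnI2)
        with comm show ?thesis by (rule cong_span)
      qed
      then show ?thesis using True by simp
    next
      case False
      then show ?thesis using cross_scale[of "[1..<j]" 0 0] by (simp add: span_zero)
    qed
    then show ?case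
      using step cong_span[OF * span_diff] by auto
  qed
  have "Y 1 (cross ws (head a)) \<approx> cross ws (Y 1 (head a))"
    unfolding head_def using ws pn p_def
    by (intro cong_sym[OF cross_Y_commute] cross_C v_C) auto
  moreover have "Y 1 (head a) \<in> span (Z \<union> ?G)"
    using aux[of 1] pn by (simp add: head_def p_def)
  ultimately show ?thesis using Psi_H by (blast intro: cong_span)
qed

lemma funpow_Y_Z: "x \<in> Z \<Longrightarrow> (Y 1 ^^ m) x \<in> Z"
  using n_pos by (induction m) (auto intro!: Y_Z)

text \<open>Each dot replaces \<open>a\<close> by earlier rows starting with the same residue, and
  rows outside \<open>F\<close> contribute nothing, so the number of rows in \<open>F\<close> that
  can still occur bounds the order of nilpotency. For Specht modules \<open>F\<close> will consist
  of the first rows of the components.\<close>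

lemma funpow_Y_head:
  assumes F: "\<And>a. a \<in> set T0 \<Longrightarrow> a \<notin> F \<Longrightarrow> head a \<in> Z" and "finite F"
    and "a \<in> set T0" "set ws \<subseteq> {2..<n}" "card {b \<in> F. b \<le> a \<and> \<sigma> b mod int e = \<sigma> a mod int e} \<le> m"
  shows "(Y 1 ^^ m) (cross ws (head a)) \<in> Z"
  using assms(3-)
proof (induction a arbitrary: ws m rule: less_induct)
  case (less a)
  let ?N = "\<lambda>a. {b \<in> F. b \<le> a \<and> \<sigma> b mod int e = \<sigma> a mod int e}"
  show ?case
  proof (cases "a \<in> F")
    case False
    then have "cross ws (head a) \<in> Z"
      using F less.prems by (intro cross_Z) auto
    then show ?thesis by (rule funpow_Y_Z)
  next
    case True
    then have "a \<in> ?N a" by simp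
    then obtain m' where m: "m = Suc m'"
      using less.prems(3) \<open>finite F\<close> by (cases m) (auto simp: card_eq_0_iff)
    have "(Y 1 ^^ m') x \<in> Z"
      if "x \<in> span (Z \<union> {cross ws' (head b) | ws' b.
        b \<in> set T0 \<and> b < a \<and> \<sigma> b mod int e = \<sigma> a mod int e \<and> set ws' \<subseteq> {2..<n}})" for x
      using that
    proof (induction rule: span_induct_alt)
      case base
      show ?case by (rule funpow_Y_Z) (simp add: subspace_0 subspace_Z)
    next
      case (step c x y)
      have lin: "(Y 1 ^^ m') (scale c x + y) = scale c ((Y 1 ^^ m') x) + (Y 1 ^^ m') y"
        by (induction m') (auto simp: Y_add Y_scale)
      have "(Y 1 ^^ m') x \<in> Z"
      proof (cases "x \<in> Z")
        case False
        then obtain ws' b where b: "x = cross ws' (head b)" "b \<in> set T0" "b < a"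
            "\<sigma> b mod int e = \<sigma> a mod int e" "set ws' \<subseteq> {2..<n}"
          using step by auto
        have "?N b \<subseteq> ?N a" "a \<notin> ?N b" using b by auto
        then have "?N b \<subset> ?N a" using \<open>a \<in> ?N a\<close> by blast
        then have "card (?N b) < card (?N a)" using \<open>finite F\<close> by (intro psubset_card_mono) auto
        then show ?thesis
          unfolding b(1) using b less.prems(3) m by (intro less.IH) auto
      qed (rule funpow_Y_Z)
      with step lin show ?case
        by (simp add: subspace_add subspace_scale subspace_Z)
    qed
    from this[OF Y_head[OF less.prems(1,2)]] show ?thesis
      by (simp add: m funpow_swap1)
  qed
qed

end

end

section \<open>The seminormal model\<close>

text \<open>Letter \<open>a\<close> carries the parameter \<open>X\<^bsup>a+1\<^esup>\<close> over the field of Laurent series, so distinct rows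
  have distinct parameters, which all vanish at \<open>X = 0\<close>.\<close>

definition parameter :: "nat \<Rightarrow> 'k::field fls" where
  "parameter a = fls_X ^ Suc a"

lemma fls_X_power_nth: "fls_nth ((fls_X :: 'k::field fls) ^ m) j = (if j = int m then 1 else 0)"
  by (simp add: fls_X_power_conv_shift_1)

lemma parameter_eq_iff [simp]: "(parameter a :: 'k::field fls) = parameter b \<longleftrightarrow> a = b"
proof
  assume "(parameter a :: 'k fls) = parameter b"
  then have "fls_nth (parameter a :: 'k fls) (int (Suc a)) = fls_nth (parameter b) (int (Suc a))" by simp
  then show "a = b"
    unfolding parameter_def fls_X_power_nth by (simp split: if_splits)
qed simp

text \<open>The arguments \<open>p\<close> and \<open>q\<close> are the values at a word and at the
  word with \<open>a\<close>, \<open>b\<close> exchanged. Equal residues give a divided difference.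
  For an arrow the factor of the quadratic relation is put on one of the two directions, so that a
  double crossing produces it once. The value 0 within a row reflects that such a crossing kills the
  generator.\<close>

definition mix :: "nat \<Rightarrow> nat \<Rightarrow> nat \<Rightarrow> int \<Rightarrow> int \<Rightarrow> 'k::field fls \<Rightarrow> 'k fls \<Rightarrow> 'k fls" where
  "mix e a b i j p q =
     (if a = b then 0
      else if i = j then (p + q) / (parameter b - parameter a)
      else if arrow e i j then (parameter b - parameter a) * q else q)"

definition dot_op :: "nat \<Rightarrow> (nat list \<Rightarrow> 'k::field fls) \<Rightarrow> nat list \<Rightarrow> 'k fls" where
  "dot_op s f = (\<lambda>T. parameter (T ! (s - 1)) * f T)"

definition cross_op :: "nat \<Rightarrow> (nat \<Rightarrow> int) \<Rightarrow> nat \<Rightarrow> (nat list \<Rightarrow> 'k::field fls) \<Rightarrow> nat list \<Rightarrow> 'k fls" where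
  "cross_op e \<sigma> s f = (\<lambda>T. mix e (T ! (s - 1)) (T ! s)
     (word_residues e \<sigma> T ! (s - 1)) (word_residues e \<sigma> T ! s) (f T) (f (swap_places s T)))"

definition series_scale :: "'k::field fps \<Rightarrow> (nat list \<Rightarrow> 'k fls) \<Rightarrow> nat list \<Rightarrow> 'k fls" where
  "series_scale c f = (\<lambda>T. fps_to_fls c * f T)"

definition word_functions :: "nat list \<Rightarrow> (nat list \<Rightarrow> 'k::field fls) set" where
  "word_functions T0 = {f. \<forall>T. f T \<noteq> 0 \<longrightarrow> mset T = mset T0}"

definition weight_functions ::
  "nat \<Rightarrow> (nat \<Rightarrow> int) \<Rightarrow> nat list \<Rightarrow> int list \<Rightarrow> (nat list \<Rightarrow> 'k::field fls) set" where
  "weight_functions e \<sigma> T0 i =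
     {f. \<forall>T. f T \<noteq> 0 \<longrightarrow> mset T = mset T0 \<and> word_residues e \<sigma> T = i}"

lemma mix_same [simp]: "mix e a a i j p q = 0"
  by (simp add: mix_def)

lemma mix_linear: "\<exists>u w :: 'k::field fls. \<forall>p q. mix e a b i j p q = u * p + w * q"
proof -
  have "mix e a b i j p q =
      (if a \<noteq> b \<and> i = j then 1 / (parameter b - parameter a) else 0) * p +
      (if a = b then 0 else if i = j then 1 / (parameter b - parameter a)
       else if arrow e i j then parameter b - parameter a else 1) * q" for p q :: "'k fls"
    by (simp add: mix_def add_divide_distrib)
  then show ?thesis by blast
qed

lemma mix_mix_commute:
  fixes p q p' q' :: "'k::field fls"
  shows
  "mix e a b i j (mix e c d k l p q) (mix e c d k l p' q') =
   mix e c d k l (mix e a b i j p p') (mix e a b i j q q')"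
proof -
  obtain u w u' w' :: "'k fls" where "\<And>p q. mix e a b i j p q = u * p + w * q"
    "\<And>p q. mix e c d k l p q = u' * p + w' * q"
    using mix_linear[where 'k='k, of e a b i j] mix_linear[where 'k='k, of e c d k l] by metis
  then show ?thesis by (simp add: algebra_simps)
qed

lemma mix_0 [simp]: "mix e a b i j 0 0 = 0"
  by (simp add: mix_def)

lemma cross_op_nonzero:
  assumes "cross_op e \<sigma> s f T \<noteq> 0"
  shows "f T \<noteq> 0 \<or> f (swap_places s T) \<noteq> 0"
  using assms by (auto simp: cross_op_def)

lemma mset_swap_places_iff:
  assumes "1 \<le> s" "s < length T0"
  shows "mset (swap_places s T) = mset T0 \<longleftrightarrow> mset T = mset T0"
  using assms mset_swap_places[of s T] size_mset
  by (metis length_swap_places)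

lemma cross_op_wt:
  assumes s: "1 \<le> s" "s < length T0" and f: "f \<in> weight_functions e \<sigma> T0 i"
  shows "cross_op e \<sigma> s f \<in> weight_functions e \<sigma> T0 (swap_places s i)"
  unfolding weight_functions_def
proof (intro CollectI allI impI)
  fix T assume nz: "cross_op e \<sigma> s f T \<noteq> 0"
  then have ms: "mset T = mset T0"
    using cross_op_nonzero[OF nz] f mset_swap_places_iff[OF s, of T]
    by (auto simp: weight_functions_def)
  then have len: "s < length T" using s by (metis size_mset)
  have ne: "T ! (s - 1) \<noteq> T ! s" using nz by (auto simp: cross_op_def)
  let ?i = "word_residues e \<sigma> T"
  have swap: "word_residues e \<sigma> (swap_places s T) = swap_places s ?i"
    using s len ne by (intro word_residues_swap)
  have "?i = swap_places s i"
  proof (cases "f (swap_places s T) = 0")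
    case False
    then have "swap_places s ?i = i" using f swap by (auto simp: weight_functions_def)
    then show ?thesis using s len swap_places_swap_places[of s ?i] by auto
  next
    case True
    \<comment> \<open>Only the coefficient of the word itself is left, and it is nonzero only for
      equal residues; then the exchange does not change the residue sequence.\<close>
    then have "?i ! (s - 1) = ?i ! s" "f T \<noteq> 0"
      using nz ne by (auto simp: cross_op_def mix_def split: if_splits)
    moreover from this(2) have "?i = i" using f by (auto simp: weight_functions_def)
    ultimately show ?thesis
      using s len by (intro nth_equalityI) (auto simp: nth_swap_places)
  qed
  with ms show "mset T = mset T0 \<and> ?i = swap_places s i" by blast
qed

lemma arrow_mod:
  assumes "e = 0 \<or> e > 2"
  shows "arrow e (a mod int e) (b mod int e) \<longleftrightarrow> (a + 1) mod int e = b mod int e"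
  using assms by (auto simp: arrow_def vertices_def mod_simps)

text \<open>The assumption on \<open>e\<close> enters through these two inequalities; the second one
  excludes \<open>e = 2\<close>.\<close>

lemma mod_Suc_neq:
  assumes "e = 0 \<or> e > 2"
  shows "(a + 1) mod int e \<noteq> a mod int e" "(a + 2) mod int e \<noteq> a mod int e"
proof -
  have "\<not> int e dvd 1" "\<not> int e dvd 2"
    using assms zdvd_imp_le[of "int e" 2] by auto
  then show "(a + 1) mod int e \<noteq> a mod int e" "(a + 2) mod int e \<noteq> a mod int e"
    by (simp_all add: mod_eq_dvd_iff)
qed

lemma arrow_irrefl: "e = 0 \<or> e > 2 \<Longrightarrow> \<not> arrow e i i"
  using mod_Suc_neq(1)[of e i] by (auto simp: arrow_def vertices_def split: if_splits)

lemma arrow_asym: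
  assumes "e = 0 \<or> e > 2" "arrow e i j" shows "\<not> arrow e j i"
proof
  assume "arrow e j i"
  with assms(2) have "i mod int e = (i + 2) mod int e"
    by (auto simp: arrow_def vertices_def mod_simps algebra_simps split: if_splits)
  with mod_Suc_neq(2)[OF assms(1)] show False by metis
qed

text \<open>The braid relation for divided differences, on the values at six arrangements. The
  assumption \<open>c = a + b\<close> holds because the outer parameter difference is the sum of the
  two inner ones.\<close>

lemma divided_difference_braid:
  fixes a b c :: "'a::field"
  assumes "a \<noteq> 0" "b \<noteq> 0" "c \<noteq> 0" "c = a + b"
  shows "(((f1 + f2) / a + (f3 + f5) / c) / b + ((f2 + f1) / (- a) + (f4 + f6) / b) / c) / a =
    (((f1 + f3) / b + (f2 + f4) / c) / a + ((f3 + f1) / (- b) + (f5 + f6) / a) / c) / b"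
  using assms(1-3) by (simp add: divide_simps) (simp add: assms(4) algebra_simps)

text \<open>The six values stand for those of a function at the rearrangements of three distinct letters.\<close>

lemma braid_mix:
  fixes f1 f2 f3 f4 f5 f6 :: "'k::field fls"
  assumes e: "e = 0 \<or> e > 2" and distinct: "x \<noteq> y" "y \<noteq> z" "x \<noteq> z"
  shows "mix e x y i j
      (mix e y z j l (mix e x y i j f1 f2) (mix e x z i l f3 f5))
      (mix e x z i l (mix e y x j i f2 f1) (mix e y z j l f4 f6)) =
    mix e y z j l
      (mix e x y i j (mix e y z j l f1 f3) (mix e x z i l f2 f4))
      (mix e x z i l (mix e z y l j f3 f1) (mix e x y i j f5 f6)) +
    (if i = l \<and> arrow e i j then f1 else if i = l \<and> arrow e j i then - f1 else 0)"
proof -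
  define X Y Z :: "'k fls" where "X = parameter x" "Y = parameter y" "Z = parameter z"
  have XYZ: "Y - X \<noteq> 0" "Z - Y \<noteq> 0" "Z - X \<noteq> 0" "X - Y \<noteq> 0" "Y - Z \<noteq> 0" "X - Z \<noteq> 0"
    using distinct by (auto simp: X_Y_Z_def)
  note mix = mix_def X_Y_Z_def[symmetric] distinct distinct[symmetric]
  consider "i = j" "j = l" | "i = j" "j \<noteq> l" | "i = l" "j \<noteq> l" | "j = l" "i \<noteq> l"
    | "i \<noteq> j" "j \<noteq> l" "i \<noteq> l" by blast
  then show ?thesis
  proof cases
    case 1
    then have il: "i = l" "j = l" by simp_all
    have same: "mix e x y l l p q = (p + q) / (Y - X)" "mix e y z l l p q = (p + q) / (Z - Y)"
      "mix e x z l l p q = (p + q) / (Z - X)" "mix e y x l l p q = (p + q) / (- (Y - X))"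
      "mix e z y l l p q = (p + q) / (- (Z - Y))" for p q
      using distinct by (simp_all add: mix)
    show ?thesis
      unfolding il same
      using divided_difference_braid[OF XYZ(1-3), of f1 f2 f3 f5 f4 f6] arrow_irrefl[OF e, of l]
      by (simp only: simp_thms if_False add_0_right) simp
  next
    case 2
    then show ?thesis using XYZ by (simp add: mix) (simp add: field_simps)
  next
    case 3
    then show ?thesis using XYZ arrow_asym[OF e, of i j] arrow_asym[OF e, of j i]
      by (cases "arrow e i j"; cases "arrow e j i") (simp_all add: mix, simp_all add: field_simps)
  next
    case 4
    then show ?thesis using XYZ by (simp add: mix) (simp add: field_simps)
  next
    case 5
    then show ?thesis by (simp add: mix)
  qed
qed

section \<open>The KLR relations in the seminormal model\<close>

lemma cross_op_append:
  "cross_op e \<sigma> (Suc (length A)) f (A @ x # y # B) =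
     mix e x y (advance \<sigma> A x mod int e) (advance \<sigma> A y mod int e)
       (f (A @ x # y # B)) (f (A @ y # x # B))"
  using swap_places_append[of A x y B]
  by (cases "x = y") (simp_all add: cross_op_def nth_append word_residues_append)

lemma cross_op_append_Suc:
  "cross_op e \<sigma> (Suc (Suc (length A))) f (A @ x # y # z # B) =
     mix e y z ((advance \<sigma> A y + of_bool (x = y)) mod int e) ((advance \<sigma> A z + of_bool (x = z)) mod int e)
       (f (A @ x # y # z # B)) (f (A @ x # z # y # B))"
  using cross_op_append[of e \<sigma> "A @ [x]" f y z B] by (simp add: advance_append)

text \<open>If two neighbouring letters agree, one side has a crossing inside a row outermost and
  vanishes at \<open>T\<close>, while the other side accounts for the correction term. If only the
  outer letters agree, both sides vanish: a contribution would need residues in the two nodes of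
  that row that are both equal to that of the middle letter.\<close>

lemma cross_op_braid:
  fixes f :: "nat list \<Rightarrow> 'k::field fls" and \<sigma> :: "nat \<Rightarrow> int"
  assumes e: "e = 0 \<or> e > 2" and r: "1 \<le> r" "Suc r < length T"
  defines "i \<equiv> word_residues e \<sigma> T"
  shows "cross_op e \<sigma> r (cross_op e \<sigma> (Suc r) (cross_op e \<sigma> r f)) T =
    cross_op e \<sigma> (Suc r) (cross_op e \<sigma> r (cross_op e \<sigma> (Suc r) f)) T +
    (if i ! (r - 1) = i ! Suc r \<and> arrow e (i ! (r - 1)) (i ! r) then f T
     else if i ! (r - 1) = i ! Suc r \<and> arrow e (i ! r) (i ! (r - 1)) then - f T else 0)"
proof -
  obtain A x y z B where T: "T = A @ x # y # z # B" and rA: "r = Suc (length A)"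
    using split_at_triple[of r T] r by (metis Suc_eq_plus1)
  define \<rho> where "\<rho> = advance \<sigma> A"
  have res: "i ! (r - 1) = \<rho> x mod int e" "i ! r = (\<rho> y + of_bool (x = y)) mod int e"
      "i ! Suc r = (\<rho> z + of_bool (x = z) + of_bool (y = z)) mod int e"
    by (simp_all add: i_def T rA word_residues_append nth_append \<rho>_def)
  note ops = cross_op_append cross_op_append_Suc T rA \<rho>_def[symmetric]
  note mods = mod_Suc_neq[OF e] mod_Suc_neq[OF e, symmetric]
  have ar: "arrow e (a mod int e) ((a + 1) mod int e)" "\<not> arrow e ((a + 1) mod int e) (a mod int e)" for a
    using arrow_mod[OF e, of a "a + 1"] arrow_mod[OF e, of "a + 1" a] mod_Suc_neq(2)[OF e, of a]
    by (simp_all add: algebra_simps)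
  consider "x \<noteq> y" "y \<noteq> z" "x \<noteq> z" | "x = y" "y = z" | "x = y" "y \<noteq> z" | "y = z" "x \<noteq> y" | "x = z" "x \<noteq> y"
    by blast
  then show ?thesis
  proof cases
    case 1
    show ?thesis
      unfolding res
      by (simp only: ops of_bool_eq 1 1[symmetric] simp_thms add_0_right) (rule braid_mix[OF e 1])
  next
    case 2
    then show ?thesis
      unfolding res using mod_Suc_neq(2)[OF e, of "\<rho> z"] by (simp add: ops add.commute)
  next
    case 3
    have nz: "parameter z - (parameter x :: 'k fls) \<noteq> 0" using 3 by simp
    have yx: "y = x" and zx: "z \<noteq> x" "x \<noteq> z" using 3 by auto
    have aux: "mix e x z ((\<rho> x + 1) mod int e) (\<rho> z mod int e) 0
        (mix e x z (\<rho> x mod int e) (\<rho> z mod int e)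
          (mix e z x (\<rho> z mod int e) ((\<rho> x + 1) mod int e) q p) 0) +
      (if \<rho> x mod int e = \<rho> z mod int e \<and> arrow e (\<rho> x mod int e) ((\<rho> x + 1) mod int e) then p
       else if \<rho> x mod int e = \<rho> z mod int e \<and> arrow e ((\<rho> x + 1) mod int e) (\<rho> x mod int e) then - p
       else 0) = 0" for p q :: "'k fls"
    proof (cases "\<rho> x mod int e = \<rho> z mod int e")
      case True
      have "(\<rho> x + 1) mod int e \<noteq> \<rho> z mod int e" using True mods by metis
      then show ?thesis
        using 3 nz ar[of "\<rho> x"] True[symmetric] by (auto simp: mix_def field_simps)
    next
      case False
      then show ?thesis by (simp add: mix_def)
    qed
    show ?thesis
      unfolding res
      by (simp only: ops yx of_bool_eq zx simp_thms add_0_right mix_same) (rule aux[symmetric])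
  next
    case 4
    have nz: "parameter y - (parameter x :: 'k fls) \<noteq> 0" using 4 by simp
    have zy: "z = y" and xy: "x \<noteq> y" "y \<noteq> x" using 4 by auto
    have aux: "mix e x y (\<rho> x mod int e) (\<rho> y mod int e) 0
        (mix e x y (\<rho> x mod int e) ((\<rho> y + 1) mod int e)
          (mix e y x (\<rho> y mod int e) (\<rho> x mod int e) q p) 0) =
      (if \<rho> x mod int e = (\<rho> y + 1) mod int e \<and> arrow e (\<rho> x mod int e) (\<rho> y mod int e) then p
       else if \<rho> x mod int e = (\<rho> y + 1) mod int e \<and> arrow e (\<rho> y mod int e) (\<rho> x mod int e) then - p
       else 0)" for p q :: "'k fls"
    proof (cases "\<rho> x mod int e = (\<rho> y + 1) mod int e")
      case True
      then show ?thesis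
        using 4 nz ar[of "\<rho> y"] mods(1)[of "\<rho> y"] by (auto simp: mix_def field_simps)
    next
      case False
      then show ?thesis by (simp add: mix_def)
    qed
    show ?thesis
      unfolding res
      by (simp only: ops zy of_bool_eq xy simp_thms add_0_right add_0_left mix_same) (rule aux)
  next
    case 5
    have no: "\<not> (\<rho> x mod int e = \<rho> y mod int e \<and> \<rho> y mod int e = (\<rho> x + 1) mod int e)"
      using mods by metis
    have "mix e x y (\<rho> x mod int e) (\<rho> y mod int e)
        (mix e y x (\<rho> y mod int e) ((\<rho> x + 1) mod int e) p 0) 0 = 0"
      "mix e y x (\<rho> y mod int e) ((\<rho> x + 1) mod int e)
        (mix e x y (\<rho> x mod int e) (\<rho> y mod int e) p 0) 0 = 0" for p :: "'k fls"
      using no by (auto simp: mix_def)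
    then show ?thesis
      unfolding res using 5 mods by (simp add: ops)
  qed
qed

lemma cross_op_quadratic:
  fixes f :: "nat list \<Rightarrow> 'k::field fls" and \<sigma> :: "nat \<Rightarrow> int"
  assumes e: "e = 0 \<or> e > 2" and r: "1 \<le> r" "r < length T"
  defines "i \<equiv> word_residues e \<sigma> T"
  shows "cross_op e \<sigma> r (cross_op e \<sigma> r f) T =
    (if i ! (r - 1) = i ! r then 0
     else if arrow e (i ! (r - 1)) (i ! r) then dot_op (Suc r) f T - dot_op r f T
     else if arrow e (i ! r) (i ! (r - 1)) then dot_op r f T - dot_op (Suc r) f T
     else f T)"
proof -
  obtain A x y B where T: "T = A @ x # y # B" and rA: "r = Suc (length A)"
    by (rule split_at_pair[OF r])
  define \<rho> where "\<rho> = advance \<sigma> A"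
  have res: "i ! (r - 1) = \<rho> x mod int e" "i ! r = (\<rho> y + of_bool (x = y)) mod int e"
    by (simp_all add: i_def T rA word_residues_append nth_append \<rho>_def)
  show ?thesis
  proof (cases "x = y")
    case True
    then show ?thesis
      unfolding res using mod_Suc_neq[OF e, of "\<rho> y"] arrow_mod[OF e, of "\<rho> y" "\<rho> y + 1"]
      by (simp add: T rA cross_op_append dot_op_def nth_append)
  next
    case False
    then have "parameter y - parameter x \<noteq> (0 :: 'k fls)" "parameter x - parameter y \<noteq> (0 :: 'k fls)"
      by simp_all
    with False show ?thesis
      unfolding res using arrow_asym[OF e, of "\<rho> x mod int e" "\<rho> y mod int e"]
      by (simp add: T rA cross_op_append dot_op_def nth_append \<rho>_def[symmetric] mix_def)
        (auto simp: field_simps)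
  qed
qed

lemma cross_op_dot_op:
  fixes f :: "nat list \<Rightarrow> 'k::field fls" and \<sigma> :: "nat \<Rightarrow> int"
  assumes e: "e = 0 \<or> e > 2" and r: "1 \<le> r" "r < length T"
  defines "i \<equiv> word_residues e \<sigma> T"
  shows "cross_op e \<sigma> r (dot_op (Suc r) f) T =
      dot_op r (cross_op e \<sigma> r f) T + (if i ! (r - 1) = i ! r then f T else 0)"
    and "dot_op (Suc r) (cross_op e \<sigma> r f) T =
      cross_op e \<sigma> r (dot_op r f) T + (if i ! (r - 1) = i ! r then f T else 0)"
proof -
  obtain A x y B where T: "T = A @ x # y # B" and rA: "r = Suc (length A)"
    by (rule split_at_pair[OF r])
  define \<rho> where "\<rho> = advance \<sigma> A"
  have res: "i ! (r - 1) = \<rho> x mod int e" "i ! r = (\<rho> y + of_bool (x = y)) mod int e"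
    by (simp_all add: i_def T rA word_residues_append nth_append \<rho>_def)
  have "parameter y - parameter x \<noteq> (0 :: 'k fls)" if "x \<noteq> y"
    using that by simp
  then show "cross_op e \<sigma> r (dot_op (Suc r) f) T =
      dot_op r (cross_op e \<sigma> r f) T + (if i ! (r - 1) = i ! r then f T else 0)"
    "dot_op (Suc r) (cross_op e \<sigma> r f) T =
      cross_op e \<sigma> r (dot_op r f) T + (if i ! (r - 1) = i ! r then f T else 0)"
    unfolding res using mod_Suc_neq(1)[OF e, of "\<rho> x"]
    by (cases "x = y"; simp add: T rA cross_op_append dot_op_def nth_append \<rho>_def[symmetric] mix_def;
        simp add: field_simps)+
qed

lemma cross_op_commute:
  assumes r: "1 \<le> r" "r < length T" and s: "1 \<le> s" "s < length T" and rs: "r + 1 < s \<or> s + 1 < r"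
  shows "cross_op e \<sigma> r (cross_op e \<sigma> s f) T = cross_op e \<sigma> s (cross_op e \<sigma> r f) T"
proof -
  let ?i = "word_residues e \<sigma>"
  have neq: "r - 1 \<noteq> s - 1" "r - 1 \<noteq> s" "r \<noteq> s - 1" "r \<noteq> s" "r - 1 < length T" "s - 1 < length T"
    using r s rs by auto
  have nth: "swap_places r U ! (s - 1) = U ! (s - 1)" "swap_places r U ! s = U ! s"
    "swap_places s U ! (r - 1) = U ! (r - 1)" "swap_places s U ! r = U ! r"
    if "length U = length T" for U :: "'c list"
    using r s neq that by (auto simp: nth_swap_places)
  have swap: "swap_places r (swap_places s T) = swap_places s (swap_places r T)"
    by (rule swap_places_commute[OF r s rs])
  consider "T ! (r - 1) = T ! r" | "T ! (s - 1) = T ! s"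
    | "T ! (r - 1) \<noteq> T ! r" "T ! (s - 1) \<noteq> T ! s" by blast
  then show ?thesis
  proof cases
    case 3
    have "?i (swap_places r T) = swap_places r (?i T)" "?i (swap_places s T) = swap_places s (?i T)"
      using r s 3 by (auto intro!: word_residues_swap)
    with swap nth[of T] nth[of "?i T"] show ?thesis
      by (simp add: cross_op_def mix_mix_commute)
  qed (use nth[of T] in \<open>simp_all add: cross_op_def\<close>)
qed

lemma cross_op_dot_op_commute:
  assumes "1 \<le> r" "r < length T" "1 \<le> s" "s \<le> length T" "s \<noteq> r" "s \<noteq> Suc r"
  shows "cross_op e \<sigma> r (dot_op s f) T = dot_op s (cross_op e \<sigma> r f) T"
proof -
  have "swap_places r T ! (s - 1) = T ! (s - 1)"
    using assms by (auto simp: nth_swap_places)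
  then show ?thesis
    by (simp add: cross_op_def dot_op_def mix_def field_simps)
qed

lemma series_module: "Modules.module series_scale"
  by unfold_locales (auto simp: series_scale_def algebra_simps fls_times_fps_to_fls)

lemma seminormal_operators:
  assumes e: "e = 0 \<or> e > 2"
  shows "klr_operators (series_scale :: 'k::field fps \<Rightarrow> _) e (length T0) (word_functions T0) {0}
     (weight_functions e \<sigma> T0) dot_op (cross_op e \<sigma>)"
proof -
  interpret Modules.module "series_scale :: 'k fps \<Rightarrow> _" by (rule series_module)
  let ?n = "length T0"
  have wt_C: "f \<in> word_functions T0" if "f \<in> weight_functions e \<sigma> T0 i" for f i
    using that by (auto simp: word_functions_def weight_functions_def)
  have zero_out: "f T = 0" if "f \<in> word_functions T0" "length T \<noteq> ?n" for f T
    using that by (auto simp: word_functions_def dest: mset_eq_length)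
  have cross_C: "cross_op e \<sigma> s f \<in> word_functions T0"
    if "1 \<le> s" "s < ?n" "f \<in> word_functions T0" for s f
    unfolding word_functions_def
  proof (intro CollectI allI impI)
    fix T assume "cross_op e \<sigma> s f T \<noteq> 0"
    from cross_op_nonzero[OF this] show "mset T = mset T0"
      using that mset_swap_places_iff[OF that(1,2), of T] by (auto simp: word_functions_def)
  qed
  have dot_C: "dot_op s f \<in> word_functions T0" if "f \<in> word_functions T0" for s f
    using that by (auto simp: word_functions_def dot_op_def)
  \<comment> \<open>Functions in \<open>word_functions\<close> vanish on words of the wrong length,
    so relations have to be compared only where all positions are in range.\<close>
  have eqI: "f - g \<in> {0}" if "f \<in> word_functions T0" "g \<in> word_functions T0"
      "\<And>T. length T = ?n \<Longrightarrow> f T = g T" for f g :: "_ \<Rightarrow> 'k fls"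
  proof -
    have "f T = g T" for T
      using that(3)[of T] zero_out[OF that(1), of T] zero_out[OF that(2), of T]
      by (cases "length T = ?n") auto
    then show ?thesis by (simp add: fun_eq_iff)
  qed
  have add_C: "f + g \<in> word_functions T0" "f - g \<in> word_functions T0" "- f \<in> word_functions T0"
      "0 \<in> word_functions T0"
    if "f \<in> word_functions T0" "g \<in> word_functions T0" for f g :: "_ \<Rightarrow> 'k fls"
    using that by (auto simp: word_functions_def) (metis add_0 diff_0_right)+
  have wt_cases: "word_residues e \<sigma> T = i \<or> f T = 0" if "f \<in> weight_functions e \<sigma> T0 i" for f i T
    using that by (auto simp: weight_functions_def)
  show ?thesis
  proof (unfold_locales, goal_cases)
    case (2 s x y) show ?case by (auto simp: dot_op_def algebra_simps)
  next
    case (3 s c x) show ?case by (auto simp: dot_op_def series_scale_def algebra_simps)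
  next
    case (4 s x y) show ?case
      by (auto simp: cross_op_def mix_def add_divide_distrib algebra_simps)
  next
    case (5 s c x) show ?case
      by (auto simp: cross_op_def mix_def series_scale_def add_divide_distrib algebra_simps)
  next
    case (6 s x) then show ?case by (intro dot_C)
  next
    case (8 s x) then show ?case by (intro cross_C)
  next
    case (10 x i) then show ?case by (rule wt_C)
  next
    case (11 r x i) then show ?case by (intro cross_op_wt)
  next
    case (12 r s x) then show ?case
      by (intro eqI cross_C dot_C cross_op_dot_op_commute) auto
  next
    case (13 r s x) then show ?case
      by (intro eqI cross_C cross_op_commute) auto
  next
    case (14 r x i)
    then have x: "x \<in> word_functions T0" using wt_C by blast
    show ?case
    proof (rule eqI)
      fix T :: "nat list" assume "length T = ?n"
      with 14 show "cross_op e \<sigma> r (dot_op (Suc r) x) T =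
          (dot_op r (cross_op e \<sigma> r x) + (if i ! (r - 1) = i ! r then x else 0)) T"
        using wt_cases[OF 14(3), of T] cross_op_dot_op(1)[OF e, of r T \<sigma> x]
        by auto
    qed (use 14 x in \<open>auto intro!: cross_C dot_C add_C\<close>)
  next
    case (15 r x i)
    then have x: "x \<in> word_functions T0" using wt_C by blast
    show ?case
    proof (rule eqI)
      fix T :: "nat list" assume "length T = ?n"
      with 15 show "dot_op (Suc r) (cross_op e \<sigma> r x) T =
          (cross_op e \<sigma> r (dot_op r x) + (if i ! (r - 1) = i ! r then x else 0)) T"
        using wt_cases[OF 15(3), of T] cross_op_dot_op(2)[OF e, of r T \<sigma> x]
        by auto
    qed (use 15 x in \<open>auto intro!: cross_C dot_C add_C\<close>)
  next
    case (16 r x i)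
    then have x: "x \<in> word_functions T0" using wt_C by blast
    show ?case
    proof (rule eqI)
      fix T :: "nat list" assume "length T = ?n"
      with 16 show "cross_op e \<sigma> r (cross_op e \<sigma> r x) T =
          (if i ! (r - 1) = i ! r then 0
         else if arrow e (i ! (r - 1)) (i ! r) then dot_op (Suc r) x - dot_op r x
         else if arrow e (i ! r) (i ! (r - 1)) then dot_op r x - dot_op (Suc r) x
         else x) T"
        using wt_cases[OF 16(3), of T] cross_op_quadratic[OF e, of r T \<sigma> x]
        by (auto simp: dot_op_def)
    qed (use 16 x in \<open>auto intro!: cross_C dot_C add_C\<close>)
  next
    case (17 r x i)
    then have x: "x \<in> word_functions T0" using wt_C by blast
    show ?case
    proof (rule eqI)
      fix T :: "nat list" assume "length T = ?n"
      with 17 show "cross_op e \<sigma> r (cross_op e \<sigma> (Suc r) (cross_op e \<sigma> r x)) T =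
          (cross_op e \<sigma> (Suc r) (cross_op e \<sigma> r (cross_op e \<sigma> (Suc r) x)) +
         (if i ! (r - 1) = i ! Suc r \<and> arrow e (i ! (r - 1)) (i ! r) then x
          else if i ! (r - 1) = i ! Suc r \<and> arrow e (i ! r) (i ! (r - 1)) then - x
          else 0)) T"
        using wt_cases[OF 17(3), of T] cross_op_braid[OF e, of r T \<sigma> x]
        by auto
    qed (use 17 x in \<open>auto intro!: cross_C dot_C add_C\<close>)
  qed (auto simp: subspace_def series_scale_def dot_op_def cross_op_def fun_eq_iff)
qed

section \<open>The free algebra\<close>

lemma (in Modules.module) span_Un_image:
  assumes Z: "subspace Z" and A: "finite A" and x: "x \<in> span (Z \<union> f ` A)"
  obtains z c where "z \<in> Z" "x = z + (\<Sum>a\<in>A. scale (c a) (f a))"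
proof -
  have "\<exists>z \<in> Z. \<exists>c. x = z + (\<Sum>a\<in>A. scale (c a) (f a))"
    using x
  proof (induction rule: span_induct_alt)
    case base
    show ?case
      using subspace_0[OF Z] by (intro bexI[of _ 0] exI[of _ "\<lambda>_. 0"]) auto
  next
    case (step d y x)
    then obtain z c where zc: "z \<in> Z" "x = z + (\<Sum>a\<in>A. scale (c a) (f a))" by blast
    show ?case
    proof (cases "y \<in> Z")
      case True
      then have "scale d y + z \<in> Z"
        using zc Z by (intro subspace_add subspace_scale)
      moreover have "scale d y + x = (scale d y + z) + (\<Sum>a\<in>A. scale (c a) (f a))"
        using zc by simp
      ultimately show ?thesis by blast
    next
      case False
      then obtain b where b: "b \<in> A" "y = f b" using step by blast
      have "(\<Sum>a\<in>A. scale (if a = b then d else 0) (f a)) = (\<Sum>a\<in>A. if a = b then scale d (f a) else 0)"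
        by (intro sum.cong) auto
      also have "\<dots> = scale d y"
        using b A by simp
      finally have "scale d y + x = z + (\<Sum>a\<in>A. scale ((if a = b then d else 0) + c a) (f a))"
        using zc by (simp add: scale_left_distrib sum.distrib)
      then show ?thesis using zc(1)
        by (intro bexI[of _ z] exI[of _ "\<lambda>a. (if a = b then d else 0) + c a"])
    qed
  qed
  then show thesis using that by blast
qed

definition scalar :: "'k::field \<Rightarrow> 'g fword \<Rightarrow>\<^sub>0 'k" where
  "scalar c = Poly_Mapping.single 0 c"

lemma poly_mapping_sum_single:
  "p = (\<Sum>w\<in>Poly_Mapping.keys p. Poly_Mapping.single w (Poly_Mapping.lookup p w))"
  by (rule poly_mapping_eqI)
    (auto simp: lookup_sum lookup_single when_def in_keys_iff sum.delta' if_distrib cong: if_cong)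

lemma scalar_commute:
  fixes p :: "'g fword \<Rightarrow>\<^sub>0 'k::field"
  shows "scalar c * p = p * scalar c"
proof -
  have "scalar c * (\<Sum>w\<in>A. Poly_Mapping.single w (f w)) = (\<Sum>w\<in>A. Poly_Mapping.single w (f w)) * scalar c"
    for A and f :: "'g fword \<Rightarrow> 'k"
    by (simp add: sum_distrib_left sum_distrib_right scalar_def mult_single mult.commute)
  then show ?thesis using poly_mapping_sum_single[of p] by metis
qed

lemma scalar_0 [simp]: "scalar 0 = 0" and scalar_1 [simp]: "scalar 1 = 1"
  and scalar_add: "scalar (c + d) = scalar c + scalar d"
  and scalar_mult: "scalar (c * d) = scalar c * scalar d"
  by (simp_all add: scalar_def single_add mult_single)

lemma scalar_module: "Modules.module (\<lambda>c p. scalar c * p)"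
  by unfold_locales (auto simp: algebra_simps scalar_add scalar_mult)

lemma single_Cons: "Poly_Mapping.single (FWord (g # w)) c = free_gen g * Poly_Mapping.single (FWord w) c"
  by (simp add: free_gen_def mult_single plus_fword_def)

definition klr_carrier :: "int multiset \<Rightarrow> 'k::field klr_free set" where
  "klr_carrier \<alpha> = carrier (free_algebra (klr_letters \<alpha>))"

lemma carrier_mult: "p \<in> klr_carrier \<alpha> \<Longrightarrow> q \<in> klr_carrier \<alpha> \<Longrightarrow> p * q \<in> klr_carrier \<alpha>"
  unfolding klr_carrier_def by (rule free_algebra_mult_closed)

lemma carrier_add: "p \<in> klr_carrier \<alpha> \<Longrightarrow> q \<in> klr_carrier \<alpha> \<Longrightarrow> p + q \<in> klr_carrier \<alpha>"
  using subsetD[OF Poly_Mapping.keys_add[of p q]]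
  by (simp add: klr_carrier_def free_algebra_def) blast

lemma carrier_uminus: "p \<in> klr_carrier \<alpha> \<Longrightarrow> - p \<in> klr_carrier \<alpha>"
  by (simp add: klr_carrier_def free_algebra_def)

lemma carrier_diff: "p \<in> klr_carrier \<alpha> \<Longrightarrow> q \<in> klr_carrier \<alpha> \<Longrightarrow> p - q \<in> klr_carrier \<alpha>"
  using carrier_add[of p \<alpha> "- q"] carrier_uminus[of q \<alpha>] by simp

lemma carrier_scalar: "scalar c \<in> klr_carrier \<alpha>"
  by (auto simp: klr_carrier_def free_algebra_def scalar_def zero_fword_def)

lemma carrier_0: "0 \<in> klr_carrier \<alpha>" and carrier_1: "1 \<in> klr_carrier \<alpha>"
  using carrier_scalar[of 0 \<alpha>] carrier_scalar[of 1 \<alpha>] by simp_all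

lemma carrier_fe: "i \<in> permutations_of_multiset \<alpha> \<Longrightarrow> fe i \<in> klr_carrier \<alpha>"
  and carrier_fy: "1 \<le> s \<Longrightarrow> s \<le> size \<alpha> \<Longrightarrow> fy s \<in> klr_carrier \<alpha>"
  and carrier_fpsi: "1 \<le> r \<Longrightarrow> r < size \<alpha> \<Longrightarrow> fpsi r \<in> klr_carrier \<alpha>"
  by (auto simp: klr_carrier_def free_algebra_def free_gen_def klr_letters_def)

lemma carrier_sum: "(\<And>a. a \<in> A \<Longrightarrow> f a \<in> klr_carrier \<alpha>) \<Longrightarrow> sum f A \<in> klr_carrier \<alpha>"
  by (induction A rule: infinite_finite_induct) (auto intro: carrier_0 carrier_add)

text \<open>Words grow on the left, since this is the side on which generators act on
  modules.\<close>

lemma carrier_induct [consumes 1, case_names one add scalar e y psi]: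
  assumes p: "p \<in> klr_carrier \<alpha>"
    and "P 1" "\<And>p q. P p \<Longrightarrow> P q \<Longrightarrow> P (p + q)" "\<And>c p. P p \<Longrightarrow> P (scalar c * p)"
    and e: "\<And>i p. i \<in> permutations_of_multiset \<alpha> \<Longrightarrow> P p \<Longrightarrow> P (fe i * p)"
    and y: "\<And>s p. 1 \<le> s \<Longrightarrow> s \<le> size \<alpha> \<Longrightarrow> P p \<Longrightarrow> P (fy s * p)"
    and psi: "\<And>r p. 1 \<le> r \<Longrightarrow> r < size \<alpha> \<Longrightarrow> P p \<Longrightarrow> P (fpsi r * p)"
  shows "P p"
proof -
  have P0: "P 0" using assms(4)[of 1 0] assms(2) by simp
  have word: "P (Poly_Mapping.single (FWord w) c)" if "set w \<subseteq> klr_letters \<alpha>" for w c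
    using that
  proof (induction w)
    case Nil
    show ?case using assms(4)[OF assms(2), of c] by (simp add: scalar_def zero_fword_def)
  next
    case (Cons g w)
    then show ?case
      by (auto simp: single_Cons klr_letters_def intro: e y psi)
  qed
  have "P (\<Sum>w\<in>A. Poly_Mapping.single w (Poly_Mapping.lookup p w))"
    if "finite A" "A \<subseteq> Poly_Mapping.keys p" for A
    using that
  proof (induction A rule: finite_induct)
    case (insert w A)
    have "set (letters w) \<subseteq> klr_letters \<alpha>"
      using insert.prems p by (auto simp: klr_carrier_def free_algebra_def)
    then have "P (Poly_Mapping.single w (Poly_Mapping.lookup p w))"
      using word[of "letters w"] by simp
    then show ?case using insert by (simp add: assms(3))
  qed (simp add: P0)
  then show ?thesis
    using poly_mapping_sum_single[of p] by (metis finite_keys order_refl)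
qed

lemma klr_ideal_ideal: "ideal (klr_ideal e \<alpha>) (free_algebra (klr_letters \<alpha>))"
  unfolding klr_ideal_def
  by (intro ring.genideal_ideal free_algebra_ring klr_relators_closed)

lemma klr_ideal_subset: "klr_ideal e \<alpha> \<subseteq> klr_carrier \<alpha>"
  using ideal.Icarr[OF klr_ideal_ideal] by (auto simp: klr_carrier_def)

lemma klr_ideal_relator: "p \<in> klr_relators e \<alpha> \<Longrightarrow> p \<in> klr_ideal e \<alpha>"
  unfolding klr_ideal_def
  using ring.genideal_self[OF free_algebra_ring klr_relators_closed] by blast

lemma klr_ideal_left: "p \<in> klr_ideal e \<alpha> \<Longrightarrow> a \<in> klr_carrier \<alpha> \<Longrightarrow> a * p \<in> klr_ideal e \<alpha>"
  and klr_ideal_right: "p \<in> klr_ideal e \<alpha> \<Longrightarrow> a \<in> klr_carrier \<alpha> \<Longrightarrow> p * a \<in> klr_ideal e \<alpha>"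
  using ideal.I_l_closed[OF klr_ideal_ideal, of p e \<alpha> a] ideal.I_r_closed[OF klr_ideal_ideal, of p e \<alpha> a]
  by (auto simp: klr_carrier_def free_algebra_def)

text \<open>For a subring \<open>C\<close> containing the generators this is the left ideal they
  generate. The permutation and Specht modules are iterated quotients; in the free algebra they all
  become left ideals containing \<open>klr_ideal\<close>, and inclusions between those replace
  statements about cosets.\<close>

inductive_set left_span :: "'a::ring_1 set \<Rightarrow> 'a set \<Rightarrow> 'a set" for C S where
  base: "x \<in> S \<Longrightarrow> x \<in> left_span C S"
| zero: "0 \<in> left_span C S"
| add: "x \<in> left_span C S \<Longrightarrow> y \<in> left_span C S \<Longrightarrow> x + y \<in> left_span C S"
| mult: "a \<in> C \<Longrightarrow> x \<in> left_span C S \<Longrightarrow> a * x \<in> left_span C S"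

lemma left_span_mono: "S \<subseteq> left_span C S' \<Longrightarrow> left_span C S \<subseteq> left_span C S'"
proof
  fix x assume "S \<subseteq> left_span C S'" "x \<in> left_span C S"
  from this(2,1) show "x \<in> left_span C S'"
    by induction (auto intro: left_span.intros)
qed

locale klr_left_ideal =
  fixes e :: nat and \<alpha> :: "int multiset" and Z :: "'k::field klr_free set"
  assumes Z_carrier: "Z \<subseteq> klr_carrier \<alpha>" and ideal_Z: "klr_ideal e \<alpha> \<subseteq> Z"
    and Z_add: "p \<in> Z \<Longrightarrow> q \<in> Z \<Longrightarrow> p + q \<in> Z"
    and Z_mult: "a \<in> klr_carrier \<alpha> \<Longrightarrow> p \<in> Z \<Longrightarrow> a * p \<in> Z"
begin

lemma Z_0: "0 \<in> Z"
  using ideal_Z ideal.axioms(1)[OF klr_ideal_ideal, of e \<alpha>]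
    additive_subgroup.zero_closed[of "klr_ideal e \<alpha>" "free_algebra (klr_letters \<alpha>)"]
  by (auto simp: free_algebra_def)

lemma Z_scalar: "p \<in> Z \<Longrightarrow> scalar c * p \<in> Z"
  by (intro Z_mult carrier_scalar)

lemma Z_uminus: "p \<in> Z \<Longrightarrow> - p \<in> Z"
  using Z_mult[OF carrier_uminus[OF carrier_1], of p] by simp

lemma Z_diff: "p \<in> Z \<Longrightarrow> q \<in> Z \<Longrightarrow> p - q \<in> Z"
  using Z_add[of p "- q"] Z_uminus[of q] by simp

definition weight_space :: "int list \<Rightarrow> 'k klr_free set" where
  "weight_space i = {x \<in> klr_carrier \<alpha>. i \<in> permutations_of_multiset \<alpha> \<and> fe i * x - x \<in> Z}"

text \<open>The local relations carry an idempotent on the right. On a weight vector it acts as one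
  modulo \<open>Z\<close>, so they hold there without it.\<close>

lemma weight_relation:
  assumes "x \<in> weight_space i" "a \<in> klr_carrier \<alpha>" "a * fe i \<in> klr_ideal e \<alpha>"
  shows "a * x \<in> Z"
proof -
  have x: "x \<in> klr_carrier \<alpha>" "fe i * x - x \<in> Z"
    using assms by (auto simp: weight_space_def)
  have "a * fe i * x \<in> Z"
    using klr_ideal_right[OF assms(3) x(1)] ideal_Z by blast
  moreover have "a * (fe i * x - x) \<in> Z" by (rule Z_mult[OF assms(2) x(2)])
  ultimately have "a * fe i * x - a * (fe i * x - x) \<in> Z" by (rule Z_diff)
  then show ?thesis by (simp add: algebra_simps)
qed

lemma relation:
  assumes "a \<in> klr_ideal e \<alpha>" "x \<in> klr_carrier \<alpha>"
  shows "a * x \<in> Z"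
  using klr_ideal_right[OF assms] ideal_Z by blast

sublocale klr_operators "\<lambda>c p. scalar c * p" e "size \<alpha>" "klr_carrier \<alpha>" Z weight_space
  "\<lambda>s p. fy s * p" "\<lambda>s p. fpsi s * p"
proof -
  interpret Modules.module "\<lambda>c p. scalar c * p :: 'k klr_free" by (rule scalar_module)
  note carr = carrier_mult carrier_add carrier_diff carrier_fy carrier_fpsi carrier_1 carrier_0
  have perm: "i \<in> permutations_of_multiset \<alpha>" "x \<in> klr_carrier \<alpha>" if "x \<in> weight_space i" for x i
    using that by (auto simp: weight_space_def)
  show "klr_operators (\<lambda>c p. scalar c * p) e (size \<alpha>) (klr_carrier \<alpha>) Z weight_space
    (\<lambda>s p. fy s * p) (\<lambda>s p. fpsi s * p)"
  proof (unfold_locales, goal_cases)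
    case 1
    show ?case by (auto simp: subspace_def Z_0 Z_add Z_scalar)
  next
    case (3 s c x)
    show ?case by (metis mult.assoc scalar_commute)
  next
    case (5 s c x)
    show ?case by (metis mult.assoc scalar_commute)
  next
    case (11 r x i)
    note p = perm[OF 11(3)]
    have r: "r \<in> {1..<size \<alpha>}" using 11 by simp
    let ?j = "swap_places r i"
    have rel: "(fpsi r * fe i - fe ?j * fpsi r) * x \<in> Z"
      by (intro relation klr_ideal_relator klr_relators.cross_idem p r)
    have "fpsi r * (fe i * x - x) \<in> Z"
      using 11 by (intro Z_mult carrier_fpsi) (auto simp: weight_space_def)
    from Z_diff[OF this rel] have "fe ?j * (fpsi r * x) - fpsi r * x \<in> Z"
      by (simp add: algebra_simps)
    then show ?case
      using 11 p swap_places_closed[OF p(1) r] by (auto simp: weight_space_def intro!: carr)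
  next
    case (12 r s x)
    have "(fpsi r * fy s - fy s * fpsi r) * x \<in> Z"
      using 12 by (intro relation klr_ideal_relator klr_relators.cross_dot) auto
    then show ?case by (simp add: algebra_simps)
  next
    case (13 r s x)
    have "(fpsi r * fpsi s - fpsi s * fpsi r) * x \<in> Z"
      using 13 by (intro relation klr_ideal_relator klr_relators.cross_cross) auto
    then show ?case by (simp add: algebra_simps)
  next
    case (14 r x i)
    note p = perm[OF 14(3)]
    have r: "r \<in> {1..<size \<alpha>}" using 14 by simp
    have "(fpsi r * fy (r + 1) - (fy r * fpsi r + (if entry i r = entry i (r + 1) then 1 else 0))) * x \<in> Z"
    proof (rule weight_relation[OF 14(3)])
      show "(fpsi r * fy (r + 1) - (fy r * fpsi r + (if entry i r = entry i (r + 1) then 1 else 0))) * fe i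
          \<in> klr_ideal e \<alpha>"
        unfolding left_diff_distrib
        by (intro klr_ideal_relator klr_relators.slide_right p r)
    qed (use 14 in \<open>auto intro!: carr\<close>)
    then show ?case by (simp add: algebra_simps split: if_splits)
  next
    case (15 r x i)
    note p = perm[OF 15(3)]
    have r: "r \<in> {1..<size \<alpha>}" using 15 by simp
    have "(fy (r + 1) * fpsi r - (fpsi r * fy r + (if entry i r = entry i (r + 1) then 1 else 0))) * x \<in> Z"
    proof (rule weight_relation[OF 15(3)])
      show "(fy (r + 1) * fpsi r - (fpsi r * fy r + (if entry i r = entry i (r + 1) then 1 else 0))) * fe i
          \<in> klr_ideal e \<alpha>"
        unfolding left_diff_distrib
        by (intro klr_ideal_relator klr_relators.slide_left p r)
    qed (use 15 in \<open>auto intro!: carr\<close>)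
    then show ?case by (simp add: algebra_simps split: if_splits)
  next
    case (16 r x i)
    note p = perm[OF 16(3)]
    have r: "r \<in> {1..<size \<alpha>}" using 16 by simp
    have "(fpsi r * fpsi r - quad_coeff e i r) * x \<in> Z"
    proof (rule weight_relation[OF 16(3)])
      show "(fpsi r * fpsi r - quad_coeff e i r) * fe i \<in> klr_ideal e \<alpha>"
        unfolding left_diff_distrib
        by (intro klr_ideal_relator klr_relators.quadratic p r)
    qed (use 16 in \<open>auto simp: quad_coeff_def intro!: carr\<close>)
    then show ?case by (auto simp: quad_coeff_def algebra_simps split: if_splits)
  next
    case (17 r x i)
    note p = perm[OF 17(3)]
    have r: "r \<in> {1..<size \<alpha>}" "r + 1 \<in> {1..<size \<alpha>}" using 17 by auto
    have "(fpsi r * fpsi (r + 1) * fpsi r -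
        (fpsi (r + 1) * fpsi r * fpsi (r + 1) + braid_coeff e i r)) * x \<in> Z"
    proof (rule weight_relation[OF 17(3)])
      show "(fpsi r * fpsi (r + 1) * fpsi r -
        (fpsi (r + 1) * fpsi r * fpsi (r + 1) + braid_coeff e i r)) * fe i \<in> klr_ideal e \<alpha>"
        unfolding left_diff_distrib
        by (intro klr_ideal_relator klr_relators.braid p r)
    qed (use 17 in \<open>auto simp: braid_coeff_def intro!: carr carrier_uminus\<close>)
    then show ?case by (auto simp: braid_coeff_def algebra_simps split: if_splits)
  qed (auto simp: algebra_simps weight_space_def intro!: carr Z_mult)
qed

end

lemma foldr_fpsi: "foldr (\<lambda>s p. fpsi s * p) ws x = prod_list (map fpsi ws) * x"
  by (induction ws) (auto simp: mult.assoc)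

lemma left_span_subset:
  assumes "S \<subseteq> klr_carrier \<alpha>"
  shows "left_span (klr_carrier \<alpha>) S \<subseteq> klr_carrier \<alpha>"
proof
  fix x assume "x \<in> left_span (klr_carrier \<alpha>) S"
  then show "x \<in> klr_carrier \<alpha>"
    by induction (use assms in \<open>auto intro: carrier_0 carrier_add carrier_mult\<close>)
qed

lemma klr_left_ideal_left_span:
  assumes "klr_ideal e \<alpha> \<subseteq> left_span (klr_carrier \<alpha>) S" "S \<subseteq> klr_carrier \<alpha>"
  shows "klr_left_ideal e \<alpha> (left_span (klr_carrier \<alpha>) S)"
  using left_span_subset[OF assms(2)] assms(1)
  by unfold_locales (auto intro: left_span.intros)

section \<open>Representations of the free algebra\<close>

locale free_action = Modules.module sc for sc :: "'k::field \<Rightarrow> 'v::ab_group_add \<Rightarrow> 'v" +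
  fixes L :: "'g \<Rightarrow> 'v \<Rightarrow> 'v"
  assumes L_add: "L g (x + y) = L g x + L g y" and L_scale: "L g (sc c x) = sc c (L g x)"
begin

abbreviation act_word :: "'g list \<Rightarrow> 'v \<Rightarrow> 'v" where
  "act_word w x \<equiv> foldr L w x"

definition act :: "('g fword \<Rightarrow>\<^sub>0 'k) \<Rightarrow> 'v \<Rightarrow> 'v" where
  "act p x = (\<Sum>w\<in>Poly_Mapping.keys p. sc (Poly_Mapping.lookup p w) (act_word (letters w) x))"

lemma act_word_add: "act_word w (x + y) = act_word w x + act_word w y"
  and act_word_scale: "act_word w (sc c x) = sc c (act_word w x)"
  by (induction w) (auto simp: L_add L_scale)

lemma act_word_sum: "act_word w (sum f A) = (\<Sum>a\<in>A. act_word w (f a))"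
proof (induction A rule: infinite_finite_induct)
  case (insert a A)
  then show ?case by (simp add: act_word_add)
qed (use act_word_scale[of w 0 0] in auto)

lemma act_superset:
  assumes "finite A" "Poly_Mapping.keys p \<subseteq> A"
  shows "act p x = (\<Sum>w\<in>A. sc (Poly_Mapping.lookup p w) (act_word (letters w) x))"
  unfolding act_def using assms
  by (intro sum.mono_neutral_left) (auto simp: in_keys_iff)

lemma act_add: "act (p + q) x = act p x + act q x"
proof -
  let ?A = "Poly_Mapping.keys p \<union> Poly_Mapping.keys q"
  have "act (p + q) x = (\<Sum>w\<in>?A. sc (Poly_Mapping.lookup (p + q) w) (act_word (letters w) x))"
    using keys_add[of p q] by (intro act_superset) auto
  also have "\<dots> = act p x + act q x"
    by (simp add: act_superset[of ?A p] act_superset[of ?A q] lookup_add scale_left_distrib sum.distrib)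
  finally show ?thesis .
qed

lemma act_0 [simp]: "act 0 x = 0"
  by (simp add: act_def)

lemma act_sum: "act (sum f A) x = (\<Sum>a\<in>A. act (f a) x)"
  by (induction A rule: infinite_finite_induct) (auto simp: act_add)

lemma act_uminus: "act (- p) x = - act p x"
  using act_add[of p "- p" x] by (simp add: eq_neg_iff_add_eq_0 add.commute)

lemma act_diff: "act (p - q) x = act p x - act q x"
  using act_add[of p "- q" x] by (simp add: act_uminus)

lemma act_single: "act (Poly_Mapping.single w c) x = sc c (act_word (letters w) x)"
  using act_superset[of "{w}" "Poly_Mapping.single w c" x] by simp

lemma act_plus_right: "act p (x + y) = act p x + act p y"
  by (simp add: act_def act_word_add scale_right_distrib sum.distrib)

lemma act_mult: "act (p * q) x = act p (act q x)"
proof -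
  have single: "act (Poly_Mapping.single w c * Poly_Mapping.single u d) x =
      act (Poly_Mapping.single w c) (act (Poly_Mapping.single u d) x)" for w u :: "'g fword" and c d
    by (simp add: mult_single act_single plus_fword_def act_word_scale)
  have "act (Poly_Mapping.single w c * q) x = act (Poly_Mapping.single w c) (act q x)" for w c
  proof -
    have "act (Poly_Mapping.single w c * q) x =
        (\<Sum>u\<in>Poly_Mapping.keys q. act (Poly_Mapping.single w c)
          (act (Poly_Mapping.single u (Poly_Mapping.lookup q u)) x))"
      by (subst poly_mapping_sum_single[of q]) (simp add: sum_distrib_left act_sum single)
    also have "\<dots> = act (Poly_Mapping.single w c) (act q x)"
      by (subst (2) poly_mapping_sum_single[of q])
        (simp add: act_sum act_single act_word_sum scale_sum_right)
    finally show ?thesis .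
  qed
  note * = this
  show ?thesis
    by (subst (1 2) poly_mapping_sum_single[of p]) (simp add: sum_distrib_right act_sum *)
qed

lemma act_gen: "act (free_gen g) x = L g x"
  by (simp add: free_gen_def act_single)

lemma act_scalar: "act (scalar c) x = sc c x"
  by (simp add: scalar_def act_single zero_fword_def)

lemma act_1 [simp]: "act 1 x = x"
  using act_scalar[of 1 x] by simp

end

text \<open>A word can be sorted by exchanges of distinct letters, and each of them merely permutes
  the residues.\<close>

lemma mset_word_residues:
  assumes "mset T = mset U"
  shows "mset (word_residues e \<sigma> T) = mset (word_residues e \<sigma> U)"
proof -
  have "mset (word_residues e \<sigma> T) = mset (word_residues e \<sigma> (sort T))" for T
  proof (induction "inversions T" arbitrary: T rule: less_induct)
    case less
    show ?case
    proof (cases "sorted T")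
      case False
      then obtain s where s: "descent T s" by (auto simp: sorted_iff_no_descent)
      then have sT: "1 \<le> s" "s < length T" "T ! (s - 1) \<noteq> T ! s" by (auto simp: descent_def)
      have "sort (swap_places s T) = sort T"
        using sT by (intro properties_for_sort) (auto simp: mset_swap_places)
      moreover have "mset (word_residues e \<sigma> (swap_places s T)) = mset (word_residues e \<sigma> T)"
        using sT by (simp add: word_residues_swap mset_swap_places)
      ultimately show ?thesis
        using less[of "swap_places s T"] inversions_swap_descent[OF s] by simp
    qed (simp add: sorted_sort_id)
  qed
  moreover have "sort T = sort U"
    using assms by (intro properties_for_sort) auto
  ultimately show ?thesis by metis
qed

section \<open>The seminormal representation and its power series lattice\<close>

definition word_relators :: "int multiset \<Rightarrow> int list \<Rightarrow> nat list \<Rightarrow> 'k::field klr_free set" where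
  "word_relators \<alpha> i T0 =
     {fe js - (if js = i then 1 else 0) | js. js \<in> permutations_of_multiset \<alpha>} \<union>
     {fy s | s. s \<in> {1..size \<alpha>}} \<union>
     {fpsi s | s. s \<in> {1..<size \<alpha>} \<and> T0 ! (s - 1) = T0 ! s}"

fun letter_op :: "nat \<Rightarrow> (nat \<Rightarrow> int) \<Rightarrow> klr_letter \<Rightarrow> (nat list \<Rightarrow> 'k::field fls) \<Rightarrow> nat list \<Rightarrow> 'k fls" where
  "letter_op e \<sigma> (LetE i) f = (\<lambda>T. if word_residues e \<sigma> T = i then f T else 0)"
| "letter_op e \<sigma> (LetY s) f = dot_op s f"
| "letter_op e \<sigma> (LetPsi s) f = cross_op e \<sigma> s f"

lemma inversions_swap_le:
  assumes "1 \<le> s" "s < length T"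
  shows "inversions T \<le> Suc (inversions (swap_places s T))"
proof -
  consider "T ! s < T ! (s - 1)" | "T ! (s - 1) < T ! s" | "T ! (s - 1) = T ! s"
    by linarith
  then show ?thesis
  proof cases
    case 3
    then have "swap_places s T = T"
      using assms by (intro nth_equalityI) (auto simp: nth_swap_places)
    then show ?thesis by simp
  qed (use assms in \<open>simp_all add: inversions_swap_descent inversions_swap_ascent descent_def ascent_def\<close>)
qed

lemma sum_fun_apply: "sum g A x = (\<Sum>a\<in>A. g a x)" for g :: "'a \<Rightarrow> 'b \<Rightarrow> 'c::ab_group_add"
  by (induction A rule: infinite_finite_induct) auto

locale seminormal =
  fixes e :: nat and \<sigma> :: "nat \<Rightarrow> int" and T0 :: "nat list" and v :: "nat list \<Rightarrow> 'k::field fls"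
  assumes e: "e = 0 \<or> e > 2" and sorted_T0: "sorted T0"
    and v_def: "v = (\<lambda>T. if T = T0 then 1 else 0)"
begin

sublocale klr_vector series_scale e "length T0" "word_functions T0" "{0}" "weight_functions e \<sigma> T0"
  dot_op "cross_op e \<sigma>" \<sigma> T0 v
proof -
  interpret klr_operators "series_scale :: 'k fps \<Rightarrow> _" e "length T0" "word_functions T0" "{0}"
    "weight_functions e \<sigma> T0" dot_op "cross_op e \<sigma>"
    by (rule seminormal_operators[OF e])
  show "klr_vector series_scale e (length T0) (word_functions T0) {0} (weight_functions e \<sigma> T0)
    dot_op (cross_op e \<sigma>) \<sigma> T0 v"
  proof (unfold_locales, goal_cases)
    case 1 show ?case by (rule sorted_T0)
  next
    case 3 show ?case by (auto simp: weight_functions_def v_def)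
  next
    case (4 s)
    have "dot_op s v = series_scale (fps_X ^ Suc (T0 ! (s - 1))) v"
      by (rule ext)
        (simp add: dot_op_def v_def series_scale_def parameter_def fps_to_fls_power del: power_Suc)
    then show ?case by auto
  next
    case (5 s)
    have "cross_op e \<sigma> s v T = 0" for T
    proof (rule ccontr)
      assume nz: "cross_op e \<sigma> s v T \<noteq> 0"
      then have "T = T0 \<or> swap_places s T = T0"
        using cross_op_nonzero[OF nz] by (auto simp: v_def split: if_splits)
      moreover have "T ! (s - 1) \<noteq> T ! s" using nz by (auto simp: cross_op_def)
      moreover have "s < length T" using 5 calculation(1) by auto
      moreover have "swap_places s T ! (s - 1) = T ! s" "swap_places s T ! s = T ! (s - 1)"
        using 5 \<open>s < length T\<close> by (auto simp: nth_swap_places)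
      ultimately show False using 5 by metis
    qed
    then show ?case by (simp add: fun_eq_iff)
  qed simp
qed

definition \<alpha> :: "int multiset" where
  "\<alpha> = mset (word_residues e \<sigma> T0)"

lemma size_\<alpha>: "size \<alpha> = length T0"
  by (simp add: \<alpha>_def)

sublocale A: free_action "\<lambda>c. series_scale (fps_const c)"
  "letter_op e \<sigma> :: klr_letter \<Rightarrow> (nat list \<Rightarrow> 'k fls) \<Rightarrow> nat list \<Rightarrow> 'k fls"
proof (unfold_locales, goal_cases)
  case (5 g x y)
  show ?case by (cases g) (auto simp: Y_add Psi_add)
next
  case (6 g c x)
  show ?case by (cases g) (simp_all add: Y_scale Psi_scale, auto simp: series_scale_def)
qed (simp_all add: scale_right_distrib scale_left_distrib
  flip: fps_const_add fps_const_mult)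

lemma letter_op_series:
  fixes x :: "nat list \<Rightarrow> 'k fls"
  shows "letter_op e \<sigma> g (series_scale c x) = series_scale c (letter_op e \<sigma> g x)"
  by (cases g) (simp_all add: Y_scale Psi_scale, auto simp: series_scale_def)

lemma act_series: "A.act p (series_scale c x) = series_scale c (A.act p x)"
proof -
  have "A.act_word w (series_scale c x) = series_scale c (A.act_word w x)" for w
    by (induction w) (auto simp: letter_op_series)
  then show ?thesis
    by (simp add: A.act_def scale_sum_right mult.commute)
qed

lemma act_e: "A.act (fe i) f = (\<lambda>T. if word_residues e \<sigma> T = i then f T else 0)"
  and act_y: "A.act (fy s) f = dot_op s f"
  and act_psi: "A.act (fpsi s) f = cross_op e \<sigma> s f"
  by (simp_all add: A.act_gen)

lemma wt_act_e: "f \<in> word_functions T0 \<Longrightarrow> A.act (fe i) f \<in> weight_functions e \<sigma> T0 i"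
  by (auto simp: act_e weight_functions_def word_functions_def)

lemma act_e_wt: "f \<in> weight_functions e \<sigma> T0 i \<Longrightarrow> A.act (fe j) f = (if i = j then f else 0)"
  by (auto simp: act_e weight_functions_def fun_eq_iff)

lemma act_relator:
  assumes "p \<in> klr_relators e \<alpha>" "f \<in> word_functions T0"
  shows "A.act p f = 0"
  using assms(1)
proof cases
  case (idem i j)
  then show ?thesis
    by (auto simp: A.act_diff A.act_mult act_e_wt[OF wt_act_e[OF assms(2)]])
next
  case unit
  have "(\<Sum>i\<in>permutations_of_multiset \<alpha>. if word_residues e \<sigma> T = i then f T else 0) = f T" for T
  proof (cases "mset T = mset T0")
    case True
    then have "word_residues e \<sigma> T \<in> permutations_of_multiset \<alpha>"
      by (simp add: permutations_of_multiset_def \<alpha>_def mset_word_residues[OF True])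
    then show ?thesis by (simp add: sum.delta)
  next
    case False
    then have "f T = 0" using assms(2) by (auto simp: word_functions_def)
    then show ?thesis by simp
  qed
  then show ?thesis
    using unit by (simp add: A.act_diff A.act_sum act_e fun_eq_iff sum_fun_apply)
next
  case (dot_idem i r)
  then show ?thesis
    by (auto simp: A.act_diff A.act_mult act_e act_y dot_op_def)
next
  case (cross_idem i r)
  have r: "1 \<le> r" "r < length T0" using cross_idem by (auto simp: size_\<alpha>)
  have "length i = length T0"
    using cross_idem by (metis length_finite_permutations_of_multiset size_\<alpha>)
  have "cross_op e \<sigma> r (A.act (fe i) f) = A.act (fe (swap_places r i)) (cross_op e \<sigma> r f)"
  proof (rule ext)
    fix T
    let ?i = "word_residues e \<sigma> T"
    show "cross_op e \<sigma> r (A.act (fe i) f) T = A.act (fe (swap_places r i)) (cross_op e \<sigma> r f) T"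
    proof (cases "mset T = mset T0 \<and> T ! (r - 1) \<noteq> T ! r")
      case True
      then have len: "length T = length T0" by (metis size_mset)
      have swap: "word_residues e \<sigma> (swap_places r T) = swap_places r ?i"
        using True r len by (intro word_residues_swap) auto
      have 1: "swap_places r ?i = i \<longleftrightarrow> ?i = swap_places r i"
        using swap_places_swap_places[of r i] swap_places_swap_places[of r ?i] r len \<open>length i = _\<close>
        by auto
      have 2: "?i ! (r - 1) = ?i ! r \<Longrightarrow> swap_places r ?i = ?i"
        using r len by (intro nth_equalityI) (auto simp: nth_swap_places)
      show ?thesis
        using 1 2 by (auto simp: cross_op_def act_e swap mix_def)
    next
      case False
      then have "mset T \<noteq> mset T0 \<or> T ! (r - 1) = T ! r" by blast
      then show ?thesis
      proof
        assume "mset T \<noteq> mset T0"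
        moreover from this have "mset (swap_places r T) \<noteq> mset T0"
          using mset_swap_places_iff[OF r, of T] by simp
        ultimately have "f T = 0" "f (swap_places r T) = 0"
          using assms(2) by (auto simp: word_functions_def)
        then show ?thesis by (auto simp: cross_op_def act_e)
      qed (auto simp: cross_op_def act_e)
    qed
  qed
  then show ?thesis
    using cross_idem by (simp add: A.act_diff A.act_mult act_psi)
next
  case (dot_dot r s)
  then show ?thesis
    by (auto simp: A.act_diff A.act_mult act_y dot_op_def)
next
  case (cross_dot r s)
  then show ?thesis
    using Psi_Y[of r s f] assms(2) by (auto simp: A.act_diff A.act_mult act_y act_psi size_\<alpha>)
next
  case (cross_cross r s)
  then have "r + 1 < s \<or> s + 1 < r" by auto
  then show ?thesis
    using Psi_Psi[of r s f] assms(2) cross_cross by (auto simp: A.act_diff A.act_mult act_psi size_\<alpha>)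
next
  case (slide_right i r)
  then show ?thesis
    using klr_operators.slide_right[OF klr_operators_axioms _ _ wt_act_e[OF assms(2)], of r i]
    by (auto simp: A.act_diff A.act_add A.act_mult act_y act_psi size_\<alpha>)
next
  case (slide_left i r)
  then show ?thesis
    using klr_operators.slide_left[OF klr_operators_axioms _ _ wt_act_e[OF assms(2)], of r i]
    by (auto simp: A.act_diff A.act_add A.act_mult act_y act_psi size_\<alpha>)
next
  case (quadratic i r)
  then show ?thesis
    using klr_operators.quadratic[OF klr_operators_axioms _ _ wt_act_e[OF assms(2)], of r i]
    by (auto simp: quad_coeff_def A.act_diff A.act_add A.act_mult act_y act_psi size_\<alpha> split: if_splits)
next
  case (braid i r)
  then show ?thesis
    using klr_operators.braid[OF klr_operators_axioms _ _ wt_act_e[OF assms(2)], of r i]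
    by (auto simp: braid_coeff_def A.act_diff A.act_add A.act_uminus A.act_mult act_y act_psi size_\<alpha>
      split: if_splits)
qed

lemma word_functions_add:
  "f \<in> word_functions T0 \<Longrightarrow> g \<in> word_functions T0 \<Longrightarrow> f + g \<in> word_functions T0"
  unfolding word_functions_def by (simp, metis add_0_left)

lemma word_functions_scale: "f \<in> word_functions T0 \<Longrightarrow> series_scale c f \<in> word_functions T0"
  by (auto simp: word_functions_def series_scale_def)

lemma act_zero_right: "A.act p 0 = 0"
  using act_series[of p 0 0] by simp

lemma act_closed:
  assumes "p \<in> klr_carrier \<alpha>" "f \<in> word_functions T0"
  shows "A.act p f \<in> word_functions T0"
  using assms(1)
proof (induction rule: carrier_induct)
  case one then show ?case using assms(2) by simp
next
  case (add p q)
  then show ?case unfolding A.act_add by (rule word_functions_add)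
next
  case (scalar c p)
  then show ?case
    unfolding A.act_mult A.act_scalar by (rule word_functions_scale)
next
  case (e i p)
  then show ?case by (auto simp: A.act_mult act_e word_functions_def)
next
  case (y s p)
  then show ?case by (auto simp: A.act_mult act_y size_\<alpha> intro: Y_C)
next
  case (psi r p)
  then show ?case by (auto simp: A.act_mult act_psi size_\<alpha> intro: Psi_C)
qed

text \<open>The annihilator of a stable space is a two-sided ideal, and the defining relators belong
  to it.\<close>

lemma act_klr_ideal:
  assumes "p \<in> klr_ideal e \<alpha>" "f \<in> word_functions T0"
  shows "A.act p f = 0"
proof -
  let ?F = "free_algebra (klr_letters \<alpha>) :: 'k klr_free ring"
  define I :: "'k klr_free set" where "I = {p \<in> klr_carrier \<alpha>. \<forall>f \<in> word_functions T0. A.act p f = 0}"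
  have "ideal I ?F"
  proof (rule idealI[OF free_algebra_ring])
    show "subgroup I (add_monoid ?F)"
    proof
      fix x assume "x \<in> I"
      have "inv\<^bsub>add_monoid ?F\<^esub> x = - x"
        using \<open>x \<in> I\<close> carrier_uminus[of x \<alpha>] ring.is_abelian_group[OF free_algebra_ring]
        by (intro abelian_group.minus_equality[of ?F "- x" x, unfolded a_inv_def])
          (auto simp: I_def klr_carrier_def free_algebra_def)
      then show "inv\<^bsub>add_monoid ?F\<^esub> x \<in> I"
        using \<open>x \<in> I\<close> by (auto simp: I_def A.act_uminus intro: carrier_uminus)
    qed (auto simp: I_def A.act_add free_algebra_def klr_carrier_def[symmetric]
        intro: carrier_add carrier_0 simp: klr_carrier_def[unfolded free_algebra_def, simplified, symmetric])
  next
    fix a x assume "a \<in> I" "x \<in> carrier ?F"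
    then have a: "a \<in> klr_carrier \<alpha>" "\<And>f. f \<in> word_functions T0 \<Longrightarrow> A.act a f = 0"
      and x: "x \<in> klr_carrier \<alpha>" by (auto simp: I_def klr_carrier_def)
    have "x * a \<in> I" "a * x \<in> I"
      using a x by (auto simp: I_def A.act_mult act_closed act_zero_right intro!: carrier_mult)
    then show "x \<otimes>\<^bsub>?F\<^esub> a \<in> I" "a \<otimes>\<^bsub>?F\<^esub> x \<in> I"
      by (simp_all add: free_algebra_def)
  qed
  moreover have "klr_relators e \<alpha> \<subseteq> I"
    using act_relator subsetD[OF klr_relators_closed[of e \<alpha>]] by (auto simp: I_def klr_carrier_def)
  ultimately have "klr_ideal e \<alpha> \<subseteq> I"
    unfolding klr_ideal_def by (intro ring.genideal_minimal free_algebra_ring)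
  then show ?thesis using assms by (auto simp: I_def)
qed

text \<open>Although the crossing operators divide by parameter differences, the power series span
  of the crossing vectors is stable: triangularity uses only the KLR relations and the eigenvalues
  of the dots on \<open>v\<close>, all of which are integral. This makes the reduction at
  \<open>X = 0\<close> meaningful.\<close>

lemma act_full:
  assumes "p \<in> klr_carrier \<alpha>" "x \<in> full"
  shows "A.act p x \<in> full"
  using assms(1)
proof (induction rule: carrier_induct)
  case one then show ?case using assms(2) by (simp only: A.act_1)
next
  case (add p q)
  then show ?case unfolding A.act_add full_def by (rule span_add)
next
  case (scalar c p)
  then show ?case unfolding A.act_mult A.act_scalar full_def by (rule span_scale)
next
  case (e i p)
  have *: "A.act (fe i) y \<in> full" if "y \<in> full" for y
    using that unfolding full_def
  proof (induction rule: span_induct_alt)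
    case base
    show ?case by (simp only: act_zero_right span_zero)
  next
    case (step c x y)
    have "A.act (fe i) x \<in> span ({0} \<union> basis ` {T. mset T = mset T0})"
    proof (cases "x = 0")
      case True
      then show ?thesis by (simp only: act_zero_right span_zero)
    next
      case False
      then obtain T where "x = basis T" "mset T = mset T0" using step by auto
      then show ?thesis using act_e_wt[OF wt_basis] by (auto intro: span_zero span_base)
    qed
    then show ?case
      using step by (simp only: A.act_plus_right act_series span_add span_scale)
  qed
  show ?case unfolding A.act_mult by (rule *[OF e(2)])
next
  case (y s p)
  show ?case unfolding A.act_mult act_y by (rule Y_full[OF y(1) y(2)[unfolded size_\<alpha>] y(3)])
next
  case (psi r p)
  show ?case unfolding A.act_mult act_psi by (rule Psi_full[OF psi(1) psi(2)[unfolded size_\<alpha>] psi(3)])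
qed

lemma v_full: "v \<in> full"
proof -
  have "basis T0 \<in> full" unfolding full_def by (intro span_base) auto
  then show ?thesis by (simp only: basis_T0)
qed

text \<open>For distinct letters the coefficient of the exchanged word in \<open>mix\<close> is
  nonzero, so the crossing vectors are triangular with nonzero diagonal against the point functions
  on words.\<close>

lemma basis_support:
  assumes "mset T = mset T0"
  shows "basis T T \<noteq> 0" and "basis T U \<noteq> 0 \<Longrightarrow> U = T \<or> inversions U < inversions T"
proof -
  have "basis T T \<noteq> 0 \<and> (\<forall>U. basis T U \<noteq> 0 \<longrightarrow> U = T \<or> inversions U < inversions T)"
    using assms
  proof (induction "inversions T" arbitrary: T rule: less_induct)
    case less
    show ?case
    proof (cases "sorted T")
      case True
      then show ?thesis using basis_sorted[OF less.prems] by (auto simp: v_def split: if_splits)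
    next
      case False
      then obtain u where u: "descent T u" "basis T = cross_op e \<sigma> u (basis (swap_places u T))"
        by (rule basis_unsorted)
      have un: "1 \<le> u" "u < length T0" "u < length T" "T ! (u - 1) \<noteq> T ! u"
        using u length_word[OF less.prems] by (auto simp: descent_def)
      let ?V = "swap_places u T"
      have V: "mset ?V = mset T0" using less.prems un by (simp add: mset_swap_word)
      have inv: "inversions T = Suc (inversions ?V)" by (rule inversions_swap_descent[OF u(1)])
      have IH: "basis ?V ?V \<noteq> 0" "\<And>U. basis ?V U \<noteq> 0 \<Longrightarrow> U = ?V \<or> inversions U < inversions ?V"
        using less.hyps[OF _ V] inv by auto
      have "basis ?V T = 0" using IH(2)[of T] inv by fastforce
      then have "basis T T \<noteq> 0"
        using IH(1) un by (auto simp: u(2) cross_op_def mix_def)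
      moreover have "U = T \<or> inversions U < inversions T" if "basis T U \<noteq> 0" for U
      proof (cases "basis ?V U = 0")
        case False
        then show ?thesis using IH(2)[of U] inv by auto
      next
        case True
        then have "basis ?V (swap_places u U) \<noteq> 0"
          using cross_op_nonzero that u(2) by metis
        moreover from this have "mset (swap_places u U) = mset T0"
          using basis_C[OF V] by (auto simp: word_functions_def)
        then have "u < length U" using un by (metis length_swap_places size_mset)
        moreover have "swap_places u U = ?V \<Longrightarrow> U = T"
          using un \<open>u < length U\<close> by (metis swap_places_swap_places)
        ultimately show ?thesis
          using IH(2)[of "swap_places u U"] inversions_swap_le[of u U] un inv by fastforce
      qed
      ultimately show ?thesis by blast
    qed
  qed
  then show "basis T T \<noteq> 0" "basis T U \<noteq> 0 \<Longrightarrow> U = T \<or> inversions U < inversions T"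
    by auto
qed

section \<open>Coordinates in the crossing basis\<close>

definition words :: "nat list set" where
  "words = {T. mset T = mset T0}"

lemma finite_words: "finite words"
proof -
  have "words = permutations_of_multiset (mset T0)"
    by (auto simp: words_def permutations_of_multiset_def)
  then show ?thesis by simp
qed

text \<open>Among the words with nonzero coefficient choose \<open>U\<close> with the most
  inversions; evaluation at \<open>U\<close> sees only its own basis vector.\<close>

lemma basis_independent:
  assumes "(\<Sum>T\<in>words. series_scale (c T) (basis T)) = 0" "T \<in> words"
  shows "c T = 0"
proof (rule ccontr)
  assume "c T \<noteq> 0"
  let ?S = "{T \<in> words. c T \<noteq> 0}"
  have "finite (inversions ` ?S)" "inversions ` ?S \<noteq> {}"
    using finite_words \<open>c T \<noteq> 0\<close> assms(2) by auto
  then obtain U where U: "U \<in> ?S" "inversions U = Max (inversions ` ?S)"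
    using Max_in by (metis (mono_tags, lifting) imageE)
  have max: "inversions V \<le> inversions U" if "V \<in> ?S" for V
    using that U(2) \<open>finite (inversions ` ?S)\<close> by simp
  have "0 = (\<Sum>V\<in>words. series_scale (c V) (basis V)) U"
    using assms(1) by simp
  also have "\<dots> = (\<Sum>V\<in>words. fps_to_fls (c V) * basis V U)"
    by (simp add: sum_fun_apply series_scale_def)
  also have "\<dots> = (\<Sum>V\<in>words. if V = U then fps_to_fls (c U) * basis U U else 0)"
  proof (rule sum.cong[OF refl])
    fix V assume V: "V \<in> words"
    show "fps_to_fls (c V) * basis V U = (if V = U then fps_to_fls (c U) * basis U U else 0)"
    proof (cases "V = U \<or> c V = 0 \<or> basis V U = 0")
      case False
      then have "inversions U < inversions V" using basis_support(2)[of V U] V by (auto simp: words_def)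
      then show ?thesis using max[of V] False V by simp
    qed auto
  qed
  also have "\<dots> = fps_to_fls (c U) * basis U U"
    using U finite_words by simp
  finally show False
    using U basis_support(1)[of U] by (auto simp: words_def)
qed

lemma full_representation:
  assumes "x \<in> full"
  obtains c where "x = (\<Sum>T\<in>words. series_scale (c T) (basis T))"
proof -
  obtain z c where "z \<in> {0}" "x = z + (\<Sum>T\<in>words. series_scale (c T) (basis T))"
    using assms unfolding full_def words_def[symmetric]
    by (rule span_Un_image[OF subspace_Z finite_words])
  then show thesis using that by simp
qed

text \<open>Only the values on \<open>words\<close> are determined by \<open>x\<close>; the lemmas
  below evaluate coordinates there.\<close>

definition coord :: "(nat list \<Rightarrow> 'k fls) \<Rightarrow> nat list \<Rightarrow> 'k fps" where
  "coord x = (SOME c. x = (\<Sum>T\<in>words. series_scale (c T) (basis T)))"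

lemma coord: "x \<in> full \<Longrightarrow> x = (\<Sum>T\<in>words. series_scale (coord x T) (basis T))"
proof -
  assume "x \<in> full"
  then have "\<exists>c. x = (\<Sum>T\<in>words. series_scale (c T) (basis T))"
    by (rule full_representation) blast
  then show ?thesis unfolding coord_def by (rule someI_ex)
qed

lemma coord_unique:
  assumes "x \<in> full" "x = (\<Sum>T\<in>words. series_scale (c T) (basis T))" "U \<in> words"
  shows "coord x U = c U"
proof -
  have "(\<Sum>T\<in>words. series_scale (coord x T - c T) (basis T)) = 0"
    using coord[OF assms(1)] assms(2) by (simp add: scale_left_diff_distrib sum_subtractf)
  from basis_independent[OF this assms(3)] show ?thesis by simp
qed

lemma coord_add:
  assumes "x \<in> full" "y \<in> full" "U \<in> words"
  shows "coord (x + y) U = coord x U + coord y U"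
proof (rule coord_unique)
  show "x + y \<in> full" using assms unfolding full_def by (intro span_add)
  have "(\<Sum>T\<in>words. series_scale (coord x T + coord y T) (basis T)) =
      (\<Sum>T\<in>words. series_scale (coord x T) (basis T)) + (\<Sum>T\<in>words. series_scale (coord y T) (basis T))"
    by (simp add: scale_left_distrib sum.distrib)
  then show "x + y = (\<Sum>T\<in>words. series_scale (coord x T + coord y T) (basis T))"
    using coord[OF assms(1)] coord[OF assms(2)] by metis
qed (rule assms)

lemma coord_scale:
  assumes "x \<in> full" "U \<in> words"
  shows "coord (series_scale d x) U = d * coord x U"
proof (rule coord_unique)
  show "series_scale d x \<in> full" using assms unfolding full_def by (intro span_scale)
  have "(\<Sum>T\<in>words. series_scale (d * coord x T) (basis T)) =
      series_scale d (\<Sum>T\<in>words. series_scale (coord x T) (basis T))"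
    by (simp add: scale_sum_right)
  then show "series_scale d x = (\<Sum>T\<in>words. series_scale (d * coord x T) (basis T))"
    using coord[OF assms(1)] by metis
qed (rule assms)

lemma coord_basis:
  assumes "T \<in> words" "U \<in> words"
  shows "coord (basis T) U = (if U = T then 1 else 0)"
proof (rule coord_unique)
  show "basis T \<in> full" using assms unfolding full_def words_def by (intro span_base) auto
  have "(\<Sum>V\<in>words. series_scale (if V = T then 1 else 0) (basis V)) =
      (\<Sum>V\<in>words. if V = T then basis V else 0)"
    by (intro sum.cong) auto
  then show "basis T = (\<Sum>V\<in>words. series_scale (if V = T then 1 else 0) (basis V))"
    using assms finite_words by simp
qed (rule assms)

definition coordinate :: "'k klr_free \<Rightarrow> nat list \<Rightarrow> 'k" where
  "coordinate p U = fps_nth (coord (A.act p v) U) 0"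

lemma coordinate_add:
  "p \<in> klr_carrier \<alpha> \<Longrightarrow> q \<in> klr_carrier \<alpha> \<Longrightarrow> U \<in> words \<Longrightarrow>
     coordinate (p + q) U = coordinate p U + coordinate q U"
  by (simp add: coordinate_def A.act_add coord_add act_full v_full)

lemma coordinate_scalar:
  "p \<in> klr_carrier \<alpha> \<Longrightarrow> U \<in> words \<Longrightarrow> coordinate (scalar c * p) U = c * coordinate p U"
  by (simp add: coordinate_def A.act_mult A.act_scalar coord_scale act_full v_full)

lemma coordinate_basis:
  assumes "T \<in> words" "U \<in> words"
  shows "coordinate (prod_list (map fpsi (reduced_word T))) U = (if U = T then 1 else 0)"
proof -
  have "A.act (prod_list (map fpsi ws)) v = cross ws v" for ws
    by (induction ws) (auto simp: A.act_mult act_psi)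
  then show ?thesis
    using coord_basis[OF assms] by (simp add: coordinate_def basis_def)
qed

text \<open>Modulo \<open>X\<close> the vector \<open>v\<close> satisfies the relations of the generator of the permutation
  module, so the coordinates at \<open>X = 0\<close> factor through that module.\<close>

lemma coordinate_ideal:
  assumes "p \<in> left_span (klr_carrier \<alpha>) (klr_ideal e \<alpha> \<union> word_relators \<alpha> (word_residues e \<sigma> T0) T0)"
    and U: "U \<in> words"
  shows "coordinate p U = 0"
proof -
  have v_C: "v \<in> word_functions T0" by (rule v_C)
  have "\<exists>x \<in> full. A.act p v = series_scale fps_X x"
    using assms(1)
  proof induction
    case (base p)
    have zero: ?case if "A.act p v = 0"
    proof
      show "0 \<in> full" unfolding full_def by (rule span_zero)
    qed (simp only: that scale_zero_right)
    show ?case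
    proof (cases "p \<in> klr_ideal e \<alpha>")
      case True
      then show ?thesis by (intro zero act_klr_ideal v_C)
    next
      case False
      with base consider
          js where "p = fe js - (if js = word_residues e \<sigma> T0 then 1 else 0)"
        | s where "p = fy s" "s \<in> {1..size \<alpha>}"
        | s where "p = fpsi s" "s \<in> {1..<size \<alpha>}" "T0 ! (s - 1) = T0 ! s"
        by (auto simp: word_relators_def)
      then show ?thesis
      proof cases
        case 1
        then show ?thesis
          by (intro zero) (auto simp: A.act_diff act_e_wt[OF wt_v])
      next
        case 2
        \<comment> \<open>\<open>parameter a\<close> is \<open>X ^ Suc a\<close>, so a factor
          \<open>X\<close> can be split off even for row 0. This is the reason for the shifted
          exponent.\<close>
        have "A.act p v = series_scale fps_X (series_scale (fps_X ^ (T0 ! (s - 1))) v)"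
          using 2 by (auto simp: act_y dot_op_def v_def series_scale_def parameter_def fps_to_fls_power
            fls_times_fps_to_fls)
        moreover have "series_scale (fps_X ^ (T0 ! (s - 1))) v \<in> full"
          using v_full unfolding full_def by (rule span_scale)
        ultimately show ?thesis by blast
      next
        case 3
        then show ?thesis using Psi_v[of s] by (intro zero) (auto simp: act_psi size_\<alpha>)
      qed
    qed
  next
    case zero
    show ?case
    proof
      show "0 \<in> full" unfolding full_def by (rule span_zero)
    qed (simp only: A.act_0 scale_zero_right)
  next
    case (add p q)
    then obtain x y where xy: "x \<in> full" "A.act p v = series_scale fps_X x"
      "y \<in> full" "A.act q v = series_scale fps_X y" by blast
    show ?case
    proof
      show "x + y \<in> full" using xy unfolding full_def by (intro span_add)
    qed (simp only: A.act_add scale_right_distrib xy)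
  next
    case (mult a p)
    then obtain x where x: "x \<in> full" "A.act p v = series_scale fps_X x" by blast
    show ?case
    proof
      show "A.act a x \<in> full" by (rule act_full[OF mult.hyps(1) x(1)])
    qed (simp only: A.act_mult x act_series)
  qed
  then show ?thesis
    using U by (auto simp: coordinate_def coord_scale)
qed

end

section \<open>Quotients of permutation modules\<close>

lemma mult_scalar_add: "a * (scalar c * x + y) = scalar c * (a * x) + a * y"
  by (simp add: distrib_left mult.assoc[symmetric] scalar_commute[of c a])

locale klr_module = klr_left_ideal e \<alpha> Z
  for e :: nat and \<alpha> :: "int multiset" and Z :: "'k::field klr_free set" +
  fixes \<sigma> :: "nat \<Rightarrow> int" and T0 :: "nat list"
  assumes sorted_T0: "sorted T0" and \<alpha>_eq: "\<alpha> = mset (word_residues e \<sigma> T0)"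
    and relators_Z: "word_relators \<alpha> (word_residues e \<sigma> T0) T0 \<subseteq> Z"
begin

lemma size_\<alpha>: "size \<alpha> = length T0"
  by (simp add: \<alpha>_eq)

lemma residues_perm: "mset T = mset T0 \<Longrightarrow> word_residues e \<sigma> T \<in> permutations_of_multiset \<alpha>"
  using mset_word_residues[of T T0 e \<sigma>] by (simp add: permutations_of_multiset_def \<alpha>_eq)

lemma fy_Z: "1 \<le> s \<Longrightarrow> s \<le> size \<alpha> \<Longrightarrow> fy s \<in> Z"
  and fpsi_Z: "1 \<le> s \<Longrightarrow> s < size \<alpha> \<Longrightarrow> T0 ! (s - 1) = T0 ! s \<Longrightarrow> fpsi s \<in> Z"
  using relators_Z by (auto simp: word_relators_def)

lemma one_weight: "1 \<in> weight_space (word_residues e \<sigma> T0)"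
proof -
  have "fe (word_residues e \<sigma> T0) - 1 \<in> Z"
    using relators_Z residues_perm[OF refl] by (force simp: word_relators_def)
  then show ?thesis
    by (simp add: weight_space_def carrier_1 residues_perm)
qed

sublocale klr_vector "\<lambda>c p. scalar c * p" e "size \<alpha>" "klr_carrier \<alpha>" Z weight_space
  "\<lambda>s p. fy s * p" "\<lambda>s p. fpsi s * p" \<sigma> T0 1
proof (unfold_locales, goal_cases)
  case 1 show ?case by (rule sorted_T0)
next
  case 2 show ?case by (simp add: size_\<alpha>)
next
  case 3 show ?case by (rule one_weight)
next
  case (4 s)
  then show ?case using fy_Z by (intro exI[of _ 0]) simp
next
  case (5 s)
  then show ?case using fpsi_Z by simp
qed

lemma fe_weight:
  assumes x: "x \<in> weight_space i" and j: "j \<in> permutations_of_multiset \<alpha>"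
  shows "fe j * x - (if j = i then x else 0) \<in> Z"
proof (cases "j = i")
  case True
  then show ?thesis using x by (simp add: weight_space_def)
next
  case False
  have i: "i \<in> permutations_of_multiset \<alpha>" "x \<in> klr_carrier \<alpha>" using x by (auto simp: weight_space_def)
  have "(fe j * fe i - (if j = i then fe j else 0)) * x \<in> Z"
    by (intro relation klr_ideal_relator klr_relators.idem j i)
  moreover have "fe j * (fe i * x - x) \<in> Z"
    using x by (intro Z_mult carrier_fe j) (auto simp: weight_space_def)
  ultimately have "(fe j * fe i - (if j = i then fe j else 0)) * x - fe j * (fe i * x - x) \<in> Z"
    by (rule Z_diff)
  then show ?thesis using False by (simp add: algebra_simps)
qed

lemma carrier_full: "klr_carrier \<alpha> \<subseteq> full"
proof
  fix p :: "'k klr_free" assume "p \<in> klr_carrier \<alpha>"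
  then show "p \<in> full"
  proof (induction rule: carrier_induct)
    case one
    have "basis T0 \<in> full" unfolding full_def by (intro span_base) auto
    then show ?case by (simp only: basis_T0)
  next
    case (add p q)
    then show ?case unfolding full_def by (rule span_add)
  next
    case (scalar c p)
    then show ?case unfolding full_def by (rule span_scale)
  next
    case (e i p)
    from e(2) show ?case unfolding full_def
    proof (induction rule: span_induct_alt)
      case base
      show ?case by (simp add: span_zero)
    next
      case (step c x y)
      have "fe i * x \<in> span (Z \<union> basis ` {T. mset T = mset T0})"
      proof (cases "x \<in> Z")
        case True
        then show ?thesis using Z_mult[OF carrier_fe[OF e(1)]] by (intro span_base) auto
      next
        case False
        then obtain T where T: "x = basis T" "mset T = mset T0" using step by auto
        let ?y = "if i = word_residues e \<sigma> T then x else 0"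
        have "fe i * x - ?y \<in> span (Z \<union> basis ` {T. mset T = mset T0})"
          using fe_weight[OF wt_basis[OF T(2)] e(1)] T(1) by (intro span_base) auto
        moreover have "?y \<in> span (Z \<union> basis ` {T. mset T = mset T0})"
          using T by (auto intro: span_base span_zero)
        ultimately show ?thesis using span_add by fastforce
      qed
      moreover have "fe i * (scalar c * x + y) = scalar c * (fe i * x) + fe i * y"
        by (rule mult_scalar_add)
      ultimately show ?case using step by (simp add: span_add span_scale)
    qed
  next
    case (y s p)
    then show ?case by (intro Y_full)
  next
    case (psi r p)
    then show ?case by (intro Psi_full)
  qed
qed

lemma basis_eq: "basis T = prod_list (map fpsi (reduced_word T))"
  by (simp add: basis_def foldr_fpsi)

lemma finite_words: "finite {T. mset T = mset T0}"
proof -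
  have "{T. mset T = mset T0} = permutations_of_multiset (mset T0)"
    by (auto simp: permutations_of_multiset_def)
  then show ?thesis by simp
qed

lemma standard_representation:
  assumes "\<And>T. mset T = mset T0 \<Longrightarrow> \<not> S T \<Longrightarrow> basis T \<in> below (inversions T)"
    and "p \<in> klr_carrier \<alpha>"
  obtains z c where "z \<in> Z" "p = z + (\<Sum>T | mset T = mset T0 \<and> S T. scalar (c T) * basis T)"
proof -
  have "p \<in> span (Z \<union> basis ` {T. mset T = mset T0 \<and> S T})"
    using full_standard[OF assms(1)] carrier_full assms(2) by blast
  moreover have "finite {T. mset T = mset T0 \<and> S T}"
    by (rule finite_subset[OF _ finite_words]) auto
  ultimately show thesis
    using span_Un_image[OF subspace_Z] that by blast
qed

text \<open>An arbitrary \<open>p\<close> is allowed because the whole module has to be annihilated.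
  It is enough to take crossings applied to \<open>head a\<close>; the idempotent leaves only those
  whose first residue, that of row \<open>a\<close>, is \<open>j ! 0\<close>, and
  \<open>funpow_Y_head\<close> bounds the exponent.\<close>

lemma cyclotomic:
  assumes n: "size \<alpha> > 0" and F: "finite F" "\<And>a. a \<in> set T0 \<Longrightarrow> a \<notin> F \<Longrightarrow> head a \<in> Z"
    and j: "j \<in> permutations_of_multiset \<alpha>" and p: "p \<in> klr_carrier \<alpha>"
  shows "fy 1 ^ card {b \<in> F. \<sigma> b mod int e = j ! 0} * fe j * p \<in> Z"
proof -
  let ?N = "card {b \<in> F. \<sigma> b mod int e = j ! 0}"
  have pow: "fy 1 ^ m * q = ((\<lambda>q. fy 1 * q) ^^ m) q" for m and q :: "'k klr_free"
    by (induction m) (auto simp: mult.assoc)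
  have pow_Z: "fy 1 ^ m * q \<in> Z" if "q \<in> Z" for m q
    unfolding pow using n that by (intro funpow_Y_Z) (auto intro: fy_Z)
  have Y_Z_v: "fy s * 1 \<in> Z" if "1 \<le> s" "s \<le> size \<alpha>" for s
    using fy_Z[OF that] by simp
  have "p \<in> span (Z \<union> {cross ws (head a) | ws a. a \<in> set T0 \<and> set ws \<subseteq> {2..<size \<alpha>}})"
    using full_head[OF n] carrier_full p by blast
  then show ?thesis
  proof (induction rule: span_induct_alt)
    case base
    show ?case by (simp add: Z_0)
  next
    case (step c x y)
    have "fy 1 ^ ?N * fe j * x \<in> Z"
    proof (cases "x \<in> Z")
      case True
      then show ?thesis
        unfolding mult.assoc by (intro pow_Z Z_mult carrier_fe j)
    next
      case False
      then obtain ws a where x: "x = cross ws (head a)" "a \<in> set T0" "set ws \<subseteq> {2..<size \<alpha>}"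
        using step by blast
      obtain i where i: "x \<in> weight_space i" "i ! 0 = \<sigma> a mod int e"
        using wt_head[OF x(2,3)] x(1) by auto
      have eq: "fy 1 ^ ?N * (fe j * x - (if j = i then x else 0)) \<in> Z"
        by (intro pow_Z fe_weight i j)
      have "fy 1 ^ ?N * (if j = i then x else 0) \<in> Z"
      proof (cases "j = i")
        case True
        have "card {b \<in> F. b \<le> a \<and> \<sigma> b mod int e = \<sigma> a mod int e} \<le> ?N"
          using F(1) i(2) True by (intro card_mono) auto
        then have "fy 1 ^ ?N * x \<in> Z"
          unfolding pow x(1) using n Y_Z_v F x by (intro funpow_Y_head) auto
        then show ?thesis using True by simp
      qed (simp add: Z_0)
      from Z_add[OF eq this] show ?thesis by (simp add: algebra_simps)
    qed
    moreover have "fy 1 ^ ?N * fe j * (scalar c * x + y) =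
        scalar c * (fy 1 ^ ?N * fe j * x) + fy 1 ^ ?N * fe j * y"
      by (rule mult_scalar_add)
    ultimately show ?case
      using step Z_add Z_scalar by simp
  qed
qed

text \<open>Among the indices with nonzero coefficient choose one whose leading word has the most
  inversions. The coordinate at that word annihilates \<open>Z\<close> and all other terms of the
  sum.\<close>

lemma leading_independent:
  assumes Z: "Z = left_span (klr_carrier \<alpha>) (klr_ideal e \<alpha> \<union> word_relators \<alpha> (word_residues e \<sigma> T0) T0)"
    and e: "e = 0 \<or> e > 2"
    and Q: "finite Q" "inj_on \<phi> Q" "\<And>q. q \<in> Q \<Longrightarrow> mset (\<phi> q) = mset T0"
    and u: "\<And>q. q \<in> Q \<Longrightarrow> u q \<in> klr_carrier \<alpha>"
      "\<And>q. q \<in> Q \<Longrightarrow> agree (inversions (\<phi> q)) (u q) (basis (\<phi> q))"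
    and sum: "(\<Sum>q\<in>Q. scalar (c q) * u q) \<in> Z"
    and q: "q \<in> Q"
  shows "c q = 0"
proof (rule ccontr)
  assume nz: "c q \<noteq> 0"
  interpret S: seminormal e \<sigma> T0 "\<lambda>T. if T = T0 then 1 else 0 :: 'k fls"
    by unfold_locales (use e sorted_T0 in auto)
  have S\<alpha>: "S.\<alpha> = \<alpha>" by (simp add: S.\<alpha>_def \<alpha>_eq)
  note coord_add = S.coordinate_add[unfolded S\<alpha> S.words_def, simplified]
  note coord_scalar = S.coordinate_scalar[unfolded S\<alpha> S.words_def, simplified]
  have coord_Z: "S.coordinate p U = 0" if "p \<in> Z" "mset U = mset T0" for p U
    using S.coordinate_ideal[of p U] that Z by (simp add: S\<alpha> S.words_def)
  have coord_basis: "S.coordinate (basis T) U = (if U = T then 1 else 0)"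
    if "mset T = mset T0" "mset U = mset T0" for T U
    using S.coordinate_basis[of T U] that by (simp add: basis_eq S.words_def)
  have coord_below: "S.coordinate p U = 0 \<and> p \<in> klr_carrier \<alpha>"
    if "p \<in> below l" "mset U = mset T0" "l \<le> inversions U" for p l U
    using that(1) unfolding below_def
  proof (induction rule: span_induct_alt)
    case base
    show ?case using coord_Z[OF Z_0] that by (simp add: carrier_0)
  next
    case (step d x y)
    have "S.coordinate x U = 0 \<and> x \<in> klr_carrier \<alpha>"
    proof (cases "x \<in> Z")
      case True
      then show ?thesis using coord_Z that Z_carrier by auto
    next
      case False
      then obtain T where "x = basis T" "mset T = mset T0" "inversions T < l"
        using step by auto
      then show ?thesis using coord_basis[of T U] that basis_C by auto
    qed
    then show ?case
      using step that by (simp add: coord_add coord_scalar carrier_mult carrier_scalar carrier_add)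
  qed
  have coord_u: "S.coordinate (u q) U = (if U = \<phi> q then 1 else 0)"
    if "q \<in> Q" "mset U = mset T0" "inversions (\<phi> q) \<le> inversions U" for q U
  proof -
    have "u q - basis (\<phi> q) \<in> below (inversions (\<phi> q))"
      using u(2)[OF that(1)] by (simp add: agree_def)
    from coord_below[OF this that(2,3)]
    have "S.coordinate (u q - basis (\<phi> q)) U = 0" "u q - basis (\<phi> q) \<in> klr_carrier \<alpha>" by auto
    then show ?thesis
      using coord_add[of "u q - basis (\<phi> q)" "basis (\<phi> q)" U] basis_C[OF Q(3)[OF that(1)]]
        coord_basis[OF Q(3)[OF that(1)] that(2)] that(2) by simp
  qed
  let ?S = "{q \<in> Q. c q \<noteq> 0}"
  have fin: "finite ((\<lambda>q. inversions (\<phi> q)) ` ?S)" "(\<lambda>q. inversions (\<phi> q)) ` ?S \<noteq> {}"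
    using Q(1) q nz by auto
  obtain m where m: "Max ((\<lambda>q. inversions (\<phi> q)) ` ?S) = inversions (\<phi> m)" "m \<in> ?S"
    using Max_in[OF fin] by (rule imageE)
  have max: "inversions (\<phi> q) \<le> inversions (\<phi> m)" if "q \<in> ?S" for q
    using that fin(1) unfolding m(1)[symmetric] by (intro Max_ge) auto
  let ?U = "\<phi> m"
  have U: "mset ?U = mset T0" using m(2) Q(3) by simp
  have sum_coord: "S.coordinate (\<Sum>q\<in>A. scalar (c q) * u q) ?U = (\<Sum>q\<in>A. c q * S.coordinate (u q) ?U)"
    if "A \<subseteq> Q" for A
    using finite_subset[OF that Q(1)] that
  proof (induction A rule: finite_induct)
    case empty
    show ?case using coord_Z[OF Z_0 U] by simp
  next
    case (insert a A)
    have "(\<Sum>q\<in>A. scalar (c q) * u q) \<in> klr_carrier \<alpha>"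
      using insert.prems u(1) by (intro carrier_sum carrier_mult carrier_scalar) auto
    then show ?case
      using insert u(1) U by (simp add: coord_add coord_scalar carrier_mult carrier_scalar)
  qed
  have "0 = S.coordinate (\<Sum>q\<in>Q. scalar (c q) * u q) ?U"
    using coord_Z[OF sum U] by simp
  also have "\<dots> = (\<Sum>q\<in>Q. c q * S.coordinate (u q) ?U)"
    by (rule sum_coord) simp
  also have "\<dots> = (\<Sum>q\<in>Q. if q = m then c m else 0)"
  proof (rule sum.cong[OF refl])
    fix q assume q: "q \<in> Q"
    show "c q * S.coordinate (u q) ?U = (if q = m then c m else 0)"
      using coord_u[OF q U max[of q]] q m(2) inj_onD[OF Q(2), of q m] by (cases "c q = 0") auto
  qed
  also have "\<dots> = c m" using m(2) Q(1) by simp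
  finally show False using m(2) by simp
qed

end

section \<open>The layers of the filtration\<close>

lemma row_word_Suc: "row_word (Suc j) L = map Suc (row_word j L)"
  by (induction L arbitrary: j) (auto simp: map_replicate)

lemma map_shift_row_word: "d < j \<Longrightarrow> map (shift d) (row_word j L) = row_word (Suc j) L"
  using set_row_word[of j L] by (auto simp: row_word_Suc shift_def intro!: map_cong)

lemma row_word_nth_split:
  assumes "a < length L"
  shows "row_word 0 L = row_word 0 (take a L) @ replicate (L ! a) a @ row_word (Suc a) (drop (Suc a) L)"
proof -
  have "L = take a L @ L ! a # drop (Suc a) L"
    using assms by (rule id_take_nth_drop)
  then have "row_word 0 L = row_word 0 (take a L @ L ! a # drop (Suc a) L)" by simp
  also have "\<dots> = row_word 0 (take a L) @ replicate (L ! a) a @ row_word (Suc a) (drop (Suc a) L)"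
    using assms by (simp add: row_word_append)
  finally show ?thesis .
qed

lemma row_word_link:
  assumes "Suc a < length L" "L ! Suc a = 1"
  shows "row_word 0 L = row_word 0 (take a L) @ replicate (L ! a) a @
    Suc a # row_word (Suc (Suc a)) (drop (Suc (Suc a)) L)"
  using row_word_nth_split[of a L] assms Cons_nth_drop_Suc[of "Suc a" L, symmetric] by simp

lemma notin_row_word:
  "a \<le> j \<Longrightarrow> j \<notin> set (row_word 0 (take a L))" "j < m \<Longrightarrow> j \<notin> set (row_word m L)"
  using set_row_word[of 0 "take a L"] set_row_word[of m L] by auto

lemma word_residues_chain:
  assumes "z \<notin> set D"
  shows "word_residues e \<sigma> (A @ z # D @ B) =
    foldr swap_places [Suc (length A)..<Suc (length A) + length D] (word_residues e \<sigma> (A @ D @ z # B))"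
  using assms
proof (induction D arbitrary: A)
  case (Cons d D)
  have upt: "[Suc (length A)..<Suc (length A) + length (d # D)] =
      Suc (length A) # [Suc (length (A @ [d]))..<Suc (length (A @ [d])) + length D]"
    by (simp add: upt_conv_Cons del: upt_Suc)
  have "word_residues e \<sigma> (A @ z # d # D @ B) =
      swap_places (Suc (length A)) (word_residues e \<sigma> (A @ d # z # D @ B))"
    using word_residues_swap[of "Suc (length A)" "A @ d # z # D @ B" e \<sigma>] Cons.prems
      swap_places_append[of A d z "D @ B"] by (simp add: nth_append)
  then show ?case
    using Cons.IH[of "A @ [d]"] Cons.prems unfolding upt by (simp del: upt_Suc)
qed simp

lemma prod_fpsi_carrier: "set ws \<subseteq> {1..<size \<alpha>} \<Longrightarrow> prod_list (map fpsi ws) \<in> klr_carrier \<alpha>"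
  by (induction ws) (auto intro!: carrier_mult carrier_fpsi carrier_1)

lemma word_relators_carrier:
  "word_relators \<alpha> i T \<subseteq> klr_carrier \<alpha>"
  by (auto simp: word_relators_def intro: carrier_diff carrier_fe carrier_1 carrier_fy carrier_fpsi)

lemma nth_block:
  "length A \<le> j \<Longrightarrow> j < length A + m \<Longrightarrow> (A @ replicate m a @ B) ! j = a"
  "length A + m \<le> j \<Longrightarrow> (A @ replicate m a @ B) ! j = B ! (j - (length A + m))"
proof -
  assume j: "length A \<le> j" "j < length A + m"
  then have "j - length A < m" by simp
  with j show "(A @ replicate m a @ B) ! j = a" by (simp add: nth_append)
next
  assume j: "length A + m \<le> j"
  then have "\<not> j < length A" "\<not> j - length A < m" by auto
  with j show "(A @ replicate m a @ B) ! j = B ! (j - (length A + m))" by (simp add: nth_append)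
qed

lemma klr_module_left_span:
  assumes "klr_ideal e \<alpha> \<union> word_relators \<alpha> (word_residues e \<sigma> T) T \<subseteq> S" "S \<subseteq> klr_carrier \<alpha>"
    and "sorted T" "\<alpha> = mset (word_residues e \<sigma> T)"
  shows "klr_module e \<alpha> (left_span (klr_carrier \<alpha>) S) \<sigma> T"
proof -
  have "S \<subseteq> left_span (klr_carrier \<alpha>) S" by (auto intro: left_span.base)
  then show ?thesis
    using assms by (intro klr_module.intro klr_module_axioms.intro klr_left_ideal_left_span) auto
qed

text \<open>\<open>hook_rows k r i\<close> and \<open>hook_start x i\<close> list the row lengths and the residues (as integers) of the
  first nodes of the rows of the \<open>i\<close>-th layer shape.\<close>

definition hook_rows :: "nat \<Rightarrow> nat \<Rightarrow> nat \<Rightarrow> nat list" where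
  "hook_rows k r i =
     (if i = 0 then map (\<lambda>j. if j = 0 then k else 1) [0..<Suc r]
      else map (\<lambda>j. (if j = 0 then k else 1) + (if j = i - 1 then 1 else 0)) [0..<r])"

definition hook_start :: "int \<Rightarrow> nat \<Rightarrow> nat \<Rightarrow> int" where
  "hook_start x i j = (if i = 0 \<or> Suc j < i then x - int j else x - int j - 1)"

text \<open>The rows that contain a Garnir node: the next row belongs to the same component. For
  \<open>i > 0\<close> these lie in the last component, which starts at row
  \<open>i - 1\<close>.\<close>

definition hook_links :: "nat \<Rightarrow> nat \<Rightarrow> nat set" where
  "hook_links r i = (if i = 0 then {0..<r} else {i - 1..<r - 1})"

text \<open>The positions of row \<open>a\<close>, read as crossings that carry the strand right
  after the row to its front.\<close>

definition row_chain :: "nat list \<Rightarrow> nat \<Rightarrow> nat list" where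
  "row_chain L a = [Suc (sum_list (take a L))..<Suc (sum_list (take a L)) + L ! a]"

locale hook_layers =
  fixes e k r :: nat and x :: int
  assumes e: "e = 0 \<or> e > 2" and k: "k \<ge> 1" and r: "r \<ge> 1"
begin

abbreviation "rows \<equiv> hook_rows k r"
abbreviation "start \<equiv> hook_start x"
abbreviation "links \<equiv> hook_links r"

definition T :: "nat \<Rightarrow> nat list" where
  "T i = row_word 0 (rows i)"

definition res :: "nat \<Rightarrow> int list" where
  "res i = word_residues e (start i) (T i)"

definition \<alpha> :: "int multiset" where
  "\<alpha> = mset (res 0)"

definition garnir :: "nat \<Rightarrow> nat \<Rightarrow> 'k::field klr_free" where
  "garnir i a = prod_list (map fpsi (row_chain (rows i) a))"

definition perm_relations :: "nat \<Rightarrow> 'k::field klr_free set" where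
  "perm_relations i = klr_ideal e \<alpha> \<union> word_relators \<alpha> (res i) (T i)"

definition specht_ideal :: "nat \<Rightarrow> 'k::field klr_free set" where
  "specht_ideal i = left_span (klr_carrier \<alpha>) (perm_relations i \<union> garnir i ` links i)"

text \<open>The preimage of M_i in the free algebra. Rows are counted from 0 here, so the Garnir
  node A_i corresponds to \<open>i - 1\<close>; at \<open>i = Suc r\<close> no Garnir element is
  left and the ideal presents M itself.\<close>

definition layer_ideal :: "nat \<Rightarrow> 'k::field klr_free set" where
  "layer_ideal i = (if i = 0 then klr_carrier \<alpha>
     else left_span (klr_carrier \<alpha>) (perm_relations 0 \<union> garnir 0 ` {i - 1..<r}))"

definition generator :: "nat \<Rightarrow> 'k::field klr_free" where
  "generator i = (if i = 0 then 1 else garnir 0 (i - 1))"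

definition standard :: "nat \<Rightarrow> nat list set" where
  "standard i = {U. mset U = mset (T i) \<and> (\<forall>a \<in> links i. \<not> violates a U)}"

lemma length_rows: "length (rows i) = (if i = 0 then Suc r else r)"
  by (simp add: hook_rows_def)

lemma nth_rows: "j < length (rows i) \<Longrightarrow> rows i ! j =
    (if j = 0 then k else 1) + (if i \<noteq> 0 \<and> j = i - 1 then 1 else 0)"
  by (auto simp: hook_rows_def nth_append simp del: upt_Suc)

lemma sum_take:
  "j \<le> length (rows i) \<Longrightarrow>
     sum_list (take j (rows i)) = (if j = 0 then 0 else k + j - 1) + (if i \<noteq> 0 \<and> i \<le> j then 1 else 0)"
  by (induction j) (auto simp: take_Suc_conv_app_nth nth_rows)

lemma sorted_T: "sorted (T i)"
  by (simp add: T_def sorted_row_word)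

lemma link_nth:
  assumes "a \<in> links i" "i \<le> r"
  shows "Suc a < length (rows i)" "rows i ! Suc a = 1" "rows i ! a \<ge> 1"
proof -
  show len: "Suc a < length (rows i)"
    using assms by (auto simp: hook_links_def length_rows split: if_splits)
  show "rows i ! Suc a = 1" "rows i ! a \<ge> 1"
    using assms len k by (auto simp: nth_rows hook_links_def split: if_splits)
qed

lemma T_link:
  assumes "a \<in> links i" "i \<le> r"
  obtains A \<rho> B where "T i = A @ replicate (Suc \<rho>) a @ Suc a # B" "a \<notin> set A" "a \<notin> set B"
    "Suc a \<notin> set A" "Suc a \<notin> set B" "row_chain (rows i) a = [Suc (length A)..<Suc (length A) + Suc \<rho>]"
proof
  note l = link_nth[OF assms]
  let ?A = "row_word 0 (take a (rows i))"
  let ?B = "row_word (Suc (Suc a)) (drop (Suc (Suc a)) (rows i))"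
  have \<rho>: "Suc (rows i ! a - 1) = rows i ! a" using l by simp
  show "T i = ?A @ replicate (Suc (rows i ! a - 1)) a @ Suc a # ?B"
    unfolding \<rho> T_def using l by (intro row_word_link) auto
  show "row_chain (rows i) a = [Suc (length ?A)..<Suc (length ?A) + Suc (rows i ! a - 1)]"
    unfolding \<rho> by (simp add: row_chain_def)
qed (simp_all add: notin_row_word)

text \<open>Layer \<open>i\<close> is compared with the hook: the one-node row \<open>i\<close> is
  absorbed into row \<open>i - 1\<close>, everything before is unchanged, and the rows after it are
  renumbered.\<close>

lemma T_split:
  assumes i: "1 \<le> i" "i \<le> r"
  obtains A \<rho> B B' where
    "T 0 = A @ replicate (Suc \<rho>) (i - 1) @ i # B"
    "T i = A @ replicate (Suc (Suc \<rho>)) (i - 1) @ B'"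
    "B = map (shift (i - 1)) B'" "i - 1 \<notin> set A" "i \<notin> set A"
    "\<And>c. c \<in> set B \<Longrightarrow> i < c"
    "row_chain (rows 0) (i - 1) = [Suc (length A)..<Suc (length A) + Suc \<rho>]"
    "row_chain (rows i) (i - 1) = [Suc (length A)..<Suc (length A) + Suc (Suc \<rho>)]"
    "length A + Suc \<rho> = k + i - 1"
proof
  define d where "d = i - 1"
  then have d: "i = Suc d" using i by simp
  let ?A = "row_word 0 (take d (rows 0))"
  let ?B = "row_word (Suc (Suc d)) (drop (Suc (Suc d)) (rows 0))"
  let ?B' = "row_word (Suc d) (drop (Suc d) (rows i))"
  have l: "Suc d < length (rows 0)" "d < length (rows i)" using i d by (auto simp: length_rows)
  have \<rho>: "Suc (rows 0 ! d - 1) = rows 0 ! d" using l k by (auto simp: nth_rows)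
  have \<rho>': "rows i ! d = Suc (rows 0 ! d)" using l d by (auto simp: nth_rows)
  have take: "take d (rows i) = take d (rows 0)"
    using l d by (intro nth_equalityI) (auto simp: nth_rows length_rows)
  have drop: "drop (Suc d) (rows i) = drop (Suc (Suc d)) (rows 0)"
    using l d by (intro nth_equalityI) (auto simp: nth_rows length_rows)
  show "T 0 = ?A @ replicate (Suc (rows 0 ! d - 1)) (i - 1) @ i # ?B"
    unfolding \<rho> T_def using l d by (simp add: row_word_link nth_rows)
  show "T i = ?A @ replicate (Suc (Suc (rows 0 ! d - 1))) (i - 1) @ ?B'"
    unfolding \<rho> \<rho>'[symmetric] T_def using l(2) d row_word_nth_split[of d "rows i"] by (simp add: take[unfolded d])
  show "?B = map (shift (i - 1)) ?B'"
    unfolding drop using d by (simp add: map_shift_row_word)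
  show "i - 1 \<notin> set ?A" "i \<notin> set ?A"
    using d notin_row_word(1)[of d d "rows 0"] notin_row_word(1)[of d "Suc d" "rows 0"] by auto
  show "i < c" if "c \<in> set ?B" for c
    using that set_row_word[of "Suc (Suc d)"] d by force
  show "row_chain (rows 0) (i - 1) = [Suc (length ?A)..<Suc (length ?A) + Suc (rows 0 ! d - 1)]"
    unfolding \<rho> using d by (simp add: row_chain_def)
  show "row_chain (rows i) (i - 1) = [Suc (length ?A)..<Suc (length ?A) + Suc (Suc (rows 0 ! d - 1))]"
    unfolding \<rho> \<rho>'[symmetric] using d take by (simp add: row_chain_def)
  show "length ?A + Suc (rows 0 ! d - 1) = k + i - 1"
    unfolding \<rho> using d l k by (cases d) (auto simp: sum_take nth_rows length_rows)
qed

text \<open>The right-hand side is also the leading word of \<open>generator i\<close>, whose chain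
  carries the letter \<open>i\<close> across row \<open>i - 1\<close>.\<close>

lemma split_T:
  assumes "1 \<le> i" "i \<le> r" "T i = A @ replicate (Suc (Suc \<rho>)) (i - 1) @ B'"
    "B = map (shift (i - 1)) B'" "i - 1 \<notin> set A" "sorted (T i)"
  shows "split_row (i - 1) (T i) = A @ i # replicate (Suc \<rho>) (i - 1) @ B"
proof -
  have "c < i - 1" if "c \<in> set A" for c
    using that assms(3,5,6) by (auto simp: sorted_append le_less)
  then have "map (shift (i - 1)) A = A"
    by (intro map_idI) (simp add: shift_def less_imp_le)
  then show ?thesis
    using assms by (simp add: split_row_append shift_def map_replicate)
qed

lemma mset_split_T:
  assumes "1 \<le> i" "i \<le> r" and U: "mset U = mset (T i)"
  shows "mset (split_row (i - 1) U) = mset (T 0)"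
proof -
  obtain A \<rho> B B' where T: "T 0 = A @ replicate (Suc \<rho>) (i - 1) @ i # B"
    "T i = A @ replicate (Suc (Suc \<rho>)) (i - 1) @ B'" "B = map (shift (i - 1)) B'" "i - 1 \<notin> set A"
    using assms(1,2) by (rule T_split)
  have mem: "i - 1 \<in> set (T i)" using T by simp
  moreover have "i - 1 \<in> set U" using mem U by (metis set_mset_mset)
  ultimately have "mset (split_row (i - 1) U) = mset (split_row (i - 1) (T i))"
    using U by (simp add: mset_split_row)
  also have "\<dots> = mset (A @ i # replicate (Suc \<rho>) (i - 1) @ B)"
    using split_T[OF assms(1,2) T(2-4) sorted_T] by simp
  finally show ?thesis using T(1) by simp
qed

text \<open>In layer \<open>i\<close> the node of row \<open>i\<close> of the hook is placed in
  front of row \<open>i - 1\<close>. This row therefore starts one residue lower, and each later row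
  takes the residues of the hook row below it; the shifted last entry of the charge comes from
  here.\<close>

lemma residues_split:
  assumes "1 \<le> i" "i \<le> r"
  shows "word_residues e (start 0) (split_row (i - 1) U) = word_residues e (start i) U"
  by (rule word_residues_split_row) (use assms in \<open>auto simp: hook_start_def shift_def\<close>)

lemma mset_res: "i \<le> r \<Longrightarrow> mset (res i) = \<alpha>"
proof (cases "i = 0")
  case False
  assume "i \<le> r"
  with False have i: "1 \<le> i" "i \<le> r" by auto
  have "mset (res i) = mset (word_residues e (start 0) (split_row (i - 1) (T i)))"
    by (simp only: residues_split[OF i] res_def)
  also have "\<dots> = \<alpha>"
    unfolding \<alpha>_def res_def by (rule mset_word_residues) (rule mset_split_T[OF i refl])
  finally show ?thesis .
qed (simp add: \<alpha>_def)

lemma size_\<alpha>: "i \<le> r \<Longrightarrow> size \<alpha> = length (T i)"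
  using mset_res[of i] by (metis length_word_residues res_def size_mset)

lemma garnir_carrier: "a \<in> links i \<Longrightarrow> i \<le> r \<Longrightarrow> garnir i a \<in> klr_carrier \<alpha>"
  unfolding garnir_def
proof (rule prod_fpsi_carrier)
  assume "a \<in> links i" "i \<le> r"
  then show "set (row_chain (rows i) a) \<subseteq> {1..<size \<alpha>}"
    by (rule T_link) (auto simp: size_\<alpha>[OF \<open>i \<le> r\<close>])
qed

lemma generator_carrier: "i \<le> r \<Longrightarrow> generator i \<in> klr_carrier \<alpha>"
  using garnir_carrier[of "i - 1" 0] by (cases i) (auto simp: generator_def hook_links_def carrier_1)

lemma perm_relations_carrier: "perm_relations i \<subseteq> klr_carrier \<alpha>"
  unfolding perm_relations_def by (intro Un_least klr_ideal_subset word_relators_carrier)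

lemma layer_module:
  "1 \<le> i \<Longrightarrow> klr_module e \<alpha> (layer_ideal i :: 'k::field klr_free set) (start 0) (T 0)"
  unfolding layer_ideal_def
  using perm_relations_carrier garnir_carrier[of _ 0]
  by (auto simp: perm_relations_def res_def \<alpha>_def hook_links_def sorted_T
    intro!: klr_module_left_span)

lemma specht_module:
  "i \<le> r \<Longrightarrow> klr_module e \<alpha> (specht_ideal i :: 'k::field klr_free set) (start i) (T i)"
  unfolding specht_ideal_def
  using perm_relations_carrier garnir_carrier[of _ i] mset_res[of i]
  by (intro klr_module_left_span) (auto simp: perm_relations_def res_def sorted_T)

lemma garnir_layer: "i \<le> Suc a \<Longrightarrow> a < r \<Longrightarrow> 1 \<le> i \<Longrightarrow> garnir 0 a \<in> layer_ideal i"
  by (auto simp: layer_ideal_def intro!: left_span.base)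

lemma generator_layer: "i \<le> r \<Longrightarrow> generator i \<in> layer_ideal i"
  using garnir_layer[of i "i - 1"] by (cases i) (auto simp: generator_def layer_ideal_def carrier_1)

lemma layer_ideal_mono: "layer_ideal (Suc i) \<subseteq> layer_ideal i"
proof (cases "i = 0")
  case True
  then show ?thesis
    using klr_module.axioms(1)[OF layer_module[of "Suc i"], THEN klr_left_ideal.Z_carrier]
    by (auto simp: layer_ideal_def)
next
  case False
  then show ?thesis
    unfolding layer_ideal_def by simp (intro left_span_mono, auto intro!: left_span.base)
qed

text \<open>Makes M_i / M_{i+1} cyclic: \<open>generator i\<close> is the one generator of layer
  \<open>i\<close> that layer \<open>i + 1\<close> drops.\<close>

lemma layer_ideal_step:
  assumes "i \<le> r" "p \<in> layer_ideal i"
  obtains q h where "q \<in> klr_carrier \<alpha>" "h \<in> layer_ideal (Suc i)" "p = h + q * generator i"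
proof -
  interpret H: klr_module e \<alpha> "layer_ideal (Suc i) :: 'a klr_free set" "start 0" "T 0"
    by (rule layer_module) simp
  have "\<exists>q \<in> klr_carrier \<alpha>. \<exists>h \<in> layer_ideal (Suc i). p = h + q * generator i"
  proof (cases "i = 0")
    case True
    then show ?thesis
      using assms(2) H.Z_0 by (intro bexI[of _ p] bexI[of _ 0]) (auto simp: generator_def layer_ideal_def)
  next
    case False
    then have "p \<in> left_span (klr_carrier \<alpha>) (perm_relations 0 \<union> garnir 0 ` {i - 1..<r})"
      using assms(2) by (simp add: layer_ideal_def)
    then show ?thesis
    proof induction
      case (base p)
      show ?case
      proof (cases "p = generator i")
        case True
        then show ?thesis
          using H.Z_0 by (intro bexI[of _ 1] bexI[of _ 0]) (auto simp: carrier_1)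
      next
        case other: False
        have "p \<in> perm_relations 0 \<union> garnir 0 ` {i..<r}"
        proof (cases "p \<in> perm_relations 0")
          case False
          then obtain a where "a \<in> {i - 1..<r}" "p = garnir 0 a" using base by auto
          moreover from this have "a \<noteq> i - 1" using other \<open>i \<noteq> 0\<close> by (auto simp: generator_def)
          ultimately show ?thesis by auto
        qed simp
        then have "p \<in> layer_ideal (Suc i)"
          by (auto simp: layer_ideal_def intro: left_span.base)
        then show ?thesis
          by (intro bexI[of _ 0] bexI[of _ p]) (auto simp: carrier_0)
      qed
    next
      case zero
      show ?case using H.Z_0 by (intro bexI[of _ 0] bexI[of _ 0]) (auto simp: carrier_0)
    next
      case (add p p')
      then obtain q h q' h' where "q \<in> klr_carrier \<alpha>" "h \<in> layer_ideal (Suc i)" "p = h + q * generator i"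
        "q' \<in> klr_carrier \<alpha>" "h' \<in> layer_ideal (Suc i)" "p' = h' + q' * generator i" by blast
      then show ?case
        using H.Z_add by (intro bexI[of _ "q + q'"] bexI[of _ "h + h'"]) (auto simp: algebra_simps intro: carrier_add)
    next
      case (mult a p)
      then obtain q h where "q \<in> klr_carrier \<alpha>" "h \<in> layer_ideal (Suc i)" "p = h + q * generator i" by blast
      then show ?case
        using H.Z_mult mult(1) by (intro bexI[of _ "a * q"] bexI[of _ "a * h"]) (auto simp: algebra_simps intro: carrier_mult)
    qed
  qed
  then show thesis using that by blast
qed

text \<open>For \<open>i = 0\<close> the Specht ideal is layer 1 by definition. Otherwise crossings
  away from the chain commute with it, those inside the lengthened row and all dots are handled by
  \<open>klr_link\<close>, the Garnir relation of the lengthened row is \<open>chain_chain\<close>,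
  and the remaining Garnir relations are single crossings that already lie in the next
  layer.\<close>

lemma specht_kills_generator:
  assumes i: "i \<le> r" and q: "q \<in> (specht_ideal i :: 'k::field klr_free set)"
  shows "q * generator i \<in> layer_ideal (Suc i)"
proof (cases "i = 0")
  case True
  have "specht_ideal 0 = (layer_ideal (Suc 0) :: 'k klr_free set)"
    by (simp add: specht_ideal_def layer_ideal_def hook_links_def)
  then show ?thesis using q True by (simp add: generator_def)
next
  case False
  with i have i1: "1 \<le> i" "i \<le> r" by auto
  interpret H: klr_module e \<alpha> "layer_ideal (Suc i) :: 'k klr_free set" "start 0" "T 0"
    by (rule layer_module) simp
  obtain A \<rho> B B' where T0: "T 0 = A @ replicate (Suc \<rho>) (i - 1) @ i # B"
    and Ti: "T i = A @ replicate (Suc (Suc \<rho>)) (i - 1) @ B'" and B: "B = map (shift (i - 1)) B'"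
    and A: "i - 1 \<notin> set A" "i \<notin> set A" and iB: "\<And>c. c \<in> set B \<Longrightarrow> i < c"
    and chain: "row_chain (rows 0) (i - 1) = [Suc (length A)..<Suc (length A) + Suc \<rho>]"
    and chain_i: "row_chain (rows i) (i - 1) = [Suc (length A)..<Suc (length A) + Suc (Suc \<rho>)]"
    and len_A: "length A + Suc \<rho> = k + i - 1"
    using i1 by (rule T_split) blast
  define u where "u = Suc (length A)"
  define p where "p = u + Suc \<rho>"
  have n: "size \<alpha> = length A + Suc \<rho> + Suc (length B)"
    using T0 by (simp add: size_\<alpha>[of 0])
  have up: "1 \<le> u" "u < p" "p \<le> size \<alpha>" by (auto simp: u_def p_def n)
  have g: "generator i = H.cross [u..<p] 1"
    using i1 chain by (simp add: generator_def garnir_def foldr_fpsi u_def p_def del: upt_Suc)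
  \<comment> \<open>The residue at the start of row \<open>i - 1\<close>; the one-node rows
    \<open>i\<close> and \<open>i + 1\<close> have residues \<open>?x - 1\<close> and
    \<open>?x - 2\<close>.\<close>
  let ?x = "x - int (i - 1)"
  have res_row: "res 0 ! (u - 1 + b) = (?x + int b) mod int e" if "b < Suc \<rho>" for b
  proof -
    have "res 0 ! (u - 1 + b) = word_residues e (advance (start 0) A) (replicate (Suc \<rho>) (i - 1)) ! b"
      using that by (simp add: res_def T0 word_residues_append u_def nth_append del: replicate_Suc)
    also have "\<dots> = (start 0 (i - 1) + int b) mod int e"
      using that A unfolding word_residues_replicate by (simp add: advance_notin del: upt_Suc)
    finally show ?thesis by (simp add: hook_start_def)
  qed
  have res_p: "res 0 ! (p - 1) = (?x - 1) mod int e"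
    using i1 A word_residues_first[of i "A @ replicate (Suc \<rho>) (i - 1)" e "start 0" B]
    by (simp add: res_def T0 u_def p_def hook_start_def of_nat_diff algebra_simps)
  \<comment> \<open>Row \<open>i\<close> of the hook has one node, so its Garnir element is the
    single crossing \<open>p\<close>. As a member of the next layer it supplies the hypothesis on
    \<open>Psi p v\<close> in \<open>chain_chain\<close>.\<close>
  have next_row: "\<exists>B2. B = Suc i # B2" "garnir 0 i = (fpsi p :: 'k klr_free)" if ir: "i < r"
  proof -
    have i0: "i \<in> links 0" using ir by (simp add: hook_links_def)
    obtain A2 \<rho>2 B2 where T2: "T 0 = A2 @ replicate (Suc \<rho>2) i @ Suc i # B2" "i \<notin> set A2"
      using i0 by (rule T_link) auto
    have "A @ replicate (Suc \<rho>) (i - 1) @ i # B = A2 @ i # replicate \<rho>2 i @ Suc i # B2"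
      using T0 T2(1) by simp
    moreover have "i \<notin> set (A @ replicate (Suc \<rho>) (i - 1))"
      using A i1 by (auto split: if_splits)
    ultimately have B2: "B = replicate \<rho>2 i @ Suc i # B2"
      using T2(2) append_eq_at_first[of "A @ replicate (Suc \<rho>) (i - 1)" i B A2 "replicate \<rho>2 i @ Suc i # B2"]
      by simp
    have "i \<notin> set B" using iB by blast
    then have "\<rho>2 = 0" using B2 by (cases \<rho>2) auto
    then show "\<exists>B2. B = Suc i # B2" using B2 by simp
    have "rows 0 ! i = 1" "sum_list (take i (rows 0)) = k + i - 1"
      using ir i1 by (auto simp: nth_rows length_rows sum_take)
    then have "row_chain (rows 0) i = [p]"
      using len_A k i1 by (simp add: row_chain_def p_def u_def)
    then show "garnir 0 i = (fpsi p :: 'k klr_free)" by (simp add: garnir_def)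
  qed
  have p_size: "p < size \<alpha> \<longleftrightarrow> i < r"
    using len_A k i1 size_\<alpha>[of 0] sum_take[of "Suc r" 0] by (simp add: p_def u_def T_def length_rows)
  have res_p1: "res 0 ! p = (?x - 2) mod int e" if ir: "i < r"
  proof -
    obtain B2 where "B = Suc i # B2" using next_row(1)[OF ir] by blast
    moreover have "Suc i \<notin> set (A @ replicate (Suc \<rho>) (i - 1) @ [i])"
    proof -
      have "c \<le> i" if "c \<in> set (A @ replicate (Suc \<rho>) (i - 1))" for c
        using sorted_T[of 0] that unfolding T0 by (auto simp: sorted_append split: if_splits)
      then show ?thesis by force
    qed
    ultimately show ?thesis
      using word_residues_first[of "Suc i" "A @ replicate (Suc \<rho>) (i - 1) @ [i]" e "start 0" B2] i1
      by (simp add: res_def T0 u_def p_def hook_start_def of_nat_diff algebra_simps)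
  qed
  interpret L: klr_link "\<lambda>c p. scalar c * p" e "size \<alpha>" "klr_carrier \<alpha>" "layer_ideal (Suc i) :: 'k klr_free set"
    H.weight_space "\<lambda>s p. fy s * p" "\<lambda>s p. fpsi s * p" 1 "res 0" u p
  proof (unfold_locales, goal_cases)
    case 4
    show ?case by (simp add: \<alpha>_def)
  next
    case 5
    show ?case using H.one_weight by (simp add: res_def)
  next
    case (6 s)
    then show ?case using H.fy_Z by simp
  next
    case (7 s)
    have "T 0 ! j = i - 1" if "length A \<le> j" "j < length A + Suc \<rho>" for j
      unfolding T0 using that by (rule nth_block(1))
    from this[of "s - 1"] this[of s] have "T 0 ! (s - 1) = i - 1" "T 0 ! s = i - 1"
      using 7 by (auto simp: u_def p_def)
    then show ?case using 7 up H.fpsi_Z[of s] by simp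
  next
    case 8
    show ?case using res_row[of 0] res_p mod_Suc_neq(1)[OF e, of "?x - 1"] by simp
  next
    case 9
    have "?x - 1 + 2 = ?x + 1" by simp
    then have "(?x + 1) mod int e \<noteq> (?x - 1) mod int e"
      using mod_Suc_neq(2)[OF e, of "?x - 1"] by metis
    with 9 show ?case using res_row[of 1] res_p up
      by (simp add: u_def p_def)
  next
    case 10
    show ?case using res_row[of 0] res_p arrow_mod[OF e, of "?x - 1" "?x"] by simp
  qed (use up in auto)
  have commute: "fpsi s * generator i \<in> (layer_ideal (Suc i) :: 'k klr_free set)"
    if "1 \<le> s" "s < size \<alpha>" "Suc s < u \<or> p < s" "fpsi s \<in> (layer_ideal (Suc i) :: 'k klr_free set)" for s
  proof -
    have "H.cross [u..<p] (fpsi s * 1) \<in> layer_ideal (Suc i)"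
      using up that by (intro H.cross_Z) auto
    moreover have "H.cong (H.cross [u..<p] (fpsi s * 1)) (fpsi s * H.cross [u..<p] 1)"
      using up that by (intro H.cross_Psi_commute L.v_C) auto
    ultimately show ?thesis unfolding g using H.cong_mem_iff by blast
  qed
  have p': "h * generator i \<in> layer_ideal (Suc i)" if "h \<in> specht_ideal i" for h :: "'k klr_free"
    using that unfolding specht_ideal_def
  proof induction
    case (base q)
    then consider "q \<in> klr_ideal e \<alpha>"
      | js where "q = fe js - (if js = res i then 1 else 0)" "js \<in> permutations_of_multiset \<alpha>"
      | s where "q = fy s" "1 \<le> s" "s \<le> size \<alpha>"
      | s where "q = fpsi s" "1 \<le> s" "s < size \<alpha>" "T i ! (s - 1) = T i ! s"
      | a where "q = garnir i a" "a \<in> links i"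
      by (auto simp: perm_relations_def word_relators_def)
    then show ?case
    proof cases
      case 1
      then show ?thesis using generator_carrier[OF i] by (rule H.relation)
    next
      case (2 js)
      have "i \<notin> set (replicate (Suc \<rho>) (i - 1))"
        using i1 by (auto split: if_splits)
      then have "word_residues e (start 0) (A @ i # replicate (Suc \<rho>) (i - 1) @ B) =
          foldr swap_places [u..<p] (res 0)"
        using word_residues_chain[of i "replicate (Suc \<rho>) (i - 1)" e "start 0" A B]
        by (simp add: res_def T0 u_def p_def del: upt_Suc)
      moreover have "word_residues e (start 0) (A @ i # replicate (Suc \<rho>) (i - 1) @ B) = res i"
        using residues_split[OF i1, of "T i"] split_T[OF i1 Ti B A(1) sorted_T] by (simp only: res_def)
      ultimately have "generator i \<in> H.weight_space (res i)"
        using L.wt_chain[of u] up by (simp add: g)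
      from H.fe_weight[OF this 2(2)] show ?thesis
        unfolding 2(1) left_diff_distrib by (simp split: if_splits)
    next
      case (3 s)
      then show ?thesis using L.Y_chain[of s] by (simp add: g)
    next
      case (4 s)
      have len_i: "size \<alpha> = length A + Suc (Suc \<rho>) + length B'"
        using Ti by (simp add: size_\<alpha>[OF i])
      \<comment> \<open>In layer \<open>i\<close> the positions \<open>u\<close> to \<open>p\<close>
        form row \<open>i - 1\<close>. The cases \<open>Suc s = u\<close> and \<open>s = p\<close>
        are the ends of this row, where different rows meet and no row relation is imposed.\<close>
      consider "Suc s < u" | "Suc s = u" | "u \<le> s" "s < p" | "s = p" | "p < s" by linarith
      then show ?thesis
      proof cases
        case 1
        then have "T 0 ! (s - 1) = T i ! (s - 1)" "T 0 ! s = T i ! s"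
          by (auto simp: T0 Ti nth_append u_def)
        then have "fpsi s \<in> (layer_ideal (Suc i) :: 'k klr_free set)"
          using 4 by (intro H.fpsi_Z) auto
        then show ?thesis using 1 4 commute by simp
      next
        case 2
        then have "s = length A" "s - 1 < length A" using 4 by (auto simp: u_def)
        then have "T i ! (s - 1) \<in> set A" "T i ! s = i - 1"
          unfolding Ti by (simp add: nth_append del: replicate_Suc, intro nth_block(1), auto)
        then show ?thesis using 4 A by simp
      next
        case 3
        then show ?thesis using L.Psi_chain_row[of s] 4 by (simp add: g)
      next
        case 5: 4
        have "T i ! (s - 1) = i - 1"
          unfolding Ti 5 by (rule nth_block(1)) (auto simp: u_def p_def)
        moreover have "T i ! s = B' ! (s - (length A + Suc (Suc \<rho>)))"
          unfolding Ti 5 by (rule nth_block(2)) (auto simp: u_def p_def)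
        then have "T i ! s \<in> set B'"
          using 4 5 len_i by (auto simp: u_def p_def)
        ultimately have "i - 1 \<in> set B'" using 4 by simp
        then have "shift (i - 1) (i - 1) \<in> set B" using B by simp
        then show ?thesis using iB[of "i - 1"] i1 by (simp add: shift_def)
      next
        case 6: 5
        have "T 0 ! j = shift (i - 1) (T i ! j)" if "p \<le> j" "j < size \<alpha>" for j
        proof -
          have j: "j - (length A + Suc \<rho>) = Suc (j - p)" "j - (length A + Suc (Suc \<rho>)) = j - p"
            "j - p < length B'"
            using that len_i by (auto simp: u_def p_def)
          have "T 0 ! j = (i # B) ! (j - (length A + Suc \<rho>))"
            unfolding T0 by (rule nth_block(2)) (use that in \<open>auto simp: u_def p_def\<close>)
          moreover have "T i ! j = B' ! (j - (length A + Suc (Suc \<rho>)))"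
            unfolding Ti by (rule nth_block(2)) (use that in \<open>auto simp: u_def p_def\<close>)
          ultimately show ?thesis using j B by simp
        qed
        from this[of "s - 1"] this[of s] have "T 0 ! (s - 1) = T 0 ! s" using 4 6 by simp
        then have "fpsi s \<in> (layer_ideal (Suc i) :: 'k klr_free set)"
          using 4 by (intro H.fpsi_Z) auto
        then show ?thesis using 6 4 commute by simp
      qed
    next
      case (5 a)
      then have a: "i - 1 \<le> a" "a < r - 1" using i1 by (auto simp: hook_links_def)
      then have ir: "i < r" by simp
      show ?thesis
      proof (cases "a = i - 1")
        case True
        have "H.cross [u..<Suc p] (H.cross [u..<p] 1) \<in> layer_ideal (Suc i)"
        proof (rule L.chain_chain)
          show "p < size \<alpha>" using ir p_size by simp
          show "fpsi p * 1 \<in> (layer_ideal (Suc i) :: 'k klr_free set)"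
            unfolding mult_1_right next_row(2)[OF ir, symmetric] using ir by (intro garnir_layer) auto
          show "res 0 ! (u - 1) \<noteq> res 0 ! p"
            using res_row[of 0] res_p1[OF ir] mod_Suc_neq(2)[OF e, of "?x - 2"] by simp
        qed
        moreover have "row_chain (rows i) a = [u..<Suc p]"
          using True chain_i by (simp add: u_def p_def)
        ultimately show ?thesis
          by (simp add: 5(1) garnir_def g foldr_fpsi mult.assoc del: upt_Suc)
      next
        case False
        with a have "i \<le> a" by simp
        then have "row_chain (rows i) a = [k + a + 1]" "row_chain (rows 0) (Suc a) = [k + a + 1]"
          using a i1 k by (auto simp: row_chain_def sum_take nth_rows length_rows)
        then have eq: "garnir i a = (fpsi (k + a + 1) :: 'k klr_free)"
            "garnir 0 (Suc a) = (fpsi (k + a + 1) :: 'k klr_free)"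
          by (simp_all add: garnir_def)
        have "fpsi (k + a + 1) \<in> (layer_ideal (Suc i) :: 'k klr_free set)"
          unfolding eq(2)[symmetric] using \<open>i \<le> a\<close> a by (intro garnir_layer) auto
        moreover have "p < k + a + 1" "k + a + 1 < size \<alpha>"
          using \<open>i \<le> a\<close> a len_A k size_\<alpha>[of 0] sum_take[of "Suc r" 0]
          by (auto simp: p_def u_def T_def length_rows)
        ultimately show ?thesis
          using commute[of "k + a + 1"] 5(1) eq by simp
      qed
    qed
  next
    case zero
    show ?case by (simp add: H.Z_0)
  next
    case (add h h')
    then show ?case by (simp add: distrib_right H.Z_add)
  next
    case (mult a h)
    then show ?case by (simp add: mult.assoc H.Z_mult)
  qed
  show ?thesis using q by (rule p')
qed


end

section \<open>Leading words of the layers and linear independence\<close>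

context hook_layers
begin

definition crossing :: "nat list \<Rightarrow> 'k::field klr_free" where
  "crossing U = prod_list (map fpsi (reduced_word U))"

definition lead :: "nat \<Rightarrow> nat list \<Rightarrow> nat list" where
  "lead i U = (if i = 0 then U else split_row (i - 1) U)"

lemma length_T: "i \<le> r \<Longrightarrow> length (T i) = size \<alpha>"
  using size_\<alpha> by simp

lemma crossing_carrier: "i \<le> r \<Longrightarrow> mset U = mset (T i) \<Longrightarrow> crossing U \<in> klr_carrier \<alpha>"
  unfolding crossing_def
  using reduced_word_subset[of U] length_T[of i] mset_eq_length[of U "T i"]
  by (intro prod_fpsi_carrier) simp

lemma finite_standard: "finite (standard i)"
proof (rule finite_subset)
  show "standard i \<subseteq> permutations_of_multiset (mset (T i))"
    by (auto simp: standard_def permutations_of_multiset_def)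
qed simp

lemma T_standard: "i \<le> r \<Longrightarrow> T i \<in> standard i"
  unfolding standard_def
proof (intro CollectI conjI ballI refl)
  fix a assume "a \<in> links i" "i \<le> r"
  then obtain A \<rho> B where "T i = A @ replicate (Suc \<rho>) a @ Suc a # B" "Suc a \<notin> set A"
    by (rule T_link)
  then show "\<not> violates a (T i)"
    using violates_Suc_mem[of a A] by (auto simp: violates_append)
qed

lemma standard_span:
  assumes "i \<le> r" "p \<in> klr_carrier \<alpha>"
  obtains z :: "'k::field klr_free" and c where "z \<in> specht_ideal i"
    "p = z + (\<Sum>U\<in>standard i. scalar (c U) * crossing U)"
proof -
  interpret S: klr_module e \<alpha> "specht_ideal i :: 'k klr_free set" "start i" "T i"
    by (rule specht_module[OF assms(1)])
  have "S.basis U \<in> S.below (inversions U)"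
    if U: "mset U = mset (T i)" "\<not> (\<forall>a \<in> links i. \<not> violates a U)" for U
  proof -
    from U obtain a where a: "a \<in> links i" "violates a U" by blast
    from a(1) assms(1) obtain A \<rho> B where T: "T i = A @ replicate (Suc \<rho>) a @ Suc a # B"
      "a \<notin> set A" "a \<notin> set B" "Suc a \<notin> set A" "Suc a \<notin> set B"
      "row_chain (rows i) a = [Suc (length A)..<Suc (length A) + Suc \<rho>]"
      by (rule T_link)
    have "(garnir i a :: 'k klr_free) \<in> specht_ideal i"
      using a by (auto simp: specht_ideal_def intro: left_span.base)
    then have "S.cross [Suc (length A)..<Suc (length A) + Suc \<rho>] 1 \<in> specht_ideal i"
      by (simp add: garnir_def T(6) foldr_fpsi del: upt_Suc)
    from S.basis_violating[OF T(1-5) this U(1) a(2)] show ?thesis .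
  qed
  then obtain z c where "z \<in> specht_ideal i"
    "p = z + (\<Sum>U | mset U = mset (T i) \<and> (\<forall>a \<in> links i. \<not> violates a U). scalar (c U) * S.basis U)"
    using assms(2) by (rule S.standard_representation)
  then show thesis
    by (intro that[of z c]) (simp_all add: standard_def crossing_def S.basis_eq)
qed

lemma layer_ideal_last:
  "layer_ideal (Suc r) = left_span (klr_carrier \<alpha>) (perm_relations 0)"
  by (simp add: layer_ideal_def)

lemma mset_lead: "i \<le> r \<Longrightarrow> mset U = mset (T i) \<Longrightarrow> mset (lead i U) = mset (T 0)"
  using mset_split_T[of i U] by (auto simp: lead_def)

text \<open>The generator of layer \<open>i\<close> has leading word
  \<open>split_row (i - 1) (T i)\<close>, and \<open>split_row_basis\<close> transports this along
  the reduced word of \<open>U\<close>.\<close>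

lemma lead_crossing:
  fixes i :: nat
  assumes i: "i \<le> r" and U: "mset U = mset (T i)"
  shows "klr_vector.agree (\<lambda>c p. scalar c * p) (layer_ideal (Suc r)) (\<lambda>s p. fpsi s * p) (T 0) (1 :: 'k::field klr_free)
      (inversions (lead i U)) (crossing U * generator i) (crossing (lead i U))"
proof -
  interpret M: klr_module e \<alpha> "layer_ideal (Suc r) :: 'k klr_free set" "start 0" "T 0"
    by (rule layer_module) simp
  show ?thesis
  proof (cases "i = 0")
    case True
    then show ?thesis by (simp add: lead_def generator_def)
  next
    case False
    with i have i1: "1 \<le> i" "i \<le> r" by auto
    obtain A \<rho> B B' where T0: "T 0 = A @ replicate (Suc \<rho>) (i - 1) @ i # B"
      and Ti: "T i = A @ replicate (Suc (Suc \<rho>)) (i - 1) @ B'" and B: "B = map (shift (i - 1)) B'"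
      and A: "i - 1 \<notin> set A"
      and chain: "row_chain (rows 0) (i - 1) = [Suc (length A)..<Suc (length A) + Suc \<rho>]"
      using i1 by (rule T_split) blast
    have g: "generator i = M.cross [Suc (length A)..<Suc (length A) + length (replicate (Suc \<rho>) (i - 1))] 1"
      using i1 chain by (simp add: generator_def garnir_def foldr_fpsi del: upt_Suc)
    have "M.agree (inversions (A @ i # replicate (Suc \<rho>) (i - 1) @ B)) (generator i)
        (M.basis (A @ i # replicate (Suc \<rho>) (i - 1) @ B))"
      unfolding g by (rule M.chain_basis) (use T0 i1 in \<open>auto split: if_splits\<close>)
    then have "M.agree (inversions (split_row (i - 1) (T i))) (generator i)
        (M.basis (split_row (i - 1) (T i)))"
      by (simp only: split_T[OF i1 Ti B A sorted_T])
    from M.split_row_basis[OF sorted_T length_T[OF i] this mset_split_T[OF i1] U]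
    show ?thesis
      using False by (simp add: lead_def crossing_def M.basis_eq foldr_fpsi)
  qed
qed

text \<open>The layer can be read off the leading word: for \<open>i > 0\<close> the largest
  \<open>a < r\<close> at which it is violated is \<open>i - 1\<close>, and for \<open>i = 0\<close>
  there is none. Within a layer \<open>split_row\<close> is injective.\<close>

lemma lead_inj:
  assumes "i \<le> r" "U \<in> standard i" "j \<le> r" "V \<in> standard j" "lead i U = lead j V"
  shows "i = j \<and> U = V"
proof -
  have violate: "violates (i - 1) (lead i U)" if "1 \<le> i" "i \<le> r" "U \<in> standard i" for i U
  proof -
    have "i - 1 \<in> set (T i)"
      using that(1,2) by (rule T_split) simp
    then have "i - 1 \<in> set U" using that(3) by (auto simp: standard_def dest: mset_eq_setD)
    then show ?thesis using that by (simp add: lead_def violates_split_row)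
  qed
  have not_violate: "\<not> violates a (lead i U)" if "i \<le> a" "a < r" "U \<in> standard i" for i a U
  proof (cases "i = 0")
    case True
    then show ?thesis using that by (auto simp: standard_def lead_def hook_links_def)
  next
    case False
    then have "a = Suc (a - 1)" "i - 1 \<le> a - 1" "a - 1 \<in> links i"
      using that by (auto simp: hook_links_def)
    then show ?thesis
      using not_violates_split_row[of "i - 1" "a - 1" U] that False by (auto simp: standard_def lead_def)
  qed
  have "\<not> i < j"
    using violate[of j V] not_violate[of i "j - 1" U] assms by fastforce
  moreover have "\<not> j < i"
    using violate[of i U] not_violate[of j "i - 1" V] assms by fastforce
  ultimately have "i = j" by simp
  with assms(5) show ?thesis by (auto simp: lead_def split_row_inject split: if_splits)
qed

definition combination :: "nat \<Rightarrow> (nat \<Rightarrow> nat list \<Rightarrow> 'k) \<Rightarrow> 'k::field klr_free" where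
  "combination j c = (\<Sum>i\<in>{j..r}. \<Sum>U\<in>standard i. scalar (c i U) * (crossing U * generator i))"

lemma combination_independent:
  assumes comb: "combination j c \<in> (layer_ideal (Suc r) :: 'k::field klr_free set)"
    and i: "j \<le> i" "i \<le> r" and U: "U \<in> standard i"
  shows "c i U = 0"
proof -
  interpret M: klr_module e \<alpha> "layer_ideal (Suc r) :: 'k klr_free set" "start 0" "T 0"
    by (rule layer_module) simp
  let ?Q = "SIGMA i:{j..r}. standard i"
  have "(\<lambda>(i, U). c i U) (i, U) = 0"
  proof (rule M.leading_independent[where Q = ?Q and \<phi> = "\<lambda>(i, U). lead i U"
        and u = "\<lambda>(i, U). crossing U * generator i"])
    show "layer_ideal (Suc r) = left_span (klr_carrier \<alpha>)
        (klr_ideal e \<alpha> \<union> word_relators \<alpha> (word_residues e (start 0) (T 0)) (T 0) :: 'k klr_free set)"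
      by (simp add: layer_ideal_last perm_relations_def res_def)
    show "e = 0 \<or> e > 2" by (rule e)
    show "finite ?Q" by (simp add: finite_standard)
    show "inj_on (\<lambda>(i, U). lead i U) ?Q"
    proof (rule inj_onI)
      fix q q' assume "q \<in> ?Q" "q' \<in> ?Q" "(\<lambda>(i, U). lead i U) q = (\<lambda>(i, U). lead i U) q'"
      then show "q = q'"
        using lead_inj[of "fst q" "snd q" "fst q'" "snd q'"] by (auto simp: split_beta prod_eq_iff)
    qed
    show "mset ((\<lambda>(i, U). lead i U) q) = mset (T 0)" if "q \<in> ?Q" for q
      using that mset_lead[of "fst q" "snd q"] by (cases q) (simp add: standard_def)
    show "(\<lambda>(i, U). crossing U * generator i) q \<in> klr_carrier \<alpha>" if "q \<in> ?Q" for q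
      using that crossing_carrier[of "fst q" "snd q"] generator_carrier[of "fst q"]
      by (auto simp: standard_def intro!: carrier_mult)
    show "M.agree (inversions ((\<lambda>(i, U). lead i U) q)) ((\<lambda>(i, U). crossing U * generator i) q)
        (M.basis ((\<lambda>(i, U). lead i U) q))" if "q \<in> ?Q" for q
      using that lead_crossing by (auto simp: standard_def M.basis_eq crossing_def[symmetric])
    have "(\<Sum>q\<in>?Q. scalar ((\<lambda>(i, U). c i U) q) * (\<lambda>(i, U). crossing U * generator i) q) = combination j c"
      unfolding combination_def by (subst sum.Sigma) (auto simp: finite_standard split_beta)
    with comb show "(\<Sum>q\<in>?Q. scalar ((\<lambda>(i, U). c i U) q) * (\<lambda>(i, U). crossing U * generator i) q)
        \<in> layer_ideal (Suc r)" by simp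
    show "(i, U) \<in> ?Q" using i U by auto
  qed
  then show ?thesis by simp
qed

lemma combination_step:
  "j \<le> r \<Longrightarrow> combination j c =
     (\<Sum>U\<in>standard j. scalar (c j U) * (crossing U * generator j)) + combination (Suc j) c"
  unfolding combination_def by (simp add: sum.atLeast_Suc_atMost)

lemma combination_cong: "(\<And>i U. j \<le> i \<Longrightarrow> c i U = d i U) \<Longrightarrow> combination j c = combination j d"
  unfolding combination_def by (auto intro!: sum.cong)

lemma combination_uminus:
  fixes c :: "nat \<Rightarrow> nat list \<Rightarrow> 'k::field"
  shows "combination j (\<lambda>i U. - c i U) = - combination j c"
proof -
  have "(scalar (- a) :: 'k klr_free) = - scalar a" for a
    by (simp add: scalar_def single_uminus)
  then show ?thesis by (simp add: combination_def sum_negf)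
qed

text \<open>Descending induction on \<open>j\<close>. The factor of \<open>generator j\<close> is
  reduced to standard words modulo \<open>specht_ideal j\<close>, and the error falls into the next
  layer.\<close>

lemma layer_span:
  assumes "1 \<le> j" "j \<le> Suc r" "p \<in> (layer_ideal j :: 'k::field klr_free set)"
  shows "\<exists>z \<in> layer_ideal (Suc r). \<exists>c. p = z + combination j c"
  using assms(2,1,3)
proof (induction arbitrary: p rule: inc_induct)
  case base
  then show ?case
    by (intro bexI[of _ p] exI[of _ "\<lambda>_ _. 0"]) (simp_all add: combination_def)
next
  case (step j)
  interpret H: klr_module e \<alpha> "layer_ideal (Suc j) :: 'k klr_free set" "start 0" "T 0"
    by (rule layer_module) simp
  have j: "j \<le> r" using step by simp
  obtain q h where q: "q \<in> klr_carrier \<alpha>" "h \<in> layer_ideal (Suc j)" "p = h + q * generator j"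
    using layer_ideal_step[OF j step.prems(2)] by blast
  obtain z' c where c: "z' \<in> specht_ideal j" "q = z' + (\<Sum>U\<in>standard j. scalar (c U) * crossing U)"
    using standard_span[OF j q(1)] by blast
  have "h + z' * generator j \<in> layer_ideal (Suc j)"
    using q(2) specht_kills_generator[OF j c(1)] by (rule H.Z_add)
  then obtain z d where d: "z \<in> layer_ideal (Suc r)" "h + z' * generator j = z + combination (Suc j) d"
    using step.IH by (metis le_add1 plus_1_eq_Suc)
  let ?c = "\<lambda>i U. if i = j then c U else d i U"
  have "p = (h + z' * generator j) + (\<Sum>U\<in>standard j. scalar (c U) * (crossing U * generator j))"
    unfolding q(3) c(2) by (simp add: distrib_right sum_distrib_right mult.assoc)
  also have "\<dots> = z + combination j ?c"
    unfolding d(2) combination_step[OF j] using combination_cong[of "Suc j" ?c d] by simp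
  finally show ?case using d(1) by blast
qed

text \<open>Independence modulo the next layer is traded for independence of all layers at once:
  \<open>layer_span\<close> writes the sum, an element of the next layer, in terms of the standard
  words of later layers.\<close>

lemma standard_independent:
  assumes i: "i \<le> r" and U: "U \<in> standard i"
    and sum: "(\<Sum>U\<in>standard i. scalar (c U) * (crossing U * generator i)) \<in> (layer_ideal (Suc i) :: 'k::field klr_free set)"
  shows "c U = 0"
proof -
  obtain z d where z: "z \<in> (layer_ideal (Suc r) :: 'k klr_free set)"
    "(\<Sum>U\<in>standard i. scalar (c U) * (crossing U * generator i)) = z + combination (Suc i) d"
    using layer_span[OF _ _ sum] i by auto
  \<comment> \<open>The later coefficients are negated so that the total combination equals
    \<open>z\<close>, which is zero in the permutation module.\<close>
  let ?c = "\<lambda>j U. if j = i then c U else - d j U"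
  have "combination (Suc i) ?c = - combination (Suc i) d"
    unfolding combination_uminus[symmetric] by (rule combination_cong) simp
  then have "combination i ?c = z"
    using z(2) by (simp add: combination_step[OF i])
  then have "combination i ?c \<in> layer_ideal (Suc r)" using z(1) by simp
  from combination_independent[OF this order_refl i U] show ?thesis by simp
qed

text \<open>Injectivity of the map from the Specht module to the layer. Modulo
  \<open>specht_ideal i\<close> the element \<open>p\<close> is a combination of standard words, and
  independence makes all its coefficients vanish.\<close>

lemma generator_kernel:
  assumes i: "i \<le> r" and p: "p \<in> klr_carrier \<alpha>"
    and g: "p * generator i \<in> (layer_ideal (Suc i) :: 'k::field klr_free set)"
  shows "p \<in> specht_ideal i"
proof -
  interpret H: klr_module e \<alpha> "layer_ideal (Suc i) :: 'k klr_free set" "start 0" "T 0"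
    by (rule layer_module) simp
  obtain z c where c: "z \<in> specht_ideal i" "p = z + (\<Sum>U\<in>standard i. scalar (c U) * crossing U)"
    using standard_span[OF i p] by blast
  have "p * generator i - z * generator i \<in> layer_ideal (Suc i)"
    by (rule H.Z_diff[OF g specht_kills_generator[OF i c(1)]])
  moreover have "p * generator i - z * generator i =
      (\<Sum>U\<in>standard i. scalar (c U) * (crossing U * generator i))"
    unfolding c(2) by (simp add: distrib_right sum_distrib_right mult.assoc)
  ultimately have "(\<Sum>U\<in>standard i. scalar (c U) * (crossing U * generator i)) \<in> layer_ideal (Suc i)"
    by (simp only:)
  then have "c U = 0" if "U \<in> standard i" for U
    by (rule standard_independent[OF i that])
  then show ?thesis using c by simp
qed

lemma generator_not_in_layer:
  assumes i: "i \<le> r"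
  shows "generator i \<notin> (layer_ideal (Suc i) :: 'k::field klr_free set)"
proof
  assume g: "generator i \<in> (layer_ideal (Suc i) :: 'k klr_free set)"
  \<comment> \<open>The sorted word \<open>T i\<close> is standard and its crossing is 1, so the
    generator is itself a combination with a nonzero coefficient.\<close>
  let ?c = "\<lambda>U. if U = T i then 1 else 0 :: 'k"
  have "(\<Sum>U\<in>standard i. scalar (?c U) * (crossing U * generator i)) =
      (\<Sum>U\<in>standard i. if U = T i then crossing U * generator i else 0)"
    by (intro sum.cong) auto
  also have "\<dots> = crossing (T i) * generator i"
    using T_standard[OF i] finite_standard by simp
  also have "\<dots> = generator i"
    by (simp add: crossing_def reduced_word_sorted sorted_T)
  finally have "(\<Sum>U\<in>standard i. scalar (?c U) * (crossing U * generator i)) \<in> layer_ideal (Suc i)"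
    using g by simp
  from standard_independent[OF i T_standard[OF i] this] show False by simp
qed

text \<open>If row \<open>a\<close> lies below another row of its component, the chain that brings
  its node to the front begins with the Garnir chain acting on \<open>v\<close>, so
  \<open>head a\<close> vanishes. Only first rows of components remain, and the exponent counts
  those with the given first residue.\<close>

lemma specht_cyclotomic:
  assumes i: "i \<le> r" and js: "js \<in> permutations_of_multiset \<alpha>" and p: "p \<in> klr_carrier \<alpha>"
  shows "fy 1 ^ card {b. b < length (rows i) \<and> b \<notin> Suc ` links i \<and> start i b mod int e = js ! 0} * fe js * p
    \<in> (specht_ideal i :: 'k::field klr_free set)"
proof -
  interpret S: klr_module e \<alpha> "specht_ideal i :: 'k klr_free set" "start i" "T i"
    by (rule specht_module[OF i])
  let ?F = "{b. b < length (rows i) \<and> b \<notin> Suc ` links i}"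
  have "S.head a \<in> specht_ideal i" if "a \<in> set (T i)" "a \<notin> ?F" for a
  proof -
    have "a < length (rows i)" using that(1) set_row_word[of 0 "rows i"] by (auto simp: T_def)
    with that(2) obtain b where b: "a = Suc b" "b \<in> links i" by blast
    from b(2) i obtain A \<rho> B where T: "T i = A @ replicate (Suc \<rho>) b @ Suc b # B"
      "Suc b \<notin> set A" "row_chain (rows i) b = [Suc (length A)..<Suc (length A) + Suc \<rho>]"
      by (rule T_link)
    have "Suc b \<notin> set (A @ replicate (Suc \<rho>) b)" using T(2) by (auto split: if_splits)
    then have fp: "first_position a (T i) = Suc (length A) + Suc \<rho>"
      using first_position_append[of "Suc b" "A @ replicate (Suc \<rho>) b" B] T(1) b(1) by simp
    have "(garnir i b :: 'k klr_free) \<in> specht_ideal i"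
      using b by (auto simp: specht_ideal_def intro: left_span.base)
    then have "S.cross [Suc (length A)..<Suc (length A) + Suc \<rho>] 1 \<in> specht_ideal i"
      by (simp add: garnir_def T(3) foldr_fpsi del: upt_Suc)
    then have "S.cross [1..<Suc (length A)] (S.cross [Suc (length A)..<Suc (length A) + Suc \<rho>] 1)
        \<in> specht_ideal i"
      using T(1) size_\<alpha>[OF i] by (intro S.cross_Z[of "[1..<Suc (length A)]"]) auto
    then show ?thesis
      unfolding S.head_def fp by (subst S.cross_upt_split[of 1 "Suc (length A)"]) auto
  qed
  moreover have "0 < size \<alpha>"
    using sum_take[of "Suc r" 0] k size_\<alpha>[of 0] by (simp add: T_def length_rows)
  ultimately have "fy 1 ^ card {b \<in> ?F. start i b mod int e = js ! 0} * fe js * p \<in> specht_ideal i"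
    using js p by (intro S.cyclotomic) auto
  then show ?thesis by (simp add: conj_assoc)
qed

end

section \<open>Initial tableaux and Garnir tableaux\<close>

definition component_nodes :: "nat \<Rightarrow> nat list \<Rightarrow> node list" where
  "component_nodes m \<rho> =
     concat (map (\<lambda>a. map (\<lambda>b. (m, a, b)) [1..<Suc (\<rho> ! (a - 1))]) [1..<Suc (length \<rho>)])"

text \<open>The nodes in the order of the initial tableau. Entries, rows and residues become maps
  over this list, which replaces the inverse function in \<open>init_residues\<close>.\<close>

definition nodes :: "mpart \<Rightarrow> node list" where
  "nodes \<mu> = concat (map (\<lambda>m. component_nodes m (\<mu> ! (m - 1))) [1..<Suc (length \<mu>)])"

text \<open>The letter of a node: rows counted from 0 through all components.\<close>

definition row_index :: "mpart \<Rightarrow> node \<Rightarrow> nat" where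
  "row_index \<mu> = (\<lambda>(m, a, b). sum_list (map length (take (m - 1) \<mu>)) + (a - 1))"

lemma component_nodes_snoc:
  "component_nodes m (\<rho> @ [l]) =
     component_nodes m \<rho> @ map (\<lambda>b. (m, Suc (length \<rho>), b)) [1..<Suc l]"
proof -
  have "map (\<lambda>a. map (\<lambda>b. (m, a, b)) [1..<Suc ((\<rho> @ [l]) ! (a - 1))]) [1..<Suc (length \<rho>)] =
      map (\<lambda>a. map (\<lambda>b. (m, a, b)) [1..<Suc (\<rho> ! (a - 1))]) [1..<Suc (length \<rho>)]"
    by (rule map_cong) (auto simp: nth_append)
  then show ?thesis
    by (simp add: component_nodes_def upt_Suc_append nth_append del: upt_Suc map_eq_conv)
qed

lemma nodes_snoc: "nodes (\<mu> @ [\<rho>]) = nodes \<mu> @ component_nodes (Suc (length \<mu>)) \<rho>"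
proof -
  have "map (\<lambda>m. component_nodes m ((\<mu> @ [\<rho>]) ! (m - 1))) [1..<Suc (length \<mu>)] =
      map (\<lambda>m. component_nodes m (\<mu> ! (m - 1))) [1..<Suc (length \<mu>)]"
    by (rule map_cong) (auto simp: nth_append)
  then show ?thesis
    by (simp add: nodes_def upt_Suc_append nth_append del: upt_Suc map_eq_conv)
qed

lemma set_component_nodes:
  "set (component_nodes m \<rho>) = {(m, a, b) | a b. a \<in> {1..length \<rho>} \<and> b \<in> {1..\<rho> ! (a - 1)}}"
  by (auto simp: component_nodes_def image_iff simp del: upt_Suc)

lemma set_nodes: "set (nodes \<mu>) = young \<mu>"
  by (auto simp: nodes_def young_def set_component_nodes simp del: upt_Suc)

lemma component_positions:
  "map (\<lambda>(m, a, b). base + sum_list (take (a - 1) \<rho>) + b) (component_nodes c \<rho>) =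
     [Suc base..<Suc (base + sum_list \<rho>)]"
proof (induction \<rho> rule: rev_induct)
  case (snoc l \<rho>)
  have "map (\<lambda>(m, a, b). base + sum_list (take (a - 1) (\<rho> @ [l])) + b) (component_nodes c \<rho>) =
      map (\<lambda>(m, a, b). base + sum_list (take (a - 1) \<rho>) + b) (component_nodes c \<rho>)"
    by (rule map_cong) (auto simp: set_component_nodes)
  moreover have "map (\<lambda>b. base + sum_list \<rho> + b) [1..<Suc l] =
      [Suc (base + sum_list \<rho>)..<Suc (base + sum_list \<rho> + l)]"
    by (rule nth_equalityI) (auto simp del: upt_Suc)
  moreover have "[Suc base..<Suc (base + sum_list (\<rho> @ [l]))] =
      [Suc base..<Suc (base + sum_list \<rho>)] @ [Suc (base + sum_list \<rho>)..<Suc (base + sum_list \<rho> + l)]"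
    using upt_add_eq_append[of "Suc base" "Suc (base + sum_list \<rho>)" l] by (simp add: ac_simps del: upt_Suc)
  ultimately show ?case
    using snoc by (simp add: component_nodes_snoc comp_def del: upt_Suc map_eq_conv)
qed (simp add: component_nodes_def)

lemma component_rows:
  "map (\<lambda>(m, a, b). base + (a - 1)) (component_nodes c \<rho>) = row_word base \<rho>"
proof (induction \<rho> rule: rev_induct)
  case (snoc l \<rho>)
  then show ?case
    by (simp add: component_nodes_snoc row_word_append comp_def map_replicate_const del: upt_Suc)
qed (simp add: component_nodes_def)

lemma component_residues:
  assumes "\<And>j. j < length \<rho> \<Longrightarrow> \<sigma> (base + j) = \<kappa> - int j"
  shows "map (\<lambda>(m, a, b). (\<kappa> + int b - int a) mod int e) (component_nodes c \<rho>) =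
    word_residues e \<sigma> (row_word base \<rho>)"
  using assms
proof (induction \<rho> rule: rev_induct)
  case (snoc l \<rho>)
  have "base + length \<rho> \<notin> set (row_word base \<rho>)"
    using set_row_word[of base \<rho>] by auto
  then have "word_residues e (advance \<sigma> (row_word base \<rho>)) (replicate l (base + length \<rho>)) =
      map (\<lambda>b. (\<kappa> - int (length \<rho>) + int b) mod int e) [0..<l]"
    using snoc.prems[of "length \<rho>"] by (simp add: word_residues_replicate advance_notin)
  also have "\<dots> = map (\<lambda>b. (\<kappa> + int b - int (Suc (length \<rho>))) mod int e) [1..<Suc l]"
    unfolding One_nat_def map_Suc_upt[symmetric] map_map by (simp add: comp_def algebra_simps)
  finally show ?case
    using snoc by (simp add: component_nodes_snoc row_word_append word_residues_append comp_def del: upt_Suc)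
qed (simp add: component_nodes_def)

lemma init_tableau_nodes: "map (init_tableau \<mu>) (nodes \<mu>) = [1..<Suc (mpart_size \<mu>)]"
proof (induction \<mu> rule: rev_induct)
  case (snoc \<rho> \<mu>)
  have "map (init_tableau (\<mu> @ [\<rho>])) (nodes \<mu>) = map (init_tableau \<mu>) (nodes \<mu>)"
    by (rule map_cong[OF refl]) (auto simp: set_nodes young_def nth_append)
  moreover have "map (init_tableau (\<mu> @ [\<rho>])) (component_nodes (Suc (length \<mu>)) \<rho>) =
      [Suc (mpart_size \<mu>)..<Suc (mpart_size \<mu> + sum_list \<rho>)]"
    unfolding component_positions[where c = "Suc (length \<mu>)", symmetric]
    by (rule map_cong[OF refl]) (auto simp: set_component_nodes)
  moreover have "mpart_size (\<mu> @ [\<rho>]) = mpart_size \<mu> + sum_list \<rho>"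
    by (simp add: mpart_size_def)
  moreover have "[1..<Suc (mpart_size \<mu> + sum_list \<rho>)] =
      [1..<Suc (mpart_size \<mu>)] @ [Suc (mpart_size \<mu>)..<Suc (mpart_size \<mu> + sum_list \<rho>)]"
    using upt_add_eq_append[of 1 "Suc (mpart_size \<mu>)" "sum_list \<rho>"] by (simp del: upt_Suc)
  ultimately show ?case
    using snoc by (simp add: nodes_snoc del: upt_Suc map_eq_conv)
qed (simp add: nodes_def mpart_size_def)

lemma row_index_nodes: "map (row_index \<mu>) (nodes \<mu>) = row_word 0 (concat \<mu>)"
proof (induction \<mu> rule: rev_induct)
  case (snoc \<rho> \<mu>)
  have "map (row_index (\<mu> @ [\<rho>])) (nodes \<mu>) = map (row_index \<mu>) (nodes \<mu>)"
    by (rule map_cong[OF refl]) (auto simp: set_nodes young_def row_index_def)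
  moreover have "map (row_index (\<mu> @ [\<rho>])) (component_nodes (Suc (length \<mu>)) \<rho>) =
      row_word (length (concat \<mu>)) \<rho>"
    unfolding component_rows[where c = "Suc (length \<mu>)", symmetric]
    by (rule map_cong[OF refl]) (auto simp: set_component_nodes row_index_def length_concat)
  ultimately show ?case
    using snoc by (simp add: nodes_snoc row_word_append del: map_eq_conv)
qed (simp add: nodes_def)

lemma residue_nodes:
  assumes "\<And>m j. m < length \<mu> \<Longrightarrow> j < length (\<mu> ! m) \<Longrightarrow>
     \<sigma> (sum_list (map length (take m \<mu>)) + j) = \<kappa> ! m - int j"
  shows "map (residue e \<kappa>) (nodes \<mu>) = word_residues e \<sigma> (row_word 0 (concat \<mu>))"
  using assms
proof (induction \<mu> rule: rev_induct)
  case (snoc \<rho> \<mu>)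
  have "\<sigma> (sum_list (map length (take m \<mu>)) + j) = \<kappa> ! m - int j"
    if "m < length \<mu>" "j < length (\<mu> ! m)" for m j
    using snoc.prems[of m j] that by (simp add: nth_append)
  then have IH: "map (residue e \<kappa>) (nodes \<mu>) = word_residues e \<sigma> (row_word 0 (concat \<mu>))"
    by (rule snoc.IH)
  let ?\<tau> = "advance \<sigma> (row_word 0 (concat \<mu>))"
  have "?\<tau> (length (concat \<mu>) + j) = \<kappa> ! length \<mu> - int j" if "j < length \<rho>" for j
  proof -
    have "length (concat \<mu>) + j \<notin> set (row_word 0 (concat \<mu>))"
      using set_row_word[of 0 "concat \<mu>"] by auto
    then show ?thesis
      using snoc.prems[of "length \<mu>" j] that by (simp add: advance_notin length_concat)
  qed
  from component_residues[of \<rho> ?\<tau> "length (concat \<mu>)" "\<kappa> ! length \<mu>" e "Suc (length \<mu>)", OF this]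
  have "map (\<lambda>(m, a, b). (\<kappa> ! length \<mu> + int b - int a) mod int e) (component_nodes (Suc (length \<mu>)) \<rho>) =
      word_residues e ?\<tau> (row_word (length (concat \<mu>)) \<rho>)" by simp
  moreover have "map (residue e \<kappa>) (component_nodes (Suc (length \<mu>)) \<rho>) =
      map (\<lambda>(m, a, b). (\<kappa> ! length \<mu> + int b - int a) mod int e) (component_nodes (Suc (length \<mu>)) \<rho>)"
    by (rule map_cong[OF refl]) (auto simp: set_component_nodes)
  ultimately show ?case
    using IH by (simp add: nodes_snoc row_word_append word_residues_append)
qed (simp add: nodes_def)

lemma length_nodes: "length (nodes \<mu>) = mpart_size \<mu>"
  using arg_cong[OF init_tableau_nodes[of \<mu>], of length] by simp

lemma distinct_nodes: "distinct (nodes \<mu>)"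
  using init_tableau_nodes[of \<mu>] by (metis distinct_map distinct_upt)

lemma init_tableau_nth: "j < mpart_size \<mu> \<Longrightarrow> init_tableau \<mu> (nodes \<mu> ! j) = Suc j"
  using arg_cong[OF init_tableau_nodes[of \<mu>], of "\<lambda>xs. xs ! j"]
  by (simp add: length_nodes del: upt_Suc)

lemma init_tableau_inj: "inj_on (init_tableau \<mu>) (young \<mu>)"
  using init_tableau_nodes[of \<mu>] set_nodes[of \<mu>] by (metis distinct_map distinct_upt)

lemma young_nodes: "N \<in> young \<mu> \<Longrightarrow> \<exists>j < mpart_size \<mu>. N = nodes \<mu> ! j"
  using set_nodes[of \<mu>] by (metis in_set_conv_nth length_nodes)

lemma init_tableau_range:
  assumes "N \<in> young \<mu>"
  shows "init_tableau \<mu> N \<in> {1..mpart_size \<mu>}" "nodes \<mu> ! (init_tableau \<mu> N - 1) = N"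
  using young_nodes[OF assms] init_tableau_nth by force+

lemma init_residues_nodes: "init_residues e \<kappa> \<mu> = map (residue e \<kappa>) (nodes \<mu>)"
proof (rule nth_equalityI)
  fix j assume "j < length (init_residues e \<kappa> \<mu>)"
  then have j: "j < mpart_size \<mu>" by (simp add: init_residues_def del: upt_Suc)
  have "nodes \<mu> ! j \<in> young \<mu>"
    using j set_nodes[of \<mu>] by (metis length_nodes nth_mem)
  then have "the_inv_into (young \<mu>) (init_tableau \<mu>) (Suc j) = nodes \<mu> ! j"
    using the_inv_into_f_f[OF init_tableau_inj] init_tableau_nth[OF j] by metis
  then show "init_residues e \<kappa> \<mu> ! j = map (residue e \<kappa>) (nodes \<mu>) ! j"
    using j by (simp add: init_residues_def length_nodes del: upt_Suc)
qed (simp add: init_residues_def length_nodes)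

lemma content_nodes: "content e \<kappa> \<mu> = mset (map (residue e \<kappa>) (nodes \<mu>))"
  using mset_set_set[OF distinct_nodes[of \<mu>]] by (simp add: content_def set_nodes)

lemma row_index_eq_iff:
  assumes "(m, a, b) \<in> young \<mu>" "(m', a', b') \<in> young \<mu>"
  shows "row_index \<mu> (m, a, b) = row_index \<mu> (m', a', b') \<longleftrightarrow> m = m' \<and> a = a'"
proof -
  have less: "row_index \<mu> (m, a, b) < row_index \<mu> (m', a', b')"
    if "(m, a, b) \<in> young \<mu>" "(m', a', b') \<in> young \<mu>" "m < m'" for m a b m' a' b'
  proof -
    have m: "m - 1 < length \<mu>" "Suc (m - 1) = m" using that by (auto simp: young_def)
    have "sum_list (map length (take (Suc (m - 1)) \<mu>)) =
        sum_list (map length (take (m - 1) \<mu>)) + length (\<mu> ! (m - 1))"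
      by (simp only: take_Suc_conv_app_nth[OF m(1)]) simp
    then have "row_index \<mu> (m, a, b) < sum_list (map length (take (Suc (m - 1)) \<mu>))"
      using that by (cases a) (auto simp: row_index_def young_def)
    also have "\<dots> \<le> sum_list (map length (take (m' - 1) \<mu>))"
    proof -
      have "take (m' - 1) \<mu> = take m (take (m' - 1) \<mu>) @ drop m (take (m' - 1) \<mu>)" by (rule append_take_drop_id[symmetric])
      also have "take m (take (m' - 1) \<mu>) = take m \<mu>" using that(3) by (cases m') (simp_all add: min_def)
      finally have "sum_list (map length (take (m' - 1) \<mu>)) =
          sum_list (map length (take m \<mu>)) + sum_list (map length (drop m (take (m' - 1) \<mu>)))"
        by (metis map_append sum_list_append)
      then show ?thesis using m by simp
    qed
    also have "\<dots> \<le> row_index \<mu> (m', a', b')" by (simp add: row_index_def)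
    finally show ?thesis .
  qed
  show ?thesis
    using less[OF assms] less[OF assms(2,1)] assms
    by (cases "m = m'"; cases a; cases a') (auto simp: row_index_def young_def neq_iff)
qed

lemma same_row_iff:
  assumes "1 \<le> s" "s < mpart_size \<mu>"
  shows "same_row \<mu> s (s + 1) \<longleftrightarrow> row_word 0 (concat \<mu>) ! (s - 1) = row_word 0 (concat \<mu>) ! s"
proof -
  have s: "s - 1 < mpart_size \<mu>" "Suc (s - 1) = s" using assms by auto
  obtain m a b where N: "nodes \<mu> ! (s - 1) = (m, a, b)" by (metis prod_cases3)
  obtain m' a' b' where N': "nodes \<mu> ! s = (m', a', b')" by (metis prod_cases3)
  have Y: "(m, a, b) \<in> young \<mu>" "(m', a', b') \<in> young \<mu>"
    using N N' s assms set_nodes[of \<mu>] length_nodes[of \<mu>] by (metis nth_mem)+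
  have init: "init_tableau \<mu> (m, a, b) = s" "init_tableau \<mu> (m', a', b') = s + 1"
    using init_tableau_nth[OF s(1)] init_tableau_nth[OF assms(2)] N N' s by simp_all
  have "same_row \<mu> s (s + 1) \<longleftrightarrow> m = m' \<and> a = a'"
  proof
    assume "same_row \<mu> s (s + 1)"
    then obtain c d f g where cd: "(c, d, f) \<in> young \<mu>" "(c, d, g) \<in> young \<mu>"
      "init_tableau \<mu> (c, d, f) = s" "init_tableau \<mu> (c, d, g) = s + 1"
      by (auto simp: same_row_def simp del: init_tableau.simps)
    then have "(c, d, f) = (m, a, b)" "(c, d, g) = (m', a', b')"
      using Y init inj_onD[OF init_tableau_inj] by metis+
    then show "m = m' \<and> a = a'" by simp
  next
    assume "m = m' \<and> a = a'"
    then show "same_row \<mu> s (s + 1)"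
      using Y init unfolding same_row_def by blast
  qed
  also have "\<dots> \<longleftrightarrow> row_index \<mu> (nodes \<mu> ! (s - 1)) = row_index \<mu> (nodes \<mu> ! s)"
    unfolding N N' by (rule row_index_eq_iff[OF Y, symmetric])
  also have "\<dots> \<longleftrightarrow> row_word 0 (concat \<mu>) ! (s - 1) = row_word 0 (concat \<mu>) ! s"
    using s assms unfolding row_index_nodes[symmetric] by (simp add: length_nodes)
  finally show ?thesis .
qed

lemma word_perm_Cons: "word_perm (w # ws) j = transpose w (w + 1) (word_perm ws j)"
  by (simp add: word_perm_def)

lemma word_perm_upt:
  assumes "u \<le> p"
  shows "word_perm [u..<p] j = (if j = p then u else if u \<le> j \<and> j < p then Suc j else j)"
  using assms
proof (induction rule: inc_induct)
  case base
  show ?case by (simp add: word_perm_def)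
next
  case (step u)
  then have "[u..<p] = u # [Suc u..<p]" by (simp add: upt_conv_Cons)
  then show ?case using step by (auto simp: word_perm_Cons transpose_def)
qed

lemma word_perm_length: "p \<le> word_perm ws p + length ws"
proof (induction ws)
  case (Cons w ws)
  have "word_perm ws p \<le> Suc (word_perm (w # ws) p)"
    by (auto simp: word_perm_Cons transpose_def)
  with Cons show ?case by simp
qed (simp add: word_perm_def)

text \<open>Each letter moves a point by at most one step, so a word moving \<open>p\<close> to \<open>u\<close> in \<open>p - u\<close> steps is
  forced.\<close>

lemma word_perm_unique:
  assumes "word_perm ws p = u" "u \<le> p" "length ws \<le> p - u"
  shows "ws = [u..<p]"
  using assms
proof (induction ws arbitrary: u)
  case Nil
  then show ?case by (simp add: word_perm_def)
next
  case (Cons w ws)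
  let ?q = "word_perm ws p"
  have "u < ?q"
    using word_perm_length[of p ws] Cons.prems by simp
  moreover have "transpose w (w + 1) ?q = u" using Cons.prems by (simp add: word_perm_Cons)
  ultimately have q: "?q = Suc u" "w = u"
    by (auto simp: transpose_def split: if_splits)
  have "ws = [Suc u..<p]"
    using Cons.prems q(1) by (intro Cons.IH) auto
  then show ?case using q Cons.prems by (simp add: upt_conv_Cons)
qed

lemma sum_list_concat: "sum_list (concat xss) = (\<Sum>xs\<leftarrow>xss. sum_list xs :: nat)"
  by (induction xss) simp_all

lemma take_concat_row:
  assumes "m < length \<mu>" "a < length (\<mu> ! m)"
  shows "take (sum_list (map length (take m \<mu>)) + a) (concat \<mu>) = concat (take m \<mu>) @ take a (\<mu> ! m)"
    and "concat \<mu> ! (sum_list (map length (take m \<mu>)) + a) = \<mu> ! m ! a"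
proof -
  have "concat \<mu> = concat (take m \<mu>) @ \<mu> ! m @ concat (drop (Suc m) \<mu>)"
    using id_take_nth_drop[OF assms(1)] by (metis concat.simps(2) concat_append)
  then show "take (sum_list (map length (take m \<mu>)) + a) (concat \<mu>) = concat (take m \<mu>) @ take a (\<mu> ! m)"
    "concat \<mu> ! (sum_list (map length (take m \<mu>)) + a) = \<mu> ! m ! a"
    using assms(2) by (simp_all add: length_concat[symmetric] nth_append)
qed

text \<open>For a node in the first column the Garnir permutation moves \<open>p\<close>, the entry
  below, to \<open>u\<close> and pushes the row up by one. The chain has \<open>p - u\<close>
  letters, as few as can move \<open>p\<close> to \<open>u\<close>, and no other word of that length
  does so; hence every reduced choice returns it.\<close>

lemma reduced_garnir:
  assumes red: "reduced_choice (mpart_size \<mu>) red" and A: "(m, a, 1) \<in> garnir_nodes \<mu>"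
  shows "red (tableau_perm \<mu> (garnir_tableau \<mu> (m, a, 1))) = row_chain (concat \<mu>) (row_index \<mu> (m, a, 1))"
proof -
  let ?n = "mpart_size \<mu>" and ?T = "garnir_tableau \<mu> (m, a, 1)"
  define u where "u = init_tableau \<mu> (m, a, 1)"
  define p where "p = init_tableau \<mu> (m, a + 1, 1)"
  have Y: "(m, a, 1) \<in> young \<mu>" "(m, a + 1, 1) \<in> young \<mu>"
    using A by (auto simp: garnir_nodes_def)
  then have ma: "m - 1 < length \<mu>" "a - 1 < length (\<mu> ! (m - 1))" "Suc (a - 1) = a" "1 \<le> a" "1 \<le> m"
    by (auto simp: young_def)
  let ?l = "\<mu> ! (m - 1) ! (a - 1)"
  have p: "p = u + ?l"
    using take_Suc_conv_app_nth[OF ma(2)] ma by (simp add: p_def u_def)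
  have init_row: "init_tableau \<mu> (m, a, c) = u + c - 1" if "1 \<le> c" for c
    using that by (simp add: u_def)
  have range: "1 \<le> u" "p \<le> ?n"
    using init_tableau_range(1)[OF Y(1)] init_tableau_range(1)[OF Y(2)] by (auto simp: u_def p_def)
  define w where "w = word_perm [u..<p]"
  have w: "w j = (if j = p then u else if u \<le> j \<and> j < p then Suc j else j)" for j
    unfolding w_def by (rule word_perm_upt) (simp add: p)
  have w_T: "w (init_tableau \<mu> N) = ?T N" if N: "N \<in> young \<mu>" for N
  proof -
    obtain m' a' c where N': "N = (m', a', c)" by (metis prod_cases3)
    consider "N = (m, a + 1, 1)" | "m' = m" "a' = a" | "N \<notin> garnir_belt \<mu> (m, a, 1)"
      using N' by auto
    then show ?thesis
    proof cases
      case 1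
      then have "?T N = u" by (simp add: u_def)
      moreover have "init_tableau \<mu> N = p" using 1 by (simp add: p_def)
      ultimately show ?thesis by (simp add: w)
    next
      case 2
      then have c: "1 \<le> c" "c \<le> ?l" using N N' by (auto simp: young_def)
      then have "?T N = u + c" using 2 N N' by (simp add: u_def)
      moreover have "init_tableau \<mu> N = u + c - 1" using 2 N' c init_row by simp
      ultimately show ?thesis using c p by (cases c) (auto simp: w)
    next
      case 3
      then have "?T N = init_tableau \<mu> N" using N' by auto
      \<comment> \<open>In the initial tableau the entries \<open>u\<close> to \<open>p\<close> are
        exactly those of the belt: row \<open>a\<close> followed by the first node of row
        \<open>a + 1\<close>.\<close>
      moreover have "init_tableau \<mu> N \<notin> {u..p}"
      proof
        assume j: "init_tableau \<mu> N \<in> {u..p}"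
        show False
        proof (cases "init_tableau \<mu> N = p")
          case True
          then have "N = (m, a + 1, 1)"
            using inj_onD[OF init_tableau_inj _ N Y(2)] by (simp add: p_def)
          then show False using 3 by simp
        next
          case False
          define c where "c = Suc (init_tableau \<mu> N - u)"
          have c: "1 \<le> c" "c \<le> ?l" using j False p by (auto simp: c_def)
          then have "(m, a, c) \<in> young \<mu>" using Y(1) by (auto simp: young_def)
          moreover have "init_tableau \<mu> (m, a, c) = init_tableau \<mu> N"
            using init_row[OF c(1)] j by (simp add: c_def del: init_tableau.simps)
          ultimately have "N = (m, a, c)"
            using inj_onD[OF init_tableau_inj _ N] by metis
          then show False using 3 c \<open>(m, a, c) \<in> young \<mu>\<close> by simp
        qed
      qed
      then have "w (init_tableau \<mu> N) = init_tableau \<mu> N" unfolding w using p by auto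
      ultimately show ?thesis by simp
    qed
  qed
  have ur: "u < p" using Y(1) ma by (auto simp: p young_def)
  have w_perm: "w permutes {1..?n}"
  proof (rule bij_imp_permutes)
    have "inj_on w {1..?n}" using ur by (intro inj_onI) (auto simp: w split: if_splits)
    moreover have "w ` {1..?n} \<subseteq> {1..?n}" using range ur by (auto simp: w)
    ultimately show "bij_betw w {1..?n} {1..?n}"
      by (simp add: bij_betw_def endo_inj_surj)
    show "w j = j" if "j \<notin> {1..?n}" for j using that range ur by (auto simp: w)
  qed
  have "tableau_perm \<mu> ?T = w"
    unfolding tableau_perm_def
  proof (rule the_equality)
    show "w permutes {1..?n} \<and> (\<forall>N\<in>young \<mu>. w (init_tableau \<mu> N) = ?T N)"
      using w_perm w_T by blast
    fix w' assume w': "w' permutes {1..?n} \<and> (\<forall>N\<in>young \<mu>. w' (init_tableau \<mu> N) = ?T N)"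
    show "w' = w"
    proof
      fix j
      show "w' j = w j"
      proof (cases "j \<in> {1..?n}")
        case True
        then have j: "j - 1 < ?n" "Suc (j - 1) = j" by auto
        have "nodes \<mu> ! (j - 1) \<in> young \<mu>"
          using j set_nodes[of \<mu>] by (metis length_nodes nth_mem)
        then show ?thesis
          using w' w_T init_tableau_nth[OF j(1)] j(2) by metis
      next
        case False
        then show ?thesis using w' w_perm by (metis permutes_not_in)
      qed
    qed
  qed
  moreover have "red w = [u..<p]"
  proof (rule word_perm_unique)
    have "reduced_expression ?n w (red w)" using red w_perm by (simp add: reduced_choice_def)
    then have "word_perm (red w) = w"
      and short: "\<And>vs. set vs \<subseteq> {1..<?n} \<Longrightarrow> word_perm vs = w \<Longrightarrow> length (red w) \<le> length vs"
      by (auto simp: reduced_expression_def)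
    then show "word_perm (red w) p = u" by (simp add: w)
    show "u \<le> p" by (simp add: p)
    have "set [u..<p] \<subseteq> {1..<?n}" using range by auto
    from short[OF this w_def[symmetric]] show "length (red w) \<le> p - u" by simp
  qed
  moreover have "row_chain (concat \<mu>) (row_index \<mu> (m, a, 1)) = [u..<p]"
    using take_concat_row[OF ma(1,2)] p ma
    by (simp add: row_chain_def row_index_def u_def mpart_size_def sum_list_concat del: upt_Suc)
  ultimately show ?thesis by simp
qed

section \<open>The shapes of the layers\<close>

lemma length_hook [simp]: "length (hook l s) = Suc s"
  by (simp add: hook_def)

lemma hook_nth: "a \<le> s \<Longrightarrow> hook l s ! a = (if a = 0 then l else 1)"
  by (cases a) (simp_all add: hook_def)

context hook_layers
begin

abbreviation "shape \<equiv> layer_shape k r"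
abbreviation "charge \<equiv> layer_charge x"

lemma length_shape: "length (shape i) = max 1 i" and length_charge: "length (charge i) = max 1 i"
  by (auto simp: layer_shape_def layer_charge_def)

lemma shape_nth:
  "m < max 1 i \<Longrightarrow> shape i ! m =
     (if Suc m < i then hook (if m = 0 then k else 1) 0
      else hook (if i = 0 then k else if i = 1 then k + 1 else 2) (r - i))"
  by (cases m) (auto simp: layer_shape_def nth_append hook_def)

lemma charge_nth: "m < max 1 i \<Longrightarrow> charge i ! m = start i m"
  by (auto simp: layer_charge_def hook_start_def nth_append)

lemma sum_shape: "m < max 1 i \<Longrightarrow> sum_list (map length (take m (shape i))) = m"
proof -
  assume m: "m < max 1 i"
  have "map length (take m (shape i)) = replicate m 1"
    using m by (intro nth_equalityI) (auto simp: length_shape shape_nth)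
  then show ?thesis by (simp add: sum_list_replicate)
qed

lemma concat_shape: "i \<le> r \<Longrightarrow> concat (shape i) = rows i"
proof -
  have "concat (replicate m [1]) = replicate m (1 :: nat)" for m
    by (induction m) auto
  moreover assume "i \<le> r"
  ultimately show ?thesis
    using r by (intro nth_equalityI)
      (auto simp: layer_shape_def length_rows nth_rows hook_def nth_append nth_Cons')
qed

lemma mpart_size_shape: "i \<le> r \<Longrightarrow> mpart_size (shape i) = size \<alpha>"
  using size_\<alpha>[of i] by (simp add: mpart_size_def sum_list_concat[symmetric] concat_shape T_def)

lemma size_eq: "size \<alpha> = k + r"
  using size_\<alpha>[of 0] sum_take[of "Suc r" 0] k by (simp add: T_def length_rows)

lemma residues_shape:
  assumes i: "i \<le> r"
  shows "map (residue e (charge i)) (nodes (shape i)) = res i"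
proof -
  have "start i (sum_list (map length (take m (shape i))) + j) = charge i ! m - int j"
    if "m < length (shape i)" "j < length (shape i ! m)" for m j
    using that by (auto simp: length_shape sum_shape charge_nth shape_nth hook_start_def split: if_splits)
  from residue_nodes[of "shape i" "start i", OF this, of e] show ?thesis
    by (simp add: concat_shape[OF i] res_def T_def)
qed

lemma content_shape: "i \<le> r \<Longrightarrow> content e (charge i) (shape i) = \<alpha>"
  by (simp add: content_nodes residues_shape mset_res)

lemma perm_relators_shape:
  assumes i: "i \<le> r"
  shows "perm_relators e (charge i) (shape i) =
    (klr_class e \<alpha> ` word_relators \<alpha> (res i) (T i) :: 'k::field klr set)"
proof -
  have same: "s \<in> {1..<size \<alpha>} \<and> same_row (shape i) s (s + 1) \<longleftrightarrow>
      s \<in> {1..<size \<alpha>} \<and> T i ! (s - 1) = T i ! s" for s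
    using same_row_iff[of s "shape i"] by (auto simp add: mpart_size_shape[OF i] concat_shape[OF i] T_def)
  show ?thesis
    unfolding perm_relators_def Let_def content_shape[OF i] init_residues_nodes residues_shape[OF i]
      word_relators_def image_Un same by (intro arg_cong2[where f = "(\<union>)"]) blast+
qed

lemma garnir_nodes_shape:
  "i \<le> r \<Longrightarrow> garnir_nodes (shape i) = (\<lambda>a. (max 1 i, a, 1)) ` {1..<Suc (r - i)}"
  using k by (auto simp: garnir_nodes_def young_def length_shape shape_nth hook_nth image_iff
      split: if_splits)

lemma row_index_garnir: "row_index (shape i) (max 1 i, a, 1) = max 1 i - 1 + (a - 1)"
  by (simp add: row_index_def sum_shape)

lemma garnir_shape:
  assumes red: "reduced_choice (k + r) red" and i: "i \<le> r" and a: "a \<in> {1..<Suc (r - i)}"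
  shows "fpsi_perm red (tableau_perm (shape i) (garnir_tableau (shape i) (max 1 i, a, 1))) =
    (garnir i (max 1 i - 1 + (a - 1)) :: 'k::field klr_free)"
proof -
  have "(max 1 i, a, 1) \<in> garnir_nodes (shape i)" using a by (simp add: garnir_nodes_shape[OF i])
  from reduced_garnir[OF _ this, of red] red show ?thesis
    unfolding mpart_size_shape[OF i] size_eq fpsi_perm_def garnir_def concat_shape[OF i] row_index_garnir
    by simp
qed

lemma garnir_links:
  assumes "i \<le> r"
  shows "(\<lambda>a. max 1 i - 1 + (a - 1)) ` {1..<Suc (r - i)} = links i"
proof (intro equalityI subsetI)
  fix c assume "c \<in> links i"
  then show "c \<in> (\<lambda>a. max 1 i - 1 + (a - 1)) ` {1..<Suc (r - i)}"
    using assms by (intro image_eqI[of _ _ "c + 2 - max 1 i"]) (auto simp: hook_links_def max_def split: if_splits)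
qed (use assms in \<open>auto simp: hook_links_def max_def split: if_splits\<close>)

text \<open>All components but the last have a single row, so the rows that start a component are
  the first \<open>max 1 i\<close> ones, and they start at the entries of the charge.\<close>

lemma charge_weight_shape:
  assumes "i \<le> r"
  shows "charge_weight e (charge i) c =
    card {b. b < length (rows i) \<and> b \<notin> Suc ` links i \<and> start i b mod int e = c}"
proof -
  have "b < length (rows i) \<and> b \<notin> Suc ` links i \<longleftrightarrow> b < max 1 i" for b
    using assms r by (cases b) (auto simp: length_rows hook_links_def image_iff)
  then have "{b. b < length (rows i) \<and> b \<notin> Suc ` links i \<and> start i b mod int e = c} =
      {b. b < max 1 i \<and> charge i ! b mod int e = c}"
    using charge_nth[of _ i] by (intro Collect_cong) (metis (no_types))
  then have "Suc ` {b. b < length (rows i) \<and> b \<notin> Suc ` links i \<and> start i b mod int e = c} =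
      Suc ` {b. b < max 1 i \<and> charge i ! b mod int e = c}"
    by simp
  also have "\<dots> = {m \<in> {1..length (charge i)}. charge i ! (m - 1) mod int e = c}"
  proof (intro equalityI subsetI)
    fix m assume "m \<in> {m \<in> {1..length (charge i)}. charge i ! (m - 1) mod int e = c}"
    then show "m \<in> Suc ` {b. b < max 1 i \<and> charge i ! b mod int e = c}"
      by (intro image_eqI[of _ _ "m - 1"]) (auto simp: length_charge)
  qed (auto simp: length_charge)
  finally have "card (Suc ` {b. b < length (rows i) \<and> b \<notin> Suc ` links i \<and> start i b mod int e = c}) =
      charge_weight e (charge i) c"
    unfolding charge_weight_def by (rule arg_cong)
  then show ?thesis by (simp only: card_image inj_Suc)
qed

end

section \<open>Modules presented by left ideals of the free algebra\<close>

lemma klr_class_hom: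
  fixes p q :: "'k::field klr_free"
  assumes "p \<in> klr_carrier \<alpha>"
  shows "klr_class e \<alpha> p \<in> carrier (klr_algebra e \<alpha>)"
    and "q \<in> klr_carrier \<alpha> \<Longrightarrow>
      klr_class e \<alpha> (p * q) = klr_class e \<alpha> p \<otimes>\<^bsub>klr_algebra e \<alpha>\<^esub> klr_class e \<alpha> q"
    and "q \<in> klr_carrier \<alpha> \<Longrightarrow>
      klr_class e \<alpha> (p + q) = klr_class e \<alpha> p \<oplus>\<^bsub>klr_algebra e \<alpha>\<^esub> klr_class e \<alpha> q"
  using ring_hom_closed[OF ideal.rcos_ring_hom[OF klr_ideal_ideal], of p \<alpha> e]
    ring_hom_mult[OF ideal.rcos_ring_hom[OF klr_ideal_ideal], of p \<alpha> q e]
    ring_hom_add[OF ideal.rcos_ring_hom[OF klr_ideal_ideal], of p \<alpha> q e] assms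
  by (simp_all add: klr_class_def klr_algebra_def klr_carrier_def free_algebra_def)

lemma klr_class_one: "klr_class e \<alpha> 1 = \<one>\<^bsub>klr_algebra e \<alpha>\<^esub>"
  using ring_hom_one[OF ideal.rcos_ring_hom[OF klr_ideal_ideal], of \<alpha> e]
  by (simp add: klr_class_def klr_algebra_def free_algebra_def)

lemma carrier_klr_algebra:
  "carrier (klr_algebra e \<alpha>) = klr_class e \<alpha> ` (klr_carrier \<alpha> :: 'k::field klr_free set)"
  by (auto simp: klr_algebra_def FactRing_def A_RCOSETS_def' klr_class_def klr_carrier_def)

lemma klr_class_zero_iff:
  fixes p :: "'k::field klr_free"
  assumes "p \<in> klr_carrier \<alpha>"
  shows "klr_class e \<alpha> p = \<zero>\<^bsub>klr_algebra e \<alpha>\<^esub> \<longleftrightarrow> p \<in> klr_ideal e \<alpha>"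
proof -
  interpret ideal "klr_ideal e \<alpha>" "free_algebra (klr_letters \<alpha>) :: 'k klr_free ring"
    by (rule klr_ideal_ideal)
  show ?thesis
    using assms a_coset_join1[OF _ _ a_subgroup, of p] a_coset_join2[OF _ a_subgroup, of p]
    by (auto simp: klr_class_def klr_algebra_def FactRing_def klr_carrier_def)
qed

lemma left_module_restrict:
  assumes "left_module R M" "submodule H R M"
  shows "left_module R (restrict_module M H)"
proof -
  interpret left_module R M by fact
  interpret H: submodule H R M by fact
  have H: "x \<in> carrier M" if "x \<in> H" for x using that H.subset by auto
  have sum: "x \<oplus>\<^bsub>M\<^esub> y \<in> H" if "x \<in> H" "y \<in> H" for x y using that H.m_closed by simp
  have "abelian_group (restrict_module M H)"
  proof (rule abelian_groupI)
    fix x assume "x \<in> carrier (restrict_module M H)"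
    then have x: "x \<in> H" by (simp add: restrict_module_def)
    then have "\<ominus>\<^bsub>M\<^esub> x \<in> H" using H.m_inv_closed[of x] by (simp add: a_inv_def)
    then show "\<exists>y \<in> carrier (restrict_module M H).
        y \<oplus>\<^bsub>restrict_module M H\<^esub> x = \<zero>\<^bsub>restrict_module M H\<^esub>"
      using H[OF x] by (intro bexI[of _ "\<ominus>\<^bsub>M\<^esub> x"]) (simp_all add: restrict_module_def M.l_neg)
  qed (use H.one_closed in \<open>auto simp: restrict_module_def sum H M.a_ac\<close>)
  then show ?thesis
    by (intro left_module.intro left_module_axioms.intro R.ring_axioms)
      (auto simp: restrict_module_def H smult_l_distr smult_r_distr smult_assoc smult_one)
qed

lemma submodule_restrict:
  assumes "left_module R M" "submodule H R M" "submodule N R M" "N \<subseteq> H"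
  shows "submodule N R (restrict_module M H)"
proof -
  interpret left_module R M by fact
  have "subgroup N (add_monoid M\<lparr>carrier := H\<rparr>)"
    using assms by (intro group.subgroup_incl M.a_group submodule.axioms(1))
  then show ?thesis
    using submodule.smult_closed[OF assms(3)]
    by (intro submodule.intro submodule_axioms.intro) (auto simp: restrict_module_def)
qed

locale klr_map = left_module "klr_algebra e \<alpha>" X
  for e :: nat and \<alpha> :: "int multiset" and X :: "('k::field klr, 'm) module" +
  fixes f :: "'k klr_free \<Rightarrow> 'm"
  assumes map_closed: "p \<in> klr_carrier \<alpha> \<Longrightarrow> f p \<in> carrier X"
    and map_add: "p \<in> klr_carrier \<alpha> \<Longrightarrow> q \<in> klr_carrier \<alpha> \<Longrightarrow> f (p + q) = f p \<oplus>\<^bsub>X\<^esub> f q"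
    and map_mult: "p \<in> klr_carrier \<alpha> \<Longrightarrow> q \<in> klr_carrier \<alpha> \<Longrightarrow>
      f (p * q) = klr_class e \<alpha> p \<odot>\<^bsub>X\<^esub> f q"
begin

lemma map_zero: "f 0 = \<zero>\<^bsub>X\<^esub>"
  using map_add[of 0 0] map_closed[of 0] carrier_0 by (metis M.add.l_cancel_one add_0)

lemma map_uminus:
  assumes "p \<in> klr_carrier \<alpha>"
  shows "f (- p) = \<ominus>\<^bsub>X\<^esub> f p"
  using assms map_add[of "- p" p] map_closed[of p] map_closed[of "- p"] carrier_uminus[of p \<alpha>] map_zero
  by (metis M.minus_equality add.left_inverse)

lemma map_diff_eq:
  assumes "p \<in> klr_carrier \<alpha>" "q \<in> klr_carrier \<alpha>"
  shows "f p = f q \<longleftrightarrow> f (p - q) = \<zero>\<^bsub>X\<^esub>"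
proof -
  have "f p = f (p - q) \<oplus>\<^bsub>X\<^esub> f q"
    using map_add[OF carrier_diff[OF assms] assms(2)] by simp
  then show ?thesis
    using map_closed assms carrier_diff by (metis M.add.r_cancel_one')
qed

text \<open>Multiplication by \<open>g\<close> on the right replaces the distinguished element by
  its image under \<open>g\<close>.\<close>

lemma klr_map_shift:
  assumes "g \<in> klr_carrier \<alpha>"
  shows "klr_map e \<alpha> X (\<lambda>p. f (p * g))"
  by (intro klr_map.intro klr_map_axioms.intro left_module_axioms)
    (simp_all add: assms carrier_mult map_closed map_add map_mult distrib_right mult.assoc smult_closed klr_class_hom(1))

lemma klr_map_restrict:
  assumes "submodule H (klr_algebra e \<alpha>) X" "\<And>p. p \<in> klr_carrier \<alpha> \<Longrightarrow> f p \<in> H"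
  shows "klr_map e \<alpha> (restrict_module X H) f"
  using assms left_module_restrict[OF left_module_axioms assms(1)]
  by (intro klr_map.intro klr_map_axioms.intro) (simp_all add: restrict_module_def map_add map_mult)

end

text \<open>A cyclic module seen from the free algebra: \<open>f p\<close> is \<open>p\<close>
  applied to a generator and \<open>K\<close> is the annihilator of that generator. Modules with the
  same \<open>K\<close> are isomorphic, so the layers and the Specht modules can be compared by
  their left ideals.\<close>

locale klr_presentation = klr_map e \<alpha> X f
  for e :: nat and \<alpha> :: "int multiset" and X :: "('k::field klr, 'm) module" and f +
  fixes K :: "'k klr_free set"
  assumes map_surj: "x \<in> carrier X \<Longrightarrow> x \<in> f ` klr_carrier \<alpha>"
    and map_kernel: "{p \<in> klr_carrier \<alpha>. f p = \<zero>\<^bsub>X\<^esub>} = K"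
begin

lemma carrier_eq: "carrier X = f ` klr_carrier \<alpha>"
  using map_surj map_closed by blast

lemma map_eq_iff:
  "p \<in> klr_carrier \<alpha> \<Longrightarrow> q \<in> klr_carrier \<alpha> \<Longrightarrow> f p = f q \<longleftrightarrow> p - q \<in> K"
  using map_diff_eq[of p q] carrier_diff[of p \<alpha> q] by (auto simp flip: map_kernel)

lemma submodule_image:
  assumes "klr_left_ideal e \<alpha> L"
  shows "submodule (f ` L) (klr_algebra e \<alpha>) X"
proof -
  interpret L: klr_left_ideal e \<alpha> L by fact
  have L: "p \<in> klr_carrier \<alpha>" if "p \<in> L" for p using that L.Z_carrier by blast
  have "subgroup (f ` L) (add_monoid X)"
  proof (rule group.subgroupI[OF M.a_group])
    show "f ` L \<subseteq> carrier (add_monoid X)" using L map_closed by auto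
    show "f ` L \<noteq> {}" using L.Z_0 by auto
    fix x assume "x \<in> f ` L"
    then obtain p where p: "p \<in> L" "x = f p" by blast
    have "inv\<^bsub>add_monoid X\<^esub> x = f (- p)"
      using map_uminus[OF L[OF p(1)]] p(2) by (simp add: a_inv_def)
    then show "inv\<^bsub>add_monoid X\<^esub> x \<in> f ` L" using L.Z_uminus[OF p(1)] by simp
    fix y assume "y \<in> f ` L"
    then obtain q where "q \<in> L" "y = f q" by blast
    then have "x \<oplus>\<^bsub>X\<^esub> y = f (p + q)" "p + q \<in> L" using p L map_add L.Z_add by auto
    then show "x \<otimes>\<^bsub>add_monoid X\<^esub> y \<in> f ` L" by simp
  qed
  moreover have "a \<odot>\<^bsub>X\<^esub> x \<in> f ` L" if ax: "a \<in> carrier (klr_algebra e \<alpha>)" "x \<in> f ` L" for a x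
  proof -
    obtain p q where pq: "p \<in> klr_carrier \<alpha>" "a = klr_class e \<alpha> p" "q \<in> L" "x = f q"
      using ax unfolding carrier_klr_algebra by blast
    then have "a \<odot>\<^bsub>X\<^esub> x = f (p * q)" using L map_mult by simp
    then show ?thesis using L.Z_mult pq by blast
  qed
  ultimately show ?thesis by (intro submodule.intro submodule_axioms.intro)
qed

text \<open>A left ideal containing the kernel is determined by its image. Strictness of the
  filtration and membership in a layer can therefore be decided in the free algebra.\<close>

lemma image_mem_iff:
  assumes "klr_left_ideal e \<alpha> L" "K \<subseteq> L" "p \<in> klr_carrier \<alpha>"
  shows "f p \<in> f ` L \<longleftrightarrow> p \<in> L"
proof
  interpret L: klr_left_ideal e \<alpha> L by fact
  assume "f p \<in> f ` L"
  then obtain q where q: "q \<in> L" "f p = f q" by blast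
  then have "p - q \<in> L" using assms map_eq_iff L.Z_carrier by blast
  from L.Z_add[OF this q(1)] show "p \<in> L" by simp
qed simp

lemma klr_ideal_kernel: "klr_ideal e \<alpha> \<subseteq> K"
proof
  fix p :: "'k klr_free" assume p: "p \<in> klr_ideal e \<alpha>"
  then have C: "p \<in> klr_carrier \<alpha>" using klr_ideal_subset by blast
  then have "f p = klr_class e \<alpha> p \<odot>\<^bsub>X\<^esub> f 1" using map_mult[OF C carrier_1] by simp
  moreover have "klr_class e \<alpha> p = klr_class e \<alpha> 0"
  proof -
    have "(0 :: 'k klr_free) \<in> klr_ideal e \<alpha>"
      using klr_ideal_left[OF p carrier_0] by simp
    then have "klr_class e \<alpha> (0 :: 'k klr_free) = \<zero>\<^bsub>klr_algebra e \<alpha>\<^esub>"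
      by (simp add: klr_class_zero_iff carrier_0)
    then show ?thesis using klr_class_zero_iff[OF C, of e] p by simp
  qed
  moreover have "klr_class e \<alpha> 0 \<odot>\<^bsub>X\<^esub> f 1 = \<zero>\<^bsub>X\<^esub>"
    using map_mult[OF carrier_0 carrier_1] map_zero by simp
  ultimately show "p \<in> K" using C by (auto simp flip: map_kernel)
qed

lemma left_ideal_span:
  assumes "S \<subseteq> klr_carrier \<alpha>"
  shows "klr_left_ideal e \<alpha> (left_span (klr_carrier \<alpha>) (K \<union> S))"
  using assms klr_ideal_kernel map_kernel by (intro klr_left_ideal_left_span) (auto intro: left_span.base)

lemma gen_submodule_image:
  assumes S: "S \<subseteq> klr_carrier \<alpha>"
  shows "gen_submodule (klr_algebra e \<alpha>) X (f ` S) = f ` left_span (klr_carrier \<alpha>) (K \<union> S)"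
proof
  have "f ` S \<subseteq> f ` left_span (klr_carrier \<alpha>) (K \<union> S)" by (auto intro: left_span.base)
  then show "gen_submodule (klr_algebra e \<alpha>) X (f ` S) \<subseteq> f ` left_span (klr_carrier \<alpha>) (K \<union> S)"
    unfolding gen_submodule_def using submodule_image[OF left_ideal_span[OF S]] by blast
  have "f p \<in> H" if H: "submodule H (klr_algebra e \<alpha>) X" "f ` S \<subseteq> H"
    and p: "p \<in> left_span (klr_carrier \<alpha>) (K \<union> S)" for p H
  proof -
    interpret H: submodule H "klr_algebra e \<alpha>" X by (rule H(1))
    have C: "K \<union> S \<subseteq> klr_carrier \<alpha>" using S map_kernel by auto
    have "\<zero>\<^bsub>X\<^esub> \<in> H" using H.one_closed by simp
    have "p \<in> klr_carrier \<alpha> \<and> f p \<in> H"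
      using p
    proof induction
      case (base p)
      then show ?case using C H(2) \<open>\<zero>\<^bsub>X\<^esub> \<in> H\<close> by (auto simp flip: map_kernel)
    next
      case zero
      show ?case using \<open>\<zero>\<^bsub>X\<^esub> \<in> H\<close> map_zero carrier_0 by simp
    next
      case (add p q)
      then show ?case using H.m_closed[of "f p" "f q"] by (simp add: map_add carrier_add)
    next
      case (mult a p)
      then show ?case
        using H.smult_closed[of "klr_class e \<alpha> a" "f p"] klr_class_hom(1)[of a \<alpha> e]
        by (simp add: map_mult carrier_mult)
    qed
    then show ?thesis by simp
  qed
  then show "f ` left_span (klr_carrier \<alpha>) (K \<union> S) \<subseteq> gen_submodule (klr_algebra e \<alpha>) X (f ` S)"
    unfolding gen_submodule_def by blast
qed

end

text \<open>The map \<open>f\<close> has to reach \<open>X\<close> only modulo \<open>N\<close>.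
  This is the situation of a layer, which a single Garnir element generates only together with the
  next layer.\<close>

lemma (in klr_map) presentation_quotient:
  assumes N: "submodule N (klr_algebra e \<alpha>) X"
    and gen: "\<And>x. x \<in> carrier X \<Longrightarrow> \<exists>n \<in> N. \<exists>p \<in> klr_carrier \<alpha>. x = n \<oplus>\<^bsub>X\<^esub> f p"
  shows "klr_presentation e \<alpha> (quot_module X N) (\<lambda>p. N +>\<^bsub>X\<^esub> f p) {p \<in> klr_carrier \<alpha>. f p \<in> N}"
proof -
  interpret N: submodule N "klr_algebra e \<alpha>" X by (rule N)
  interpret S: abelian_subgroup N X
    by (rule abelian_subgroupI3)
      (auto simp: additive_subgroup_def N.subgroup_axioms M.abelian_group_axioms)
  have absorb: "N +>\<^bsub>X\<^esub> y = N +>\<^bsub>X\<^esub> x" if "y \<in> N +>\<^bsub>X\<^esub> x" "x \<in> carrier X" for x y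
    using S.a_repr_independence'[OF that] by simp
  have act: "(\<Union>y \<in> N +>\<^bsub>X\<^esub> x. N +>\<^bsub>X\<^esub> (a \<odot>\<^bsub>X\<^esub> y)) = N +>\<^bsub>X\<^esub> (a \<odot>\<^bsub>X\<^esub> x)"
    if a: "a \<in> carrier (klr_algebra e \<alpha>)" and x: "x \<in> carrier X" for a x
  proof -
    have "N +>\<^bsub>X\<^esub> (a \<odot>\<^bsub>X\<^esub> y) = N +>\<^bsub>X\<^esub> (a \<odot>\<^bsub>X\<^esub> x)" if y: "y \<in> N +>\<^bsub>X\<^esub> x" for y
    proof (rule absorb)
      from y obtain h where h: "h \<in> N" "y = h \<oplus>\<^bsub>X\<^esub> x" by (auto simp: a_r_coset_def')
      then have "a \<odot>\<^bsub>X\<^esub> y = a \<odot>\<^bsub>X\<^esub> h \<oplus>\<^bsub>X\<^esub> a \<odot>\<^bsub>X\<^esub> x"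
        using a x S.a_Hcarr by (simp add: smult_r_distr)
      then show "a \<odot>\<^bsub>X\<^esub> y \<in> N +>\<^bsub>X\<^esub> (a \<odot>\<^bsub>X\<^esub> x)"
        using N.smult_closed[OF a h(1)] by (auto simp: a_r_coset_def')
    qed (rule smult_closed[OF a x])
    then show ?thesis using S.a_rcos_self[OF x] by blast
  qed
  show ?thesis
  proof (intro klr_presentation.intro klr_map.intro klr_map_axioms.intro klr_presentation_axioms.intro)
    show "left_module (klr_algebra e \<alpha>) (quot_module X N)"
      by (rule quot_left_module[OF left_module_axioms N])
    fix p q :: "'k klr_free"
    assume p: "p \<in> klr_carrier \<alpha>"
    then show "N +>\<^bsub>X\<^esub> f p \<in> carrier (quot_module X N)"
      using map_closed by (auto simp: quot_module_def A_RCOSETS_def')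
    assume q: "q \<in> klr_carrier \<alpha>"
    show "N +>\<^bsub>X\<^esub> f (p + q) = (N +>\<^bsub>X\<^esub> f p) \<oplus>\<^bsub>quot_module X N\<^esub> (N +>\<^bsub>X\<^esub> f q)"
      using S.a_rcos_sum[OF map_closed[OF p] map_closed[OF q]] p q by (simp add: quot_module_def map_add)
    show "N +>\<^bsub>X\<^esub> f (p * q) = klr_class e \<alpha> p \<odot>\<^bsub>quot_module X N\<^esub> (N +>\<^bsub>X\<^esub> f q)"
      using act[OF klr_class_hom(1)[OF p] map_closed[OF q]] p q by (simp add: quot_module_def map_mult)
  next
    fix Y assume "Y \<in> carrier (quot_module X N)"
    then obtain x where x: "x \<in> carrier X" "Y = N +>\<^bsub>X\<^esub> x"
      by (auto simp: quot_module_def A_RCOSETS_def')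
    obtain n p where np: "n \<in> N" "p \<in> klr_carrier \<alpha>" "x = n \<oplus>\<^bsub>X\<^esub> f p" using gen[OF x(1)] by blast
    then have "x \<in> N +>\<^bsub>X\<^esub> f p" by (auto simp: a_r_coset_def')
    from absorb[OF this map_closed[OF np(2)]] x np
    show "Y \<in> (\<lambda>p. N +>\<^bsub>X\<^esub> f p) ` klr_carrier \<alpha>" by blast
  next
    show "{p \<in> klr_carrier \<alpha>. N +>\<^bsub>X\<^esub> f p = \<zero>\<^bsub>quot_module X N\<^esub>} = {p \<in> klr_carrier \<alpha>. f p \<in> N}"
      using M.a_coset_join1[OF _ map_closed N.subgroup_axioms] M.a_coset_join2[OF map_closed N.subgroup_axioms]
      by (auto simp: quot_module_def)
  qed
qed

lemma (in klr_presentation) presentation_gen_submodule: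
  assumes S: "S \<subseteq> klr_carrier \<alpha>"
  shows "klr_presentation e \<alpha> (quot_module X (gen_submodule (klr_algebra e \<alpha>) X (f ` S)))
    (\<lambda>p. gen_submodule (klr_algebra e \<alpha>) X (f ` S) +>\<^bsub>X\<^esub> f p) (left_span (klr_carrier \<alpha>) (K \<union> S))"
proof -
  let ?N = "gen_submodule (klr_algebra e \<alpha>) X (f ` S)" and ?L = "left_span (klr_carrier \<alpha>) (K \<union> S)"
  note L = left_ideal_span[OF S]
  have N: "submodule ?N (klr_algebra e \<alpha>) X"
    unfolding gen_submodule_image[OF S] by (rule submodule_image[OF L])
  have "\<exists>n \<in> ?N. \<exists>p \<in> klr_carrier \<alpha>. x = n \<oplus>\<^bsub>X\<^esub> f p" if x: "x \<in> carrier X" for x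
  proof -
    have "\<zero>\<^bsub>X\<^esub> \<in> ?N" using subgroup.one_closed[OF submodule.axioms(1)[OF N]] by simp
    moreover obtain p where "p \<in> klr_carrier \<alpha>" "x = f p" using map_surj[OF x] by blast
    ultimately show ?thesis using M.l_zero[OF x] by metis
  qed
  moreover have "{p \<in> klr_carrier \<alpha>. f p \<in> ?N} = ?L"
  proof -
    have "K \<subseteq> ?L" by (auto intro: left_span.base)
    then show ?thesis
      unfolding gen_submodule_image[OF S]
      using image_mem_iff[OF L] klr_left_ideal.Z_carrier[OF L] by blast
  qed
  ultimately show ?thesis using presentation_quotient[OF N] by simp
qed

lemma presentation_iso:
  assumes "klr_presentation e \<alpha> X f K" "klr_presentation e \<alpha> Y g K"
  shows "left_module_iso (klr_algebra e \<alpha>) X Y"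
proof -
  interpret X: klr_presentation e \<alpha> X f K by fact
  interpret Y: klr_presentation e \<alpha> Y g K by fact
  \<comment> \<open>The map sends \<open>f p\<close> to \<open>g p\<close>; the chosen preimage does
    not matter because \<open>f\<close> and \<open>g\<close> have the same kernel
    \<open>K\<close>.\<close>
  define h where "h = (\<lambda>x. g (SOME p. p \<in> klr_carrier \<alpha> \<and> f p = x))"
  have h: "h (f p) = g p" if p: "p \<in> klr_carrier \<alpha>" for p
  proof -
    have "(SOME q. q \<in> klr_carrier \<alpha> \<and> f q = f p) \<in> klr_carrier \<alpha> \<and>
        f (SOME q. q \<in> klr_carrier \<alpha> \<and> f q = f p) = f p"
      by (rule someI_ex) (use p in blast)
    then show ?thesis unfolding h_def using p X.map_eq_iff Y.map_eq_iff by blast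
  qed
  have "bij_betw h (carrier X) (carrier Y)"
    unfolding bij_betw_def
  proof
    show "inj_on h (carrier X)"
    proof (rule inj_onI)
      fix x y assume "x \<in> carrier X" "y \<in> carrier X" "h x = h y"
      then obtain p q where "p \<in> klr_carrier \<alpha>" "q \<in> klr_carrier \<alpha>" "x = f p" "y = f q" "g p = g q"
        unfolding X.carrier_eq by (auto simp: h)
      then show "x = y" using X.map_eq_iff Y.map_eq_iff by blast
    qed
    show "h ` carrier X = carrier Y"
      unfolding X.carrier_eq Y.carrier_eq image_image by (rule image_cong) (simp_all add: h)
  qed
  moreover have "h (x \<oplus>\<^bsub>X\<^esub> y) = h x \<oplus>\<^bsub>Y\<^esub> h y" if "x \<in> carrier X" "y \<in> carrier X" for x y
  proof -
    obtain p q where "p \<in> klr_carrier \<alpha>" "q \<in> klr_carrier \<alpha>" "x = f p" "y = f q"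
      using \<open>x \<in> carrier X\<close> \<open>y \<in> carrier X\<close> unfolding X.carrier_eq by blast
    then show ?thesis
      using h[of "p + q"] by (simp add: h carrier_add X.map_add Y.map_add)
  qed
  moreover have "h (a \<odot>\<^bsub>X\<^esub> x) = a \<odot>\<^bsub>Y\<^esub> h x"
    if ax: "a \<in> carrier (klr_algebra e \<alpha>)" "x \<in> carrier X" for a x
  proof -
    obtain p q where "p \<in> klr_carrier \<alpha>" "q \<in> klr_carrier \<alpha>" "a = klr_class e \<alpha> p" "x = f q"
      using ax unfolding X.carrier_eq carrier_klr_algebra by blast
    then show ?thesis
      using h[of "p * q"] by (simp add: h carrier_mult X.map_mult Y.map_mult)
  qed
  ultimately show ?thesis
    unfolding left_module_iso_def using X.left_module_axioms Y.left_module_axioms by blast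
qed

lemma regular_presentation:
  "klr_presentation e \<alpha> (regular_module (klr_algebra e \<alpha>)) (klr_class e \<alpha>) (klr_ideal e \<alpha> :: 'k::field klr_free set)"
proof (intro klr_presentation.intro klr_map.intro klr_map_axioms.intro klr_presentation_axioms.intro)
  show "left_module (klr_algebra e \<alpha>) (regular_module (klr_algebra e \<alpha>))"
    by (rule regular_left_module[OF klr_algebra_ring])
  show "{p \<in> klr_carrier \<alpha>. klr_class e \<alpha> p = \<zero>\<^bsub>regular_module (klr_algebra e \<alpha>)\<^esub>} =
      (klr_ideal e \<alpha> :: 'k klr_free set)"
    using klr_ideal_subset[of e \<alpha>] klr_class_zero_iff[of _ \<alpha> e] by (auto simp: regular_module_def)
qed (auto simp: klr_class_hom regular_module_def carrier_klr_algebra)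

lemma cyclic_presentation:
  fixes e :: nat and S :: "'k::field klr_free set"
  assumes S: "S \<subseteq> klr_carrier \<alpha>"
  defines "A \<equiv> klr_algebra e \<alpha>" and "P \<equiv> klr_class e \<alpha> ` S"
  shows "klr_presentation e \<alpha> (cyclic_module A P)
    (\<lambda>p. klr_class e \<alpha> p \<odot>\<^bsub>cyclic_module A P\<^esub> cyclic_gen A P)
    (left_span (klr_carrier \<alpha>) (klr_ideal e \<alpha> \<union> S))"
proof -
  let ?f = "\<lambda>p. gen_submodule A (regular_module A) P +>\<^bsub>regular_module A\<^esub> klr_class e \<alpha> p"
  interpret klr_presentation e \<alpha> "regular_module A" "klr_class e \<alpha>" "klr_ideal e \<alpha> :: 'k klr_free set"
    unfolding A_def by (rule regular_presentation)
  have F: "klr_presentation e \<alpha> (cyclic_module A P) ?f (left_span (klr_carrier \<alpha>) (klr_ideal e \<alpha> \<union> S))"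
    using presentation_gen_submodule[OF S] by (simp add: A_def P_def cyclic_module_def)
  then interpret F: klr_presentation e \<alpha> "cyclic_module A P" ?f
    "left_span (klr_carrier \<alpha>) (klr_ideal e \<alpha> \<union> S)" .
  have eq: "?f p = klr_class e \<alpha> p \<odot>\<^bsub>cyclic_module A P\<^esub> cyclic_gen A P" if "p \<in> klr_carrier \<alpha>" for p
    using F.map_mult[OF that carrier_1] by (simp add: cyclic_gen_def klr_class_one A_def)
  show ?thesis
  proof (intro klr_presentation.intro klr_map.intro klr_map_axioms.intro klr_presentation_axioms.intro
      F.left_module_axioms)
    fix p q :: "'k klr_free" assume p: "p \<in> klr_carrier \<alpha>"
    show "klr_class e \<alpha> p \<odot>\<^bsub>cyclic_module A P\<^esub> cyclic_gen A P \<in> carrier (cyclic_module A P)"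
      using F.map_closed[OF p] eq[OF p] by simp
    assume q: "q \<in> klr_carrier \<alpha>"
    show "klr_class e \<alpha> (p + q) \<odot>\<^bsub>cyclic_module A P\<^esub> cyclic_gen A P =
        klr_class e \<alpha> p \<odot>\<^bsub>cyclic_module A P\<^esub> cyclic_gen A P \<oplus>\<^bsub>cyclic_module A P\<^esub>
        klr_class e \<alpha> q \<odot>\<^bsub>cyclic_module A P\<^esub> cyclic_gen A P"
      using F.map_add[OF p q] eq[OF carrier_add[OF p q]] eq[OF p] eq[OF q] by simp
    show "klr_class e \<alpha> (p * q) \<odot>\<^bsub>cyclic_module A P\<^esub> cyclic_gen A P =
        klr_class e \<alpha> p \<odot>\<^bsub>cyclic_module A P\<^esub> (klr_class e \<alpha> q \<odot>\<^bsub>cyclic_module A P\<^esub> cyclic_gen A P)"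
      using F.map_mult[OF p q] eq[OF carrier_mult[OF p q]] eq[OF q] by simp
  next
    fix x assume "x \<in> carrier (cyclic_module A P)"
    then show "x \<in> (\<lambda>p. klr_class e \<alpha> p \<odot>\<^bsub>cyclic_module A P\<^esub> cyclic_gen A P) ` klr_carrier \<alpha>"
      using F.map_surj eq by (auto simp: image_iff)
  next
    show "{p \<in> klr_carrier \<alpha>. klr_class e \<alpha> p \<odot>\<^bsub>cyclic_module A P\<^esub> cyclic_gen A P = \<zero>\<^bsub>cyclic_module A P\<^esub>} =
        left_span (klr_carrier \<alpha>) (klr_ideal e \<alpha> \<union> S)"
      using F.map_kernel eq by auto
  qed
qed

lemma left_span_left_span:
  "left_span C (left_span C S \<union> S') = left_span C (S \<union> S')"
proof
  have "left_span C S \<subseteq> left_span C (S \<union> S')" by (rule left_span_mono) (auto intro: left_span.base)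
  then show "left_span C (left_span C S \<union> S') \<subseteq> left_span C (S \<union> S')"
    by (intro left_span_mono) (auto intro: left_span.base)
qed (intro left_span_mono, auto intro: left_span.base)

text \<open>The annihilator of a module is a two-sided ideal, so only the generators of the
  cyclotomic ideal have to be tested, on all elements \<open>f p\<close>.\<close>

lemma annihilates_cyclotomic:
  assumes "klr_presentation e \<alpha> X f (K :: 'k::field klr_free set)" "1 \<le> size \<alpha>"
    and K: "\<And>js p. js \<in> permutations_of_multiset \<alpha> \<Longrightarrow> p \<in> klr_carrier \<alpha> \<Longrightarrow>
      fy 1 ^ \<Lambda> (js ! 0) * fe js * p \<in> K"
  shows "annihilates (cyclotomic_ideal e \<alpha> \<Lambda>) X"
proof -
  interpret klr_presentation e \<alpha> X f K by fact
  let ?A = "klr_algebra e \<alpha> :: 'k klr ring"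
  define J where "J = {a \<in> carrier ?A. \<forall>x \<in> carrier X. a \<odot>\<^bsub>X\<^esub> x = \<zero>\<^bsub>X\<^esub>}"
  have zero_smult: "\<zero>\<^bsub>?A\<^esub> \<odot>\<^bsub>X\<^esub> x = \<zero>\<^bsub>X\<^esub>" if "x \<in> carrier X" for x
    using that smult_l_distr[of "\<zero>\<^bsub>?A\<^esub>" "\<zero>\<^bsub>?A\<^esub>" x] smult_closed[of "\<zero>\<^bsub>?A\<^esub>" x]
    by (metis M.add.l_cancel_one R.l_zero R.zero_closed)
  have smult_zero: "a \<odot>\<^bsub>X\<^esub> \<zero>\<^bsub>X\<^esub> = \<zero>\<^bsub>X\<^esub>" if "a \<in> carrier ?A" for a
    using that smult_r_distr[of a "\<zero>\<^bsub>X\<^esub>" "\<zero>\<^bsub>X\<^esub>"] smult_closed[of a "\<zero>\<^bsub>X\<^esub>"]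
    by (metis M.add.l_cancel_one M.l_zero M.zero_closed)
  have "ideal J ?A"
  proof (rule idealI[OF klr_algebra_ring])
    show "subgroup J (add_monoid ?A)"
    proof (rule group.subgroupI[OF R.a_group])
      show "J \<subseteq> carrier (add_monoid ?A)" by (auto simp: J_def)
      show "J \<noteq> {}" using zero_smult by (auto simp: J_def)
      fix a assume a: "a \<in> J"
      have "(\<ominus>\<^bsub>?A\<^esub> a) \<odot>\<^bsub>X\<^esub> x = \<zero>\<^bsub>X\<^esub>" if x: "x \<in> carrier X" for x
      proof -
        have "(\<ominus>\<^bsub>?A\<^esub> a) \<odot>\<^bsub>X\<^esub> x \<oplus>\<^bsub>X\<^esub> a \<odot>\<^bsub>X\<^esub> x = \<zero>\<^bsub>X\<^esub>"
          using a x smult_l_distr[of "\<ominus>\<^bsub>?A\<^esub> a" a x] by (simp add: J_def R.l_neg zero_smult)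
        then show ?thesis using a x by (simp add: J_def smult_closed)
      qed
      then have "\<ominus>\<^bsub>?A\<^esub> a \<in> J" using a by (simp add: J_def)
      then show "inv\<^bsub>add_monoid ?A\<^esub> a \<in> J" by (simp add: a_inv_def)
      fix b assume "b \<in> J"
      then show "a \<otimes>\<^bsub>add_monoid ?A\<^esub> b \<in> J" using a by (simp add: J_def smult_l_distr)
    qed
  qed (auto simp: J_def smult_assoc smult_zero smult_closed)
  moreover have "klr_class e \<alpha> (fy 1 ^ \<Lambda> (js ! 0) * fe js) \<in> J"
    if js: "js \<in> permutations_of_multiset \<alpha>" for js
  proof -
    let ?p = "fy 1 ^ \<Lambda> (js ! 0) * fe js :: 'k klr_free"
    have "fy 1 ^ m \<in> klr_carrier \<alpha>" for m
      using assms(2) by (induction m) (simp_all add: carrier_1 carrier_mult carrier_fy)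
    then have p: "?p \<in> klr_carrier \<alpha>" by (intro carrier_mult carrier_fe js)
    have "klr_class e \<alpha> ?p \<odot>\<^bsub>X\<^esub> x = \<zero>\<^bsub>X\<^esub>" if x: "x \<in> carrier X" for x
    proof -
      obtain q where q: "q \<in> klr_carrier \<alpha>" "x = f q" using map_surj[OF x] by blast
      have "f (?p * q) = \<zero>\<^bsub>X\<^esub>" using K[OF js q(1)] by (auto simp flip: map_kernel)
      then show ?thesis using map_mult[OF p q(1)] q(2) by simp
    qed
    then show ?thesis using klr_class_hom(1)[OF p] by (simp add: J_def)
  qed
  ultimately have "cyclotomic_ideal e \<alpha> \<Lambda> \<subseteq> J"
    unfolding cyclotomic_ideal_def by (intro R.genideal_minimal) auto
  then show ?thesis by (auto simp: annihilates_def J_def)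
qed

section \<open>The filtration\<close>

context hook_layers
begin

abbreviation perm_map :: "nat \<Rightarrow> 'k::field klr_free \<Rightarrow> 'k klr set" where
  "perm_map i p \<equiv>
     klr_class e \<alpha> p \<odot>\<^bsub>perm_module e (charge i) (shape i)\<^esub> perm_gen e (charge i) (shape i)"

lemma perm_presentation:
  "i \<le> r \<Longrightarrow> klr_presentation e \<alpha> (perm_module e (charge i) (shape i)) (perm_map i)
    (left_span (klr_carrier \<alpha>) (perm_relations i :: 'k::field klr_free set))"
  unfolding perm_module_def perm_gen_def content_shape perm_relators_shape perm_relations_def
  by (rule cyclic_presentation[OF word_relators_carrier])

lemma garnir_elem_shape:
  assumes "reduced_choice (k + r) red" "i \<le> r" "a \<in> {1..<Suc (r - i)}"
  shows "garnir_elem red e (charge i) (shape i) (max 1 i, a, 1) =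
    (perm_map i (garnir i (max 1 i - 1 + (a - 1))) :: 'k::field klr set)"
  unfolding garnir_elem_def content_shape[OF assms(2)] garnir_shape[OF assms] ..

lemma specht_presentation:
  assumes red: "reduced_choice (k + r) red" and i: "i \<le> r"
  obtains f where "klr_presentation e \<alpha> (specht_module red e (charge i) (shape i)) f
    (specht_ideal i :: 'k::field klr_free set)"
proof
  interpret P: klr_presentation e \<alpha> "perm_module e (charge i) (shape i)" "perm_map i"
    "left_span (klr_carrier \<alpha>) (perm_relations i :: 'k klr_free set)"
    by (rule perm_presentation[OF i])
  have "garnir_elem red e (charge i) (shape i) ` garnir_nodes (shape i) =
      perm_map i ` (garnir i ` links i :: 'k klr_free set)"
    unfolding garnir_nodes_shape[OF i] garnir_links[OF i, symmetric] image_image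
    by (intro image_cong refl garnir_elem_shape[OF red i])
  moreover have "garnir i ` links i \<subseteq> (klr_carrier \<alpha> :: 'k klr_free set)"
    using garnir_carrier i by blast
  ultimately show "klr_presentation e \<alpha> (specht_module red e (charge i) (shape i))
      (\<lambda>p. gen_submodule (klr_algebra e \<alpha>) (perm_module e (charge i) (shape i))
          (garnir_elem red e (charge i) (shape i) ` garnir_nodes (shape i))
        +>\<^bsub>perm_module e (charge i) (shape i)\<^esub> perm_map i p)
      (specht_ideal i :: 'k klr_free set)"
    using P.presentation_gen_submodule[of "garnir i ` links i"]
    by (simp add: specht_module_def content_shape[OF i] specht_ideal_def left_span_left_span)
qed

lemma layer_left_ideal: "klr_left_ideal e \<alpha> (layer_ideal i :: 'k::field klr_free set)"
proof (cases "i = 0")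
  case True
  then show ?thesis
    by unfold_locales (auto simp: layer_ideal_def carrier_add carrier_mult subsetD[OF klr_ideal_subset])
next
  case False
  then show ?thesis using klr_module.axioms(1)[OF layer_module[of i]] by simp
qed

lemma kernel_layer: "left_span (klr_carrier \<alpha>) (perm_relations 0) \<subseteq> (layer_ideal i :: 'k::field klr_free set)"
proof (cases "i = 0")
  case True
  then show ?thesis
    using left_span_subset[OF perm_relations_carrier] by (simp add: layer_ideal_def)
next
  case False
  then show ?thesis
    unfolding layer_ideal_def by (simp, intro left_span_mono) (auto intro: left_span.base)
qed

lemma filtration_layer:
  assumes red: "reduced_choice (k + r) red" and i: "i \<le> Suc r"
  shows "hook_filtration red e x k r i = perm_map 0 ` (layer_ideal i :: 'k::field klr_free set)"
proof -
  interpret P: klr_presentation e \<alpha> "perm_module e (charge 0) (shape 0)" "perm_map 0"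
    "left_span (klr_carrier \<alpha>) (perm_relations 0 :: 'k klr_free set)"
    by (rule perm_presentation) simp
  have shape: "[x] = charge 0" "[hook k r] = shape 0" by (simp_all add: layer_charge_def layer_shape_def)
  consider "i = 0" | "1 \<le> i" "i \<le> r" | "i = Suc r" using i by linarith
  then show ?thesis
  proof cases
    case 1
    then show ?thesis
      using P.carrier_eq by (simp add: hook_filtration_def shape layer_ideal_def)
  next
    case 2
    have "garnir_elem red e (charge 0) (shape 0) (1, j, 1) = (perm_map 0 (garnir 0 (j - 1)) :: 'k klr set)"
      if "j \<in> {i..r}" for j
      using garnir_elem_shape[OF red, of 0 j, where 'k = 'k] that 2 by simp
    then have "{garnir_elem red e (charge 0) (shape 0) (1, j, 1) | j. j \<in> {i..r}} =
        (\<lambda>j. perm_map 0 (garnir 0 (j - 1)) :: 'k klr set) ` {i..r}"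
      unfolding Setcompr_eq_image by (intro image_cong refl)
    also have "\<dots> = perm_map 0 ` (garnir 0 ` ((\<lambda>j. j - 1) ` {i..r}) :: 'k klr_free set)"
      by (simp only: image_image)
    also have "(\<lambda>j. j - 1) ` {i..r} = {i - 1..<r}"
    proof (intro equalityI subsetI)
      fix a assume "a \<in> {i - 1..<r}"
      then show "a \<in> (\<lambda>j. j - 1) ` {i..r}" by (intro image_eqI[of _ _ "Suc a"]) auto
    qed (use 2 in auto)
    finally have "hook_filtration red e x k r i = gen_submodule (klr_algebra e \<alpha>)
        (perm_module e (charge 0) (shape 0)) (perm_map 0 ` (garnir 0 ` {i - 1..<r} :: 'k klr_free set))"
      using 2 content_shape[of 0] by (simp add: hook_filtration_def shape)
    moreover have "garnir 0 ` {i - 1..<r} \<subseteq> (klr_carrier \<alpha> :: 'k klr_free set)"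
      using garnir_carrier[of _ 0] by (auto simp: hook_links_def)
    ultimately show ?thesis
      using 2 P.gen_submodule_image by (simp add: layer_ideal_def left_span_left_span)
  next
    case 3
    have "perm_map 0 ` (layer_ideal i :: 'k klr_free set) = {\<zero>\<^bsub>perm_module e (charge 0) (shape 0)\<^esub>}"
    proof -
      have "layer_ideal i = {p \<in> klr_carrier \<alpha>. perm_map 0 p =
          (\<zero>\<^bsub>perm_module e (charge 0) (shape 0)\<^esub> :: 'k klr set)}"
        unfolding 3 layer_ideal_last P.map_kernel ..
      moreover have "(0 :: 'k klr_free) \<in> layer_ideal i"
        by (rule klr_left_ideal.Z_0[OF layer_left_ideal])
      ultimately show ?thesis by auto
    qed
    then show ?thesis using 3 by (simp add: hook_filtration_def shape)
  qed
qed

text \<open>The generator is the coset of the Garnir element. Its annihilator is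
  \<open>specht_ideal i\<close>: one inclusion is \<open>specht_kills_generator\<close>, the other
  \<open>generator_kernel\<close>.\<close>

lemma layer_presentation:
  assumes red: "reduced_choice (k + r) red" and i: "i \<le> r"
  obtains f where "klr_presentation e \<alpha>
    (quot_module (restrict_module (perm_module e (charge 0) (shape 0)) (hook_filtration red e x k r i))
      (hook_filtration red e x k r (Suc i)))
    f (specht_ideal i :: 'k::field klr_free set)"
proof -
  let ?M = "perm_module e (charge 0) (shape 0) :: ('k klr, 'k klr set) module"
  let ?H = "perm_map 0 ` (layer_ideal i :: 'k klr_free set)"
  let ?N = "perm_map 0 ` (layer_ideal (Suc i) :: 'k klr_free set)"
  interpret P: klr_presentation e \<alpha> ?M "perm_map 0"
    "left_span (klr_carrier \<alpha>) (perm_relations 0 :: 'k klr_free set)"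
    by (rule perm_presentation) simp
  have H: "submodule ?H (klr_algebra e \<alpha>) ?M" and N: "submodule ?N (klr_algebra e \<alpha>) ?M"
    by (intro P.submodule_image layer_left_ideal)+
  have g: "generator i \<in> (klr_carrier \<alpha> :: 'k klr_free set)" by (rule generator_carrier[OF i])
  interpret S: klr_map e \<alpha> ?M "\<lambda>p. perm_map 0 (p * generator i)"
    by (rule P.klr_map_shift[OF g])
  have "perm_map 0 (p * generator i) \<in> ?H" if "p \<in> klr_carrier \<alpha>" for p :: "'k klr_free"
    using klr_left_ideal.Z_mult[OF layer_left_ideal that generator_layer[OF i]] by blast
  then interpret Q: klr_map e \<alpha> "restrict_module ?M ?H" "\<lambda>p. perm_map 0 (p * generator i)"
    by (rule S.klr_map_restrict[OF H])
  have N': "submodule ?N (klr_algebra e \<alpha>) (restrict_module ?M ?H)"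
    using layer_ideal_mono by (intro submodule_restrict[OF P.left_module_axioms H N] image_mono)
  have "\<exists>n \<in> ?N. \<exists>p \<in> klr_carrier \<alpha>. y = n \<oplus>\<^bsub>restrict_module ?M ?H\<^esub> perm_map 0 (p * generator i)"
    if y: "y \<in> carrier (restrict_module ?M ?H)" for y
  proof -
    obtain p :: "'k klr_free" where p: "p \<in> layer_ideal i" "y = perm_map 0 p"
      using y by (auto simp: restrict_module_def)
    obtain q h where qh: "q \<in> klr_carrier \<alpha>" "h \<in> layer_ideal (Suc i)" "p = h + q * generator i"
      using layer_ideal_step[OF i p(1)] .
    have "h \<in> klr_carrier \<alpha>"
      using qh(2) klr_left_ideal.Z_carrier[OF layer_left_ideal] by blast
    then have "y = perm_map 0 h \<oplus>\<^bsub>?M\<^esub> perm_map 0 (q * generator i)"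
      unfolding p(2) qh(3) using qh(1) g by (intro P.map_add carrier_mult)
    then show ?thesis
      using qh(1,2) by (auto simp: restrict_module_def)
  qed
  from Q.presentation_quotient[OF N' this]
  have "klr_presentation e \<alpha> (quot_module (restrict_module ?M ?H) ?N)
    (\<lambda>p. ?N +>\<^bsub>restrict_module ?M ?H\<^esub> perm_map 0 (p * generator i))
    {p \<in> klr_carrier \<alpha>. perm_map 0 (p * generator i) \<in> ?N}" .
  moreover have "{p \<in> klr_carrier \<alpha>. perm_map 0 (p * generator i) \<in> ?N} = specht_ideal i"
  proof -
    have "perm_map 0 (p * generator i) \<in> ?N \<longleftrightarrow> p * generator i \<in> (layer_ideal (Suc i) :: 'k klr_free set)"
      if "p \<in> klr_carrier \<alpha>" for p
      by (rule P.image_mem_iff[OF layer_left_ideal kernel_layer carrier_mult[OF that g]])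
    moreover have "specht_ideal i \<subseteq> (klr_carrier \<alpha> :: 'k klr_free set)"
      using klr_left_ideal.Z_carrier[OF klr_module.axioms(1)[OF specht_module[OF i]]] .
    ultimately show ?thesis
      using generator_kernel[OF i] specht_kills_generator[OF i] by blast
  qed
  ultimately show thesis
    using that filtration_layer[OF red, where 'k = 'k] i by simp
qed

lemma filtration_strict:
  assumes red: "reduced_choice (k + r) red" and i: "i \<le> r"
  shows "(hook_filtration red e x k r (Suc i) :: 'k::field klr set set) \<subset> hook_filtration red e x k r i"
proof -
  interpret P: klr_presentation e \<alpha> "perm_module e (charge 0) (shape 0)" "perm_map 0"
    "left_span (klr_carrier \<alpha>) (perm_relations 0 :: 'k klr_free set)"
    by (rule perm_presentation) simp
  have "perm_map 0 (generator i) \<notin> perm_map 0 ` (layer_ideal (Suc i) :: 'k klr_free set)"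
    using P.image_mem_iff[OF layer_left_ideal kernel_layer generator_carrier[OF i]]
      generator_not_in_layer[OF i] by blast
  moreover have "perm_map 0 (generator i) \<in> perm_map 0 ` (layer_ideal i :: 'k klr_free set)"
    using generator_layer[OF i] by blast
  moreover have "layer_ideal (Suc i) \<subseteq> (layer_ideal i :: 'k klr_free set)" by (rule layer_ideal_mono)
  ultimately have "perm_map 0 ` (layer_ideal (Suc i) :: 'k klr_free set) \<subset> perm_map 0 ` layer_ideal i"
    by blast
  then show ?thesis using filtration_layer[OF red, where 'k = 'k] i by simp
qed

lemma specht_annihilated:
  assumes red: "reduced_choice (k + r) red" and i: "i \<le> r"
  shows "annihilates (cyclotomic_ideal e \<alpha> (charge_weight e (charge i)))
    (specht_module red e (charge i) (shape i) :: ('k::field klr, 'k klr set set) module)"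
proof -
  obtain f where f: "klr_presentation e \<alpha> (specht_module red e (charge i) (shape i)) f
      (specht_ideal i :: 'k klr_free set)"
    using specht_presentation[OF red i] .
  show ?thesis
  proof (rule annihilates_cyclotomic[OF f])
    show "1 \<le> size \<alpha>" using k by (simp add: size_eq)
    fix js and p :: "'k klr_free"
    assume "js \<in> permutations_of_multiset \<alpha>" "p \<in> klr_carrier \<alpha>"
    then show "fy 1 ^ charge_weight e (charge i) (js ! 0) * fe js * p \<in> specht_ideal i"
      unfolding charge_weight_shape[OF i] by (rule specht_cyclotomic[OF i])
  qed
qed

end

theorem theorem4p2:
  fixes e k r :: nat and x :: int
    and red :: "(nat \<Rightarrow> nat) \<Rightarrow> nat list"
    and \<alpha> :: "int multiset"
    and R :: "'k::field klr ring"
    and M :: "('k klr, 'k klr set) module"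
    and F :: "nat \<Rightarrow> 'k klr set set"
  assumes "e = 0 \<or> e > 2"
    and "x \<in> vertices e"
    and "k \<ge> 1" and "r \<ge> 1"
    and "reduced_choice (k + r) red"
    and "\<alpha> = content e [x] [hook k r]"
    and "R = klr_algebra e \<alpha>"
    and "M = perm_module e [x] [hook k r]"
    and "F = hook_filtration red e x k r"
  shows "F 0 = carrier M \<and> F (r + 1) = {\<zero>\<^bsub>M\<^esub>} \<and>
    (\<forall>i \<le> r. F (i + 1) \<subset> F i) \<and>
    (\<forall>i \<le> r.
       content e (layer_charge x i) (layer_shape k r i) = \<alpha> \<and>
       annihilates (cyclotomic_ideal e \<alpha> (charge_weight e (layer_charge x i)))
         (specht_module red e (layer_charge x i) (layer_shape k r i)
            :: ('k klr, 'k klr set set) module) \<and>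
       left_module_iso R
         (quot_module (restrict_module M (F i)) (F (i + 1)))
         (specht_module red e (layer_charge x i) (layer_shape k r i)))"
proof -
  interpret H: hook_layers e k r x using assms by unfold_locales auto
  have shape: "[x] = layer_charge x 0" "[hook k r] = layer_shape k r 0"
    by (simp_all add: layer_charge_def layer_shape_def)
  have \<alpha>: "\<alpha> = H.\<alpha>" using assms(6) H.content_shape[of 0] by (simp add: shape)
  have "left_module_iso R (quot_module (restrict_module M (F i)) (F (i + 1)))
      (specht_module red e (layer_charge x i) (layer_shape k r i))" if i: "i \<le> r" for i
  proof -
    obtain f where f: "klr_presentation e H.\<alpha> (quot_module (restrict_module M (F i)) (F (Suc i))) f
        (H.specht_ideal i)"
      using H.layer_presentation[OF assms(5) i] unfolding assms(8,9) shape by blast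
    obtain g where g: "klr_presentation e H.\<alpha> (specht_module red e (layer_charge x i) (layer_shape k r i)) g
        (H.specht_ideal i :: 'k klr_free set)"
      using H.specht_presentation[OF assms(5) i] .
    show ?thesis using presentation_iso[OF f g] by (simp add: assms(7) \<alpha>)
  qed
  moreover have "F 0 = carrier M" "F (r + 1) = {\<zero>\<^bsub>M\<^esub>}"
    by (simp_all add: assms(8,9) hook_filtration_def)
  ultimately show ?thesis
    using H.filtration_strict[OF assms(5), where 'k = 'k] H.content_shape
      H.specht_annihilated[OF assms(5), where 'k = 'k]
    by (simp add: \<alpha> assms(9))
qed

end
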